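(* Let $(\mathcal{C},\mathbb{E},\mathfrak{s})$ be an $n$-exangulated category, let $\mathcal{P}$ (resp. $\mathcal{I}$) be its full subcategory of projective (resp. injective) objects, and let $\mathcal{X}$ be a full subcategory of $\mathcal{C}$, closed under isomorphisms and finite direct sums, such that $\mathcal{X}\subseteq\mathcal{P}\cap\mathcal{I}$. Then the ideal quotient $\mathcal{C}/\mathcal{X}$, equipped with the induced bifunctor $\overline{\mathbb{E}}$ and the induced correspondence $\overline{\mathfrak{s}}$, is an $n$-exangulated category if and only if every distinguished $n$-exangle in $\mathcal{C}$ induces a weak kernel-cokernel sequence in $\mathcal{C}/\mathcal{X}$.
   Context: Throughout, $n\ge 1$ is an integer, $\mathcal{C}$ is an additive category and $\mathbb{E}:\mathcal{C}^{\mathrm{op}}\times\mathcal{C}\to\mathrm{Ab}$ is an additive bifunctor. **Extensions.** An element $\delta\in\mathbb{E}(C,A)$ is called an extension. For $a\in\mathcal{C}(A,A')$, $c\in\mathcal{C}(C',C)$ write $a_*\delta=\mathbb{E}(C,a)(\delta)$ and $c^*\delta=\mathbb{E}(c,A)(\delta)$. A morphism of extensions from $\delta\in\mathbb{E}(C,A)$ to $\delta'\in\mathbb{E}(C',A')$ is a pair $(a,c)$ with $a\in\mathcal{C}(A,A')$, $c\in\mathcal{C}(C,C')$ and $a_*\delta=c^*\delta'$. **Complexes.** $\mathbf{C}^{n+2}_{\mathcal{C}}$ is the category of complexes $X^\bullet=(X^0\xrightarrow{d_X^0}X^1\to\cdots\xrightarrow{d_X^n}X^{n+1})$ in $\mathcal{C}$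 concentrated in degrees $0,\dots,n+1$. For objects $A,C$, $\mathbf{C}^{n+2}_{(A,C)}$ is the subcategory of those $X^\bullet$ with $X^0=A$, $X^{n+1}=C$, with morphisms those $f^\bullet$ with $f^0=1_A$, $f^{n+1}=1_C$; its quotient by the usual homotopy relation is $\mathbf{K}^{n+2}_{(A,C)}$, and $[X^\bullet]$ denotes the homotopy equivalence class of $X^\bullet$ there. **$n$-exangles.** An $n$-exangle is a pair $\langle X^\bullet,\delta\rangle$ with $X^\bullet\in\mathbf{C}^{n+2}_{\mathcal{C}}$, $\delta\in\mathbb{E}(X^{n+1},X^0)$ such that the sequences of functors $\mathcal{C}(-,X^0)\to\mathcal{C}(-,X^1)\to\cdots\to\mathcal{C}(-,X^{n+1})\xrightarrow{f\mapsto f^*\delta}\mathbb{E}(-,X^0)$ and $\mathcal{C}(X^{n+1},-)\to\mathcal{C}(X^n,-)\to\cdots\to\mathcal{C}(X^0,-)\xrightarrow{g\mapsto g_*\delta}\mathbb{E}(X^{n+1},-)$ are exact (at the intermediate terms). **Exact realizations.** A realization $\mathfrak{s}$ of $\mathbb{E}$ assigns to each $\delta\in\mathbb{E}(C,A)$ a homotopy equivalence class $\mathfrak{s}(\delta)=[X^\bullet]$ with $X^\bullet\in\mathbf{C}^{n+2}_{(A,C)}$ such that: (R0) if $\mathfrak{s}(\delta)=[X^\bullet]$, $\mathfrak{s}(\rho)=[Y^\bullet]$, every morphism of extensions $(a,c):\delta\to\rho$ has a lift, i.e. a chain map $f^\bullet:X^\bullet\to Y^\bullet$ with $f^0=a$,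 $f^{n+1}=c$. It is exact if moreover: (R1) whenever $\mathfrak{s}(\delta)=[X^\bullet]$, $\langle X^\bullet,\delta\rangle$ is an $n$-exangle; (R2) for every $A$, the zero element of $\mathbb{E}(0,A)$ is sent to $[A\xrightarrow{1}A\to0\to\cdots\to0]$ and the zero element of $\mathbb{E}(A,0)$ to $[0\to\cdots\to0\to A\xrightarrow{1}A]$. If $\mathfrak{s}(\delta)=[X^\bullet]$, $\langle X^\bullet,\delta\rangle$ is called a distinguished $n$-exangle, $X^\bullet$ a conflation, $d_X^0$ an inflation and $d_X^n$ a deflation. **Mapping (co)cones.** For $f^\bullet:X^\bullet\to Y^\bullet$ with $f^0=1$, the mapping cone $M_f^\bullet$ is $X^1\to X^2\oplus Y^1\to\cdots\to X^{n+1}\oplus Y^n\to Y^{n+1}$ with differentials $\begin{bmatrix}-d_X^1\\ f^1\end{bmatrix}$, $\begin{bmatrix}-d_X^{i+1}&0\\ f^{i+1}&d_Y^i\end{bmatrix}$ ($1\le i\le n-1$), $\begin{bmatrix}f^{n+1}&d_Y^n\end{bmatrix}$. Dually, for $h^\bullet:X^\bullet\to Y^\bullet$ with $h^{n+1}=1$, the mapping cocone $N_h^\bullet$ is $X^0\to X^1\oplus Y^0\to\cdots\to X^n\oplus Y^{n-1}\to Y^n$ with the analogous differentials. **$n$-exangulated category.** A triplet $(\mathcal{C},\mathbb{E},\mathfrak{s})$ with $\mathfrak{s}$ an exact realization of $\mathbb{E}$ such that: (EA1) inflations are closed under composition and deflations are closed under composition; (EA2) for $\rho\in\mathbb{E}(D,A)$,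 $c\in\mathcal{C}(C,D)$ and distinguished $n$-exangles $\langle X^\bullet,c^*\rho\rangle$, $\langle Y^\bullet,\rho\rangle$, the pair $(1_A,c)$ has a lift $f^\bullet$ such that $\langle M_f^\bullet,(d_X^0)_*\rho\rangle$ is a distinguished $n$-exangle; (EA2$^{\mathrm{op}}$) dually, for $\rho\in\mathbb{E}(C,A)$, $a\in\mathcal{C}(A,B)$ and distinguished $n$-exangles $\langle X^\bullet,\rho\rangle$, $\langle Y^\bullet,a_*\rho\rangle$, the pair $(a,1_C)$ has a lift $h^\bullet$ such that $\langle N_h^\bullet,(d_Y^n)^*\rho\rangle$ is a distinguished $n$-exangle. **Projectives and injectives.** $P\in\mathcal{C}$ is projective if for every distinguished $n$-exangle $\langle A^\bullet,\delta\rangle$ and every $c\in\mathcal{C}(P,A^{n+1})$ there is $b\in\mathcal{C}(P,A^n)$ with $d_A^n b=c$. Injective objects are defined dually (every morphism $A^0\to I$ factors through $d_A^0$). **Ideal quotient.** $\overline{\mathcal{C}}=\mathcal{C}/\mathcal{X}$ has the same objects as $\mathcal{C}$, and $\overline{\mathcal{C}}(A,B)=\mathcal{C}(A,B)/[\mathcal{X}](A,B)$, where $[\mathcal{X}](A,B)$ is the subgroup of morphisms factoring through an object of $\mathcal{X}$; $\overline{f}$ denotes the image of $f$. Since $\mathcal{X}\subseteq\mathcal{P}\cap\mathcal{I}$, there is an additive bifunctor $\overline{\mathbb{E}}:\overline{\mathcal{C}}^{\mathrm{op}}\times\overline{\mathcal{C}}\to\mathrm{Ab}$ with $\overline{\mathbb{E}}(C,A)=\mathbb{E}(C,A)$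 and $\overline{\mathbb{E}}(\overline{c},\overline{a})=\mathbb{E}(c,a)$. For $\delta\in\overline{\mathbb{E}}(C,A)$ with $\mathfrak{s}(\delta)=[A\xrightarrow{\alpha_0}B^1\to\cdots\to B^n\xrightarrow{\alpha_n}C]$, put $\overline{\mathfrak{s}}(\delta)=[A\xrightarrow{\overline{\alpha_0}}B^1\to\cdots\to B^n\xrightarrow{\overline{\alpha_n}}C]$. **Weak kernel-cokernel sequence.** A distinguished $n$-exangle $A^0\xrightarrow{\alpha_0}A^1\to\cdots\to A^n\xrightarrow{\alpha_n}A^{n+1}$ (with extension $\delta$) in $\mathcal{C}$ induces a weak kernel-cokernel sequence in $\overline{\mathcal{C}}$ if the sequences of functors $\overline{\mathcal{C}}(-,A^0)\to\overline{\mathcal{C}}(-,A^1)\to\cdots\to\overline{\mathcal{C}}(-,A^{n+1})$ and $\overline{\mathcal{C}}(A^{n+1},-)\to\overline{\mathcal{C}}(A^n,-)\to\cdots\to\overline{\mathcal{C}}(A^0,-)$, induced by the $\overline{\alpha_i}$, are exact (at the intermediate terms). *)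

theory Defs
  imports "HOL-Algebra.Coset"
begin

text \<open>
  The abelian groups \<open>\<C>(A,B)\<close> and \<open>\<E>(C,A)\<close> are groups in the sense of HOL-Algebra, which are
  written multiplicatively: there \<open>\<otimes>\<close> is the addition, \<open>\<one>\<close> the zero element and \<open>inv\<close> the negative.
\<close>

section \<open>Additive categories\<close>

record ('o, 'm) precategory =
  Ob :: "'o set"
  Hom :: "'o \<Rightarrow> 'o \<Rightarrow> 'm monoid"
  Id :: "'o \<Rightarrow> 'm"
  Comp :: "'m \<Rightarrow> 'm \<Rightarrow> 'm"  (infixr "\<cdot>\<index>" 75)

abbreviation arrows :: "('o, 'm) precategory \<Rightarrow> 'o \<Rightarrow> 'o \<Rightarrow> 'm set" where
  "arrows \<C> A B \<equiv> carrier (Hom \<C> A B)"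

definition zero_object :: "('o, 'm) precategory \<Rightarrow> 'o \<Rightarrow> bool" where
  "zero_object \<C> Z \<longleftrightarrow> Z \<in> Ob \<C> \<and>
     (\<forall>A\<in>Ob \<C>. (\<exists>!f. f \<in> arrows \<C> A Z) \<and> (\<exists>!f. f \<in> arrows \<C> Z A))"

definition biproduct ::
  "('o, 'm) precategory \<Rightarrow> 'o \<Rightarrow> 'o \<Rightarrow> 'o \<Rightarrow> 'm \<Rightarrow> 'm \<Rightarrow> 'm \<Rightarrow> 'm \<Rightarrow> bool" where
  "biproduct \<C> A B S i\<^sub>1 i\<^sub>2 p\<^sub>1 p\<^sub>2 \<longleftrightarrow>
     S \<in> Ob \<C> \<and>
     i\<^sub>1 \<in> arrows \<C> A S \<and> i\<^sub>2 \<in> arrows \<C> B S \<and> p\<^sub>1 \<in> arrows \<C> S A \<and> p\<^sub>2 \<in> arrows \<C> S B \<and>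
     p\<^sub>1 \<cdot>\<^bsub>\<C>\<^esub> i\<^sub>1 = Id \<C> A \<and> p\<^sub>2 \<cdot>\<^bsub>\<C>\<^esub> i\<^sub>2 = Id \<C> B \<and>
     p\<^sub>1 \<cdot>\<^bsub>\<C>\<^esub> i\<^sub>2 = \<one>\<^bsub>Hom \<C> B A\<^esub> \<and> p\<^sub>2 \<cdot>\<^bsub>\<C>\<^esub> i\<^sub>1 = \<one>\<^bsub>Hom \<C> A B\<^esub> \<and>
     (i\<^sub>1 \<cdot>\<^bsub>\<C>\<^esub> p\<^sub>1) \<otimes>\<^bsub>Hom \<C> S S\<^esub> (i\<^sub>2 \<cdot>\<^bsub>\<C>\<^esub> p\<^sub>2) = Id \<C> S"

definition isomorphic :: "('o, 'm) precategory \<Rightarrow> 'o \<Rightarrow> 'o \<Rightarrow> bool" where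
  "isomorphic \<C> A B \<longleftrightarrow>
     (\<exists>f\<in>arrows \<C> A B. \<exists>g\<in>arrows \<C> B A. g \<cdot>\<^bsub>\<C>\<^esub> f = Id \<C> A \<and> f \<cdot>\<^bsub>\<C>\<^esub> g = Id \<C> B)"

locale additive_category =
  fixes \<C> :: "('o, 'm) precategory" (structure)
  assumes hom_disjoint:
      "\<lbrakk>A \<in> Ob \<C>; B \<in> Ob \<C>; A' \<in> Ob \<C>; B' \<in> Ob \<C>; f \<in> arrows \<C> A B; f \<in> arrows \<C> A' B'\<rbrakk>
        \<Longrightarrow> A = A' \<and> B = B'"
    and id_closed: "A \<in> Ob \<C> \<Longrightarrow> Id \<C> A \<in> arrows \<C> A A"
    and comp_closed:
      "\<lbrakk>A \<in> Ob \<C>; B \<in> Ob \<C>; D \<in> Ob \<C>; f \<in> arrows \<C> A B; g \<in> arrows \<C> B D\<rbrakk>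
        \<Longrightarrow> g \<cdot> f \<in> arrows \<C> A D"
    and comp_assoc:
      "\<lbrakk>A \<in> Ob \<C>; B \<in> Ob \<C>; D \<in> Ob \<C>; F \<in> Ob \<C>;
        f \<in> arrows \<C> A B; g \<in> arrows \<C> B D; h \<in> arrows \<C> D F\<rbrakk>
        \<Longrightarrow> (h \<cdot> g) \<cdot> f = h \<cdot> (g \<cdot> f)"
    and id_left: "\<lbrakk>A \<in> Ob \<C>; B \<in> Ob \<C>; f \<in> arrows \<C> A B\<rbrakk> \<Longrightarrow> Id \<C> B \<cdot> f = f"
    and id_right: "\<lbrakk>A \<in> Ob \<C>; B \<in> Ob \<C>; f \<in> arrows \<C> A B\<rbrakk> \<Longrightarrow> f \<cdot> Id \<C> A = f"
    and hom_comm_group: "\<lbrakk>A \<in> Ob \<C>; B \<in> Ob \<C>\<rbrakk> \<Longrightarrow> comm_group (Hom \<C> A B)"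
    and comp_add_left:
      "\<lbrakk>A \<in> Ob \<C>; B \<in> Ob \<C>; D \<in> Ob \<C>; f \<in> arrows \<C> A B; g \<in> arrows \<C> B D; g' \<in> arrows \<C> B D\<rbrakk>
        \<Longrightarrow> (g \<otimes>\<^bsub>Hom \<C> B D\<^esub> g') \<cdot> f = (g \<cdot> f) \<otimes>\<^bsub>Hom \<C> A D\<^esub> (g' \<cdot> f)"
    and comp_add_right:
      "\<lbrakk>A \<in> Ob \<C>; B \<in> Ob \<C>; D \<in> Ob \<C>; f \<in> arrows \<C> A B; f' \<in> arrows \<C> A B; g \<in> arrows \<C> B D\<rbrakk>
        \<Longrightarrow> g \<cdot> (f \<otimes>\<^bsub>Hom \<C> A B\<^esub> f') = (g \<cdot> f) \<otimes>\<^bsub>Hom \<C> A D\<^esub> (g \<cdot> f')"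
    and zero_object_exists: "\<exists>Z. zero_object \<C> Z"
    and biproduct_exists:
      "\<lbrakk>A \<in> Ob \<C>; B \<in> Ob \<C>\<rbrakk> \<Longrightarrow> \<exists>S i\<^sub>1 i\<^sub>2 p\<^sub>1 p\<^sub>2. biproduct \<C> A B S i\<^sub>1 i\<^sub>2 p\<^sub>1 p\<^sub>2"


section \<open>Additive bifunctors\<close>

text \<open>
  \<open>Ext \<E> C A\<close> is \<open>\<E>(C,A)\<close>, contravariant in the first and covariant in the second argument, and
  \<open>Act \<E> c a\<close> is \<open>\<E>(c,a)\<close>. The objects need not be passed to \<open>Act\<close>, since an arrow determines
  its source and target; the groups \<open>\<E>(C,A)\<close> themselves may overlap.
\<close>

record ('o, 'm, 'e) bifunctor =
  Ext :: "'o \<Rightarrow> 'o \<Rightarrow> 'e monoid"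
  Act :: "'m \<Rightarrow> 'm \<Rightarrow> 'e \<Rightarrow> 'e"

abbreviation extensions :: "('o, 'm, 'e) bifunctor \<Rightarrow> 'o \<Rightarrow> 'o \<Rightarrow> 'e set" where
  "extensions \<E> C A \<equiv> carrier (Ext \<E> C A)"

locale additive_bifunctor = additive_category \<C>
  for \<C> :: "('o, 'm) precategory" (structure) +
  fixes \<E> :: "('o, 'm, 'e) bifunctor"
  assumes ext_comm_group: "\<lbrakk>C \<in> Ob \<C>; A \<in> Ob \<C>\<rbrakk> \<Longrightarrow> comm_group (Ext \<E> C A)"
    and act_hom:
      "\<lbrakk>C \<in> Ob \<C>; C' \<in> Ob \<C>; A \<in> Ob \<C>; A' \<in> Ob \<C>; c \<in> arrows \<C> C' C; a \<in> arrows \<C> A A'\<rbrakk>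
        \<Longrightarrow> Act \<E> c a \<in> hom (Ext \<E> C A) (Ext \<E> C' A')"
    and act_id:
      "\<lbrakk>C \<in> Ob \<C>; A \<in> Ob \<C>; \<delta> \<in> extensions \<E> C A\<rbrakk> \<Longrightarrow> Act \<E> (Id \<C> C) (Id \<C> A) \<delta> = \<delta>"
    and act_comp:
      "\<lbrakk>C \<in> Ob \<C>; C' \<in> Ob \<C>; C'' \<in> Ob \<C>; A \<in> Ob \<C>; A' \<in> Ob \<C>; A'' \<in> Ob \<C>;
        c \<in> arrows \<C> C' C; c' \<in> arrows \<C> C'' C'; a \<in> arrows \<C> A A'; a' \<in> arrows \<C> A' A'';
        \<delta> \<in> extensions \<E> C A\<rbrakk>
        \<Longrightarrow> Act \<E> (c \<cdot> c') (a' \<cdot> a) \<delta> = Act \<E> c' a' (Act \<E> c a \<delta>)"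
    and act_add_left:
      "\<lbrakk>C \<in> Ob \<C>; C' \<in> Ob \<C>; A \<in> Ob \<C>; A' \<in> Ob \<C>;
        c \<in> arrows \<C> C' C; c' \<in> arrows \<C> C' C; a \<in> arrows \<C> A A'; \<delta> \<in> extensions \<E> C A\<rbrakk>
        \<Longrightarrow> Act \<E> (c \<otimes>\<^bsub>Hom \<C> C' C\<^esub> c') a \<delta> = Act \<E> c a \<delta> \<otimes>\<^bsub>Ext \<E> C' A'\<^esub> Act \<E> c' a \<delta>"
    and act_add_right:
      "\<lbrakk>C \<in> Ob \<C>; C' \<in> Ob \<C>; A \<in> Ob \<C>; A' \<in> Ob \<C>;
        c \<in> arrows \<C> C' C; a \<in> arrows \<C> A A'; a' \<in> arrows \<C> A A'; \<delta> \<in> extensions \<E> C A\<rbrakk>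
        \<Longrightarrow> Act \<E> c (a \<otimes>\<^bsub>Hom \<C> A A'\<^esub> a') \<delta> = Act \<E> c a \<delta> \<otimes>\<^bsub>Ext \<E> C' A'\<^esub> Act \<E> c a' \<delta>"

text \<open>\<open>a\<^sub>*\<delta>\<close> for \<open>\<delta> \<in> \<E>(C,A)\<close>, and \<open>c\<^sup>*\<delta>\<close> for \<open>\<delta> \<in> \<E>(C,A)\<close>; the argument \<open>C\<close>, resp. \<open>A\<close>, is needed to
  name the identity.\<close>

definition push ::
  "('o, 'm) precategory \<Rightarrow> ('o, 'm, 'e) bifunctor \<Rightarrow> 'o \<Rightarrow> 'm \<Rightarrow> 'e \<Rightarrow> 'e" where
  "push \<C> \<E> C a \<delta> = Act \<E> (Id \<C> C) a \<delta>"

definition pull ::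
  "('o, 'm) precategory \<Rightarrow> ('o, 'm, 'e) bifunctor \<Rightarrow> 'o \<Rightarrow> 'm \<Rightarrow> 'e \<Rightarrow> 'e" where
  "pull \<C> \<E> A c \<delta> = Act \<E> c (Id \<C> A) \<delta>"

definition ext_morphism ::
  "('o, 'm) precategory \<Rightarrow> ('o, 'm, 'e) bifunctor \<Rightarrow>
   'o \<Rightarrow> 'o \<Rightarrow> 'e \<Rightarrow> 'o \<Rightarrow> 'o \<Rightarrow> 'e \<Rightarrow> 'm \<Rightarrow> 'm \<Rightarrow> bool" where
  "ext_morphism \<C> \<E> C A \<delta> C' A' \<delta>' a c \<longleftrightarrow>
     a \<in> arrows \<C> A A' \<and> c \<in> arrows \<C> C C' \<and> push \<C> \<E> C a \<delta> = pull \<C> \<E> A' c \<delta>'"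


section \<open>Complexes and homotopy\<close>

text \<open>
  Only the objects in degrees \<open>0, \<dots>, n + 1\<close> and the differentials in degrees \<open>0, \<dots>, n\<close> matter. The
  values outside this range are arbitrary, and every notion below ignores them; in particular
  a homotopy equivalence class is closed under changing them.
\<close>

record ('o, 'm) cochain =
  obj :: "nat \<Rightarrow> 'o"
  dif :: "nat \<Rightarrow> 'm"

definition cochain_complex :: "nat \<Rightarrow> ('o, 'm) precategory \<Rightarrow> ('o, 'm) cochain \<Rightarrow> bool" where
  "cochain_complex n \<C> X \<longleftrightarrow>
     (\<forall>i\<le>n+1. obj X i \<in> Ob \<C>) \<and>
     (\<forall>i\<le>n. dif X i \<in> arrows \<C> (obj X i) (obj X (i+1))) \<and>
     (\<forall>i<n. dif X (i+1) \<cdot>\<^bsub>\<C>\<^esub> dif X i = \<one>\<^bsub>Hom \<C> (obj X i) (obj X (i+2))\<^esub>)"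

definition complexes_between ::
  "nat \<Rightarrow> ('o, 'm) precategory \<Rightarrow> 'o \<Rightarrow> 'o \<Rightarrow> ('o, 'm) cochain set" where
  "complexes_between n \<C> A C = {X. cochain_complex n \<C> X \<and> obj X 0 = A \<and> obj X (n+1) = C}"

definition chain_map ::
  "nat \<Rightarrow> ('o, 'm) precategory \<Rightarrow> ('o, 'm) cochain \<Rightarrow> ('o, 'm) cochain \<Rightarrow> (nat \<Rightarrow> 'm) \<Rightarrow> bool" where
  "chain_map n \<C> X Y f \<longleftrightarrow>
     (\<forall>i\<le>n+1. f i \<in> arrows \<C> (obj X i) (obj Y i)) \<and>
     (\<forall>i\<le>n. f (i+1) \<cdot>\<^bsub>\<C>\<^esub> dif X i = dif Y i \<cdot>\<^bsub>\<C>\<^esub> f i)"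

text \<open>A chain map with prescribed components \<open>a\<close>, \<open>c\<close> in the extreme degrees.\<close>

definition lift ::
  "nat \<Rightarrow> ('o, 'm) precategory \<Rightarrow> ('o, 'm) cochain \<Rightarrow> ('o, 'm) cochain \<Rightarrow> 'm \<Rightarrow> 'm \<Rightarrow> (nat \<Rightarrow> 'm) \<Rightarrow> bool"
  where
  "lift n \<C> X Y a c f \<longleftrightarrow> chain_map n \<C> X Y f \<and> f 0 = a \<and> f (n+1) = c"

definition homotopic ::
  "nat \<Rightarrow> ('o, 'm) precategory \<Rightarrow> ('o, 'm) cochain \<Rightarrow> ('o, 'm) cochain \<Rightarrow>
   (nat \<Rightarrow> 'm) \<Rightarrow> (nat \<Rightarrow> 'm) \<Rightarrow> bool" where
  "homotopic n \<C> X Y f g \<longleftrightarrow> (\<exists>h.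
     (\<forall>i\<in>{1..n+1}. h i \<in> arrows \<C> (obj X i) (obj Y (i-1))) \<and>
     g 0 = f 0 \<otimes>\<^bsub>Hom \<C> (obj X 0) (obj Y 0)\<^esub> (h 1 \<cdot>\<^bsub>\<C>\<^esub> dif X 0) \<and>
     (\<forall>i\<in>{1..n}. g i = f i \<otimes>\<^bsub>Hom \<C> (obj X i) (obj Y i)\<^esub>
        ((dif Y (i-1) \<cdot>\<^bsub>\<C>\<^esub> h i) \<otimes>\<^bsub>Hom \<C> (obj X i) (obj Y i)\<^esub> (h (i+1) \<cdot>\<^bsub>\<C>\<^esub> dif X i))) \<and>
     g (n+1) = f (n+1) \<otimes>\<^bsub>Hom \<C> (obj X (n+1)) (obj Y (n+1))\<^esub> (dif Y n \<cdot>\<^bsub>\<C>\<^esub> h (n+1)))"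

text \<open>Isomorphism in \<open>\<K>\<^sub>(\<^sub>A\<^sub>,\<^sub>C\<^sub>)\<close>: the chain maps are identities in the extreme degrees.\<close>

definition homotopy_equivalent ::
  "nat \<Rightarrow> ('o, 'm) precategory \<Rightarrow> 'o \<Rightarrow> 'o \<Rightarrow> ('o, 'm) cochain \<Rightarrow> ('o, 'm) cochain \<Rightarrow> bool" where
  "homotopy_equivalent n \<C> A C X Y \<longleftrightarrow> (\<exists>f g.
     lift n \<C> X Y (Id \<C> A) (Id \<C> C) f \<and> lift n \<C> Y X (Id \<C> A) (Id \<C> C) g \<and>
     homotopic n \<C> X X (\<lambda>i. g i \<cdot>\<^bsub>\<C>\<^esub> f i) (\<lambda>i. Id \<C> (obj X i)) \<and>
     homotopic n \<C> Y Y (\<lambda>i. f i \<cdot>\<^bsub>\<C>\<^esub> g i) (\<lambda>i. Id \<C> (obj Y i)))"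

definition homotopy_class ::
  "nat \<Rightarrow> ('o, 'm) precategory \<Rightarrow> 'o \<Rightarrow> 'o \<Rightarrow> ('o, 'm) cochain \<Rightarrow> ('o, 'm) cochain set" where
  "homotopy_class n \<C> A C X =
     {Y \<in> complexes_between n \<C> A C. homotopy_equivalent n \<C> A C X Y}"


section \<open>\<open>n\<close>-exangles\<close>

text \<open>
  Exactness at the terms \<open>\<C>(W,X\<^sup>i)\<close> resp. \<open>\<C>(X\<^sup>i,W)\<close>, \<open>1 \<le> i \<le> n\<close>, of the sequences
  \<open>\<C>(-,X\<^sup>0) \<rightarrow> \<dots> \<rightarrow> \<C>(-,X\<^sup>n\<^sup>+\<^sup>1)\<close> and \<open>\<C>(X\<^sup>n\<^sup>+\<^sup>1,-) \<rightarrow> \<dots> \<rightarrow> \<C>(X\<^sup>0,-)\<close>.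
\<close>

definition weak_kernel_cokernel :: "nat \<Rightarrow> ('o, 'm) precategory \<Rightarrow> ('o, 'm) cochain \<Rightarrow> bool" where
  "weak_kernel_cokernel n \<C> X \<longleftrightarrow> (\<forall>W\<in>Ob \<C>. \<forall>i\<in>{1..n}.
     (\<lambda>f. dif X (i-1) \<cdot>\<^bsub>\<C>\<^esub> f) ` arrows \<C> W (obj X (i-1)) =
       kernel (Hom \<C> W (obj X i)) (Hom \<C> W (obj X (i+1))) (\<lambda>f. dif X i \<cdot>\<^bsub>\<C>\<^esub> f) \<and>
     (\<lambda>g. g \<cdot>\<^bsub>\<C>\<^esub> dif X i) ` arrows \<C> (obj X (i+1)) W =
       kernel (Hom \<C> (obj X i) W) (Hom \<C> (obj X (i-1)) W) (\<lambda>g. g \<cdot>\<^bsub>\<C>\<^esub> dif X (i-1)))"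

definition n_exangle ::
  "nat \<Rightarrow> ('o, 'm) precategory \<Rightarrow> ('o, 'm, 'e) bifunctor \<Rightarrow> ('o, 'm) cochain \<Rightarrow> 'e \<Rightarrow> bool" where
  "n_exangle n \<C> \<E> X \<delta> \<longleftrightarrow>
     cochain_complex n \<C> X \<and> \<delta> \<in> extensions \<E> (obj X (n+1)) (obj X 0) \<and>
     weak_kernel_cokernel n \<C> X \<and>
     (\<forall>W\<in>Ob \<C>.
        (\<lambda>f. dif X n \<cdot>\<^bsub>\<C>\<^esub> f) ` arrows \<C> W (obj X n) =
          kernel (Hom \<C> W (obj X (n+1))) (Ext \<E> W (obj X 0)) (\<lambda>f. pull \<C> \<E> (obj X 0) f \<delta>) \<and>
        (\<lambda>g. g \<cdot>\<^bsub>\<C>\<^esub> dif X 0) ` arrows \<C> (obj X 1) W =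
          kernel (Hom \<C> (obj X 0) W) (Ext \<E> (obj X (n+1)) W) (\<lambda>g. push \<C> \<E> (obj X (n+1)) g \<delta>))"


section \<open>Exact realizations\<close>

text \<open>
  A correspondence \<open>\<ss>\<close> sends \<open>C\<close>, \<open>A\<close> and \<open>\<delta> \<in> \<E>(C,A)\<close> to a set of complexes; the objects are
  passed since the groups \<open>\<E>(C,A)\<close> may overlap. As \<open>\<ss>(\<delta>)\<close> is a homotopy equivalence class,
  \<open>\<ss>(\<delta>) = [X]\<close> means \<open>X \<in> \<ss>(\<delta>)\<close>.
\<close>

type_synonym ('o, 'm, 'e) correspondence = "'o \<Rightarrow> 'o \<Rightarrow> 'e \<Rightarrow> ('o, 'm) cochain set"

definition distinguished ::
  "nat \<Rightarrow> ('o, 'm) precategory \<Rightarrow> ('o, 'm, 'e) bifunctor \<Rightarrow> ('o, 'm, 'e) correspondence \<Rightarrow>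
   ('o, 'm) cochain \<Rightarrow> 'e \<Rightarrow> bool" where
  "distinguished n \<C> \<E> \<ss> X \<delta> \<longleftrightarrow>
     obj X 0 \<in> Ob \<C> \<and> obj X (n+1) \<in> Ob \<C> \<and>
     \<delta> \<in> extensions \<E> (obj X (n+1)) (obj X 0) \<and> X \<in> \<ss> (obj X (n+1)) (obj X 0) \<delta>"

text \<open>\<open>A \<rightarrow> A \<rightarrow> 0 \<rightarrow> \<dots> \<rightarrow> 0\<close> and \<open>0 \<rightarrow> \<dots> \<rightarrow> 0 \<rightarrow> A \<rightarrow> A\<close>, where \<open>Z\<close> is a zero object.\<close>

definition trivial_left ::
  "nat \<Rightarrow> ('o, 'm) precategory \<Rightarrow> 'o \<Rightarrow> 'o \<Rightarrow> ('o, 'm) cochain" where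
  "trivial_left n \<C> A Z =
     (let X = (\<lambda>i. if i \<le> 1 then A else Z)
      in \<lparr>obj = X, dif = (\<lambda>i. if i = 0 then Id \<C> A else \<one>\<^bsub>Hom \<C> (X i) (X (i+1))\<^esub>)\<rparr>)"

definition trivial_right ::
  "nat \<Rightarrow> ('o, 'm) precategory \<Rightarrow> 'o \<Rightarrow> 'o \<Rightarrow> ('o, 'm) cochain" where
  "trivial_right n \<C> A Z =
     (let X = (\<lambda>i. if i < n then Z else A)
      in \<lparr>obj = X, dif = (\<lambda>i. if i = n then Id \<C> A else \<one>\<^bsub>Hom \<C> (X i) (X (i+1))\<^esub>)\<rparr>)"

locale exact_realization = additive_bifunctor \<C> \<E>
  for n :: nat and \<C> :: "('o, 'm) precategory" (structure) and \<E> :: "('o, 'm, 'e) bifunctor" +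
  fixes \<ss> :: "('o, 'm, 'e) correspondence"
  assumes realization_class:
      "\<lbrakk>C \<in> Ob \<C>; A \<in> Ob \<C>; \<delta> \<in> extensions \<E> C A\<rbrakk>
        \<Longrightarrow> \<exists>X\<in>complexes_between n \<C> A C. \<ss> C A \<delta> = homotopy_class n \<C> A C X"
    and R0:
      "\<lbrakk>distinguished n \<C> \<E> \<ss> X \<delta>; distinguished n \<C> \<E> \<ss> Y \<rho>;
        ext_morphism \<C> \<E> (obj X (n+1)) (obj X 0) \<delta> (obj Y (n+1)) (obj Y 0) \<rho> a c\<rbrakk>
        \<Longrightarrow> \<exists>f. lift n \<C> X Y a c f"
    and R1: "distinguished n \<C> \<E> \<ss> X \<delta> \<Longrightarrow> n_exangle n \<C> \<E> X \<delta>"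
    and R2_left:
      "\<lbrakk>A \<in> Ob \<C>; zero_object \<C> Z\<rbrakk>
        \<Longrightarrow> \<ss> Z A \<one>\<^bsub>Ext \<E> Z A\<^esub> = homotopy_class n \<C> A Z (trivial_left n \<C> A Z)"
    and R2_right:
      "\<lbrakk>A \<in> Ob \<C>; zero_object \<C> Z\<rbrakk>
        \<Longrightarrow> \<ss> A Z \<one>\<^bsub>Ext \<E> A Z\<^esub> = homotopy_class n \<C> Z A (trivial_right n \<C> A Z)"

definition inflation ::
  "nat \<Rightarrow> ('o, 'm) precategory \<Rightarrow> ('o, 'm, 'e) bifunctor \<Rightarrow> ('o, 'm, 'e) correspondence \<Rightarrow>
   'o \<Rightarrow> 'o \<Rightarrow> 'm \<Rightarrow> bool" where
  "inflation n \<C> \<E> \<ss> A B f \<longleftrightarrow>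
     (\<exists>X \<delta>. distinguished n \<C> \<E> \<ss> X \<delta> \<and> obj X 0 = A \<and> obj X 1 = B \<and> dif X 0 = f)"

definition deflation ::
  "nat \<Rightarrow> ('o, 'm) precategory \<Rightarrow> ('o, 'm, 'e) bifunctor \<Rightarrow> ('o, 'm, 'e) correspondence \<Rightarrow>
   'o \<Rightarrow> 'o \<Rightarrow> 'm \<Rightarrow> bool" where
  "deflation n \<C> \<E> \<ss> B C f \<longleftrightarrow>
     (\<exists>X \<delta>. distinguished n \<C> \<E> \<ss> X \<delta> \<and> obj X n = B \<and> obj X (n+1) = C \<and> dif X n = f)"


section \<open>Mapping cones and cocones\<close>

text \<open>
  Biproducts are determined only up to canonical isomorphism, so the cone is a relation:
  \<open>M\<close> is a mapping cone of \<open>f\<close> formed with some choice of the biproducts \<open>X\<^sup>k\<^sup>+\<^sup>1 \<oplus> Y\<^sup>k\<close>. Two choices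
  give isomorphic complexes with the same extreme terms, hence the same homotopy equivalence class.
  The differentials are given by their matrix entries.
\<close>

definition mapping_cone ::
  "nat \<Rightarrow> ('o, 'm) precategory \<Rightarrow> ('o, 'm) cochain \<Rightarrow> ('o, 'm) cochain \<Rightarrow> (nat \<Rightarrow> 'm) \<Rightarrow>
   ('o, 'm) cochain \<Rightarrow> bool" where
  "mapping_cone n \<C> X Y f M \<longleftrightarrow>
     obj M 0 = obj X 1 \<and> obj M (n+1) = obj Y (n+1) \<and>
     (\<forall>k\<le>n. dif M k \<in> arrows \<C> (obj M k) (obj M (k+1))) \<and>
     (\<exists>i\<^sub>1 i\<^sub>2 p\<^sub>1 p\<^sub>2.
        (\<forall>k\<in>{1..n}. biproduct \<C> (obj X (k+1)) (obj Y k) (obj M k) (i\<^sub>1 k) (i\<^sub>2 k) (p\<^sub>1 k) (p\<^sub>2 k)) \<and>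
        p\<^sub>1 1 \<cdot>\<^bsub>\<C>\<^esub> dif M 0 = inv\<^bsub>Hom \<C> (obj X 1) (obj X 2)\<^esub> dif X 1 \<and>
        p\<^sub>2 1 \<cdot>\<^bsub>\<C>\<^esub> dif M 0 = f 1 \<and>
        (\<forall>k\<in>{1..<n}.
           p\<^sub>1 (k+1) \<cdot>\<^bsub>\<C>\<^esub> dif M k \<cdot>\<^bsub>\<C>\<^esub> i\<^sub>1 k = inv\<^bsub>Hom \<C> (obj X (k+1)) (obj X (k+2))\<^esub> dif X (k+1) \<and>
           p\<^sub>1 (k+1) \<cdot>\<^bsub>\<C>\<^esub> dif M k \<cdot>\<^bsub>\<C>\<^esub> i\<^sub>2 k = \<one>\<^bsub>Hom \<C> (obj Y k) (obj X (k+2))\<^esub> \<and>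
           p\<^sub>2 (k+1) \<cdot>\<^bsub>\<C>\<^esub> dif M k \<cdot>\<^bsub>\<C>\<^esub> i\<^sub>1 k = f (k+1) \<and>
           p\<^sub>2 (k+1) \<cdot>\<^bsub>\<C>\<^esub> dif M k \<cdot>\<^bsub>\<C>\<^esub> i\<^sub>2 k = dif Y k) \<and>
        dif M n \<cdot>\<^bsub>\<C>\<^esub> i\<^sub>1 n = f (n+1) \<and>
        dif M n \<cdot>\<^bsub>\<C>\<^esub> i\<^sub>2 n = dif Y n)"

text \<open>
  The cocone \<open>X\<^sup>0 \<rightarrow> X\<^sup>1 \<oplus> Y\<^sup>0 \<rightarrow> \<dots> \<rightarrow> X\<^sup>n \<oplus> Y\<^sup>n\<^sup>-\<^sup>1 \<rightarrow> Y\<^sup>n\<close> is the mapping cone formed in the opposite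
  category. Dualizing puts the signs on the differentials of \<open>Y\<close>: the first differential is
  \<open>(d\<^sub>X, h)\<close>, the matrix of a middle one has the rows \<open>(d\<^sub>X, 0)\<close> and \<open>(h, -d\<^sub>Y)\<close>, and the last one is
  \<open>(h, -d\<^sub>Y)\<close>. With the signs on the differentials of \<open>X\<close> instead, one would get a complex that
  realizes \<open>(-1)\<^sup>n(d\<^sub>Y)\<^sup>*\<rho>\<close> rather than \<open>(d\<^sub>Y)\<^sup>*\<rho>\<close>.
\<close>

definition mapping_cocone ::
  "nat \<Rightarrow> ('o, 'm) precategory \<Rightarrow> ('o, 'm) cochain \<Rightarrow> ('o, 'm) cochain \<Rightarrow> (nat \<Rightarrow> 'm) \<Rightarrow>
   ('o, 'm) cochain \<Rightarrow> bool" where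
  "mapping_cocone n \<C> X Y h N \<longleftrightarrow>
     obj N 0 = obj X 0 \<and> obj N (n+1) = obj Y n \<and>
     (\<forall>k\<le>n. dif N k \<in> arrows \<C> (obj N k) (obj N (k+1))) \<and>
     (\<exists>i\<^sub>1 i\<^sub>2 p\<^sub>1 p\<^sub>2.
        (\<forall>k\<in>{1..n}. biproduct \<C> (obj X k) (obj Y (k-1)) (obj N k) (i\<^sub>1 k) (i\<^sub>2 k) (p\<^sub>1 k) (p\<^sub>2 k)) \<and>
        p\<^sub>1 1 \<cdot>\<^bsub>\<C>\<^esub> dif N 0 = dif X 0 \<and>
        p\<^sub>2 1 \<cdot>\<^bsub>\<C>\<^esub> dif N 0 = h 0 \<and>
        (\<forall>k\<in>{1..<n}.
           p\<^sub>1 (k+1) \<cdot>\<^bsub>\<C>\<^esub> dif N k \<cdot>\<^bsub>\<C>\<^esub> i\<^sub>1 k = dif X k \<and>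
           p\<^sub>1 (k+1) \<cdot>\<^bsub>\<C>\<^esub> dif N k \<cdot>\<^bsub>\<C>\<^esub> i\<^sub>2 k = \<one>\<^bsub>Hom \<C> (obj Y (k-1)) (obj X (k+1))\<^esub> \<and>
           p\<^sub>2 (k+1) \<cdot>\<^bsub>\<C>\<^esub> dif N k \<cdot>\<^bsub>\<C>\<^esub> i\<^sub>1 k = h k \<and>
           p\<^sub>2 (k+1) \<cdot>\<^bsub>\<C>\<^esub> dif N k \<cdot>\<^bsub>\<C>\<^esub> i\<^sub>2 k = inv\<^bsub>Hom \<C> (obj Y (k-1)) (obj Y k)\<^esub> dif Y (k-1)) \<and>
        dif N n \<cdot>\<^bsub>\<C>\<^esub> i\<^sub>1 n = h n \<and>
        dif N n \<cdot>\<^bsub>\<C>\<^esub> i\<^sub>2 n = inv\<^bsub>Hom \<C> (obj Y (n-1)) (obj Y n)\<^esub> dif Y (n-1))"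


section \<open>\<open>n\<close>-exangulated categories\<close>

locale n_exangulated_category = exact_realization n \<C> \<E> \<ss>
  for n :: nat and \<C> :: "('o, 'm) precategory" (structure) and \<E> :: "('o, 'm, 'e) bifunctor"
    and \<ss> :: "('o, 'm, 'e) correspondence" +
  assumes EA1_inflation:
      "\<lbrakk>inflation n \<C> \<E> \<ss> A B f; inflation n \<C> \<E> \<ss> B D g\<rbrakk> \<Longrightarrow> inflation n \<C> \<E> \<ss> A D (g \<cdot> f)"
    and EA1_deflation:
      "\<lbrakk>deflation n \<C> \<E> \<ss> A B f; deflation n \<C> \<E> \<ss> B D g\<rbrakk> \<Longrightarrow> deflation n \<C> \<E> \<ss> A D (g \<cdot> f)"
    and EA2:
      "\<lbrakk>A \<in> Ob \<C>; C \<in> Ob \<C>; D \<in> Ob \<C>; \<rho> \<in> extensions \<E> D A; c \<in> arrows \<C> C D;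
        obj X 0 = A; obj X (n+1) = C; distinguished n \<C> \<E> \<ss> X (pull \<C> \<E> A c \<rho>);
        obj Y 0 = A; obj Y (n+1) = D; distinguished n \<C> \<E> \<ss> Y \<rho>\<rbrakk>
        \<Longrightarrow> \<exists>f M. lift n \<C> X Y (Id \<C> A) c f \<and> mapping_cone n \<C> X Y f M \<and>
              distinguished n \<C> \<E> \<ss> M (push \<C> \<E> D (dif X 0) \<rho>)"
    and EA2_op:
      "\<lbrakk>A \<in> Ob \<C>; B \<in> Ob \<C>; C \<in> Ob \<C>; \<rho> \<in> extensions \<E> C A; a \<in> arrows \<C> A B;
        obj X 0 = A; obj X (n+1) = C; distinguished n \<C> \<E> \<ss> X \<rho>;
        obj Y 0 = B; obj Y (n+1) = C; distinguished n \<C> \<E> \<ss> Y (push \<C> \<E> C a \<rho>)\<rbrakk>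
        \<Longrightarrow> \<exists>h N. lift n \<C> X Y a (Id \<C> C) h \<and> mapping_cocone n \<C> X Y h N \<and>
              distinguished n \<C> \<E> \<ss> N (pull \<C> \<E> A (dif Y n) \<rho>)"

definition projectives ::
  "nat \<Rightarrow> ('o, 'm) precategory \<Rightarrow> ('o, 'm, 'e) bifunctor \<Rightarrow> ('o, 'm, 'e) correspondence \<Rightarrow> 'o set"
  where
  "projectives n \<C> \<E> \<ss> = {P \<in> Ob \<C>. \<forall>X \<delta>. distinguished n \<C> \<E> \<ss> X \<delta> \<longrightarrow>
     (\<forall>c\<in>arrows \<C> P (obj X (n+1)). \<exists>b\<in>arrows \<C> P (obj X n). dif X n \<cdot>\<^bsub>\<C>\<^esub> b = c)}"

definition injectives ::
  "nat \<Rightarrow> ('o, 'm) precategory \<Rightarrow> ('o, 'm, 'e) bifunctor \<Rightarrow> ('o, 'm, 'e) correspondence \<Rightarrow> 'o set"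
  where
  "injectives n \<C> \<E> \<ss> = {I \<in> Ob \<C>. \<forall>X \<delta>. distinguished n \<C> \<E> \<ss> X \<delta> \<longrightarrow>
     (\<forall>a\<in>arrows \<C> (obj X 0) I. \<exists>b\<in>arrows \<C> (obj X 1) I. b \<cdot>\<^bsub>\<C>\<^esub> dif X 0 = a)}"


section \<open>Ideal quotients\<close>

text \<open>Full subcategories are given by their sets of objects. The zero objects are the empty direct sums.\<close>

definition iso_closed :: "('o, 'm) precategory \<Rightarrow> 'o set \<Rightarrow> bool" where
  "iso_closed \<C> \<X> \<longleftrightarrow> (\<forall>A\<in>\<X>. \<forall>B\<in>Ob \<C>. isomorphic \<C> A B \<longrightarrow> B \<in> \<X>)"

definition finite_sum_closed :: "('o, 'm) precategory \<Rightarrow> 'o set \<Rightarrow> bool" where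
  "finite_sum_closed \<C> \<X> \<longleftrightarrow>
     (\<forall>Z. zero_object \<C> Z \<longrightarrow> Z \<in> \<X>) \<and>
     (\<forall>A\<in>\<X>. \<forall>B\<in>\<X>. \<forall>S i\<^sub>1 i\<^sub>2 p\<^sub>1 p\<^sub>2. biproduct \<C> A B S i\<^sub>1 i\<^sub>2 p\<^sub>1 p\<^sub>2 \<longrightarrow> S \<in> \<X>)"

definition factoring :: "('o, 'm) precategory \<Rightarrow> 'o set \<Rightarrow> 'o \<Rightarrow> 'o \<Rightarrow> 'm set" where
  "factoring \<C> \<X> A B = {g \<cdot>\<^bsub>\<C>\<^esub> f | Q f g. Q \<in> \<X> \<and> f \<in> arrows \<C> A Q \<and> g \<in> arrows \<C> Q B}"

definition residue :: "('o, 'm) precategory \<Rightarrow> 'o set \<Rightarrow> 'o \<Rightarrow> 'o \<Rightarrow> 'm \<Rightarrow> 'm set" where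
  "residue \<C> \<X> A B f = factoring \<C> \<X> A B #>\<^bsub>Hom \<C> A B\<^esub> f"

text \<open>
  The morphisms of \<open>\<C>/\<X>\<close> are cosets. Composition and the action of \<open>\<E>\<close> are computed on
  representatives; for an ideal \<open>[\<X>]\<close> on which \<open>\<E>\<close> vanishes all of them give the same result, so
  the union below is a union of equal cosets, and the image below is a singleton.
\<close>

definition ideal_quotient :: "('o, 'm) precategory \<Rightarrow> 'o set \<Rightarrow> ('o, 'm set) precategory" where
  "ideal_quotient \<C> \<X> =
     \<lparr>Ob = Ob \<C>,
      Hom = (\<lambda>A B. Hom \<C> A B Mod factoring \<C> \<X> A B),
      Id = (\<lambda>A. residue \<C> \<X> A A (Id \<C> A)),
      Comp = (\<lambda>G F. \<Union>{residue \<C> \<X> A D (g \<cdot>\<^bsub>\<C>\<^esub> f) | A B D f g.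
                A \<in> Ob \<C> \<and> B \<in> Ob \<C> \<and> D \<in> Ob \<C> \<and>
                f \<in> F \<inter> arrows \<C> A B \<and> g \<in> G \<inter> arrows \<C> B D})\<rparr>"

definition quotient_bifunctor :: "('o, 'm, 'e) bifunctor \<Rightarrow> ('o, 'm set, 'e) bifunctor" where
  "quotient_bifunctor \<E> =
     \<lparr>Ext = Ext \<E>,
      Act = (\<lambda>c' a' \<delta>. the_elem {Act \<E> c a \<delta> | c a. c \<in> c' \<and> a \<in> a'})\<rparr>"

definition quotient_complex ::
  "('o, 'm) precategory \<Rightarrow> 'o set \<Rightarrow> ('o, 'm) cochain \<Rightarrow> ('o, 'm set) cochain" where
  "quotient_complex \<C> \<X> X =
     \<lparr>obj = obj X, dif = (\<lambda>i. residue \<C> \<X> (obj X i) (obj X (i+1)) (dif X i))\<rparr>"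

text \<open>Again the union is one of equal classes, as homotopies in \<open>\<C>\<close> descend to \<open>\<C>/\<X>\<close>.\<close>

definition quotient_correspondence ::
  "nat \<Rightarrow> ('o, 'm) precategory \<Rightarrow> 'o set \<Rightarrow> ('o, 'm, 'e) correspondence \<Rightarrow>
   ('o, 'm set, 'e) correspondence" where
  "quotient_correspondence n \<C> \<X> \<ss> = (\<lambda>C A \<delta>.
     \<Union>X\<in>\<ss> C A \<delta>. homotopy_class n (ideal_quotient \<C> \<X>) A C (quotient_complex \<C> \<X> X))"

end

theory Submission
  imports Defs "HOL-Algebra.Ring"
begin

text \<open>
  Let \<open>\<X>\<close> consist of objects that are both projective and injective. An extension that ends or starts in
  \<open>\<X>\<close> is zero, because the last, resp. first, differential of its realization splits. Hence \<open>\<E>\<close>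
  vanishes on the ideal \<open>[\<X>]\<close> and descends to the quotient, and so do chain maps, homotopies and
  mapping cones. Of the conditions for an \<open>n\<close>-exangle, those at the terms next to \<open>\<E>\<close> hold in the
  quotient automatically: if \<open>f\<^sup>*\<delta> = 0\<close> in the quotient, then \<open>f\<^sup>*\<delta> = 0\<close> in \<open>\<C>\<close>, and \<open>f\<close> factors
  already there. The conditions at the intermediate terms are the weak kernel-cokernel condition.
  So the condition is necessary by (R1), and if it holds, the induced correspondence is an exact
  realization (\<open>quot_exact_realization\<close>).

  It remains to pass (EA1) and (EA2) to the quotient. The obstacle is that a realization is a homotopy
  class in the quotient: a distinguished complex there is only homotopy equivalent to the image of one
  of \<open>\<C>\<close>, its objects may be unrelated to those of the latter, and an inflation of the quotient need
  not be the class of an inflation of \<open>\<C>\<close>.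

  The basic tool is \<open>homotopy_equivalent_of_lifts\<close>: if complexes with weak kernels have the same ends
  and chain maps \<open>f\<close>, \<open>g\<close> in both directions that are identities at the ends, then they are homotopy
  equivalent, even if \<open>f\<close> and \<open>g\<close> are unrelated. Indeed \<open>u = 1 - gf\<close> vanishes at the ends, so \<open>u\<^sup>2\<close>
  is null-homotopic, and \<open>1 - u\<^sup>2 = (2g - gfg)f\<close>. It shows that a complex realizes an extension as
  soon as it can be compared with a known realization.

  For (EA2), cones of chain maps that agree up to homotopy can be compared in this way. Therefore
  (EA2) holds for all representatives of the two homotopy classes once it holds for one choice of
  them (\<open>EA2_representatives\<close>), and the images of complexes of \<open>\<C>\<close> provide such a choice.

  For (EA1), let \<open>F : A \<rightarrow> B\<close> and \<open>G : B \<rightarrow> D\<close> be inflations of the quotient. There is an inflation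
  \<open>f : A \<rightarrow> S\<close> of \<open>\<C>\<close> such that, in the quotient, \<open>B\<close> is a retract of \<open>S\<close> and \<open>F\<close>, \<open>f\<close> correspond to
  each other under the retraction and its section \<open>\<psi> : B \<rightarrow> S\<close> (\<open>split_inflation\<close>). The extension of \<open>G\<close>,
  pushed out along \<open>\<psi>\<close>, is realized in \<open>\<C>\<close>, and composing its inflation with \<open>f\<close> gives, by (EA1) in \<open>\<C>\<close>,
  an inflation \<open>v\<close> such that \<open>v\<close> and \<open>GF\<close> factor through each other. For \<open>n \<ge> 2\<close> a morphism that
  factors through an inflation and conversely is itself an inflation: the two factorizations are
  absorbed by summands added in degrees \<open>2\<close> and \<open>3\<close> (\<open>inflation_of_domination\<close>). For \<open>n = 1\<close> there is
  no room for such summands, but then homotopy equivalences that fix the ends are isomorphisms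
  (\<open>short_middle_isomorphism\<close>), and the claim is immediate.

  Deflations and cocones are treated by applying all this to the opposite category.
\<close>

section \<open>Morphisms of an additive category\<close>

context additive_category
begin

text \<open>
  A morphism determines its source and target, as the sets of morphisms are disjoint. With \<open>src\<close> and \<open>tgt\<close>
  the group operations need not name the group they belong to, so that identities between sums of
  composites become rewriting problems.
\<close>

definition arr :: "'m \<Rightarrow> bool" where
  "arr f \<longleftrightarrow> (\<exists>A\<in>Ob \<C>. \<exists>B\<in>Ob \<C>. f \<in> arrows \<C> A B)"

definition src :: "'m \<Rightarrow> 'o" where
  "src f = (THE A. A \<in> Ob \<C> \<and> (\<exists>B\<in>Ob \<C>. f \<in> arrows \<C> A B))"

definition tgt :: "'m \<Rightarrow> 'o" where
  "tgt f = (THE B. B \<in> Ob \<C> \<and> (\<exists>A\<in>Ob \<C>. f \<in> arrows \<C> A B))"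

definition add :: "'m \<Rightarrow> 'm \<Rightarrow> 'm" (infixl \<open>\<boxplus>\<close> 65) where
  "f \<boxplus> g = f \<otimes>\<^bsub>Hom \<C> (src f) (tgt f)\<^esub> g"

definition neg :: "'m \<Rightarrow> 'm" (\<open>\<boxminus> _\<close> [80] 80) where
  "\<boxminus> f = inv\<^bsub>Hom \<C> (src f) (tgt f)\<^esub> f"

definition zero :: "'o \<Rightarrow> 'o \<Rightarrow> 'm" where
  "zero A B = \<one>\<^bsub>Hom \<C> A B\<^esub>"

definition maps :: "'m \<Rightarrow> 'o \<Rightarrow> 'o \<Rightarrow> bool" (\<open>_ \<proportion> _ \<rightarrow> _\<close> [51, 51, 51] 50) where
  "f \<proportion> A \<rightarrow> B \<longleftrightarrow> A \<in> Ob \<C> \<and> B \<in> Ob \<C> \<and> f \<in> arrows \<C> A B"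

lemma src_eq: "f \<proportion> A \<rightarrow> B \<Longrightarrow> src f = A"
  unfolding maps_def src_def by (rule the_equality) (use hom_disjoint in blast)+

lemma tgt_eq: "f \<proportion> A \<rightarrow> B \<Longrightarrow> tgt f = B"
  unfolding maps_def tgt_def by (rule the_equality) (use hom_disjoint in blast)+

lemma maps_iff: "f \<proportion> A \<rightarrow> B \<longleftrightarrow> arr f \<and> src f = A \<and> tgt f = B"
proof
  assume "f \<proportion> A \<rightarrow> B"
  then show "arr f \<and> src f = A \<and> tgt f = B"
    using src_eq tgt_eq by (auto simp: arr_def maps_def)
next
  assume *: "arr f \<and> src f = A \<and> tgt f = B"
  then obtain A' B' where "f \<proportion> A' \<rightarrow> B'" unfolding arr_def maps_def by blast
  then show "f \<proportion> A \<rightarrow> B" using src_eq tgt_eq * by auto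
qed

lemma arrows_iff: "A \<in> Ob \<C> \<Longrightarrow> B \<in> Ob \<C> \<Longrightarrow> f \<in> arrows \<C> A B \<longleftrightarrow> arr f \<and> src f = A \<and> tgt f = B"
  using maps_iff by (auto simp: maps_def)

lemma src_Ob [simp]: "arr f \<Longrightarrow> src f \<in> Ob \<C>"
  and tgt_Ob [simp]: "arr f \<Longrightarrow> tgt f \<in> Ob \<C>"
  using maps_iff[of f "src f" "tgt f"] by (auto simp: maps_def)

lemma arr_arrows: "arr f \<Longrightarrow> f \<in> arrows \<C> (src f) (tgt f)"
  using arrows_iff by simp

lemma hom_group: "A \<in> Ob \<C> \<Longrightarrow> B \<in> Ob \<C> \<Longrightarrow> group (Hom \<C> A B)"
  by (simp add: comm_group.axioms(2) hom_comm_group)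

lemma hom_monoid: "A \<in> Ob \<C> \<Longrightarrow> B \<in> Ob \<C> \<Longrightarrow> monoid (Hom \<C> A B)"
  by (simp add: group.is_monoid hom_group)

lemma maps_comp: "f \<proportion> A \<rightarrow> B \<Longrightarrow> g \<proportion> B \<rightarrow> D \<Longrightarrow> g \<cdot> f \<proportion> A \<rightarrow> D"
  unfolding maps_def using comp_closed by blast

lemma maps_add: "f \<proportion> A \<rightarrow> B \<Longrightarrow> g \<proportion> A \<rightarrow> B \<Longrightarrow> f \<boxplus> g \<proportion> A \<rightarrow> B"
  using src_eq tgt_eq hom_monoid[of A B] by (auto simp: add_def maps_def monoid.m_closed)

lemma maps_neg: "f \<proportion> A \<rightarrow> B \<Longrightarrow> \<boxminus> f \<proportion> A \<rightarrow> B"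
  using src_eq tgt_eq hom_group[of A B] by (auto simp: neg_def maps_def group.inv_closed)

lemma maps_zero: "A \<in> Ob \<C> \<Longrightarrow> B \<in> Ob \<C> \<Longrightarrow> zero A B \<proportion> A \<rightarrow> B"
  using hom_monoid[of A B] by (auto simp: zero_def maps_def monoid.one_closed)

lemma maps_Id: "A \<in> Ob \<C> \<Longrightarrow> Id \<C> A \<proportion> A \<rightarrow> A"
  by (simp add: maps_def id_closed)

lemma arr_comp [simp]:
  assumes "arr f" "arr g" "tgt f = src g"
  shows "arr (g \<cdot> f)" "src (g \<cdot> f) = src f" "tgt (g \<cdot> f) = tgt g"
  using maps_comp[of f "src f" "tgt f" g "tgt g"] assms by (auto simp: maps_iff)

lemma arr_add [simp]:
  assumes "arr f" "arr g" "src f = src g" "tgt f = tgt g"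
  shows "arr (f \<boxplus> g)" "src (f \<boxplus> g) = src f" "tgt (f \<boxplus> g) = tgt f"
  using maps_add[of f "src f" "tgt f" g] assms by (auto simp: maps_iff)

lemma arr_neg [simp]:
  assumes "arr f"
  shows "arr (\<boxminus> f)" "src (\<boxminus> f) = src f" "tgt (\<boxminus> f) = tgt f"
  using maps_neg[of f "src f" "tgt f"] assms by (auto simp: maps_iff)

lemma arr_zero [simp]:
  assumes "A \<in> Ob \<C>" "B \<in> Ob \<C>"
  shows "arr (zero A B)" "src (zero A B) = A" "tgt (zero A B) = B"
  using maps_zero[of A B] assms by (auto simp: maps_iff)

lemma arr_Id [simp]:
  assumes "A \<in> Ob \<C>"
  shows "arr (Id \<C> A)" "src (Id \<C> A) = A" "tgt (Id \<C> A) = A"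
  using maps_Id[of A] assms by (auto simp: maps_iff)

lemma Id_comp [simp]: "arr f \<Longrightarrow> tgt f = A \<Longrightarrow> Id \<C> A \<cdot> f = f"
  and comp_Id [simp]: "arr f \<Longrightarrow> src f = A \<Longrightarrow> f \<cdot> Id \<C> A = f"
  using id_left id_right arr_arrows by (metis src_Ob tgt_Ob)+

lemma assoc: "\<lbrakk>arr f; arr g; arr h; tgt f = src g; tgt g = src h\<rbrakk> \<Longrightarrow> (h \<cdot> g) \<cdot> f = h \<cdot> (g \<cdot> f)"
  using comp_assoc arr_arrows by (metis src_Ob tgt_Ob)

lemma add_eq: "f \<proportion> A \<rightarrow> B \<Longrightarrow> f \<otimes>\<^bsub>Hom \<C> A B\<^esub> g = f \<boxplus> g"
  by (simp add: add_def src_eq tgt_eq)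

lemma neg_eq: "f \<proportion> A \<rightarrow> B \<Longrightarrow> inv\<^bsub>Hom \<C> A B\<^esub> f = \<boxminus> f"
  by (simp add: neg_def src_eq tgt_eq)

lemma comp_add: "\<lbrakk>arr f; arr f'; arr g; src f = src f'; tgt f = tgt f'; tgt f = src g\<rbrakk>
    \<Longrightarrow> g \<cdot> (f \<boxplus> f') = g \<cdot> f \<boxplus> g \<cdot> f'"
  using comp_add_right[of "src f" "tgt f" "tgt g" f f' g] arr_arrows
  by (simp add: add_def arrows_iff)

lemma add_comp: "\<lbrakk>arr f; arr g; arr g'; src g = src g'; tgt g = tgt g'; tgt f = src g\<rbrakk>
    \<Longrightarrow> (g \<boxplus> g') \<cdot> f = g \<cdot> f \<boxplus> g' \<cdot> f"
  using comp_add_left[of "src f" "tgt f" "tgt g" f g g'] arr_arrows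
  by (simp add: add_def arrows_iff)

lemma add_assoc: "\<lbrakk>arr f; arr g; arr h; src f = src g; src g = src h; tgt f = tgt g; tgt g = tgt h\<rbrakk>
    \<Longrightarrow> (f \<boxplus> g) \<boxplus> h = f \<boxplus> (g \<boxplus> h)"
  using monoid.m_assoc[OF hom_monoid, of "src f" "tgt f" f g h] arr_arrows arr_add[of f g]
  by (simp add: add_def arrows_iff)

lemma add_comm: "\<lbrakk>arr f; arr g; src f = src g; tgt f = tgt g\<rbrakk> \<Longrightarrow> f \<boxplus> g = g \<boxplus> f"
  using comm_monoid.m_comm[OF comm_group.axioms(1)[OF hom_comm_group], of "src f" "tgt f" f g] arr_arrows
  by (simp add: add_def arrows_iff)

lemma add_zero [simp]:
  assumes "arr f" "src f = A" "tgt f = B" shows "f \<boxplus> zero A B = f"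
  using assms monoid.r_one[OF hom_monoid, of A B f] arr_arrows[of f] by (auto simp: add_def zero_def)

lemma zero_add [simp]:
  assumes "arr f" "src f = A" "tgt f = B" shows "zero A B \<boxplus> f = f"
  using assms add_comm[of "zero A B" f] by fastforce

lemma add_neg [simp]:
  assumes "arr f" shows "f \<boxplus> \<boxminus> f = zero (src f) (tgt f)"
  using assms group.r_inv[OF hom_group, of "src f" "tgt f" f] arr_arrows[of f]
  by (simp add: add_def neg_def zero_def)

lemma neg_add [simp]:
  assumes "arr f" shows "\<boxminus> f \<boxplus> f = zero (src f) (tgt f)"
  using assms add_comm[of "\<boxminus> f" f] by simp

lemma add_left_comm: "\<lbrakk>arr f; arr g; arr h; src f = src g; src g = src h; tgt f = tgt g; tgt g = tgt h\<rbrakk>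
    \<Longrightarrow> f \<boxplus> (g \<boxplus> h) = g \<boxplus> (f \<boxplus> h)"
  by (metis add_assoc add_comm)

lemma add_neg_cancel [simp]: "\<lbrakk>arr f; arr g; src f = src g; tgt f = tgt g\<rbrakk> \<Longrightarrow> f \<boxplus> (\<boxminus> f \<boxplus> g) = g"
  and neg_add_cancel [simp]: "\<lbrakk>arr f; arr g; src f = src g; tgt f = tgt g\<rbrakk> \<Longrightarrow> \<boxminus> f \<boxplus> (f \<boxplus> g) = g"
  by (simp_all flip: add_assoc)

lemma add_cancel: "\<lbrakk>arr f; arr g; arr h; src f = src g; src g = src h; tgt f = tgt g; tgt g = tgt h\<rbrakk>
    \<Longrightarrow> f \<boxplus> g = f \<boxplus> h \<longleftrightarrow> g = h"
  by (metis neg_add_cancel)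

lemma neg_unique: "\<lbrakk>arr f; arr g; src f = src g; tgt f = tgt g; f \<boxplus> g = zero (src f) (tgt f)\<rbrakk> \<Longrightarrow> g = \<boxminus> f"
  by (rule iffD1[OF add_cancel[of f g "\<boxminus> f"]]) simp_all

lemma neg_neg [simp]: "arr f \<Longrightarrow> \<boxminus> \<boxminus> f = f"
  by (rule neg_unique[symmetric]) simp_all

lemma zero_comp [simp]: "\<lbrakk>arr f; tgt f = A; B \<in> Ob \<C>\<rbrakk> \<Longrightarrow> zero A B \<cdot> f = zero (src f) B"
proof -
  assume f: "arr f" "tgt f = A" "B \<in> Ob \<C>"
  then have A: "A \<in> Ob \<C>" using tgt_Ob by blast
  have "zero A B \<cdot> f \<boxplus> zero A B \<cdot> f = zero A B \<cdot> f \<boxplus> zero (src f) B"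
    using add_comp[of f "zero A B" "zero A B"] f A by simp
  then show ?thesis using add_cancel[of "zero A B \<cdot> f" "zero A B \<cdot> f" "zero (src f) B"] f A by simp
qed

lemma comp_zero [simp]: "\<lbrakk>arr f; src f = B; A \<in> Ob \<C>\<rbrakk> \<Longrightarrow> f \<cdot> zero A B = zero A (tgt f)"
proof -
  assume f: "arr f" "src f = B" "A \<in> Ob \<C>"
  then have B: "B \<in> Ob \<C>" using src_Ob by blast
  have "f \<cdot> zero A B \<boxplus> f \<cdot> zero A B = f \<cdot> zero A B \<boxplus> zero A (tgt f)"
    using comp_add[of "zero A B" "zero A B" f] f B by simp
  then show ?thesis using add_cancel[of "f \<cdot> zero A B" "f \<cdot> zero A B" "zero A (tgt f)"] f B by simp
qed

lemma neg_comp: "\<lbrakk>arr f; arr g; tgt f = src g\<rbrakk> \<Longrightarrow> (\<boxminus> g) \<cdot> f = \<boxminus> (g \<cdot> f)"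
  by (rule neg_unique) (simp_all flip: add_comp)

lemma comp_neg: "\<lbrakk>arr f; arr g; tgt f = src g\<rbrakk> \<Longrightarrow> g \<cdot> (\<boxminus> f) = \<boxminus> (g \<cdot> f)"
  by (rule neg_unique) (simp_all flip: comp_add)

lemma neg_zero [simp]: "\<lbrakk>A \<in> Ob \<C>; B \<in> Ob \<C>\<rbrakk> \<Longrightarrow> \<boxminus> zero A B = zero A B"
  by (rule neg_unique[symmetric]) simp_all

lemma neg_sum: "\<lbrakk>arr f; arr g; src f = src g; tgt f = tgt g\<rbrakk> \<Longrightarrow> \<boxminus> (f \<boxplus> g) = \<boxminus> f \<boxplus> \<boxminus> g"
  by (rule neg_unique[symmetric]) (simp_all add: add_assoc add_left_comm[of _ "\<boxminus> f"])

lemma maps_unfold: "f \<proportion> A \<rightarrow> B \<longleftrightarrow> arr f \<and> src f = A \<and> tgt f = B \<and> A \<in> Ob \<C> \<and> B \<in> Ob \<C>"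
  by (auto simp: maps_iff)

text \<open>
  These rules turn an expression into a sum of right-associated composites, ordered by permutative
  rewriting; the ring normalizer can then prove equations between such expressions.
\<close>

lemmas [algebra add: additive_category "zero" "add" "neg" "Comp \<C>"] =
  maps_unfold src_Ob tgt_Ob arr_comp arr_add arr_neg arr_zero arr_Id Id_comp comp_Id assoc comp_add add_comp
  add_assoc add_comm add_left_comm add_zero zero_add add_neg neg_add neg_neg add_neg_cancel
  neg_add_cancel zero_comp comp_zero neg_comp comp_neg neg_zero neg_sum

end

section \<open>Chain maps and homotopies\<close>

context additive_category
begin

lemma cochain_complex_iff:
  "cochain_complex n \<C> X \<longleftrightarrow> (\<forall>i\<le>Suc n. obj X i \<in> Ob \<C>) \<and>
     (\<forall>i\<le>n. dif X i \<proportion> obj X i \<rightarrow> obj X (Suc i)) \<and>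
     (\<forall>i<n. dif X (Suc i) \<cdot> dif X i = zero (obj X i) (obj X (Suc (Suc i))))"
  by (auto simp: cochain_complex_def maps_def zero_def)

lemma chain_map_iff:
  assumes "cochain_complex n \<C> X" "cochain_complex n \<C> Y"
  shows "chain_map n \<C> X Y f \<longleftrightarrow> (\<forall>i\<le>Suc n. f i \<proportion> obj X i \<rightarrow> obj Y i) \<and>
     (\<forall>i\<le>n. f (Suc i) \<cdot> dif X i = dif Y i \<cdot> f i)"
  using assms by (auto simp: chain_map_def maps_def cochain_complex_def)

lemma complex_Ob: "cochain_complex n \<C> X \<Longrightarrow> i \<le> Suc n \<Longrightarrow> obj X i \<in> Ob \<C>"
  and complex_dif: "cochain_complex n \<C> X \<Longrightarrow> i \<le> n \<Longrightarrow> dif X i \<proportion> obj X i \<rightarrow> obj X (Suc i)"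
  and complex_dif_dif: "cochain_complex n \<C> X \<Longrightarrow> i < n \<Longrightarrow>
    dif X (Suc i) \<cdot> dif X i = zero (obj X i) (obj X (Suc (Suc i)))"
  by (auto simp: cochain_complex_iff)

lemma chain_map_maps: "cochain_complex n \<C> X \<Longrightarrow> cochain_complex n \<C> Y \<Longrightarrow> chain_map n \<C> X Y f \<Longrightarrow>
    i \<le> Suc n \<Longrightarrow> f i \<proportion> obj X i \<rightarrow> obj Y i"
  and chain_map_commute: "cochain_complex n \<C> X \<Longrightarrow> cochain_complex n \<C> Y \<Longrightarrow> chain_map n \<C> X Y f \<Longrightarrow>
    i \<le> n \<Longrightarrow> f (Suc i) \<cdot> dif X i = dif Y i \<cdot> f i"
  by (auto simp: chain_map_iff)

lemma maps_comp_assoc: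
  "f \<proportion> A \<rightarrow> B \<Longrightarrow> g \<proportion> B \<rightarrow> D \<Longrightarrow> h \<proportion> D \<rightarrow> E \<Longrightarrow> (h \<cdot> g) \<cdot> f = h \<cdot> g \<cdot> f"
  by (simp add: maps_iff assoc)

lemma chain_map_comp:
  assumes X: "cochain_complex n \<C> X" and Y: "cochain_complex n \<C> Y" and Z: "cochain_complex n \<C> Z"
    and f: "chain_map n \<C> X Y f" and g: "chain_map n \<C> Y Z g"
  shows "chain_map n \<C> X Z (\<lambda>i. g i \<cdot> f i)"
  unfolding chain_map_iff[OF X Z]
proof (intro conjI allI impI)
  fix i assume "i \<le> Suc n"
  then show "g i \<cdot> f i \<proportion> obj X i \<rightarrow> obj Z i"
    using chain_map_maps[OF X Y f] chain_map_maps[OF Y Z g] maps_comp by blast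
next
  fix i assume i: "i \<le> n"
  then have "(g (Suc i) \<cdot> f (Suc i)) \<cdot> dif X i = g (Suc i) \<cdot> dif Y i \<cdot> f i"
    using chain_map_maps[OF X Y f, of "Suc i"] chain_map_maps[OF Y Z g, of "Suc i"] complex_dif[OF X, of i]
      chain_map_commute[OF X Y f, of i] maps_comp_assoc by simp
  also have "\<dots> = (g (Suc i) \<cdot> dif Y i) \<cdot> f i"
    using i chain_map_maps[OF X Y f, of i] chain_map_maps[OF Y Z g, of "Suc i"] complex_dif[OF Y, of i]
      maps_comp_assoc by simp
  also have "\<dots> = dif Z i \<cdot> g i \<cdot> f i"
    using i chain_map_maps[OF X Y f, of i] chain_map_maps[OF Y Z g, of i] complex_dif[OF Z, of i]
      chain_map_commute[OF Y Z g, of i] maps_comp_assoc by simp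
  finally show "(g (Suc i) \<cdot> f (Suc i)) \<cdot> dif X i = dif Z i \<cdot> g i \<cdot> f i" .
qed

lemma chain_map_Id:
  assumes X: "cochain_complex n \<C> X"
  shows "chain_map n \<C> X X (\<lambda>i. Id \<C> (obj X i))"
  unfolding chain_map_iff[OF X X]
  using complex_Ob[OF X] complex_dif[OF X] by (auto simp: maps_Id maps_iff)

lemma chain_map_add:
  assumes X: "cochain_complex n \<C> X" and Y: "cochain_complex n \<C> Y"
    and f: "chain_map n \<C> X Y f" and g: "chain_map n \<C> X Y g"
  shows "chain_map n \<C> X Y (\<lambda>i. f i \<boxplus> g i)"
  unfolding chain_map_iff[OF X Y]
proof (intro conjI allI impI)
  fix i assume "i \<le> Suc n"
  then show "f i \<boxplus> g i \<proportion> obj X i \<rightarrow> obj Y i"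
    using chain_map_maps[OF X Y f] chain_map_maps[OF X Y g] maps_add by blast
next
  fix i assume i: "i \<le> n"
  show "(f (Suc i) \<boxplus> g (Suc i)) \<cdot> dif X i = dif Y i \<cdot> (f i \<boxplus> g i)"
    using i chain_map_maps[OF X Y f, of i] chain_map_maps[OF X Y g, of i] chain_map_maps[OF X Y f, of "Suc i"]
      chain_map_maps[OF X Y g, of "Suc i"] complex_dif[OF X, of i] complex_dif[OF Y, of i]
      chain_map_commute[OF X Y f, of i] chain_map_commute[OF X Y g, of i]
    by (simp add: maps_iff add_comp comp_add)
qed

lemma chain_map_neg:
  assumes X: "cochain_complex n \<C> X" and Y: "cochain_complex n \<C> Y" and f: "chain_map n \<C> X Y f"
  shows "chain_map n \<C> X Y (\<lambda>i. \<boxminus> f i)"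
  unfolding chain_map_iff[OF X Y]
proof (intro conjI allI impI)
  fix i assume "i \<le> Suc n"
  then show "\<boxminus> f i \<proportion> obj X i \<rightarrow> obj Y i"
    using chain_map_maps[OF X Y f] maps_neg by blast
next
  fix i assume i: "i \<le> n"
  show "\<boxminus> f (Suc i) \<cdot> dif X i = dif Y i \<cdot> \<boxminus> f i"
    using i chain_map_maps[OF X Y f, of i] chain_map_maps[OF X Y f, of "Suc i"]
      complex_dif[OF X, of i] complex_dif[OF Y, of i] chain_map_commute[OF X Y f, of i]
    by (simp add: maps_iff neg_comp comp_neg)
qed

text \<open>
  The chain map \<open>dk + kd\<close>. The family \<open>k\<close> is indexed by its target, \<open>k i\<close> leads from degree \<open>i + 1\<close> to
  degree \<open>i\<close>, which keeps all indices in the range \<open>{0..n}\<close>.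
\<close>

definition boundary :: "nat \<Rightarrow> ('o, 'm) cochain \<Rightarrow> ('o, 'm) cochain \<Rightarrow> (nat \<Rightarrow> 'm) \<Rightarrow> nat \<Rightarrow> 'm" where
  "boundary n X Y k i =
     (if i = 0 then k 0 \<cdot> dif X 0 else if i = Suc n then dif Y n \<cdot> k n
      else dif Y (i - 1) \<cdot> k (i - 1) \<boxplus> k i \<cdot> dif X i)"

definition lowering :: "nat \<Rightarrow> ('o, 'm) cochain \<Rightarrow> ('o, 'm) cochain \<Rightarrow> (nat \<Rightarrow> 'm) \<Rightarrow> bool" where
  "lowering n X Y k \<longleftrightarrow> (\<forall>i\<le>n. k i \<proportion> obj X (Suc i) \<rightarrow> obj Y i)"

lemma boundary_simps:
  "boundary n X Y k 0 = k 0 \<cdot> dif X 0"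
  "boundary n X Y k (Suc n) = dif Y n \<cdot> k n"
  "i < n \<Longrightarrow> boundary n X Y k (Suc i) = dif Y i \<cdot> k i \<boxplus> k (Suc i) \<cdot> dif X (Suc i)"
  by (auto simp: boundary_def)

lemma degree_cases [consumes 1, case_names first middle last]:
  fixes i n :: nat
  assumes "i \<le> Suc n"
  obtains "i = 0" | j where "i = Suc j" "j < n" | "i = Suc n"
  using assms by (cases i) (auto simp: less_le)

lemma boundary_maps:
  assumes X: "cochain_complex n \<C> X" and Y: "cochain_complex n \<C> Y" and k: "lowering n X Y k"
    and i: "i \<le> Suc n"
  shows "boundary n X Y k i \<proportion> obj X i \<rightarrow> obj Y i"
  using i
proof (cases rule: degree_cases)
  case first
  then show ?thesis using complex_dif[OF X, of 0] k
    by (auto simp: boundary_simps lowering_def intro: maps_comp)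
next
  case (middle j)
  then show ?thesis using complex_dif[OF X, of "Suc j"] complex_dif[OF Y, of j] k
    by (auto simp: boundary_simps lowering_def intro!: maps_add intro: maps_comp less_imp_le Suc_leI)
next
  case last
  then show ?thesis using complex_dif[OF Y, of n] k
    by (auto simp: boundary_simps lowering_def intro: maps_comp)
qed

lemma homotopic_iff:
  assumes X: "cochain_complex n \<C> X" and Y: "cochain_complex n \<C> Y"
    and f: "\<And>i. i \<le> Suc n \<Longrightarrow> f i \<proportion> obj X i \<rightarrow> obj Y i"
  shows "homotopic n \<C> X Y f g \<longleftrightarrow>
    (\<exists>k. lowering n X Y k \<and> (\<forall>i\<le>Suc n. g i = f i \<boxplus> boundary n X Y k i))"
proof
  assume "homotopic n \<C> X Y f g"
  then obtain h where h: "\<And>i. i \<in> {1..n+1} \<Longrightarrow> h i \<in> arrows \<C> (obj X i) (obj Y (i-1))"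
    and h0: "g 0 = f 0 \<otimes>\<^bsub>Hom \<C> (obj X 0) (obj Y 0)\<^esub> (h 1 \<cdot> dif X 0)"
    and hi: "\<And>i. i \<in> {1..n} \<Longrightarrow> g i = f i \<otimes>\<^bsub>Hom \<C> (obj X i) (obj Y i)\<^esub>
        ((dif Y (i-1) \<cdot> h i) \<otimes>\<^bsub>Hom \<C> (obj X i) (obj Y i)\<^esub> (h (i+1) \<cdot> dif X i))"
    and hn: "g (n+1) = f (n+1) \<otimes>\<^bsub>Hom \<C> (obj X (n+1)) (obj Y (n+1))\<^esub> (dif Y n \<cdot> h (n+1))"
    unfolding homotopic_def by blast
  define k where "k i = h (Suc i)" for i
  have k: "lowering n X Y k"
    using h[of "Suc _"] complex_Ob[OF X] complex_Ob[OF Y] by (auto simp: lowering_def k_def maps_def)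
  have "g i = f i \<boxplus> boundary n X Y k i" if "i \<le> Suc n" for i
    using that
  proof (cases rule: degree_cases)
    case first
    then show ?thesis using h0 add_eq[OF f[of 0]] by (simp add: boundary_simps k_def)
  next
    case (middle j)
    have "dif Y j \<cdot> k j \<proportion> obj X (Suc j) \<rightarrow> obj Y (Suc j)"
      using middle k complex_dif[OF Y, of j] by (auto simp: lowering_def maps_iff)
    then show ?thesis using middle hi[of "Suc j"] add_eq[OF f[of "Suc j"]] add_eq
      by (simp add: boundary_simps k_def)
  next
    case last
    then show ?thesis using hn add_eq[OF f[of "Suc n"]] by (simp add: boundary_simps k_def)
  qed
  with k show "\<exists>k. lowering n X Y k \<and> (\<forall>i\<le>Suc n. g i = f i \<boxplus> boundary n X Y k i)" by blast
next
  assume "\<exists>k. lowering n X Y k \<and> (\<forall>i\<le>Suc n. g i = f i \<boxplus> boundary n X Y k i)"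
  then obtain k where k: "lowering n X Y k" and g: "\<And>i. i \<le> Suc n \<Longrightarrow> g i = f i \<boxplus> boundary n X Y k i"
    by blast
  have mid: "g (Suc j) = f (Suc j) \<otimes>\<^bsub>Hom \<C> (obj X (Suc j)) (obj Y (Suc j))\<^esub>
      ((dif Y j \<cdot> k j) \<otimes>\<^bsub>Hom \<C> (obj X (Suc j)) (obj Y (Suc j))\<^esub> (k (Suc j) \<cdot> dif X (Suc j)))"
    if j: "j < n" for j
  proof -
    have "dif Y j \<cdot> k j \<proportion> obj X (Suc j) \<rightarrow> obj Y (Suc j)"
      using j k complex_dif[OF Y, of j] by (auto simp: lowering_def maps_iff)
    then show ?thesis using j g[of "Suc j"] add_eq[OF f[of "Suc j"]] add_eq
      by (simp add: boundary_simps)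
  qed
  show "homotopic n \<C> X Y f g"
    unfolding homotopic_def
  proof (intro exI[of _ "\<lambda>i. k (i - 1)"] conjI ballI)
    fix i assume "i \<in> {1..n + 1}"
    then show "k (i - 1) \<in> arrows \<C> (obj X i) (obj Y (i - 1))"
      using k by (cases i) (auto simp: lowering_def maps_def)
  next
    show "g 0 = f 0 \<otimes>\<^bsub>Hom \<C> (obj X 0) (obj Y 0)\<^esub> (k (1 - 1) \<cdot> dif X 0)"
      using g[of 0] add_eq[OF f[of 0]] by (simp add: boundary_simps)
    show "g (n+1) = f (n+1) \<otimes>\<^bsub>Hom \<C> (obj X (n+1)) (obj Y (n+1))\<^esub> (dif Y n \<cdot> k (n + 1 - 1))"
      using g[of "Suc n"] add_eq[OF f[of "Suc n"]] by (simp add: boundary_simps)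
  next
    fix i assume "i \<in> {1..n}"
    then obtain j where "i = Suc j" "j < n" by (cases i) auto
    then show "g i = f i \<otimes>\<^bsub>Hom \<C> (obj X i) (obj Y i)\<^esub>
        ((dif Y (i-1) \<cdot> k (i - 1)) \<otimes>\<^bsub>Hom \<C> (obj X i) (obj Y i)\<^esub> (k (i + 1 - 1) \<cdot> dif X i))"
      using mid[of j] by simp
  qed
qed

lemma homotopic_chain_map_iff:
  assumes "cochain_complex n \<C> X" "cochain_complex n \<C> Y" "chain_map n \<C> X Y f"
  shows "homotopic n \<C> X Y f g \<longleftrightarrow>
    (\<exists>k. lowering n X Y k \<and> (\<forall>i\<le>Suc n. g i = f i \<boxplus> boundary n X Y k i))"
  using assms by (intro homotopic_iff chain_map_maps)

lemma comp_boundary: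
  assumes X: "cochain_complex n \<C> X" and Y: "cochain_complex n \<C> Y" and Z: "cochain_complex n \<C> Z"
    and k: "lowering n X Y k" and g: "chain_map n \<C> Y Z g" and i: "i \<le> Suc n"
  shows "g i \<cdot> boundary n X Y k i = boundary n X Z (\<lambda>i. g i \<cdot> k i) i"
  using i
proof (cases rule: degree_cases)
  case first
  then show ?thesis
    using k complex_dif[OF X, of 0] chain_map_maps[OF Y Z g, of 0]
    by (simp add: boundary_simps lowering_def maps_iff assoc)
next
  case (middle j)
  have "(g (Suc j) \<cdot> dif Y j) \<cdot> k j = (dif Z j \<cdot> g j) \<cdot> k j"
    using middle chain_map_commute[OF Y Z g, of j] by simp
  moreover have "k j \<proportion> obj X (Suc j) \<rightarrow> obj Y j" "k (Suc j) \<proportion> obj X (Suc (Suc j)) \<rightarrow> obj Y (Suc j)"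
    using middle k by (auto simp: lowering_def)
  ultimately show ?thesis
    using middle complex_dif[OF X, of "Suc j"] complex_dif[OF Y, of j] complex_dif[OF Z, of j]
      chain_map_maps[OF Y Z g, of j] chain_map_maps[OF Y Z g, of "Suc j"]
    by (simp add: boundary_simps maps_iff assoc comp_add)
next
  case last
  have "(g (Suc n) \<cdot> dif Y n) \<cdot> k n = (dif Z n \<cdot> g n) \<cdot> k n"
    using chain_map_commute[OF Y Z g, of n] by simp
  then show ?thesis
    using last k complex_dif[OF Y, of n] complex_dif[OF Z, of n] chain_map_maps[OF Y Z g, of "n"]
      chain_map_maps[OF Y Z g, of "Suc n"]
    by (simp add: boundary_simps lowering_def maps_iff assoc)
qed

lemma boundary_comp:
  assumes X: "cochain_complex n \<C> X" and Y: "cochain_complex n \<C> Y" and Z: "cochain_complex n \<C> Z"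
    and k: "lowering n Y Z k" and f: "chain_map n \<C> X Y f" and i: "i \<le> Suc n"
  shows "boundary n Y Z k i \<cdot> f i = boundary n X Z (\<lambda>i. k i \<cdot> f (Suc i)) i"
  using i
proof (cases rule: degree_cases)
  case first
  have "k 0 \<cdot> (f (Suc 0) \<cdot> dif X 0) = k 0 \<cdot> (dif Y 0 \<cdot> f 0)"
    using chain_map_commute[OF X Y f, of 0] by simp
  then show ?thesis
    using first k complex_dif[OF X, of 0] complex_dif[OF Y, of 0] chain_map_maps[OF X Y f, of 0]
      chain_map_maps[OF X Y f, of "Suc 0"]
    by (simp add: boundary_simps lowering_def maps_iff assoc)
next
  case (middle j)
  have "k (Suc j) \<cdot> (f (Suc (Suc j)) \<cdot> dif X (Suc j)) = k (Suc j) \<cdot> (dif Y (Suc j) \<cdot> f (Suc j))"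
    using middle chain_map_commute[OF X Y f, of "Suc j"] by simp
  moreover have "k j \<proportion> obj Y (Suc j) \<rightarrow> obj Z j" "k (Suc j) \<proportion> obj Y (Suc (Suc j)) \<rightarrow> obj Z (Suc j)"
    using middle k by (auto simp: lowering_def)
  ultimately show ?thesis
    using middle complex_dif[OF X, of "Suc j"] complex_dif[OF Y, of "Suc j"] complex_dif[OF Z, of j]
      chain_map_maps[OF X Y f, of "Suc j"] chain_map_maps[OF X Y f, of "Suc (Suc j)"]
    by (simp add: boundary_simps maps_iff assoc add_comp)
next
  case last
  then show ?thesis
    using k complex_dif[OF Z, of n] chain_map_maps[OF X Y f, of "Suc n"]
    by (simp add: boundary_simps lowering_def maps_iff assoc)
qed

lemma boundary_add:
  assumes X: "cochain_complex n \<C> X" and Y: "cochain_complex n \<C> Y"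
    and k: "lowering n X Y k" and l: "lowering n X Y l" and i: "i \<le> Suc n"
  shows "boundary n X Y k i \<boxplus> boundary n X Y l i = boundary n X Y (\<lambda>i. k i \<boxplus> l i) i"
  using i
proof (cases rule: degree_cases)
  case first
  then show ?thesis
    using k l complex_dif[OF X, of 0] by (simp add: boundary_simps lowering_def maps_iff add_comp)
next
  case (middle j)
  then have "k j \<proportion> obj X (Suc j) \<rightarrow> obj Y j" "k (Suc j) \<proportion> obj X (Suc (Suc j)) \<rightarrow> obj Y (Suc j)"
    "l j \<proportion> obj X (Suc j) \<rightarrow> obj Y j" "l (Suc j) \<proportion> obj X (Suc (Suc j)) \<rightarrow> obj Y (Suc j)"
    using k l by (auto simp: lowering_def)
  then show ?thesis
    using middle complex_dif[OF X, of "Suc j"] complex_dif[OF Y, of j]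
    by (simp add: boundary_simps maps_iff add_comp comp_add add_assoc add_left_comm)
next
  case last
  then show ?thesis
    using k l complex_dif[OF Y, of n] by (simp add: boundary_simps lowering_def maps_iff comp_add)
qed

lemma boundary_neg:
  assumes X: "cochain_complex n \<C> X" and Y: "cochain_complex n \<C> Y"
    and k: "lowering n X Y k" and i: "i \<le> Suc n"
  shows "boundary n X Y (\<lambda>i. \<boxminus> k i) i = \<boxminus> boundary n X Y k i"
  using i
proof (cases rule: degree_cases)
  case first
  then show ?thesis
    using k complex_dif[OF X, of 0] by (simp add: boundary_simps lowering_def maps_iff neg_comp)
next
  case (middle j)
  then have "k j \<proportion> obj X (Suc j) \<rightarrow> obj Y j" "k (Suc j) \<proportion> obj X (Suc (Suc j)) \<rightarrow> obj Y (Suc j)"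
    using k by (auto simp: lowering_def)
  then show ?thesis
    using middle complex_dif[OF X, of "Suc j"] complex_dif[OF Y, of j]
    by (simp add: boundary_simps maps_iff neg_comp comp_neg neg_sum)
next
  case last
  then show ?thesis
    using k complex_dif[OF Y, of n] by (simp add: boundary_simps lowering_def maps_iff comp_neg)
qed

lemma lowering_zero:
  assumes X: "cochain_complex n \<C> X" and Y: "cochain_complex n \<C> Y"
  shows "lowering n X Y (\<lambda>i. zero (obj X (Suc i)) (obj Y i))"
  using complex_Ob[OF X] complex_Ob[OF Y] by (simp add: lowering_def maps_zero)

lemma boundary_zero:
  assumes X: "cochain_complex n \<C> X" and Y: "cochain_complex n \<C> Y" and i: "i \<le> Suc n"
  shows "boundary n X Y (\<lambda>i. zero (obj X (Suc i)) (obj Y i)) i = zero (obj X i) (obj Y i)"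
  using i
proof (cases rule: degree_cases)
  case first
  then show ?thesis
    using complex_Ob[OF Y, of 0] complex_dif[OF X, of 0] by (simp add: boundary_simps maps_iff)
next
  case (middle j)
  then show ?thesis
    using complex_Ob[OF X, of "Suc j"] complex_Ob[OF Y, of j] complex_Ob[OF Y, of "Suc j"]
      complex_dif[OF X, of "Suc j"] complex_dif[OF Y, of j]
    by (simp add: boundary_simps maps_iff)
next
  case last
  then show ?thesis
    using complex_Ob[OF X, of "Suc n"] complex_dif[OF Y, of n] by (simp add: boundary_simps maps_iff)
qed

lemma homotopic_refl:
  assumes X: "cochain_complex n \<C> X" and Y: "cochain_complex n \<C> Y" and f: "chain_map n \<C> X Y f"
    and eq: "\<And>i. i \<le> Suc n \<Longrightarrow> g i = f i"
  shows "homotopic n \<C> X Y f g"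
  unfolding homotopic_chain_map_iff[OF X Y f]
  using lowering_zero[OF X Y] boundary_zero[OF X Y] eq chain_map_maps[OF X Y f]
  by (intro exI[of _ "\<lambda>i. zero (obj X (Suc i)) (obj Y i)"]) (simp add: maps_iff)

lemma homotopic_sym:
  assumes X: "cochain_complex n \<C> X" and Y: "cochain_complex n \<C> Y"
    and f: "chain_map n \<C> X Y f" and g: "chain_map n \<C> X Y g" and fg: "homotopic n \<C> X Y f g"
  shows "homotopic n \<C> X Y g f"
proof -
  obtain k where k: "lowering n X Y k" and g_eq: "\<And>i. i \<le> Suc n \<Longrightarrow> g i = f i \<boxplus> boundary n X Y k i"
    using fg unfolding homotopic_chain_map_iff[OF X Y f] by blast
  have "f i = g i \<boxplus> boundary n X Y (\<lambda>i. \<boxminus> k i) i" if i: "i \<le> Suc n" for i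
    using chain_map_maps[OF X Y f i] boundary_maps[OF X Y k i] g_eq[OF i] boundary_neg[OF X Y k i]
    by (simp add: maps_iff add_assoc)
  moreover have "lowering n X Y (\<lambda>i. \<boxminus> k i)"
    using k by (simp add: lowering_def maps_neg)
  ultimately show ?thesis
    unfolding homotopic_chain_map_iff[OF X Y g] by blast
qed

lemma homotopic_trans:
  assumes X: "cochain_complex n \<C> X" and Y: "cochain_complex n \<C> Y"
    and f: "chain_map n \<C> X Y f" and g: "chain_map n \<C> X Y g"
    and fg: "homotopic n \<C> X Y f g" and gh: "homotopic n \<C> X Y g h"
  shows "homotopic n \<C> X Y f h"
proof -
  obtain k where k: "lowering n X Y k" and g_eq: "\<And>i. i \<le> Suc n \<Longrightarrow> g i = f i \<boxplus> boundary n X Y k i"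
    using fg unfolding homotopic_chain_map_iff[OF X Y f] by blast
  obtain l where l: "lowering n X Y l" and h_eq: "\<And>i. i \<le> Suc n \<Longrightarrow> h i = g i \<boxplus> boundary n X Y l i"
    using gh unfolding homotopic_chain_map_iff[OF X Y g] by blast
  have "h i = f i \<boxplus> boundary n X Y (\<lambda>i. k i \<boxplus> l i) i" if i: "i \<le> Suc n" for i
    using chain_map_maps[OF X Y f i] boundary_maps[OF X Y k i] boundary_maps[OF X Y l i]
      g_eq[OF i] h_eq[OF i] boundary_add[OF X Y k l i, symmetric]
    by (simp add: maps_iff add_assoc)
  moreover have "lowering n X Y (\<lambda>i. k i \<boxplus> l i)"
    using k l by (simp add: lowering_def maps_add)
  ultimately show ?thesis
    unfolding homotopic_chain_map_iff[OF X Y f] by blast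
qed

lemma homotopic_comp_left:
  assumes X: "cochain_complex n \<C> X" and Y: "cochain_complex n \<C> Y" and Z: "cochain_complex n \<C> Z"
    and f: "chain_map n \<C> X Y f" and g: "chain_map n \<C> Y Z g" and ff': "homotopic n \<C> X Y f f'"
  shows "homotopic n \<C> X Z (\<lambda>i. g i \<cdot> f i) (\<lambda>i. g i \<cdot> f' i)"
proof -
  obtain k where k: "lowering n X Y k" and eq: "\<And>i. i \<le> Suc n \<Longrightarrow> f' i = f i \<boxplus> boundary n X Y k i"
    using ff' unfolding homotopic_chain_map_iff[OF X Y f] by blast
  have "g i \<cdot> f' i = g i \<cdot> f i \<boxplus> boundary n X Z (\<lambda>i. g i \<cdot> k i) i" if i: "i \<le> Suc n" for i
    using chain_map_maps[OF X Y f i] boundary_maps[OF X Y k i] chain_map_maps[OF Y Z g i]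
      eq[OF i] comp_boundary[OF X Y Z k g i, symmetric]
    by (simp add: maps_iff comp_add)
  moreover have "lowering n X Z (\<lambda>i. g i \<cdot> k i)"
    using k chain_map_maps[OF Y Z g] by (auto simp: lowering_def maps_iff)
  ultimately show ?thesis
    unfolding homotopic_chain_map_iff[OF X Z chain_map_comp[OF X Y Z f g]] by blast
qed

lemma homotopic_comp_right:
  assumes X: "cochain_complex n \<C> X" and Y: "cochain_complex n \<C> Y" and Z: "cochain_complex n \<C> Z"
    and f: "chain_map n \<C> X Y f" and g: "chain_map n \<C> Y Z g" and gg': "homotopic n \<C> Y Z g g'"
  shows "homotopic n \<C> X Z (\<lambda>i. g i \<cdot> f i) (\<lambda>i. g' i \<cdot> f i)"
proof -
  obtain k where k: "lowering n Y Z k" and eq: "\<And>i. i \<le> Suc n \<Longrightarrow> g' i = g i \<boxplus> boundary n Y Z k i"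
    using gg' unfolding homotopic_chain_map_iff[OF Y Z g] by blast
  have "g' i \<cdot> f i = g i \<cdot> f i \<boxplus> boundary n X Z (\<lambda>i. k i \<cdot> f (Suc i)) i" if i: "i \<le> Suc n" for i
    using chain_map_maps[OF X Y f i] boundary_maps[OF Y Z k i] chain_map_maps[OF Y Z g i]
      eq[OF i] boundary_comp[OF X Y Z k f i, symmetric]
    by (simp add: maps_iff add_comp)
  moreover have "lowering n X Z (\<lambda>i. k i \<cdot> f (Suc i))"
    using k chain_map_maps[OF X Y f] by (auto simp: lowering_def maps_iff)
  ultimately show ?thesis
    unfolding homotopic_chain_map_iff[OF X Z chain_map_comp[OF X Y Z f g]] by blast
qed

lemma lift_comp:
  assumes "cochain_complex n \<C> X" "cochain_complex n \<C> Y" "cochain_complex n \<C> Z"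
    and "lift n \<C> X Y a c f" "lift n \<C> Y Z a' c' g"
  shows "lift n \<C> X Z (a' \<cdot> a) (c' \<cdot> c) (\<lambda>i. g i \<cdot> f i)"
  using assms chain_map_comp by (auto simp: lift_def)

lemma complexes_betweenD:
  assumes "X \<in> complexes_between n \<C> A C"
  shows "cochain_complex n \<C> X" "obj X 0 = A" "obj X (Suc n) = C" "A \<in> Ob \<C>" "C \<in> Ob \<C>"
  using assms by (auto simp: complexes_between_def cochain_complex_def)

lemma homotopy_equivalent_refl:
  assumes "X \<in> complexes_between n \<C> A C"
  shows "homotopy_equivalent n \<C> A C X X"
proof -
  note X = complexes_betweenD[OF assms]
  have "lift n \<C> X X (Id \<C> A) (Id \<C> C) (\<lambda>i. Id \<C> (obj X i))"
    using chain_map_Id[OF X(1)] X by (simp add: lift_def)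
  moreover have "homotopic n \<C> X X (\<lambda>i. Id \<C> (obj X i) \<cdot> Id \<C> (obj X i)) (\<lambda>i. Id \<C> (obj X i))"
    by (rule homotopic_refl[OF X(1,1) chain_map_comp[OF X(1,1,1) chain_map_Id[OF X(1)] chain_map_Id[OF X(1)]]])
      (use complex_Ob[OF X(1)] in simp)
  ultimately show ?thesis unfolding homotopy_equivalent_def by blast
qed

lemma homotopy_equivalent_sym:
  "homotopy_equivalent n \<C> A C X Y \<Longrightarrow> homotopy_equivalent n \<C> A C Y X"
  unfolding homotopy_equivalent_def by blast

lemma homotopy_equivalent_trans:
  assumes X': "X \<in> complexes_between n \<C> A C" and Y': "Y \<in> complexes_between n \<C> A C"
    and Z': "Z \<in> complexes_between n \<C> A C"
    and XY: "homotopy_equivalent n \<C> A C X Y" and YZ: "homotopy_equivalent n \<C> A C Y Z"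
  shows "homotopy_equivalent n \<C> A C X Z"
proof -
  note X = complexes_betweenD[OF X'] and Y = complexes_betweenD[OF Y'] and Z = complexes_betweenD[OF Z']
  obtain f g where f: "lift n \<C> X Y (Id \<C> A) (Id \<C> C) f" and g: "lift n \<C> Y X (Id \<C> A) (Id \<C> C) g"
    and gf: "homotopic n \<C> X X (\<lambda>i. g i \<cdot> f i) (\<lambda>i. Id \<C> (obj X i))"
    and fg: "homotopic n \<C> Y Y (\<lambda>i. f i \<cdot> g i) (\<lambda>i. Id \<C> (obj Y i))"
    using XY unfolding homotopy_equivalent_def by blast
  obtain f' g' where f': "lift n \<C> Y Z (Id \<C> A) (Id \<C> C) f'" and g': "lift n \<C> Z Y (Id \<C> A) (Id \<C> C) g'"
    and gf': "homotopic n \<C> Y Y (\<lambda>i. g' i \<cdot> f' i) (\<lambda>i. Id \<C> (obj Y i))"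
    and fg': "homotopic n \<C> Z Z (\<lambda>i. f' i \<cdot> g' i) (\<lambda>i. Id \<C> (obj Z i))"
    using YZ unfolding homotopy_equivalent_def by blast
  \<comment> \<open>Contract the inner homotopy equivalence first.\<close>
  have step: "homotopic n \<C> X X (\<lambda>i. (g i \<cdot> g' i) \<cdot> f' i \<cdot> f i) (\<lambda>i. Id \<C> (obj X i))"
    if X: "cochain_complex n \<C> X" and Y: "cochain_complex n \<C> Y" and Z: "cochain_complex n \<C> Z"
      and f: "chain_map n \<C> X Y f" and g: "chain_map n \<C> Y X g"
      and f': "chain_map n \<C> Y Z f'" and g': "chain_map n \<C> Z Y g'"
      and gf: "homotopic n \<C> X X (\<lambda>i. g i \<cdot> f i) (\<lambda>i. Id \<C> (obj X i))"
      and gf': "homotopic n \<C> Y Y (\<lambda>i. g' i \<cdot> f' i) (\<lambda>i. Id \<C> (obj Y i))"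
    for X Y Z f g f' g'
  proof -
    have "homotopic n \<C> X Y (\<lambda>i. (g' i \<cdot> f' i) \<cdot> f i) (\<lambda>i. Id \<C> (obj Y i) \<cdot> f i)"
      by (rule homotopic_comp_right[OF X Y Y f chain_map_comp[OF Y Z Y f' g'] gf'])
    then have 1: "homotopic n \<C> X X (\<lambda>i. g i \<cdot> (g' i \<cdot> f' i) \<cdot> f i) (\<lambda>i. g i \<cdot> Id \<C> (obj Y i) \<cdot> f i)"
      by (rule homotopic_comp_left[OF X Y X chain_map_comp[OF X Y Y f chain_map_comp[OF Y Z Y f' g']] g])
    have 2: "homotopic n \<C> X X (\<lambda>i. g i \<cdot> Id \<C> (obj Y i) \<cdot> f i) (\<lambda>i. g i \<cdot> f i)"
      by (rule homotopic_refl[OF X X chain_map_comp[OF X Y X chain_map_comp[OF X Y Y f chain_map_Id[OF Y]] g]])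
        (use chain_map_maps[OF X Y f] in \<open>simp add: maps_iff\<close>)
    have 3: "homotopic n \<C> X X (\<lambda>i. (g i \<cdot> g' i) \<cdot> f' i \<cdot> f i) (\<lambda>i. g i \<cdot> (g' i \<cdot> f' i) \<cdot> f i)"
      by (rule homotopic_refl[OF X X chain_map_comp[OF X Z X chain_map_comp[OF X Y Z f f'] chain_map_comp[OF Z Y X g'
        g]]])
        (use chain_map_maps[OF X Y f] chain_map_maps[OF Y X g] chain_map_maps[OF Y Z f'] chain_map_maps[OF Z Y g']
          in \<open>simp add: maps_iff assoc\<close>)
    note c = chain_map_comp[OF X Z X chain_map_comp[OF X Y Z f f'] chain_map_comp[OF Z Y X g' g]]
      chain_map_comp[OF X Y X chain_map_comp[OF X Y Y f chain_map_comp[OF Y Z Y f' g']] g]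
      chain_map_comp[OF X Y X chain_map_comp[OF X Y Y f chain_map_Id[OF Y]] g]
      chain_map_comp[OF X Y X f g]
    show ?thesis
      by (rule homotopic_trans[OF X X c(1) c(2) 3 homotopic_trans[OF X X c(2) c(3) 1
            homotopic_trans[OF X X c(3) c(4) 2 gf]]])
  qed
  have "lift n \<C> X Z (Id \<C> A) (Id \<C> C) (\<lambda>i. f' i \<cdot> f i)"
    using lift_comp[OF X(1) Y(1) Z(1) f f'] X by simp
  moreover have "lift n \<C> Z X (Id \<C> A) (Id \<C> C) (\<lambda>i. g i \<cdot> g' i)"
    using lift_comp[OF Z(1) Y(1) X(1) g' g] X by simp
  moreover have "homotopic n \<C> X X (\<lambda>i. (g i \<cdot> g' i) \<cdot> f' i \<cdot> f i) (\<lambda>i. Id \<C> (obj X i))"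
    using step[OF X(1) Y(1) Z(1) _ _ _ _ gf gf'] f g f' g' by (simp add: lift_def)
  moreover have "homotopic n \<C> Z Z (\<lambda>i. (f' i \<cdot> f i) \<cdot> g i \<cdot> g' i) (\<lambda>i. Id \<C> (obj Z i))"
    using step[OF Z(1) Y(1) X(1) _ _ _ _ fg' fg] f g f' g' by (simp add: lift_def)
  ultimately show ?thesis unfolding homotopy_equivalent_def by blast
qed

lemma homotopy_class_eq:
  assumes "X \<in> complexes_between n \<C> A C" "Y \<in> complexes_between n \<C> A C"
    "homotopy_equivalent n \<C> A C X Y"
  shows "homotopy_class n \<C> A C X = homotopy_class n \<C> A C Y"
  unfolding homotopy_class_def
  using assms homotopy_equivalent_trans homotopy_equivalent_sym by blast

lemma homotopy_class_self:
  "X \<in> complexes_between n \<C> A C \<Longrightarrow> X \<in> homotopy_class n \<C> A C X"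
  by (simp add: homotopy_class_def homotopy_equivalent_refl)

end

section \<open>Weak kernels and homotopy equivalences\<close>

context additive_category
begin

text \<open>
  The two halves of the weak kernel-cokernel condition are kept apart, because most arguments use one
  of them only and duality exchanges them.
\<close>

definition weak_kernels :: "nat \<Rightarrow> ('o, 'm) cochain \<Rightarrow> bool" where
  "weak_kernels n X \<longleftrightarrow> (\<forall>i<n. \<forall>W u. u \<proportion> W \<rightarrow> obj X (Suc i) \<longrightarrow>
     dif X (Suc i) \<cdot> u = zero W (obj X (Suc (Suc i))) \<longrightarrow>
     (\<exists>v. v \<proportion> W \<rightarrow> obj X i \<and> dif X i \<cdot> v = u))"

definition weak_cokernels :: "nat \<Rightarrow> ('o, 'm) cochain \<Rightarrow> bool" where
  "weak_cokernels n X \<longleftrightarrow> (\<forall>i<n. \<forall>W u. u \<proportion> obj X (Suc i) \<rightarrow> W \<longrightarrow>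
     u \<cdot> dif X i = zero (obj X i) W \<longrightarrow>
     (\<exists>v. v \<proportion> obj X (Suc (Suc i)) \<rightarrow> W \<and> v \<cdot> dif X (Suc i) = u))"

lemma weak_kernelsE:
  assumes "weak_kernels n X" "i < n" "u \<proportion> W \<rightarrow> obj X (Suc i)"
    "dif X (Suc i) \<cdot> u = zero W (obj X (Suc (Suc i)))"
  obtains v where "v \<proportion> W \<rightarrow> obj X i" "dif X i \<cdot> v = u"
  using assms unfolding weak_kernels_def by blast

lemma weak_cokernelsE:
  assumes "weak_cokernels n X" "i < n" "u \<proportion> obj X (Suc i) \<rightarrow> W"
    "u \<cdot> dif X i = zero (obj X i) W"
  obtains v where "v \<proportion> obj X (Suc (Suc i)) \<rightarrow> W" "v \<cdot> dif X (Suc i) = u"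
  using assms unfolding weak_cokernels_def by blast

lemma image_eq_kernel_comp:
  assumes f: "f \<proportion> A \<rightarrow> B" and g: "g \<proportion> B \<rightarrow> D" and gf: "g \<cdot> f = zero A D" and W: "W \<in> Ob \<C>"
  shows "(\<lambda>v. f \<cdot> v) ` arrows \<C> W A = kernel (Hom \<C> W B) (Hom \<C> W D) (\<lambda>u. g \<cdot> u) \<longleftrightarrow>
    (\<forall>u. u \<proportion> W \<rightarrow> B \<longrightarrow> g \<cdot> u = zero W D \<longrightarrow> (\<exists>v. v \<proportion> W \<rightarrow> A \<and> f \<cdot> v = u))"
proof -
  have Ob: "A \<in> Ob \<C>" "B \<in> Ob \<C>" using f by (auto simp: maps_def)
  have "(\<lambda>v. f \<cdot> v) ` arrows \<C> W A \<subseteq> kernel (Hom \<C> W B) (Hom \<C> W D) (\<lambda>u. g \<cdot> u)"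
  proof
    fix u assume "u \<in> (\<lambda>v. f \<cdot> v) ` arrows \<C> W A"
    then obtain v where v: "v \<proportion> W \<rightarrow> A" "u = f \<cdot> v" using W Ob by (auto simp: maps_def)
    have "g \<cdot> f \<cdot> v = (g \<cdot> f) \<cdot> v" using maps_comp_assoc[OF v(1) f g] by simp
    then have "g \<cdot> u = zero W D" using v gf g by (simp add: maps_unfold)
    moreover have "u \<proportion> W \<rightarrow> B" using v f maps_comp by blast
    ultimately show "u \<in> kernel (Hom \<C> W B) (Hom \<C> W D) (\<lambda>u. g \<cdot> u)"
      by (simp add: kernel_def maps_def zero_def)
  qed
  then show ?thesis
    unfolding set_eq_subset using W Ob
    by (simp add: kernel_def maps_def zero_def image_iff Bex_def subset_iff) metis
qed

lemma image_eq_kernel_precomp: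
  assumes f: "f \<proportion> A \<rightarrow> B" and g: "g \<proportion> B \<rightarrow> D" and gf: "g \<cdot> f = zero A D" and W: "W \<in> Ob \<C>"
  shows "(\<lambda>v. v \<cdot> g) ` arrows \<C> D W = kernel (Hom \<C> B W) (Hom \<C> A W) (\<lambda>u. u \<cdot> f) \<longleftrightarrow>
    (\<forall>u. u \<proportion> B \<rightarrow> W \<longrightarrow> u \<cdot> f = zero A W \<longrightarrow> (\<exists>v. v \<proportion> D \<rightarrow> W \<and> v \<cdot> g = u))"
proof -
  have Ob: "B \<in> Ob \<C>" "D \<in> Ob \<C>" using g by (auto simp: maps_def)
  have "(\<lambda>v. v \<cdot> g) ` arrows \<C> D W \<subseteq> kernel (Hom \<C> B W) (Hom \<C> A W) (\<lambda>u. u \<cdot> f)"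
  proof
    fix u assume "u \<in> (\<lambda>v. v \<cdot> g) ` arrows \<C> D W"
    then obtain v where v: "v \<proportion> D \<rightarrow> W" "u = v \<cdot> g" using W Ob by (auto simp: maps_def)
    have "(v \<cdot> g) \<cdot> f = v \<cdot> (g \<cdot> f)" using maps_comp_assoc[OF f g v(1)] by simp
    then have "u \<cdot> f = zero A W" using v gf f by (simp add: maps_unfold)
    moreover have "u \<proportion> B \<rightarrow> W" using v g maps_comp by blast
    ultimately show "u \<in> kernel (Hom \<C> B W) (Hom \<C> A W) (\<lambda>u. u \<cdot> f)"
      by (simp add: kernel_def maps_def zero_def)
  qed
  then show ?thesis
    unfolding set_eq_subset using W Ob
    by (simp add: kernel_def maps_def zero_def image_iff Bex_def subset_iff) metis
qed

lemma weak_kernel_cokernel_iff: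
  assumes X: "cochain_complex n \<C> X"
  shows "weak_kernel_cokernel n \<C> X \<longleftrightarrow> weak_kernels n X \<and> weak_cokernels n X"
proof -
  have *: "(\<forall>i\<in>{1..n}. P i) \<longleftrightarrow> (\<forall>i<n. P (Suc i))" for P
    by (metis Suc_leI atLeastAtMost_iff le_add1 less_eq_Suc_le not0_implies_Suc not_one_le_zero plus_1_eq_Suc)
  have k: "(\<lambda>f. dif X i \<cdot> f) ` arrows \<C> W (obj X i) =
       kernel (Hom \<C> W (obj X (Suc i))) (Hom \<C> W (obj X (Suc (Suc i)))) (\<lambda>f. dif X (Suc i) \<cdot> f) \<longleftrightarrow>
      (\<forall>u. u \<proportion> W \<rightarrow> obj X (Suc i) \<longrightarrow> dif X (Suc i) \<cdot> u = zero W (obj X (Suc (Suc i))) \<longrightarrow>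
        (\<exists>v. v \<proportion> W \<rightarrow> obj X i \<and> dif X i \<cdot> v = u))"
    and c: "(\<lambda>g. g \<cdot> dif X (Suc i)) ` arrows \<C> (obj X (Suc (Suc i))) W =
       kernel (Hom \<C> (obj X (Suc i)) W) (Hom \<C> (obj X i) W) (\<lambda>g. g \<cdot> dif X i) \<longleftrightarrow>
      (\<forall>u. u \<proportion> obj X (Suc i) \<rightarrow> W \<longrightarrow> u \<cdot> dif X i = zero (obj X i) W \<longrightarrow>
        (\<exists>v. v \<proportion> obj X (Suc (Suc i)) \<rightarrow> W \<and> v \<cdot> dif X (Suc i) = u))"
    if "W \<in> Ob \<C>" "i < n" for W i
    using that complex_dif[OF X, of i] complex_dif[OF X, of "Suc i"] complex_dif_dif[OF X, of i]
    by (intro image_eq_kernel_comp image_eq_kernel_precomp; simp)+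
  have "weak_kernel_cokernel n \<C> X \<longleftrightarrow> (\<forall>W\<in>Ob \<C>. \<forall>i<n.
      (\<forall>u. u \<proportion> W \<rightarrow> obj X (Suc i) \<longrightarrow> dif X (Suc i) \<cdot> u = zero W (obj X (Suc (Suc i))) \<longrightarrow>
        (\<exists>v. v \<proportion> W \<rightarrow> obj X i \<and> dif X i \<cdot> v = u)) \<and>
      (\<forall>u. u \<proportion> obj X (Suc i) \<rightarrow> W \<longrightarrow> u \<cdot> dif X i = zero (obj X i) W \<longrightarrow>
        (\<exists>v. v \<proportion> obj X (Suc (Suc i)) \<rightarrow> W \<and> v \<cdot> dif X (Suc i) = u)))"
    unfolding weak_kernel_cokernel_def * using k c by (simp cong: conj_cong)
  also have "\<dots> \<longleftrightarrow> weak_kernels n X \<and> weak_cokernels n X"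
    unfolding weak_kernels_def weak_cokernels_def by (auto simp: maps_def)
  finally show ?thesis .
qed

text \<open>
  The contraction is built downwards from the top degree: there \<open>u\<close> vanishes, and in each step the part of
  \<open>u\<close> not yet accounted for is annihilated by the differential, hence factors through the previous one.
  In degree \<open>0\<close> nothing is obtained: \<open>h\<^sub>0 d\<^sub>0\<close> need not be \<open>u\<^sub>0\<close>, even if \<open>u\<^sub>0 = 0\<close>.
\<close>

lemma null_homotopy_from_top:
  assumes X: "cochain_complex n \<C> X" and wk: "weak_kernels n X" and u: "chain_map n \<C> X X u"
    and top: "u (Suc n) = zero (obj X (Suc n)) (obj X (Suc n))"
  shows "\<exists>h. lowering n X X h \<and> h n = zero (obj X (Suc n)) (obj X n) \<and>
    (\<forall>i<n. u (Suc i) = dif X i \<cdot> h i \<boxplus> h (Suc i) \<cdot> dif X (Suc i))"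
proof -
  have "\<exists>h. (\<forall>i. n - j \<le> i \<and> i \<le> n \<longrightarrow> h i \<proportion> obj X (Suc i) \<rightarrow> obj X i) \<and>
      h n = zero (obj X (Suc n)) (obj X n) \<and>
      (\<forall>i. n - j \<le> i \<and> i < n \<longrightarrow> u (Suc i) = dif X i \<cdot> h i \<boxplus> h (Suc i) \<cdot> dif X (Suc i))"
    if "j \<le> n" for j
    using that
  proof (induction j)
    case 0
    show ?case
      using complex_Ob[OF X, of n] complex_Ob[OF X, of "Suc n"]
      by (intro exI[of _ "\<lambda>i. zero (obj X (Suc n)) (obj X n)"]) (auto simp: maps_zero)
  next
    case (Suc j)
    then obtain h where h: "\<And>i. n - j \<le> i \<Longrightarrow> i \<le> n \<Longrightarrow> h i \<proportion> obj X (Suc i) \<rightarrow> obj X i"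
      and hn: "h n = zero (obj X (Suc n)) (obj X n)"
      and eq: "\<And>i. n - j \<le> i \<Longrightarrow> i < n \<Longrightarrow> u (Suc i) = dif X i \<cdot> h i \<boxplus> h (Suc i) \<cdot> dif X (Suc i)"
      by auto
    define m where "m = n - Suc j"
    have m: "m < n" "n - j = Suc m" using Suc.prems by (auto simp: m_def)
    let ?w = "u (Suc m) \<boxplus> \<boxminus> (h (Suc m) \<cdot> dif X (Suc m))"
    have h1: "h (Suc m) \<proportion> obj X (Suc (Suc m)) \<rightarrow> obj X (Suc m)" using h m by simp
    have d: "dif X m \<proportion> obj X m \<rightarrow> obj X (Suc m)" "dif X (Suc m) \<proportion> obj X (Suc m) \<rightarrow> obj X (Suc (Suc m))"
      using complex_dif[OF X] m by auto
    have u1: "u (Suc m) \<proportion> obj X (Suc m) \<rightarrow> obj X (Suc m)"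
      "u (Suc (Suc m)) \<proportion> obj X (Suc (Suc m)) \<rightarrow> obj X (Suc (Suc m))"
      using chain_map_maps[OF X X u] m by auto
    have ud: "dif X (Suc m) \<cdot> u (Suc m) = u (Suc (Suc m)) \<cdot> dif X (Suc m)"
      using chain_map_commute[OF X X u, of "Suc m"] m by simp
    have w: "?w \<proportion> obj X (Suc m) \<rightarrow> obj X (Suc m)" using h1 d u1 by algebra
    have "dif X (Suc m) \<cdot> (h (Suc m) \<cdot> dif X (Suc m)) = u (Suc (Suc m)) \<cdot> dif X (Suc m)"
    proof (cases "Suc m = n")
      case True
      then show ?thesis using hn top d by (simp add: maps_unfold)
    next
      case False
      then have m2: "Suc m < n" using m by simp
      have h2: "h (Suc (Suc m)) \<proportion> obj X (Suc (Suc (Suc m))) \<rightarrow> obj X (Suc (Suc m))"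
        using h[of "Suc (Suc m)"] m m2 by simp
      have d2: "dif X (Suc (Suc m)) \<proportion> obj X (Suc (Suc m)) \<rightarrow> obj X (Suc (Suc (Suc m)))"
        using complex_dif[OF X, of "Suc (Suc m)"] m2 by simp
      have dd: "dif X (Suc (Suc m)) \<cdot> dif X (Suc m) = zero (obj X (Suc m)) (obj X (Suc (Suc (Suc m))))"
        using complex_dif_dif[OF X m2] .
      have "u (Suc (Suc m)) = dif X (Suc m) \<cdot> h (Suc m) \<boxplus> h (Suc (Suc m)) \<cdot> dif X (Suc (Suc m))"
        using eq[of "Suc m"] m m2 by simp
      then show ?thesis using h1 h2 d d2 dd by algebra
    qed
    then have "dif X (Suc m) \<cdot> ?w = zero (obj X (Suc m)) (obj X (Suc (Suc m)))"
      using h1 d u1 ud by algebra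
    then obtain v where v: "v \<proportion> obj X (Suc m) \<rightarrow> obj X m" "dif X m \<cdot> v = ?w"
      using weak_kernelsE[OF wk m(1) w] by blast
    have new: "u (Suc m) = dif X m \<cdot> v \<boxplus> h (Suc m) \<cdot> dif X (Suc m)"
      unfolding v(2) using h1 d u1 by algebra
    show ?case
    proof (intro exI[of _ "h(m := v)"] conjI allI impI)
      fix i assume i: "n - Suc j \<le> i \<and> i \<le> n"
      show "(h(m := v)) i \<proportion> obj X (Suc i) \<rightarrow> obj X i"
        using v(1) h[of i] i m by (cases "i = m") (auto simp: m_def)
    next
      show "(h(m := v)) n = zero (obj X (Suc n)) (obj X n)" using hn m by simp
    next
      fix i assume i: "n - Suc j \<le> i \<and> i < n"
      show "u (Suc i) = dif X i \<cdot> (h(m := v)) i \<boxplus> (h(m := v)) (Suc i) \<cdot> dif X (Suc i)"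
        using new eq[of i] i m by (cases "i = m") (auto simp: m_def)
    qed
  qed
  from this[of n] show ?thesis by (auto simp: lowering_def)
qed

text \<open>
  Multiplying the partial contraction \<open>h\<close> of \<open>u\<close> by \<open>u\<close> removes its defect in degree \<open>0\<close>, since \<open>u\<^sub>0 = 0\<close>.
\<close>

lemma square_of_null_at_ends:
  assumes X: "cochain_complex n \<C> X" and wk: "weak_kernels n X" and u: "chain_map n \<C> X X u"
    and bot: "u 0 = zero (obj X 0) (obj X 0)"
    and top: "u (Suc n) = zero (obj X (Suc n)) (obj X (Suc n))"
  obtains k where "lowering n X X k" "k 0 = zero (obj X (Suc 0)) (obj X 0)"
    "k n = zero (obj X (Suc n)) (obj X n)" "\<And>i. i \<le> Suc n \<Longrightarrow> u i \<cdot> u i = boundary n X X k i"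
proof -
  obtain h where h: "lowering n X X h" and hn: "h n = zero (obj X (Suc n)) (obj X n)"
    and eq: "\<And>i. i < n \<Longrightarrow> u (Suc i) = dif X i \<cdot> h i \<boxplus> h (Suc i) \<cdot> dif X (Suc i)"
    using null_homotopy_from_top[OF X wk u top] by blast
  let ?k = "\<lambda>i. u i \<cdot> h i"
  have um: "\<And>i. i \<le> Suc n \<Longrightarrow> u i \<proportion> obj X i \<rightarrow> obj X i" using chain_map_maps[OF X X u] .
  have hm: "\<And>i. i \<le> n \<Longrightarrow> h i \<proportion> obj X (Suc i) \<rightarrow> obj X i" using h by (simp add: lowering_def)
  have k: "lowering n X X ?k"
    unfolding lowering_def using um hm by (auto simp: maps_iff)
  have k0: "?k 0 = zero (obj X (Suc 0)) (obj X 0)" using bot hm[of 0] by (simp add: maps_unfold)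
  have kn: "?k n = zero (obj X (Suc n)) (obj X n)"
    using hn um[of n] complex_Ob[OF X, of "Suc n"] by (simp add: maps_unfold)
  have "u i \<cdot> u i = boundary n X X ?k i" if i: "i \<le> Suc n" for i
    using i
  proof (cases rule: degree_cases)
    case first
    then show ?thesis using k0 bot complex_dif[OF X, of 0] um[of 0]
      by (simp add: boundary_simps maps_unfold)
  next
    case (middle j)
    have c: "boundary n X X h i = u i" using eq middle by (simp add: boundary_simps)
    show ?thesis using comp_boundary[OF X X X h u i] c by simp
  next
    case last
    then show ?thesis using kn top complex_dif[OF X, of n] um[of "Suc n"] complex_Ob[OF X, of "Suc n"]
      by (simp add: boundary_simps maps_unfold)
  qed
  with k k0 kn show thesis by (rule that)
qed

text \<open>
  One step of Newton's iteration for inverting \<open>f\<close>, starting from \<open>g\<close>: the new error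
  \<open>1 - (2g - gfg)f\<close> is the square of the old one \<open>1 - gf\<close>.
\<close>

definition quasi_inverse :: "(nat \<Rightarrow> 'm) \<Rightarrow> (nat \<Rightarrow> 'm) \<Rightarrow> nat \<Rightarrow> 'm" where
  "quasi_inverse f g i = (g i \<boxplus> g i) \<boxplus> \<boxminus> (g i \<cdot> f i \<cdot> g i)"

lemma chain_map_quasi_inverse:
  assumes X: "cochain_complex n \<C> X" and Y: "cochain_complex n \<C> Y"
    and f: "chain_map n \<C> X Y f" and g: "chain_map n \<C> Y X g"
  shows "chain_map n \<C> Y X (quasi_inverse f g)"
  unfolding quasi_inverse_def[abs_def]
  by (intro chain_map_add[OF Y X] chain_map_neg[OF Y X] g chain_map_comp[OF Y X X _ chain_map_comp[OF X Y X]]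
      chain_map_comp[OF Y Y X] chain_map_comp[OF Y X Y] f)

lemma quasi_inverse_end:
  assumes f: "f i \<proportion> A \<rightarrow> B" and g: "g i \<proportion> B \<rightarrow> A" and fg: "f i \<cdot> g i = Id \<C> B"
  shows "quasi_inverse f g i = g i"
  unfolding quasi_inverse_def fg using f g by algebra

text \<open>
  The error \<open>1 - gf\<close> vanishes at the ends, so its square is null-homotopic. That square is
  also \<open>1 - g(2f - fgf)\<close>, which gives the second equation.
\<close>

lemma quasi_inverse_homotopy:
  assumes X: "cochain_complex n \<C> X" and Y: "cochain_complex n \<C> Y" and wk: "weak_kernels n X"
    and f: "chain_map n \<C> X Y f" and g: "chain_map n \<C> Y X g"
    and bot: "g 0 \<cdot> f 0 = Id \<C> (obj X 0)" and top: "g (Suc n) \<cdot> f (Suc n) = Id \<C> (obj X (Suc n))"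
  obtains k where "lowering n X X k" "k 0 = zero (obj X (Suc 0)) (obj X 0)"
    "k n = zero (obj X (Suc n)) (obj X n)"
    "\<And>i. i \<le> Suc n \<Longrightarrow> Id \<C> (obj X i) = quasi_inverse f g i \<cdot> f i \<boxplus> boundary n X X k i"
    "\<And>i. i \<le> Suc n \<Longrightarrow> Id \<C> (obj X i) = g i \<cdot> quasi_inverse g f i \<boxplus> boundary n X X k i"
proof -
  let ?u = "\<lambda>i. Id \<C> (obj X i) \<boxplus> \<boxminus> (g i \<cdot> f i)"
  have u: "chain_map n \<C> X X ?u"
    by (intro chain_map_add[OF X X] chain_map_neg[OF X X] chain_map_Id[OF X] chain_map_comp[OF X Y X] f g)
  have fm: "\<And>i. i \<le> Suc n \<Longrightarrow> f i \<proportion> obj X i \<rightarrow> obj Y i" using chain_map_maps[OF X Y f] .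
  have gm: "\<And>i. i \<le> Suc n \<Longrightarrow> g i \<proportion> obj Y i \<rightarrow> obj X i" using chain_map_maps[OF Y X g] .
  have "?u 0 = zero (obj X 0) (obj X 0)" "?u (Suc n) = zero (obj X (Suc n)) (obj X (Suc n))"
    using bot top complex_Ob[OF X, of 0] complex_Ob[OF X, of "Suc n"] by simp_all
  from square_of_null_at_ends[OF X wk u this] obtain k where k: "lowering n X X k"
      "k 0 = zero (obj X (Suc 0)) (obj X 0)" "k n = zero (obj X (Suc n)) (obj X n)"
    and sq: "\<And>i. i \<le> Suc n \<Longrightarrow> ?u i \<cdot> ?u i = boundary n X X k i" by blast
  have "Id \<C> (obj X i) = quasi_inverse f g i \<cdot> f i \<boxplus> boundary n X X k i"
       "Id \<C> (obj X i) = g i \<cdot> quasi_inverse g f i \<boxplus> boundary n X X k i" if "i \<le> Suc n" for i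
    unfolding sq[OF that, symmetric] quasi_inverse_def using fm[OF that] gm[OF that] by (algebra, algebra)
  with k show thesis by (rule that)
qed

text \<open>
  The quasi-inverse of \<open>f\<close> is a homotopy inverse on both sides, since the argument applies to
  \<open>1 - gf\<close> as well as to \<open>1 - fg\<close>.
\<close>

lemma homotopy_equivalent_of_lifts:
  assumes X': "X \<in> complexes_between n \<C> A C" and Y': "Y \<in> complexes_between n \<C> A C"
    and wX: "weak_kernels n X" and wY: "weak_kernels n Y"
    and f: "lift n \<C> X Y (Id \<C> A) (Id \<C> C) f" and g: "lift n \<C> Y X (Id \<C> A) (Id \<C> C) g"
  shows "homotopy_equivalent n \<C> A C X Y"
proof -
  note X = complexes_betweenD[OF X'] and Y = complexes_betweenD[OF Y']
  have fc: "chain_map n \<C> X Y f" and gc: "chain_map n \<C> Y X g" using f g by (auto simp: lift_def)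
  have f0: "f 0 = Id \<C> A" "g 0 = Id \<C> A" "f (Suc n) = Id \<C> C" "g (Suc n) = Id \<C> C"
    using f g by (auto simp: lift_def)
  let ?L = "quasi_inverse f g"
  have L: "chain_map n \<C> Y X ?L" by (rule chain_map_quasi_inverse[OF X(1) Y(1) fc gc])
  have "?L 0 = Id \<C> A" "?L (Suc n) = Id \<C> C"
    using quasi_inverse_end[of f 0 A A g] quasi_inverse_end[of f "Suc n" C C g] f0 X(4,5)
    by (auto simp: maps_Id)
  then have lift: "lift n \<C> Y X (Id \<C> A) (Id \<C> C) ?L" using L by (simp add: lift_def)
  obtain k where k: "lowering n X X k"
    and kX: "\<And>i. i \<le> Suc n \<Longrightarrow> Id \<C> (obj X i) = ?L i \<cdot> f i \<boxplus> boundary n X X k i"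
    using quasi_inverse_homotopy[OF X(1) Y(1) wX fc gc] f0 X by (metis (no_types, lifting) comp_Id arr_Id(1,2))
  obtain l where l: "lowering n Y Y l"
    and lY: "\<And>i. i \<le> Suc n \<Longrightarrow> Id \<C> (obj Y i) = f i \<cdot> ?L i \<boxplus> boundary n Y Y l i"
    using quasi_inverse_homotopy[OF Y(1) X(1) wY gc fc] f0 Y by (metis (no_types, lifting) comp_Id arr_Id(1,2))
  have "homotopic n \<C> X X (\<lambda>i. ?L i \<cdot> f i) (\<lambda>i. Id \<C> (obj X i))"
    unfolding homotopic_chain_map_iff[OF X(1,1) chain_map_comp[OF X(1) Y(1) X(1) fc L]] using k kX by blast
  moreover have "homotopic n \<C> Y Y (\<lambda>i. f i \<cdot> ?L i) (\<lambda>i. Id \<C> (obj Y i))"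
    unfolding homotopic_chain_map_iff[OF Y(1,1) chain_map_comp[OF Y(1) X(1) Y(1) L fc]] using l lY by blast
  ultimately show ?thesis using f lift unfolding homotopy_equivalent_def by blast
qed

text \<open>
  For \<open>n = 1\<close> the homotopy has only the two components that are known to vanish, so the quasi-inverse
  is a strict inverse in the middle.
\<close>

lemma short_middle_isomorphism:
  assumes X: "cochain_complex 1 \<C> X" and Y: "cochain_complex 1 \<C> Y"
    and wX: "weak_kernels 1 X" and wY: "weak_kernels 1 Y"
    and f: "chain_map 1 \<C> X Y f" and g: "chain_map 1 \<C> Y X g"
    and gf: "g 0 \<cdot> f 0 = Id \<C> (obj X 0)" "g 2 \<cdot> f 2 = Id \<C> (obj X 2)"
    and fg: "f 0 \<cdot> g 0 = Id \<C> (obj Y 0)" "f 2 \<cdot> g 2 = Id \<C> (obj Y 2)"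
  obtains m where "m \<proportion> obj Y 1 \<rightarrow> obj X 1" "m \<cdot> f 1 = Id \<C> (obj X 1)" "f 1 \<cdot> m = Id \<C> (obj Y 1)"
    "m \<cdot> dif Y 0 = dif X 0 \<cdot> g 0"
proof -
  let ?L = "quasi_inverse f g"
  have L: "chain_map 1 \<C> Y X ?L" by (rule chain_map_quasi_inverse[OF X Y f g])
  have bd: "boundary 1 Z Z k 1 = zero (obj Z 1) (obj Z 1)"
    if "cochain_complex 1 \<C> Z" "k 0 = zero (obj Z (Suc 0)) (obj Z 0)" "k 1 = zero (obj Z (Suc 1)) (obj Z 1)" for Z k
    using that complex_dif[OF that(1), of 0] complex_dif[OF that(1), of 1]
    by (simp add: boundary_def maps_unfold)
  have fm: "f 1 \<proportion> obj X 1 \<rightarrow> obj Y 1" "?L 1 \<proportion> obj Y 1 \<rightarrow> obj X 1"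
    using chain_map_maps[OF X Y f, of 1] chain_map_maps[OF Y X L, of 1] by simp_all
  have 2: "Suc 1 = 2" by simp
  obtain k where "k 0 = zero (obj X (Suc 0)) (obj X 0)" "k 1 = zero (obj X (Suc 1)) (obj X 1)"
      and k: "\<And>i. i \<le> Suc 1 \<Longrightarrow> Id \<C> (obj X i) = ?L i \<cdot> f i \<boxplus> boundary 1 X X k i"
    using quasi_inverse_homotopy[OF X Y wX f g] gf unfolding 2 by metis
  then have 1: "?L 1 \<cdot> f 1 = Id \<C> (obj X 1)" using k[of 1] bd[OF X, of k] fm by (simp add: maps_unfold)
  obtain l where "l 0 = zero (obj Y (Suc 0)) (obj Y 0)" "l 1 = zero (obj Y (Suc 1)) (obj Y 1)"
      and l: "\<And>i. i \<le> Suc 1 \<Longrightarrow> Id \<C> (obj Y i) = f i \<cdot> ?L i \<boxplus> boundary 1 Y Y l i"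
    using quasi_inverse_homotopy[OF Y X wY g f] fg unfolding 2 by metis
  then have 3: "f 1 \<cdot> ?L 1 = Id \<C> (obj Y 1)" using l[of 1] bd[OF Y, of l] fm by (simp add: maps_unfold)
  have "?L 0 = g 0"
    using quasi_inverse_end chain_map_maps[OF X Y f, of 0] chain_map_maps[OF Y X g, of 0] fg by simp
  then have 4: "?L 1 \<cdot> dif Y 0 = dif X 0 \<cdot> g 0" using chain_map_commute[OF Y X L, of 0] by simp
  show thesis using that[of "?L 1"] fm 1 3 4 by blast
qed

lemma homotopy_equivalent_of_iso:
  assumes X': "X \<in> complexes_between n \<C> A C" and Y': "Y \<in> complexes_between n \<C> A C"
    and f: "lift n \<C> X Y (Id \<C> A) (Id \<C> C) f" and g: "lift n \<C> Y X (Id \<C> A) (Id \<C> C) g"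
    and gf: "\<And>i. i \<le> Suc n \<Longrightarrow> g i \<cdot> f i = Id \<C> (obj X i)"
    and fg: "\<And>i. i \<le> Suc n \<Longrightarrow> f i \<cdot> g i = Id \<C> (obj Y i)"
  shows "homotopy_equivalent n \<C> A C X Y"
proof -
  note X = complexes_betweenD[OF X'] and Y = complexes_betweenD[OF Y']
  have fc: "chain_map n \<C> X Y f" and gc: "chain_map n \<C> Y X g" using f g by (auto simp: lift_def)
  have "homotopic n \<C> X X (\<lambda>i. g i \<cdot> f i) (\<lambda>i. Id \<C> (obj X i))"
    "homotopic n \<C> Y Y (\<lambda>i. f i \<cdot> g i) (\<lambda>i. Id \<C> (obj Y i))"
    using homotopic_refl[OF X(1,1) chain_map_comp[OF X(1) Y(1) X(1) fc gc]] gf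
      homotopic_refl[OF Y(1,1) chain_map_comp[OF Y(1) X(1) Y(1) gc fc]] fg by simp_all
  then show ?thesis using f g unfolding homotopy_equivalent_def by blast
qed

text \<open>
  Write \<open>1 = fg + dk + kd\<close> on \<open>Y\<close> and apply it to a morphism annihilated by the differential: the last
  term disappears, and \<open>g\<close> carries the problem over to \<open>X\<close>.
\<close>

lemma weak_kernels_homotopy_invariant:
  assumes X': "X \<in> complexes_between n \<C> A C" and Y': "Y \<in> complexes_between n \<C> A C"
    and XY: "homotopy_equivalent n \<C> A C X Y" and wX: "weak_kernels n X"
  shows "weak_kernels n Y"
  unfolding weak_kernels_def
proof (intro allI impI)
  note X = complexes_betweenD[OF X'] and Y = complexes_betweenD[OF Y']
  obtain f g where f: "chain_map n \<C> X Y f" and g: "chain_map n \<C> Y X g"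
    and fg: "homotopic n \<C> Y Y (\<lambda>i. f i \<cdot> g i) (\<lambda>i. Id \<C> (obj Y i))"
    using XY unfolding homotopy_equivalent_def lift_def by blast
  obtain k where k: "lowering n Y Y k"
    and eq: "\<And>i. i \<le> Suc n \<Longrightarrow> Id \<C> (obj Y i) = f i \<cdot> g i \<boxplus> boundary n Y Y k i"
    using fg unfolding homotopic_chain_map_iff[OF Y(1,1) chain_map_comp[OF Y(1) X(1) Y(1) g f]] by blast
  fix i W u assume i: "i < n" and u: "u \<proportion> W \<rightarrow> obj Y (Suc i)"
    and du: "dif Y (Suc i) \<cdot> u = zero W (obj Y (Suc (Suc i)))"
  have fm: "f i \<proportion> obj X i \<rightarrow> obj Y i" "f (Suc i) \<proportion> obj X (Suc i) \<rightarrow> obj Y (Suc i)"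
    using chain_map_maps[OF X(1) Y(1) f] i by auto
  have gm: "g (Suc i) \<proportion> obj Y (Suc i) \<rightarrow> obj X (Suc i)"
    "g (Suc (Suc i)) \<proportion> obj Y (Suc (Suc i)) \<rightarrow> obj X (Suc (Suc i))"
    using chain_map_maps[OF Y(1) X(1) g] i by auto
  have dX: "dif X i \<proportion> obj X i \<rightarrow> obj X (Suc i)" "dif X (Suc i) \<proportion> obj X (Suc i) \<rightarrow> obj X (Suc (Suc i))"
    using complex_dif[OF X(1)] i by auto
  have dY: "dif Y i \<proportion> obj Y i \<rightarrow> obj Y (Suc i)" "dif Y (Suc i) \<proportion> obj Y (Suc i) \<rightarrow> obj Y (Suc (Suc i))"
    using complex_dif[OF Y(1)] i by auto
  have km: "k i \<proportion> obj Y (Suc i) \<rightarrow> obj Y i" "k (Suc i) \<proportion> obj Y (Suc (Suc i)) \<rightarrow> obj Y (Suc i)"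
    using k i by (auto simp: lowering_def)
  have c: "dif X (Suc i) \<cdot> g (Suc i) = g (Suc (Suc i)) \<cdot> dif Y (Suc i)" "f (Suc i) \<cdot> dif X i = dif Y i \<cdot> f i"
    using chain_map_commute[OF Y(1) X(1) g, of "Suc i"] chain_map_commute[OF X(1) Y(1) f, of i] i by auto
  have gu: "g (Suc i) \<cdot> u \<proportion> W \<rightarrow> obj X (Suc i)" using gm u maps_comp by blast
  have "dif X (Suc i) \<cdot> g (Suc i) \<cdot> u = (dif X (Suc i) \<cdot> g (Suc i)) \<cdot> u" using dX gm u by algebra
  also have "\<dots> = g (Suc (Suc i)) \<cdot> dif Y (Suc i) \<cdot> u" unfolding c using dY gm u by algebra
  also have "\<dots> = zero W (obj X (Suc (Suc i)))" unfolding du using gm u by algebra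
  finally obtain v where v: "v \<proportion> W \<rightarrow> obj X i" "dif X i \<cdot> v = g (Suc i) \<cdot> u"
    using weak_kernelsE[OF wX i gu] by blast
  have "u = Id \<C> (obj Y (Suc i)) \<cdot> u" using u by algebra
  also have "\<dots> = f (Suc i) \<cdot> g (Suc i) \<cdot> u \<boxplus> (dif Y i \<cdot> k i \<cdot> u \<boxplus> k (Suc i) \<cdot> dif Y (Suc i) \<cdot> u)"
    unfolding eq[OF less_imp_le, of "Suc i", OF Suc_less_eq[THEN iffD2, OF i]]
      boundary_simps(3)[OF i] using u fm gm dY km by algebra
  also have "f (Suc i) \<cdot> g (Suc i) \<cdot> u = (f (Suc i) \<cdot> dif X i) \<cdot> v"
    unfolding v(2)[symmetric] using fm dX v(1) by algebra
  also have "\<dots> = dif Y i \<cdot> f i \<cdot> v" unfolding c using fm dY v(1) by algebra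
  finally have "u = dif Y i \<cdot> f i \<cdot> v \<boxplus> (dif Y i \<cdot> k i \<cdot> u \<boxplus> k (Suc i) \<cdot> dif Y (Suc i) \<cdot> u)" .
  then have "dif Y i \<cdot> (f i \<cdot> v \<boxplus> k i \<cdot> u) = u"
    unfolding du using u v(1) fm dY km by algebra
  moreover have "f i \<cdot> v \<boxplus> k i \<cdot> u \<proportion> W \<rightarrow> obj Y i" using u v(1) fm km by algebra
  ultimately show "\<exists>v. v \<proportion> W \<rightarrow> obj Y i \<and> dif Y i \<cdot> v = u" by blast
qed

end

section \<open>Extensions and exactness\<close>

context additive_bifunctor
begin

lemma push_closed: "\<lbrakk>C \<in> Ob \<C>; a \<proportion> A \<rightarrow> A'; \<delta> \<in> extensions \<E> C A\<rbrakk> \<Longrightarrow> push \<C> \<E> C a \<delta> \<in> extensions \<E> C A'"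
  using act_hom[of C C A A' "Id \<C> C" a] by (auto simp: push_def maps_def id_closed hom_def Pi_def)

lemma pull_closed: "\<lbrakk>A \<in> Ob \<C>; c \<proportion> C' \<rightarrow> C; \<delta> \<in> extensions \<E> C A\<rbrakk> \<Longrightarrow> pull \<C> \<E> A c \<delta> \<in> extensions \<E> C' A"
  using act_hom[of C C' A A c "Id \<C> A"] by (auto simp: pull_def maps_def id_closed hom_def Pi_def)

lemma push_push: "\<lbrakk>C \<in> Ob \<C>; a \<proportion> A \<rightarrow> A'; b \<proportion> A' \<rightarrow> A''; \<delta> \<in> extensions \<E> C A\<rbrakk>
    \<Longrightarrow> push \<C> \<E> C b (push \<C> \<E> C a \<delta>) = push \<C> \<E> C (b \<cdot> a) \<delta>"
  using act_comp[of C C C A A' A'' "Id \<C> C" "Id \<C> C" a b \<delta>] by (auto simp: push_def maps_def id_closed)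

lemma pull_pull: "\<lbrakk>A \<in> Ob \<C>; c \<proportion> C' \<rightarrow> C; d \<proportion> C'' \<rightarrow> C'; \<delta> \<in> extensions \<E> C A\<rbrakk>
    \<Longrightarrow> pull \<C> \<E> A d (pull \<C> \<E> A c \<delta>) = pull \<C> \<E> A (c \<cdot> d) \<delta>"
  using act_comp[of C C' C'' A A A c d "Id \<C> A" "Id \<C> A" \<delta>] by (auto simp: pull_def maps_def id_closed)

lemma push_Id: "\<lbrakk>C \<in> Ob \<C>; A \<in> Ob \<C>; \<delta> \<in> extensions \<E> C A\<rbrakk> \<Longrightarrow> push \<C> \<E> C (Id \<C> A) \<delta> = \<delta>"
  and pull_Id: "\<lbrakk>C \<in> Ob \<C>; A \<in> Ob \<C>; \<delta> \<in> extensions \<E> C A\<rbrakk> \<Longrightarrow> pull \<C> \<E> A (Id \<C> C) \<delta> = \<delta>"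
  by (simp_all add: push_def pull_def act_id)

lemma ext_group: "\<lbrakk>C \<in> Ob \<C>; A \<in> Ob \<C>\<rbrakk> \<Longrightarrow> group (Ext \<E> C A)"
  by (simp add: comm_group.axioms(2) ext_comm_group)

lemma ext_zero_closed: "\<lbrakk>C \<in> Ob \<C>; A \<in> Ob \<C>\<rbrakk> \<Longrightarrow> \<one>\<^bsub>Ext \<E> C A\<^esub> \<in> extensions \<E> C A"
  by (simp add: ext_group group.is_monoid monoid.one_closed)

lemma act_zero:
  "\<lbrakk>c \<proportion> C' \<rightarrow> C; a \<proportion> A \<rightarrow> A'\<rbrakk> \<Longrightarrow> Act \<E> c a \<one>\<^bsub>Ext \<E> C A\<^esub> = \<one>\<^bsub>Ext \<E> C' A'\<^esub>"
  using act_hom[of C C' A A' c a] hom_one ext_group by (metis maps_def)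

lemma push_zero: "\<lbrakk>C \<in> Ob \<C>; a \<proportion> A \<rightarrow> A'\<rbrakk> \<Longrightarrow> push \<C> \<E> C a \<one>\<^bsub>Ext \<E> C A\<^esub> = \<one>\<^bsub>Ext \<E> C A'\<^esub>"
  by (simp add: push_def act_zero maps_Id)

lemma pull_zero: "\<lbrakk>A \<in> Ob \<C>; c \<proportion> C' \<rightarrow> C\<rbrakk> \<Longrightarrow> pull \<C> \<E> A c \<one>\<^bsub>Ext \<E> C A\<^esub> = \<one>\<^bsub>Ext \<E> C' A\<^esub>"
  by (simp add: pull_def act_zero maps_Id)

lemma ext_cancel:
  assumes "C \<in> Ob \<C>" "A \<in> Ob \<C>" "x \<in> extensions \<E> C A" "y \<in> extensions \<E> C A"
    "x = x \<otimes>\<^bsub>Ext \<E> C A\<^esub> y"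
  shows "y = \<one>\<^bsub>Ext \<E> C A\<^esub>"
  using assms ext_group[OF assms(1,2)] by (metis group.l_cancel_one' )

lemma push_add: "\<lbrakk>C \<in> Ob \<C>; a \<proportion> A \<rightarrow> A'; b \<proportion> A \<rightarrow> A'; \<delta> \<in> extensions \<E> C A\<rbrakk>
    \<Longrightarrow> push \<C> \<E> C (a \<boxplus> b) \<delta> = push \<C> \<E> C a \<delta> \<otimes>\<^bsub>Ext \<E> C A'\<^esub> push \<C> \<E> C b \<delta>"
  using act_add_right[of C C A A' "Id \<C> C" a b \<delta>] by (auto simp: push_def maps_def id_closed add_eq)

lemma pull_add: "\<lbrakk>A \<in> Ob \<C>; c \<proportion> C' \<rightarrow> C; d \<proportion> C' \<rightarrow> C; \<delta> \<in> extensions \<E> C A\<rbrakk>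
    \<Longrightarrow> pull \<C> \<E> A (c \<boxplus> d) \<delta> = pull \<C> \<E> A c \<delta> \<otimes>\<^bsub>Ext \<E> C' A\<^esub> pull \<C> \<E> A d \<delta>"
  using act_add_left[of C C' A A c d "Id \<C> A" \<delta>] by (auto simp: pull_def maps_def id_closed add_eq)

text \<open>
  Together with exactness this compares two morphisms that act equally on an extension: their
  difference factors through a differential.
\<close>

lemma push_difference:
  assumes C: "C \<in> Ob \<C>" and a: "a \<proportion> A \<rightarrow> A'" and b: "b \<proportion> A \<rightarrow> A'" and \<delta>: "\<delta> \<in> extensions \<E> C A"
    and eq: "push \<C> \<E> C a \<delta> = push \<C> \<E> C b \<delta>"
  shows "push \<C> \<E> C (a \<boxplus> \<boxminus> b) \<delta> = \<one>\<^bsub>Ext \<E> C A'\<^esub>"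
proof (rule ext_cancel[OF C])
  have ab: "a \<boxplus> \<boxminus> b \<proportion> A \<rightarrow> A'" using a b by algebra
  show "A' \<in> Ob \<C>" using a by (simp add: maps_def)
  show "push \<C> \<E> C b \<delta> \<in> extensions \<E> C A'" "push \<C> \<E> C (a \<boxplus> \<boxminus> b) \<delta> \<in> extensions \<E> C A'"
    using push_closed[OF C _ \<delta>] b ab by auto
  have "b \<boxplus> (a \<boxplus> \<boxminus> b) = a" using a b by algebra
  then show "push \<C> \<E> C b \<delta> = push \<C> \<E> C b \<delta> \<otimes>\<^bsub>Ext \<E> C A'\<^esub> push \<C> \<E> C (a \<boxplus> \<boxminus> b) \<delta>"
    using push_add[OF C b ab \<delta>] eq by simp
qed

lemma pull_difference:
  assumes A: "A \<in> Ob \<C>" and c: "c \<proportion> C' \<rightarrow> C" and d: "d \<proportion> C' \<rightarrow> C" and \<delta>: "\<delta> \<in> extensions \<E> C A"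
    and eq: "pull \<C> \<E> A c \<delta> = pull \<C> \<E> A d \<delta>"
  shows "pull \<C> \<E> A (c \<boxplus> \<boxminus> d) \<delta> = \<one>\<^bsub>Ext \<E> C' A\<^esub>"
proof (rule ext_cancel)
  have cd: "c \<boxplus> \<boxminus> d \<proportion> C' \<rightarrow> C" using c d by algebra
  show "A \<in> Ob \<C>" "C' \<in> Ob \<C>" using A c by (simp_all add: maps_def)
  show "pull \<C> \<E> A d \<delta> \<in> extensions \<E> C' A" "pull \<C> \<E> A (c \<boxplus> \<boxminus> d) \<delta> \<in> extensions \<E> C' A"
    using pull_closed[OF A _ \<delta>] d cd by auto
  have "d \<boxplus> (c \<boxplus> \<boxminus> d) = c" using c d by algebra
  then show "pull \<C> \<E> A d \<delta> = pull \<C> \<E> A d \<delta> \<otimes>\<^bsub>Ext \<E> C' A\<^esub> pull \<C> \<E> A (c \<boxplus> \<boxminus> d) \<delta>"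
    using pull_add[OF A d cd \<delta>] eq by simp
qed

text \<open>
  The covariant and the contravariant half of being an \<open>n\<close>-exangle, on elements.
\<close>

definition left_exact :: "nat \<Rightarrow> ('o, 'm) cochain \<Rightarrow> 'e \<Rightarrow> bool" where
  "left_exact n X \<delta> \<longleftrightarrow> weak_kernels n X \<and>
     pull \<C> \<E> (obj X 0) (dif X n) \<delta> = \<one>\<^bsub>Ext \<E> (obj X n) (obj X 0)\<^esub> \<and>
     (\<forall>W u. u \<proportion> W \<rightarrow> obj X (Suc n) \<longrightarrow> pull \<C> \<E> (obj X 0) u \<delta> = \<one>\<^bsub>Ext \<E> W (obj X 0)\<^esub> \<longrightarrow>
       (\<exists>v. v \<proportion> W \<rightarrow> obj X n \<and> dif X n \<cdot> v = u))"

definition right_exact :: "nat \<Rightarrow> ('o, 'm) cochain \<Rightarrow> 'e \<Rightarrow> bool" where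
  "right_exact n X \<delta> \<longleftrightarrow> weak_cokernels n X \<and>
     push \<C> \<E> (obj X (Suc n)) (dif X 0) \<delta> = \<one>\<^bsub>Ext \<E> (obj X (Suc n)) (obj X 1)\<^esub> \<and>
     (\<forall>W u. u \<proportion> obj X 0 \<rightarrow> W \<longrightarrow> push \<C> \<E> (obj X (Suc n)) u \<delta> = \<one>\<^bsub>Ext \<E> (obj X (Suc n)) W\<^esub> \<longrightarrow>
       (\<exists>v. v \<proportion> obj X 1 \<rightarrow> W \<and> v \<cdot> dif X 0 = u))"

lemma image_eq_kernel_pull:
  assumes A: "A \<in> Ob \<C>" and d: "d \<proportion> B \<rightarrow> C" and \<delta>: "\<delta> \<in> extensions \<E> C A"
  shows "(\<forall>W\<in>Ob \<C>. (\<lambda>f. d \<cdot> f) ` arrows \<C> W B =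
        kernel (Hom \<C> W C) (Ext \<E> W A) (\<lambda>f. pull \<C> \<E> A f \<delta>)) \<longleftrightarrow>
      pull \<C> \<E> A d \<delta> = \<one>\<^bsub>Ext \<E> B A\<^esub> \<and>
      (\<forall>W u. u \<proportion> W \<rightarrow> C \<longrightarrow> pull \<C> \<E> A u \<delta> = \<one>\<^bsub>Ext \<E> W A\<^esub> \<longrightarrow> (\<exists>v. v \<proportion> W \<rightarrow> B \<and> d \<cdot> v = u))"
    (is "?kernels \<longleftrightarrow> ?zero \<and> ?lifts")
proof -
  have Ob: "B \<in> Ob \<C>" "C \<in> Ob \<C>" using d by (auto simp: maps_def)
  have zero: ?zero if ?kernels
  proof -
    have "d \<cdot> Id \<C> B \<in> kernel (Hom \<C> B C) (Ext \<E> B A) (\<lambda>f. pull \<C> \<E> A f \<delta>)"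
      using that[THEN bspec, OF Ob(1)] id_closed[OF Ob(1)] by blast
    then show ?thesis using d by (simp add: kernel_def maps_unfold)
  qed
  have sub: "(\<lambda>f. d \<cdot> f) ` arrows \<C> W B \<subseteq> kernel (Hom \<C> W C) (Ext \<E> W A) (\<lambda>f. pull \<C> \<E> A f \<delta>)"
    if W: "W \<in> Ob \<C>" and z: ?zero for W
  proof
    fix u assume "u \<in> (\<lambda>f. d \<cdot> f) ` arrows \<C> W B"
    then obtain v where v: "v \<proportion> W \<rightarrow> B" "u = d \<cdot> v" using W Ob by (auto simp: maps_def)
    have "pull \<C> \<E> A u \<delta> = pull \<C> \<E> A v (pull \<C> \<E> A d \<delta>)"
      using pull_pull[OF A d v(1) \<delta>] v(2) by simp
    also have "\<dots> = \<one>\<^bsub>Ext \<E> W A\<^esub>" using z v A by (simp add: pull_zero)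
    finally show "u \<in> kernel (Hom \<C> W C) (Ext \<E> W A) (\<lambda>f. pull \<C> \<E> A f \<delta>)"
      using v maps_comp[OF v(1) d] by (simp add: kernel_def maps_def)
  qed
  have "?kernels \<longleftrightarrow> ?zero \<and> (\<forall>W\<in>Ob \<C>. kernel (Hom \<C> W C) (Ext \<E> W A) (\<lambda>f. pull \<C> \<E> A f \<delta>) \<subseteq>
      (\<lambda>f. d \<cdot> f) ` arrows \<C> W B)"
    using zero sub by blast
  also have "\<dots> \<longleftrightarrow> ?zero \<and> ?lifts"
    using Ob by (auto simp: kernel_def maps_def image_iff Bex_def subset_iff)
  finally show ?thesis .
qed

lemma image_eq_kernel_push:
  assumes C: "C \<in> Ob \<C>" and d: "d \<proportion> A \<rightarrow> B" and \<delta>: "\<delta> \<in> extensions \<E> C A"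
  shows "(\<forall>W\<in>Ob \<C>. (\<lambda>f. f \<cdot> d) ` arrows \<C> B W =
        kernel (Hom \<C> A W) (Ext \<E> C W) (\<lambda>f. push \<C> \<E> C f \<delta>)) \<longleftrightarrow>
      push \<C> \<E> C d \<delta> = \<one>\<^bsub>Ext \<E> C B\<^esub> \<and>
      (\<forall>W u. u \<proportion> A \<rightarrow> W \<longrightarrow> push \<C> \<E> C u \<delta> = \<one>\<^bsub>Ext \<E> C W\<^esub> \<longrightarrow> (\<exists>v. v \<proportion> B \<rightarrow> W \<and> v \<cdot> d = u))"
    (is "?kernels \<longleftrightarrow> ?zero \<and> ?lifts")
proof -
  have Ob: "A \<in> Ob \<C>" "B \<in> Ob \<C>" using d by (auto simp: maps_def)
  have zero: ?zero if ?kernels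
  proof -
    have "Id \<C> B \<cdot> d \<in> kernel (Hom \<C> A B) (Ext \<E> C B) (\<lambda>f. push \<C> \<E> C f \<delta>)"
      using that[THEN bspec, OF Ob(2)] id_closed[OF Ob(2)] by blast
    then show ?thesis using d by (simp add: kernel_def maps_unfold)
  qed
  have sub: "(\<lambda>f. f \<cdot> d) ` arrows \<C> B W \<subseteq> kernel (Hom \<C> A W) (Ext \<E> C W) (\<lambda>f. push \<C> \<E> C f \<delta>)"
    if W: "W \<in> Ob \<C>" and z: ?zero for W
  proof
    fix u assume "u \<in> (\<lambda>f. f \<cdot> d) ` arrows \<C> B W"
    then obtain v where v: "v \<proportion> B \<rightarrow> W" "u = v \<cdot> d" using W Ob by (auto simp: maps_def)
    have "push \<C> \<E> C u \<delta> = push \<C> \<E> C v (push \<C> \<E> C d \<delta>)"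
      using push_push[OF C d v(1) \<delta>] v(2) by simp
    also have "\<dots> = \<one>\<^bsub>Ext \<E> C W\<^esub>" using z v C by (simp add: push_zero)
    finally show "u \<in> kernel (Hom \<C> A W) (Ext \<E> C W) (\<lambda>f. push \<C> \<E> C f \<delta>)"
      using v maps_comp[OF d v(1)] by (simp add: kernel_def maps_def)
  qed
  have "?kernels \<longleftrightarrow> ?zero \<and> (\<forall>W\<in>Ob \<C>. kernel (Hom \<C> A W) (Ext \<E> C W) (\<lambda>f. push \<C> \<E> C f \<delta>) \<subseteq>
      (\<lambda>f. f \<cdot> d) ` arrows \<C> B W)"
    using zero sub by blast
  also have "\<dots> \<longleftrightarrow> ?zero \<and> ?lifts"
    using Ob by (auto simp: kernel_def maps_def image_iff Bex_def subset_iff)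
  finally show ?thesis .
qed

lemma n_exangle_iff:
  "n_exangle n \<C> \<E> X \<delta> \<longleftrightarrow> cochain_complex n \<C> X \<and> \<delta> \<in> extensions \<E> (obj X (Suc n)) (obj X 0) \<and>
     left_exact n X \<delta> \<and> right_exact n X \<delta>"
proof (cases "cochain_complex n \<C> X \<and> \<delta> \<in> extensions \<E> (obj X (Suc n)) (obj X 0)")
  case True
  then have X: "cochain_complex n \<C> X" and \<delta>: "\<delta> \<in> extensions \<E> (obj X (Suc n)) (obj X 0)" by auto
  have Ob: "obj X 0 \<in> Ob \<C>" "obj X (Suc n) \<in> Ob \<C>" using complex_Ob[OF X] by simp_all
  have d: "dif X n \<proportion> obj X n \<rightarrow> obj X (Suc n)" "dif X 0 \<proportion> obj X 0 \<rightarrow> obj X 1"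
    using complex_dif[OF X, of n] complex_dif[OF X, of 0] by simp_all
  show ?thesis
    unfolding n_exangle_def left_exact_def right_exact_def ball_conj_distrib
    using image_eq_kernel_pull[OF Ob(1) d(1) \<delta>] image_eq_kernel_push[OF Ob(2) d(2) \<delta>]
      weak_kernel_cokernel_iff[OF X] True by (simp add: conj_ac)
qed (auto simp: n_exangle_def)

lemma left_exact_homotopy_invariant:
  assumes X': "X \<in> complexes_between n \<C> A C" and Y': "Y \<in> complexes_between n \<C> A C"
    and XY: "homotopy_equivalent n \<C> A C X Y" and \<delta>: "\<delta> \<in> extensions \<E> C A" and lX: "left_exact n X \<delta>"
  shows "left_exact n Y \<delta>"
proof -
  note X = complexes_betweenD[OF X'] and Y = complexes_betweenD[OF Y']
  obtain f g where f: "lift n \<C> X Y (Id \<C> A) (Id \<C> C) f" and g: "lift n \<C> Y X (Id \<C> A) (Id \<C> C) g"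
    using XY unfolding homotopy_equivalent_def by blast
  have fc: "chain_map n \<C> X Y f" "f (Suc n) = Id \<C> C" and gc: "chain_map n \<C> Y X g" "g (Suc n) = Id \<C> C"
    using f g by (auto simp: lift_def)
  have dX: "dif X n \<proportion> obj X n \<rightarrow> C" and dY: "dif Y n \<proportion> obj Y n \<rightarrow> C"
    using complex_dif[OF X(1), of n] complex_dif[OF Y(1), of n] X Y by auto
  have fm: "f n \<proportion> obj X n \<rightarrow> obj Y n" and gm: "g n \<proportion> obj Y n \<rightarrow> obj X n"
    using chain_map_maps[OF X(1) Y(1) fc(1)] chain_map_maps[OF Y(1) X(1) gc(1)] by auto
  have fd: "dif Y n \<cdot> f n = dif X n" and gd: "dif X n \<cdot> g n = dif Y n"
    using chain_map_commute[OF X(1) Y(1) fc(1), of n] chain_map_commute[OF Y(1) X(1) gc(1), of n]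
      fc(2) gc(2) dX dY by (simp_all add: maps_unfold)
  have "pull \<C> \<E> A (dif Y n) \<delta> = \<one>\<^bsub>Ext \<E> (obj Y n) A\<^esub>"
    using lX pull_pull[OF X(4) dX gm \<delta>] pull_zero[OF X(4) gm] X(2) unfolding gd left_exact_def by simp
  moreover have "\<exists>v. v \<proportion> W \<rightarrow> obj Y n \<and> dif Y n \<cdot> v = u"
    if "u \<proportion> W \<rightarrow> C" "pull \<C> \<E> A u \<delta> = \<one>\<^bsub>Ext \<E> W A\<^esub>" for W u
  proof -
    have "\<exists>v. v \<proportion> W \<rightarrow> obj X n \<and> dif X n \<cdot> v = u"
      using lX that X(2,3) unfolding left_exact_def by simp
    then obtain v where v: "v \<proportion> W \<rightarrow> obj X n" "dif X n \<cdot> v = u" by blast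
    have "dif Y n \<cdot> f n \<cdot> v = u" using maps_comp_assoc[OF v(1) fm dY] v(2) fd by simp
    then show ?thesis using maps_comp[OF v(1) fm] by blast
  qed
  ultimately show ?thesis
    using lX weak_kernels_homotopy_invariant[OF X' Y' XY] X Y unfolding left_exact_def by simp
qed

end

section \<open>Mapping cones\<close>

context additive_category
begin

text \<open>
  Composites are kept right-associated, where the left-hand side of an equation \<open>g \<cdot> f = h\<close> does not
  occur as a subterm; this form of the equation does.
\<close>

lemma comp_rewrite:
  "\<lbrakk>g \<cdot> f = h; arr f; arr g; tgt f = src g; arr x; tgt x = src f\<rbrakk> \<Longrightarrow> g \<cdot> (f \<cdot> x) = h \<cdot> x"
  by (simp flip: assoc)

lemma biproductD:
  assumes "biproduct \<C> A B S i\<^sub>1 i\<^sub>2 p\<^sub>1 p\<^sub>2" "A \<in> Ob \<C>" "B \<in> Ob \<C>"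
  shows "i\<^sub>1 \<proportion> A \<rightarrow> S" "i\<^sub>2 \<proportion> B \<rightarrow> S" "p\<^sub>1 \<proportion> S \<rightarrow> A" "p\<^sub>2 \<proportion> S \<rightarrow> B"
    "p\<^sub>1 \<cdot> i\<^sub>1 = Id \<C> A" "p\<^sub>2 \<cdot> i\<^sub>2 = Id \<C> B" "p\<^sub>1 \<cdot> i\<^sub>2 = zero B A" "p\<^sub>2 \<cdot> i\<^sub>1 = zero A B"
    "i\<^sub>1 \<cdot> p\<^sub>1 \<boxplus> i\<^sub>2 \<cdot> p\<^sub>2 = Id \<C> S"
proof -
  show m: "i\<^sub>1 \<proportion> A \<rightarrow> S" "i\<^sub>2 \<proportion> B \<rightarrow> S" "p\<^sub>1 \<proportion> S \<rightarrow> A" "p\<^sub>2 \<proportion> S \<rightarrow> B"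
    using assms by (auto simp: biproduct_def maps_def)
  show "p\<^sub>1 \<cdot> i\<^sub>1 = Id \<C> A" "p\<^sub>2 \<cdot> i\<^sub>2 = Id \<C> B" "p\<^sub>1 \<cdot> i\<^sub>2 = zero B A" "p\<^sub>2 \<cdot> i\<^sub>1 = zero A B"
    using assms by (auto simp: biproduct_def zero_def)
  show "i\<^sub>1 \<cdot> p\<^sub>1 \<boxplus> i\<^sub>2 \<cdot> p\<^sub>2 = Id \<C> S"
    using assms add_eq[OF maps_comp[OF m(3) m(1)]] by (auto simp: biproduct_def)
qed

lemma biproductI:
  assumes m: "i\<^sub>1 \<proportion> A \<rightarrow> S" "i\<^sub>2 \<proportion> B \<rightarrow> S" "p\<^sub>1 \<proportion> S \<rightarrow> A" "p\<^sub>2 \<proportion> S \<rightarrow> B"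
    and eq: "p\<^sub>1 \<cdot> i\<^sub>1 = Id \<C> A" "p\<^sub>2 \<cdot> i\<^sub>2 = Id \<C> B" "p\<^sub>1 \<cdot> i\<^sub>2 = zero B A" "p\<^sub>2 \<cdot> i\<^sub>1 = zero A B"
    "i\<^sub>1 \<cdot> p\<^sub>1 \<boxplus> i\<^sub>2 \<cdot> p\<^sub>2 = Id \<C> S"
  shows "biproduct \<C> A B S i\<^sub>1 i\<^sub>2 p\<^sub>1 p\<^sub>2"
  using m eq add_eq[OF maps_comp[OF m(3) m(1)]] by (auto simp: biproduct_def zero_def maps_def)

lemma biproduct_into_eqI:
  assumes bp: "biproduct \<C> A B S i\<^sub>1 i\<^sub>2 p\<^sub>1 p\<^sub>2" "A \<in> Ob \<C>" "B \<in> Ob \<C>"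
    and u: "u \<proportion> W \<rightarrow> S" and v: "v \<proportion> W \<rightarrow> S" and eq: "p\<^sub>1 \<cdot> u = p\<^sub>1 \<cdot> v" "p\<^sub>2 \<cdot> u = p\<^sub>2 \<cdot> v"
  shows "u = v"
proof -
  note B = biproductD[OF bp]
  have "w = i\<^sub>1 \<cdot> p\<^sub>1 \<cdot> w \<boxplus> i\<^sub>2 \<cdot> p\<^sub>2 \<cdot> w" if w: "w \<proportion> W \<rightarrow> S" for w
  proof -
    have "w = (i\<^sub>1 \<cdot> p\<^sub>1 \<boxplus> i\<^sub>2 \<cdot> p\<^sub>2) \<cdot> w" unfolding B(9) using w by algebra
    also have "\<dots> = i\<^sub>1 \<cdot> p\<^sub>1 \<cdot> w \<boxplus> i\<^sub>2 \<cdot> p\<^sub>2 \<cdot> w" using w B(1-4) by algebra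
    finally show ?thesis .
  qed
  from this[OF u] this[OF v] show ?thesis using eq by simp
qed

lemma biproduct_from_decompose:
  assumes bp: "biproduct \<C> A B S i\<^sub>1 i\<^sub>2 p\<^sub>1 p\<^sub>2" "A \<in> Ob \<C>" "B \<in> Ob \<C>" and u: "u \<proportion> S \<rightarrow> W"
  shows "u = (u \<cdot> i\<^sub>1) \<cdot> p\<^sub>1 \<boxplus> (u \<cdot> i\<^sub>2) \<cdot> p\<^sub>2"
proof -
  note B = biproductD[OF bp]
  have "u = u \<cdot> (i\<^sub>1 \<cdot> p\<^sub>1 \<boxplus> i\<^sub>2 \<cdot> p\<^sub>2)" unfolding B(9) using u by algebra
  also have "\<dots> = (u \<cdot> i\<^sub>1) \<cdot> p\<^sub>1 \<boxplus> (u \<cdot> i\<^sub>2) \<cdot> p\<^sub>2" using u B(1-4) by algebra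
  finally show ?thesis .
qed

text \<open>
  A mapping cone with its differentials given by their rows instead of their matrix entries. In diagram
  chases a morphism into the cone is given by its two components, and the rows say what the differential
  does to them.
\<close>

definition cone_rows :: "nat \<Rightarrow> ('o, 'm) cochain \<Rightarrow> ('o, 'm) cochain \<Rightarrow> (nat \<Rightarrow> 'm) \<Rightarrow> ('o, 'm) cochain \<Rightarrow>
    (nat \<Rightarrow> 'm) \<Rightarrow> (nat \<Rightarrow> 'm) \<Rightarrow> (nat \<Rightarrow> 'm) \<Rightarrow> (nat \<Rightarrow> 'm) \<Rightarrow> bool" where
  "cone_rows n X Y f M i\<^sub>1 i\<^sub>2 p\<^sub>1 p\<^sub>2 \<longleftrightarrow>
     obj M 0 = obj X 1 \<and> obj M (Suc n) = obj Y (Suc n) \<and>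
     (\<forall>k\<le>n. dif M k \<proportion> obj M k \<rightarrow> obj M (Suc k)) \<and>
     (\<forall>k\<in>{1..n}. biproduct \<C> (obj X (Suc k)) (obj Y k) (obj M k) (i\<^sub>1 k) (i\<^sub>2 k) (p\<^sub>1 k) (p\<^sub>2 k)) \<and>
     p\<^sub>1 1 \<cdot> dif M 0 = \<boxminus> dif X 1 \<and> p\<^sub>2 1 \<cdot> dif M 0 = f 1 \<and>
     (\<forall>k\<in>{1..<n}. p\<^sub>1 (Suc k) \<cdot> dif M k = \<boxminus> (dif X (Suc k) \<cdot> p\<^sub>1 k) \<and>
        p\<^sub>2 (Suc k) \<cdot> dif M k = f (Suc k) \<cdot> p\<^sub>1 k \<boxplus> dif Y k \<cdot> p\<^sub>2 k) \<and>
     dif M n = f (Suc n) \<cdot> p\<^sub>1 n \<boxplus> dif Y n \<cdot> p\<^sub>2 n"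

text \<open>
  A morphism out of a biproduct is determined by its restrictions to the two summands, so the entries
  determine the rows.
\<close>

lemma mapping_cone_iff:
  assumes n: "n \<ge> 1" and X: "cochain_complex n \<C> X" and Y: "cochain_complex n \<C> Y"
    and f: "chain_map n \<C> X Y f"
  shows "mapping_cone n \<C> X Y f M \<longleftrightarrow> (\<exists>i\<^sub>1 i\<^sub>2 p\<^sub>1 p\<^sub>2. cone_rows n X Y f M i\<^sub>1 i\<^sub>2 p\<^sub>1 p\<^sub>2)"
proof -
  have "mapping_cone n \<C> X Y f M \<longleftrightarrow>
     obj M 0 = obj X 1 \<and> obj M (n+1) = obj Y (n+1) \<and>
     (\<forall>k\<le>n. dif M k \<in> arrows \<C> (obj M k) (obj M (k+1))) \<and>
     (\<exists>i\<^sub>1 i\<^sub>2 p\<^sub>1 p\<^sub>2. cone_rows n X Y f M i\<^sub>1 i\<^sub>2 p\<^sub>1 p\<^sub>2)"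
    unfolding mapping_cone_def
  proof (intro conj_cong refl ex_cong1)
    fix i\<^sub>1 i\<^sub>2 p\<^sub>1 p\<^sub>2
    assume M0: "obj M 0 = obj X 1" and Mn: "obj M (n+1) = obj Y (n+1)"
      and arrD: "\<forall>k\<le>n. dif M k \<in> arrows \<C> (obj M k) (obj M (k+1))"
    let ?bip = "\<forall>k\<in>{1..n}. biproduct \<C> (obj X (k+1)) (obj Y k) (obj M k) (i\<^sub>1 k) (i\<^sub>2 k) (p\<^sub>1 k) (p\<^sub>2 k)"
    show "(?bip \<and>
        p\<^sub>1 1 \<cdot> dif M 0 = inv\<^bsub>Hom \<C> (obj X 1) (obj X 2)\<^esub> dif X 1 \<and>
        p\<^sub>2 1 \<cdot> dif M 0 = f 1 \<and>
        (\<forall>k\<in>{1..<n}.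
           p\<^sub>1 (k+1) \<cdot> dif M k \<cdot> i\<^sub>1 k = inv\<^bsub>Hom \<C> (obj X (k+1)) (obj X (k+2))\<^esub> dif X (k+1) \<and>
           p\<^sub>1 (k+1) \<cdot> dif M k \<cdot> i\<^sub>2 k = \<one>\<^bsub>Hom \<C> (obj Y k) (obj X (k+2))\<^esub> \<and>
           p\<^sub>2 (k+1) \<cdot> dif M k \<cdot> i\<^sub>1 k = f (k+1) \<and>
           p\<^sub>2 (k+1) \<cdot> dif M k \<cdot> i\<^sub>2 k = dif Y k) \<and>
        dif M n \<cdot> i\<^sub>1 n = f (n+1) \<and> dif M n \<cdot> i\<^sub>2 n = dif Y n)
      \<longleftrightarrow> cone_rows n X Y f M i\<^sub>1 i\<^sub>2 p\<^sub>1 p\<^sub>2" (is "?entries \<longleftrightarrow> ?rows")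
    proof (cases ?bip)
      case True
      have MOb: "obj M k \<in> Ob \<C>" if "k \<le> Suc n" for k
        using that
      proof (cases rule: degree_cases)
        case first then show ?thesis using M0 complex_Ob[OF X, of 1] by simp
      next
        case (middle j) then show ?thesis using True by (auto simp: biproduct_def)
      next
        case last then show ?thesis using Mn complex_Ob[OF Y, of "Suc n"] by simp
      qed
      have D: "dif M k \<proportion> obj M k \<rightarrow> obj M (Suc k)" if "k \<le> n" for k
        using arrD that MOb by (simp add: maps_def)
      have B: "biproduct \<C> (obj X (Suc k)) (obj Y k) (obj M k) (i\<^sub>1 k) (i\<^sub>2 k) (p\<^sub>1 k) (p\<^sub>2 k)"
          "obj X (Suc k) \<in> Ob \<C>" "obj Y k \<in> Ob \<C>"
        if "1 \<le> k" "k \<le> n" for k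
        using that True complex_Ob[OF X, of "Suc k"] complex_Ob[OF Y, of k] by simp_all
      have neg: "inv\<^bsub>Hom \<C> (obj X k) (obj X (Suc k))\<^esub> dif X k = \<boxminus> dif X k" if "k \<le> n" for k
        using complex_dif[OF X that] neg_eq by simp
      have mid: "(p\<^sub>1 (Suc k) \<cdot> dif M k \<cdot> i\<^sub>1 k = \<boxminus> dif X (Suc k) \<and>
           p\<^sub>1 (Suc k) \<cdot> dif M k \<cdot> i\<^sub>2 k = zero (obj Y k) (obj X (Suc (Suc k))) \<and>
           p\<^sub>2 (Suc k) \<cdot> dif M k \<cdot> i\<^sub>1 k = f (Suc k) \<and> p\<^sub>2 (Suc k) \<cdot> dif M k \<cdot> i\<^sub>2 k = dif Y k) \<longleftrightarrow>
         (p\<^sub>1 (Suc k) \<cdot> dif M k = \<boxminus> (dif X (Suc k) \<cdot> p\<^sub>1 k) \<and>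
          p\<^sub>2 (Suc k) \<cdot> dif M k = f (Suc k) \<cdot> p\<^sub>1 k \<boxplus> dif Y k \<cdot> p\<^sub>2 k)"
        if k: "1 \<le> k" "k < n" for k
      proof -
        note b = biproductD[OF B[OF k(1) less_imp_le[OF k(2)]]]
        have kn: "1 \<le> Suc k" "Suc k \<le> n" using k by auto
        note b' = biproductD[OF B[OF kn]]
        have Dk: "dif M k \<proportion> obj M k \<rightarrow> obj M (Suc k)" using D k by simp
        have dX: "dif X (Suc k) \<proportion> obj X (Suc k) \<rightarrow> obj X (Suc (Suc k))" and dY: "dif Y k \<proportion> obj Y k \<rightarrow> obj Y (Suc k)"
          and fk: "f (Suc k) \<proportion> obj X (Suc k) \<rightarrow> obj Y (Suc k)"
          using complex_dif[OF X, of "Suc k"] complex_dif[OF Y, of k] chain_map_maps[OF X Y f, of "Suc k"] k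
            by simp_all
        have row1: "p\<^sub>1 (Suc k) \<cdot> dif M k = (p\<^sub>1 (Suc k) \<cdot> dif M k \<cdot> i\<^sub>1 k) \<cdot> p\<^sub>1 k \<boxplus> (p\<^sub>1 (Suc k) \<cdot> dif M k \<cdot> i\<^sub>2 k)
          \<cdot> p\<^sub>2 k"
          using biproduct_from_decompose[OF B[OF k(1) less_imp_le[OF k(2)]] maps_comp[OF Dk b'(3)]]
            maps_comp_assoc[OF b(1) Dk b'(3)] maps_comp_assoc[OF b(2) Dk b'(3)] by simp
        have row2: "p\<^sub>2 (Suc k) \<cdot> dif M k = (p\<^sub>2 (Suc k) \<cdot> dif M k \<cdot> i\<^sub>1 k) \<cdot> p\<^sub>1 k \<boxplus> (p\<^sub>2 (Suc k) \<cdot> dif M k \<cdot> i\<^sub>2 k)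
          \<cdot> p\<^sub>2 k"
          using biproduct_from_decompose[OF B[OF k(1) less_imp_le[OF k(2)]] maps_comp[OF Dk b'(4)]]
            maps_comp_assoc[OF b(1) Dk b'(4)] maps_comp_assoc[OF b(2) Dk b'(4)] by simp
        show ?thesis (is "?e \<longleftrightarrow> ?r")
        proof
          assume e: ?e
          have "(\<boxminus> dif X (Suc k)) \<cdot> p\<^sub>1 k \<boxplus> zero (obj Y k) (obj X (Suc (Suc k))) \<cdot> p\<^sub>2 k = \<boxminus> (dif X (Suc k) \<cdot> p\<^sub>1 k)"
            using dX b(3,4) by algebra
          then show ?r using row1 row2 e by simp
        next
          assume r: ?r
          then have r1: "p\<^sub>1 (Suc k) \<cdot> dif M k = \<boxminus> (dif X (Suc k) \<cdot> p\<^sub>1 k)"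
            and r2: "p\<^sub>2 (Suc k) \<cdot> dif M k = f (Suc k) \<cdot> p\<^sub>1 k \<boxplus> dif Y k \<cdot> p\<^sub>2 k" by auto
          show ?e
            using comp_rewrite[OF r1] comp_rewrite[OF r2] b b' dX dY fk Dk
            by (simp add: maps_unfold add_comp neg_comp assoc)
        qed
      qed
      have last: "(dif M n \<cdot> i\<^sub>1 n = f (n+1) \<and> dif M n \<cdot> i\<^sub>2 n = dif Y n) \<longleftrightarrow> dif M n = f (Suc n) \<cdot> p\<^sub>1 n \<boxplus> dif Y n \<cdot>
        p\<^sub>2 n"
      proof -
        note b = biproductD[OF B[OF n order_refl]]
        have dY: "dif Y n \<proportion> obj Y n \<rightarrow> obj Y (Suc n)" and fn: "f (Suc n) \<proportion> obj X (Suc n) \<rightarrow> obj Y (Suc n)"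
          using complex_dif[OF Y, of n] chain_map_maps[OF X Y f, of "Suc n"] by simp_all
        show ?thesis
          using biproduct_from_decompose[OF B[OF n order_refl] D[OF order_refl]] b dY fn
          by (auto simp: maps_unfold add_comp neg_comp assoc)
      qed
      have "?entries \<longleftrightarrow> (p\<^sub>1 1 \<cdot> dif M 0 = \<boxminus> dif X 1 \<and> p\<^sub>2 1 \<cdot> dif M 0 = f 1 \<and>
        (\<forall>k\<in>{1..<n}. p\<^sub>1 (Suc k) \<cdot> dif M k = \<boxminus> (dif X (Suc k) \<cdot> p\<^sub>1 k) \<and>
           p\<^sub>2 (Suc k) \<cdot> dif M k = f (Suc k) \<cdot> p\<^sub>1 k \<boxplus> dif Y k \<cdot> p\<^sub>2 k) \<and>
        dif M n = f (Suc n) \<cdot> p\<^sub>1 n \<boxplus> dif Y n \<cdot> p\<^sub>2 n)"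
        using True neg[of 1] n neg mid last by (simp add: zero_def[symmetric] numeral_2_eq_2)
      also have "\<dots> \<longleftrightarrow> ?rows" using True M0 Mn D by (simp add: cone_rows_def)
      finally show ?thesis .
    next
      case False
      then have "\<not> cone_rows n X Y f M i\<^sub>1 i\<^sub>2 p\<^sub>1 p\<^sub>2" by (simp add: cone_rows_def)
      with False show ?thesis by blast
    qed
  qed
  also have "\<dots> \<longleftrightarrow> (\<exists>i\<^sub>1 i\<^sub>2 p\<^sub>1 p\<^sub>2. cone_rows n X Y f M i\<^sub>1 i\<^sub>2 p\<^sub>1 p\<^sub>2)"
    by (auto simp: cone_rows_def maps_def)
  finally show ?thesis .
qed

lemma cone_rowsD:
  assumes n: "n \<ge> 1" and X: "cochain_complex n \<C> X" and Y: "cochain_complex n \<C> Y"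
    and f: "chain_map n \<C> X Y f" and r: "cone_rows n X Y f M i\<^sub>1 i\<^sub>2 p\<^sub>1 p\<^sub>2"
  shows "obj M 0 = obj X 1" "obj M (Suc n) = obj Y (Suc n)"
    "\<And>k. k \<le> n \<Longrightarrow> dif M k \<proportion> obj M k \<rightarrow> obj M (Suc k)"
    "\<And>k. 1 \<le> k \<Longrightarrow> k \<le> n \<Longrightarrow> biproduct \<C> (obj X (Suc k)) (obj Y k) (obj M k) (i\<^sub>1 k) (i\<^sub>2 k) (p\<^sub>1 k) (p\<^sub>2 k)"
    "p\<^sub>1 1 \<cdot> dif M 0 = \<boxminus> dif X 1" "p\<^sub>2 1 \<cdot> dif M 0 = f 1"
    "\<And>k. 1 \<le> k \<Longrightarrow> k < n \<Longrightarrow> p\<^sub>1 (Suc k) \<cdot> dif M k = \<boxminus> (dif X (Suc k) \<cdot> p\<^sub>1 k)"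
    "\<And>k. 1 \<le> k \<Longrightarrow> k < n \<Longrightarrow> p\<^sub>2 (Suc k) \<cdot> dif M k = f (Suc k) \<cdot> p\<^sub>1 k \<boxplus> dif Y k \<cdot> p\<^sub>2 k"
    "dif M n = f (Suc n) \<cdot> p\<^sub>1 n \<boxplus> dif Y n \<cdot> p\<^sub>2 n"
    "\<And>k. 1 \<le> k \<Longrightarrow> k \<le> n \<Longrightarrow> i\<^sub>1 k \<proportion> obj X (Suc k) \<rightarrow> obj M k"
    "\<And>k. 1 \<le> k \<Longrightarrow> k \<le> n \<Longrightarrow> i\<^sub>2 k \<proportion> obj Y k \<rightarrow> obj M k"
    "\<And>k. 1 \<le> k \<Longrightarrow> k \<le> n \<Longrightarrow> p\<^sub>1 k \<proportion> obj M k \<rightarrow> obj X (Suc k)"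
    "\<And>k. 1 \<le> k \<Longrightarrow> k \<le> n \<Longrightarrow> p\<^sub>2 k \<proportion> obj M k \<rightarrow> obj Y k"
    "\<And>k. 1 \<le> k \<Longrightarrow> k \<le> n \<Longrightarrow> p\<^sub>1 k \<cdot> i\<^sub>1 k = Id \<C> (obj X (Suc k))"
    "\<And>k. 1 \<le> k \<Longrightarrow> k \<le> n \<Longrightarrow> p\<^sub>2 k \<cdot> i\<^sub>2 k = Id \<C> (obj Y k)"
    "\<And>k. 1 \<le> k \<Longrightarrow> k \<le> n \<Longrightarrow> p\<^sub>1 k \<cdot> i\<^sub>2 k = zero (obj Y k) (obj X (Suc k))"
    "\<And>k. 1 \<le> k \<Longrightarrow> k \<le> n \<Longrightarrow> p\<^sub>2 k \<cdot> i\<^sub>1 k = zero (obj X (Suc k)) (obj Y k)"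
proof -
  show "obj M 0 = obj X 1" "obj M (Suc n) = obj Y (Suc n)"
    "\<And>k. k \<le> n \<Longrightarrow> dif M k \<proportion> obj M k \<rightarrow> obj M (Suc k)"
    "p\<^sub>1 1 \<cdot> dif M 0 = \<boxminus> dif X 1" "p\<^sub>2 1 \<cdot> dif M 0 = f 1"
    "\<And>k. 1 \<le> k \<Longrightarrow> k < n \<Longrightarrow> p\<^sub>1 (Suc k) \<cdot> dif M k = \<boxminus> (dif X (Suc k) \<cdot> p\<^sub>1 k)"
    "\<And>k. 1 \<le> k \<Longrightarrow> k < n \<Longrightarrow> p\<^sub>2 (Suc k) \<cdot> dif M k = f (Suc k) \<cdot> p\<^sub>1 k \<boxplus> dif Y k \<cdot> p\<^sub>2 k"
    "dif M n = f (Suc n) \<cdot> p\<^sub>1 n \<boxplus> dif Y n \<cdot> p\<^sub>2 n"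
    and B: "\<And>k. 1 \<le> k \<Longrightarrow> k \<le> n \<Longrightarrow> biproduct \<C> (obj X (Suc k)) (obj Y k) (obj M k) (i\<^sub>1 k) (i\<^sub>2 k) (p\<^sub>1 k) (p\<^sub>2 k)"
    using r by (auto simp: cone_rows_def)
  fix k assume k: "1 \<le> k" "k \<le> n"
  have Ob: "obj X (Suc k) \<in> Ob \<C>" "obj Y k \<in> Ob \<C>" using complex_Ob[OF X] complex_Ob[OF Y] k by auto
  show "i\<^sub>1 k \<proportion> obj X (Suc k) \<rightarrow> obj M k" "i\<^sub>2 k \<proportion> obj Y k \<rightarrow> obj M k" "p\<^sub>1 k \<proportion> obj M k \<rightarrow> obj X (Suc k)"
    "p\<^sub>2 k \<proportion> obj M k \<rightarrow> obj Y k" "p\<^sub>1 k \<cdot> i\<^sub>1 k = Id \<C> (obj X (Suc k))" "p\<^sub>2 k \<cdot> i\<^sub>2 k = Id \<C> (obj Y k)"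
    "p\<^sub>1 k \<cdot> i\<^sub>2 k = zero (obj Y k) (obj X (Suc k))" "p\<^sub>2 k \<cdot> i\<^sub>1 k = zero (obj X (Suc k)) (obj Y k)"
    using biproductD[OF B[OF k] Ob] by auto
qed

lemma cone_into_eqI:
  assumes n: "n \<ge> 1" and X: "cochain_complex n \<C> X" and Y: "cochain_complex n \<C> Y"
    and f: "chain_map n \<C> X Y f" and r: "cone_rows n X Y f M i\<^sub>1 i\<^sub>2 p\<^sub>1 p\<^sub>2"
    and k: "1 \<le> k" "k \<le> n" and u: "u \<proportion> W \<rightarrow> obj M k" "v \<proportion> W \<rightarrow> obj M k"
    and eq: "p\<^sub>1 k \<cdot> u = p\<^sub>1 k \<cdot> v" "p\<^sub>2 k \<cdot> u = p\<^sub>2 k \<cdot> v"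
  shows "u = v"
  using biproduct_into_eqI[OF cone_rowsD(4)[OF n X Y f r k] _ _ u eq] complex_Ob[OF X, of "Suc k"]
    complex_Ob[OF Y, of k] k
  by simp

lemma cone_complex:
  assumes n: "n \<ge> 1" and X: "cochain_complex n \<C> X" and Y: "cochain_complex n \<C> Y"
    and f: "chain_map n \<C> X Y f" and r: "cone_rows n X Y f M i\<^sub>1 i\<^sub>2 p\<^sub>1 p\<^sub>2"
  shows "cochain_complex n \<C> M"
proof -
  note R = cone_rowsD[OF n X Y f r]
  have "obj M k \<in> Ob \<C>" if "k \<le> Suc n" for k
    using that
  proof (cases "k = Suc n")
    case True then show ?thesis using R(3)[of n] by (simp add: maps_def)
  next
    case False then show ?thesis using that R(3)[of k] by (simp add: maps_def)
  qed
  moreover have "dif M (Suc k) \<cdot> dif M k = zero (obj M k) (obj M (Suc (Suc k)))" if k: "k < n" for k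
  proof -
    have D: "dif M k \<proportion> obj M k \<rightarrow> obj M (Suc k)" "dif M (Suc k) \<proportion> obj M (Suc k) \<rightarrow> obj M (Suc (Suc k))"
      using R(3) k by auto
    have dX: "dif X (Suc k) \<proportion> obj X (Suc k) \<rightarrow> obj X (Suc (Suc k))"
      and dY: "dif Y (Suc k) \<proportion> obj Y (Suc k) \<rightarrow> obj Y (Suc (Suc k))"
      "dif Y k \<proportion> obj Y k \<rightarrow> obj Y (Suc k)"
      and fk: "f (Suc k) \<proportion> obj X (Suc k) \<rightarrow> obj Y (Suc k)"
        "f (Suc (Suc k)) \<proportion> obj X (Suc (Suc k)) \<rightarrow> obj Y (Suc (Suc k))"
      using complex_dif[OF X, of "Suc k"] complex_dif[OF Y, of "Suc k"] complex_dif[OF Y, of k]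
        chain_map_maps[OF X Y f] k by simp_all
    have dd: "dif Y (Suc k) \<cdot> dif Y k = zero (obj Y k) (obj Y (Suc (Suc k)))" using complex_dif_dif[OF Y k] .
    have fd: "f (Suc (Suc k)) \<cdot> dif X (Suc k) = dif Y (Suc k) \<cdot> f (Suc k)"
      using chain_map_commute[OF X Y f, of "Suc k"] k by simp
    have p': "p\<^sub>1 (Suc k) \<proportion> obj M (Suc k) \<rightarrow> obj X (Suc (Suc k))" "p\<^sub>2 (Suc k) \<proportion> obj M (Suc k) \<rightarrow> obj Y (Suc k)"
      using R(12,13)[of "Suc k"] k by auto
    \<comment> \<open>The two components of the differential, applied to an arbitrary component of the source.\<close>
    have "\<exists>x y. x \<proportion> obj M k \<rightarrow> obj X (Suc k) \<and> y \<proportion> obj M k \<rightarrow> obj Y (Suc k) \<and>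
        dif Y (Suc k) \<cdot> y = zero (obj M k) (obj Y (Suc (Suc k))) \<and>
        p\<^sub>1 (Suc k) \<cdot> dif M k = \<boxminus> (dif X (Suc k) \<cdot> x) \<and> p\<^sub>2 (Suc k) \<cdot> dif M k = f (Suc k) \<cdot> x \<boxplus> y"
    proof (cases k)
      case 0
      have "Id \<C> (obj X 1) \<proportion> obj M k \<rightarrow> obj X (Suc k)" "zero (obj X 1) (obj Y 1) \<proportion> obj M k \<rightarrow> obj Y (Suc k)"
        using 0 R(1) fk by (simp_all add: maps_unfold)
      moreover have "dif Y (Suc k) \<cdot> zero (obj X 1) (obj Y 1) = zero (obj M k) (obj Y (Suc (Suc k)))"
        using 0 R(1) fk dY by (simp add: maps_unfold)
      moreover have "p\<^sub>1 (Suc k) \<cdot> dif M k = \<boxminus> (dif X (Suc k) \<cdot> Id \<C> (obj X 1))"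
        "p\<^sub>2 (Suc k) \<cdot> dif M k = f (Suc k) \<cdot> Id \<C> (obj X 1) \<boxplus> zero (obj X 1) (obj Y 1)"
        using 0 R(5,6) fk dX by (simp_all add: maps_unfold)
      ultimately show ?thesis by blast
    next
      case (Suc j)
      then have k1: "1 \<le> k" "k \<le> n" using k by auto
      have p: "p\<^sub>1 k \<proportion> obj M k \<rightarrow> obj X (Suc k)" "p\<^sub>2 k \<proportion> obj M k \<rightarrow> obj Y k" using R(12,13)[OF k1] by auto
      have "dif Y (Suc k) \<cdot> dif Y k \<cdot> p\<^sub>2 k = zero (obj M k) (obj Y (Suc (Suc k)))"
        using comp_rewrite[OF dd] p dY by algebra
      moreover have "dif Y k \<cdot> p\<^sub>2 k \<proportion> obj M k \<rightarrow> obj Y (Suc k)" using p dY by algebra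
      ultimately show ?thesis using R(7,8)[OF k1(1) k] p by blast
    qed
    then obtain x y where xy: "x \<proportion> obj M k \<rightarrow> obj X (Suc k)" "y \<proportion> obj M k \<rightarrow> obj Y (Suc k)"
      and dy: "dif Y (Suc k) \<cdot> y = zero (obj M k) (obj Y (Suc (Suc k)))"
      and p1: "p\<^sub>1 (Suc k) \<cdot> dif M k = \<boxminus> (dif X (Suc k) \<cdot> x)"
      and p2: "p\<^sub>2 (Suc k) \<cdot> dif M k = f (Suc k) \<cdot> x \<boxplus> y" by blast
    have second: "f (Suc (Suc k)) \<cdot> (\<boxminus> (dif X (Suc k) \<cdot> x)) \<boxplus> dif Y (Suc k) \<cdot> (f (Suc k) \<cdot> x \<boxplus> y) =
        zero (obj M k) (obj Y (Suc (Suc k)))"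
      using comp_rewrite[OF fd] xy dy dX dY fk by algebra
    show ?thesis
    proof (cases "Suc k = n")
      case True
      have "dif M (Suc k) \<cdot> dif M k = f (Suc (Suc k)) \<cdot> (p\<^sub>1 (Suc k) \<cdot> dif M k) \<boxplus> dif Y (Suc k) \<cdot> (p\<^sub>2 (Suc k) \<cdot> dif M
        k)"
        using R(9) True p' fk dY D(1) by (simp add: maps_unfold add_comp assoc)
      then show ?thesis unfolding p1 p2 second using True R(2) by simp
    next
      case False
      then have k2: "1 \<le> Suc k" "Suc k < n" "1 \<le> Suc (Suc k)" "Suc (Suc k) \<le> n" using k by auto
      have q: "p\<^sub>1 (Suc (Suc k)) \<proportion> obj M (Suc (Suc k)) \<rightarrow> obj X (Suc (Suc (Suc k)))"
        "p\<^sub>2 (Suc (Suc k)) \<proportion> obj M (Suc (Suc k)) \<rightarrow> obj Y (Suc (Suc k))"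
        using R(12,13)[OF k2(3,4)] by auto
      have dX2: "dif X (Suc (Suc k)) \<proportion> obj X (Suc (Suc k)) \<rightarrow> obj X (Suc (Suc (Suc k)))"
        using complex_dif[OF X, of "Suc (Suc k)"] k2 by simp
      have ddX: "dif X (Suc (Suc k)) \<cdot> dif X (Suc k) = zero (obj X (Suc k)) (obj X (Suc (Suc (Suc k))))"
        using complex_dif_dif[OF X, of "Suc k"] k2 by simp
      have z: "zero (obj M k) (obj M (Suc (Suc k))) \<proportion> obj M k \<rightarrow> obj M (Suc (Suc k))" using D by algebra
      have "p\<^sub>1 (Suc (Suc k)) \<cdot> dif M (Suc k) \<cdot> dif M k = \<boxminus> (dif X (Suc (Suc k)) \<cdot> (p\<^sub>1 (Suc k) \<cdot> dif M k))"
        using comp_rewrite[OF R(7)[OF k2(1,2)]] q p' dX2 D by algebra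
      also have "\<dots> = p\<^sub>1 (Suc (Suc k)) \<cdot> zero (obj M k) (obj M (Suc (Suc k)))"
        unfolding p1 using comp_rewrite[OF ddX] q D xy dX dX2 by algebra
      finally have 1: "p\<^sub>1 (Suc (Suc k)) \<cdot> dif M (Suc k) \<cdot> dif M k = p\<^sub>1 (Suc (Suc k)) \<cdot> zero (obj M k) (obj M (Suc
        (Suc k)))" .
      have "p\<^sub>2 (Suc (Suc k)) \<cdot> dif M (Suc k) \<cdot> dif M k =
          f (Suc (Suc k)) \<cdot> (p\<^sub>1 (Suc k) \<cdot> dif M k) \<boxplus> dif Y (Suc k) \<cdot> (p\<^sub>2 (Suc k) \<cdot> dif M k)"
        using comp_rewrite[OF R(8)[OF k2(1,2)]] q p' fk dY D by algebra
      also have "\<dots> = p\<^sub>2 (Suc (Suc k)) \<cdot> zero (obj M k) (obj M (Suc (Suc k)))"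
        unfolding p1 p2 second using q D by algebra
      finally have 2: "p\<^sub>2 (Suc (Suc k)) \<cdot> dif M (Suc k) \<cdot> dif M k = p\<^sub>2 (Suc (Suc k)) \<cdot> zero (obj M k) (obj M (Suc
        (Suc k)))" .
      show ?thesis
        by (rule cone_into_eqI[OF n X Y f r k2(3,4) maps_comp[OF D] z 1 2])
    qed
  qed
  ultimately show ?thesis using R(3) by (simp add: cochain_complex_iff)
qed

lemma cone_exists:
  assumes n: "n \<ge> 1" and X: "cochain_complex n \<C> X" and Y: "cochain_complex n \<C> Y"
    and f: "chain_map n \<C> X Y f"
  shows "\<exists>M i\<^sub>1 i\<^sub>2 p\<^sub>1 p\<^sub>2. cone_rows n X Y f M i\<^sub>1 i\<^sub>2 p\<^sub>1 p\<^sub>2"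
proof -
  have "\<exists>b. biproduct \<C> (obj X (Suc k)) (obj Y k) (fst b) (fst (snd b)) (fst (snd (snd b)))
      (fst (snd (snd (snd b)))) (snd (snd (snd (snd b))))" if "k \<le> n" for k
    using biproduct_exists[of "obj X (Suc k)" "obj Y k"] complex_Ob[OF X, of "Suc k"] complex_Ob[OF Y, of k] that
    by (metis Suc_le_mono fst_conv le_SucI snd_conv)
  then obtain b where b: "\<And>k. k \<le> n \<Longrightarrow> biproduct \<C> (obj X (Suc k)) (obj Y k) (fst (b k)) (fst (snd (b k))) (fst (snd
    (snd (b k))))
      (fst (snd (snd (snd (b k))))) (snd (snd (snd (snd (b k)))))"
    by metis
  define S i\<^sub>1 i\<^sub>2 p\<^sub>1 p\<^sub>2 where "S k = fst (b k)" and "i\<^sub>1 k = fst (snd (b k))" and "i\<^sub>2 k = fst (snd (snd (b k)))"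
    and "p\<^sub>1 k = fst (snd (snd (snd (b k))))" and "p\<^sub>2 k = snd (snd (snd (snd (b k))))" for k
  have bip: "biproduct \<C> (obj X (Suc k)) (obj Y k) (S k) (i\<^sub>1 k) (i\<^sub>2 k) (p\<^sub>1 k) (p\<^sub>2 k)"
    "obj X (Suc k) \<in> Ob \<C>" "obj Y k \<in> Ob \<C>" if "k \<le> n" for k
    using b[OF that] complex_Ob[OF X, of "Suc k"] complex_Ob[OF Y, of k] that
    unfolding S_def i\<^sub>1_def i\<^sub>2_def p\<^sub>1_def p\<^sub>2_def by simp_all
  define M where "M = \<lparr>obj = (\<lambda>k. if k = 0 then obj X 1 else if k = Suc n then obj Y (Suc n) else S k),
    dif = (\<lambda>k. if k = 0 then i\<^sub>1 1 \<cdot> (\<boxminus> dif X 1) \<boxplus> i\<^sub>2 1 \<cdot> f 1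
       else if k = n then f (Suc n) \<cdot> p\<^sub>1 n \<boxplus> dif Y n \<cdot> p\<^sub>2 n
       else i\<^sub>1 (Suc k) \<cdot> (\<boxminus> (dif X (Suc k) \<cdot> p\<^sub>1 k)) \<boxplus> i\<^sub>2 (Suc k) \<cdot> (f (Suc k) \<cdot> p\<^sub>1 k \<boxplus> dif Y k \<cdot> p\<^sub>2 k))\<rparr>"
  have pair: "i\<^sub>1 k \<cdot> x \<boxplus> i\<^sub>2 k \<cdot> y \<proportion> W \<rightarrow> S k" "p\<^sub>1 k \<cdot> (i\<^sub>1 k \<cdot> x \<boxplus> i\<^sub>2 k \<cdot> y) = x"
    "p\<^sub>2 k \<cdot> (i\<^sub>1 k \<cdot> x \<boxplus> i\<^sub>2 k \<cdot> y) = y"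
    if "k \<le> n" "x \<proportion> W \<rightarrow> obj X (Suc k)" "y \<proportion> W \<rightarrow> obj Y k" for k x y W
  proof -
    note B = biproductD[OF bip[OF that(1)]]
    show "i\<^sub>1 k \<cdot> x \<boxplus> i\<^sub>2 k \<cdot> y \<proportion> W \<rightarrow> S k" using B(1,2) that by algebra
    show "p\<^sub>1 k \<cdot> (i\<^sub>1 k \<cdot> x \<boxplus> i\<^sub>2 k \<cdot> y) = x" "p\<^sub>2 k \<cdot> (i\<^sub>1 k \<cdot> x \<boxplus> i\<^sub>2 k \<cdot> y) = y"
      using comp_rewrite[OF B(5)] comp_rewrite[OF B(6)] comp_rewrite[OF B(7)] comp_rewrite[OF B(8)] B(1-4) that
      by (algebra, algebra)
  qed
  have first: "i\<^sub>1 1 \<cdot> (\<boxminus> dif X 1) \<boxplus> i\<^sub>2 1 \<cdot> f 1 \<proportion> obj X 1 \<rightarrow> S 1"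
      "p\<^sub>1 1 \<cdot> (i\<^sub>1 1 \<cdot> (\<boxminus> dif X 1) \<boxplus> i\<^sub>2 1 \<cdot> f 1) = \<boxminus> dif X 1" "p\<^sub>2 1 \<cdot> (i\<^sub>1 1 \<cdot> (\<boxminus> dif X 1) \<boxplus> i\<^sub>2 1 \<cdot> f 1) = f 1"
    using pair[of 1 "\<boxminus> dif X 1" "obj X 1" "f 1"] n complex_dif[OF X, of 1] chain_map_maps[OF X Y f, of 1] maps_neg
    by simp_all
  have mid: "i\<^sub>1 (Suc k) \<cdot> (\<boxminus> (dif X (Suc k) \<cdot> p\<^sub>1 k)) \<boxplus> i\<^sub>2 (Suc k) \<cdot> (f (Suc k) \<cdot> p\<^sub>1 k \<boxplus> dif Y k \<cdot> p\<^sub>2 k) \<proportion> S k \<rightarrow> S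
    (Suc k)"
      "p\<^sub>1 (Suc k) \<cdot> (i\<^sub>1 (Suc k) \<cdot> (\<boxminus> (dif X (Suc k) \<cdot> p\<^sub>1 k)) \<boxplus> i\<^sub>2 (Suc k) \<cdot> (f (Suc k) \<cdot> p\<^sub>1 k \<boxplus> dif Y k \<cdot> p\<^sub>2 k))
        = \<boxminus> (dif X (Suc k) \<cdot> p\<^sub>1 k)"
      "p\<^sub>2 (Suc k) \<cdot> (i\<^sub>1 (Suc k) \<cdot> (\<boxminus> (dif X (Suc k) \<cdot> p\<^sub>1 k)) \<boxplus> i\<^sub>2 (Suc k) \<cdot> (f (Suc k) \<cdot> p\<^sub>1 k \<boxplus> dif Y k \<cdot> p\<^sub>2 k))
        = f (Suc k) \<cdot> p\<^sub>1 k \<boxplus> dif Y k \<cdot> p\<^sub>2 k"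
    if k: "k < n" for k
  proof -
    note B = biproductD[OF bip[OF less_imp_le[OF k]]]
    have "\<boxminus> (dif X (Suc k) \<cdot> p\<^sub>1 k) \<proportion> S k \<rightarrow> obj X (Suc (Suc k))"
      using complex_dif[OF X Suc_leI[OF k]] B(3) by algebra
    moreover have "f (Suc k) \<cdot> p\<^sub>1 k \<boxplus> dif Y k \<cdot> p\<^sub>2 k \<proportion> S k \<rightarrow> obj Y (Suc k)"
      using complex_dif[OF Y less_imp_le[OF k]] chain_map_maps[OF X Y f, of "Suc k", simplified, OF less_imp_le[OF k]]
        B(3,4) by algebra
    ultimately show "i\<^sub>1 (Suc k) \<cdot> (\<boxminus> (dif X (Suc k) \<cdot> p\<^sub>1 k)) \<boxplus> i\<^sub>2 (Suc k) \<cdot> (f (Suc k) \<cdot> p\<^sub>1 k \<boxplus> dif Y k \<cdot> p\<^sub>2 k) \<proportion>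
      S k \<rightarrow> S (Suc k)"
      "p\<^sub>1 (Suc k) \<cdot> (i\<^sub>1 (Suc k) \<cdot> (\<boxminus> (dif X (Suc k) \<cdot> p\<^sub>1 k)) \<boxplus> i\<^sub>2 (Suc k) \<cdot> (f (Suc k) \<cdot> p\<^sub>1 k \<boxplus> dif Y k \<cdot> p\<^sub>2 k))
        = \<boxminus> (dif X (Suc k) \<cdot> p\<^sub>1 k)"
      "p\<^sub>2 (Suc k) \<cdot> (i\<^sub>1 (Suc k) \<cdot> (\<boxminus> (dif X (Suc k) \<cdot> p\<^sub>1 k)) \<boxplus> i\<^sub>2 (Suc k) \<cdot> (f (Suc k) \<cdot> p\<^sub>1 k \<boxplus> dif Y k \<cdot> p\<^sub>2 k))
        = f (Suc k) \<cdot> p\<^sub>1 k \<boxplus> dif Y k \<cdot> p\<^sub>2 k"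
      using pair[of "Suc k"] Suc_leI[OF k] by blast+
  qed
  note Bn = biproductD[OF bip[OF order_refl]]
  have last: "f (Suc n) \<cdot> p\<^sub>1 n \<boxplus> dif Y n \<cdot> p\<^sub>2 n \<proportion> S n \<rightarrow> obj Y (Suc n)"
    using complex_dif[OF Y order_refl] chain_map_maps[OF X Y f order_refl] Bn(3,4) by algebra
  have "cone_rows n X Y f M i\<^sub>1 i\<^sub>2 p\<^sub>1 p\<^sub>2"
    unfolding cone_rows_def M_def using n first mid last bip(1)
    by (auto simp: Suc_le_eq)
  then show ?thesis by blast
qed

end

context additive_category
begin

lemma chain_map_boundary:
  assumes X: "cochain_complex n \<C> X" and Y: "cochain_complex n \<C> Y" and k: "lowering n X Y k"
  shows "chain_map n \<C> X Y (boundary n X Y k)"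
  unfolding chain_map_iff[OF X Y]
proof (intro conjI allI impI)
  fix i assume "i \<le> Suc n"
  then show "boundary n X Y k i \<proportion> obj X i \<rightarrow> obj Y i" by (rule boundary_maps[OF X Y k])
next
  fix i assume i: "i \<le> n"
  have d: "dif X i \<proportion> obj X i \<rightarrow> obj X (Suc i)" "dif Y i \<proportion> obj Y i \<rightarrow> obj Y (Suc i)"
    using complex_dif[OF X] complex_dif[OF Y] i by auto
  have ki: "k i \<proportion> obj X (Suc i) \<rightarrow> obj Y i" using k i by (simp add: lowering_def)
  have "boundary n X Y k (Suc i) \<cdot> dif X i = dif Y i \<cdot> k i \<cdot> dif X i"
  proof (cases "i = n")
    case True
    then show ?thesis using d ki by (simp add: boundary_simps maps_unfold assoc)
  next
    case False
    then have lt: "i < n" using i by simp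
    have "k (Suc i) \<proportion> obj X (Suc (Suc i)) \<rightarrow> obj Y (Suc i)" "dif X (Suc i) \<proportion> obj X (Suc i) \<rightarrow> obj X (Suc (Suc i))"
      using k lt complex_dif[OF X, of "Suc i"] by (auto simp: lowering_def)
    then show ?thesis unfolding boundary_simps(3)[OF lt] using d ki complex_dif_dif[OF X lt] by algebra
  qed
  moreover have "dif Y i \<cdot> boundary n X Y k i = dif Y i \<cdot> k i \<cdot> dif X i"
  proof (cases i)
    case 0
    then show ?thesis by (simp add: boundary_simps)
  next
    case (Suc j)
    then have lt: "j < n" using i by simp
    have "k j \<proportion> obj X (Suc j) \<rightarrow> obj Y j" "dif Y j \<proportion> obj Y j \<rightarrow> obj Y (Suc j)"
      using k lt complex_dif[OF Y, of j] by (auto simp: lowering_def)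
    then show ?thesis unfolding Suc boundary_simps(3)[OF lt]
      using d[unfolded Suc] ki[unfolded Suc] comp_rewrite[OF complex_dif_dif[OF Y lt]] by algebra
  qed
  ultimately show "boundary n X Y k (Suc i) \<cdot> dif X i = dif Y i \<cdot> boundary n X Y k i" by simp
qed

text \<open>
  Adding the boundary of a homotopy that is concentrated in one extreme degree changes the chain map
  at that end and not at the other one.
\<close>

lemma adjust_bottom:
  assumes n: "n \<ge> 1" and X: "cochain_complex n \<C> X" and Y: "cochain_complex n \<C> Y"
    and f: "chain_map n \<C> X Y f" and r: "r \<proportion> obj X 1 \<rightarrow> obj Y 0"
  obtains g where "chain_map n \<C> X Y g" "g 0 = f 0 \<boxplus> r \<cdot> dif X 0" "g (Suc n) = f (Suc n)"
proof -
  let ?k = "\<lambda>i. if i = 0 then r else zero (obj X (Suc i)) (obj Y i)"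
  let ?g = "\<lambda>i. f i \<boxplus> boundary n X Y ?k i"
  have k: "lowering n X Y ?k"
    using r lowering_zero[OF X Y] by (simp add: lowering_def)
  have "chain_map n \<C> X Y ?g" by (rule chain_map_add[OF X Y f chain_map_boundary[OF X Y k]])
  moreover have "?g 0 = f 0 \<boxplus> r \<cdot> dif X 0" by (simp add: boundary_simps)
  moreover have "?g (Suc n) = f (Suc n)"
    using n chain_map_maps[OF X Y f, of "Suc n"] complex_dif[OF Y, of n] complex_Ob[OF X, of "Suc n"]
    by (simp add: boundary_simps maps_unfold)
  ultimately show thesis by (rule that)
qed

lemma adjust_top:
  assumes n: "n \<ge> 1" and X: "cochain_complex n \<C> X" and Y: "cochain_complex n \<C> Y"
    and f: "chain_map n \<C> X Y f" and r: "r \<proportion> obj X (Suc n) \<rightarrow> obj Y n"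
  obtains g where "chain_map n \<C> X Y g" "g 0 = f 0" "g (Suc n) = f (Suc n) \<boxplus> dif Y n \<cdot> r"
proof -
  let ?k = "\<lambda>i. if i = n then r else zero (obj X (Suc i)) (obj Y i)"
  let ?g = "\<lambda>i. f i \<boxplus> boundary n X Y ?k i"
  have k: "lowering n X Y ?k"
    using r lowering_zero[OF X Y] by (simp add: lowering_def)
  have "chain_map n \<C> X Y ?g" by (rule chain_map_add[OF X Y f chain_map_boundary[OF X Y k]])
  moreover have "?g 0 = f 0"
    using n chain_map_maps[OF X Y f, of 0] complex_dif[OF X, of 0] complex_Ob[OF Y, of 0]
    by (simp add: boundary_simps maps_unfold)
  moreover have "?g (Suc n) = f (Suc n) \<boxplus> dif Y n \<cdot> r" by (simp add: boundary_simps)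
  ultimately show thesis by (rule that)
qed

text \<open>
  A homotopy \<open>s\<close> between the two ways around a square of chain maps induces a map between the cones of its
  horizontal sides, with matrix \<open>(\<phi>, 0; s, \<psi>)\<close>. As the cone starts in degree \<open>1\<close> of \<open>X\<close>, the component \<open>s\<^sub>0\<close>
  has no place in this matrix and enters the lowest map as the correction \<open>d s\<^sub>0\<close>.
\<close>

lemma cone_comparison:
  assumes n: "n \<ge> 1"
    and X1': "X1 \<in> complexes_between n \<C> A C" and X2': "X2 \<in> complexes_between n \<C> A C"
    and Y1': "Y1 \<in> complexes_between n \<C> A D" and Y2': "Y2 \<in> complexes_between n \<C> A D"
    and f1: "lift n \<C> X1 Y1 (Id \<C> A) c f1" and f2: "lift n \<C> X2 Y2 (Id \<C> A) c f2"
    and \<phi>: "lift n \<C> X1 X2 (Id \<C> A) (Id \<C> C) \<phi>" and \<psi>: "lift n \<C> Y1 Y2 (Id \<C> A) (Id \<C> D) \<psi>"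
    and h: "homotopic n \<C> X1 Y2 (\<lambda>i. f2 i \<cdot> \<phi> i) (\<lambda>i. \<psi> i \<cdot> f1 i)"
    and M1: "cone_rows n X1 Y1 f1 M1 i1 i2 p1 p2" and M2: "cone_rows n X2 Y2 f2 M2 j1 j2 q1 q2"
  obtains t where "chain_map n \<C> M1 M2 t" "t (Suc n) = Id \<C> D" "t 0 \<cdot> dif X1 0 = dif X2 0"
proof -
  note X1 = complexes_betweenD[OF X1'] and X2 = complexes_betweenD[OF X2']
    and Y1 = complexes_betweenD[OF Y1'] and Y2 = complexes_betweenD[OF Y2']
  have f1c: "chain_map n \<C> X1 Y1 f1" and f2c: "chain_map n \<C> X2 Y2 f2"
    and \<phi>c: "chain_map n \<C> X1 X2 \<phi>" and \<psi>c: "chain_map n \<C> Y1 Y2 \<psi>"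
    and ends: "f1 0 = Id \<C> A" "f2 0 = Id \<C> A" "\<phi> 0 = Id \<C> A" "\<psi> 0 = Id \<C> A" "f1 (Suc n) = c" "f2 (Suc n) = c"
      "\<phi> (Suc n) = Id \<C> C" "\<psi> (Suc n) = Id \<C> D"
    using f1 f2 \<phi> \<psi> by (auto simp: lift_def)
  note R1 = cone_rowsD[OF n X1(1) Y1(1) f1c M1] and R2 = cone_rowsD[OF n X2(1) Y2(1) f2c M2]
  have M1c: "cochain_complex n \<C> M1" by (rule cone_complex[OF n X1(1) Y1(1) f1c M1])
  have M2c: "cochain_complex n \<C> M2" by (rule cone_complex[OF n X2(1) Y2(1) f2c M2])
  have c: "c \<proportion> C \<rightarrow> D" using chain_map_maps[OF X1(1) Y1(1) f1c, of "Suc n"] ends X1 Y1 by simp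
  obtain s where s: "lowering n X1 Y2 s"
    and heq: "\<And>i. i \<le> Suc n \<Longrightarrow> \<psi> i \<cdot> f1 i = f2 i \<cdot> \<phi> i \<boxplus> boundary n X1 Y2 s i"
    using h unfolding homotopic_chain_map_iff[OF X1(1) Y2(1) chain_map_comp[OF X1(1) X2(1) Y2(1) \<phi>c f2c]] by blast
  have sm: "s i \<proportion> obj X1 (Suc i) \<rightarrow> obj Y2 i" if "i \<le> n" for i using s that by (simp add: lowering_def)
  have d0: "dif X1 0 \<proportion> A \<rightarrow> obj X1 1" "dif X2 0 \<proportion> A \<rightarrow> obj X2 1" "dif Y2 0 \<proportion> A \<rightarrow> obj Y2 1"
    using complex_dif[OF X1(1), of 0] complex_dif[OF X2(1), of 0] complex_dif[OF Y2(1), of 0] X1 X2 Y2 by simp_all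
  have s0: "s 0 \<proportion> obj X1 1 \<rightarrow> A" using sm[of 0] Y2 by simp
  have sn: "s n \<proportion> C \<rightarrow> obj Y2 n" using sm[of n] X1 by simp
  have dYn: "dif Y2 n \<proportion> obj Y2 n \<rightarrow> D" "dif Y1 n \<proportion> obj Y1 n \<rightarrow> D"
    using complex_dif[OF Y2(1), of n] complex_dif[OF Y1(1), of n] Y2 Y1 by simp_all
  \<comment> \<open>The homotopy is between maps that agree in the extreme degrees.\<close>
  have s0d: "s 0 \<cdot> dif X1 0 = zero A A"
  proof -
    have sd: "s 0 \<cdot> dif X1 0 \<proportion> A \<rightarrow> A" using s0 d0 maps_comp by blast
    have I: "Id \<C> A \<proportion> A \<rightarrow> A" using X1(4) by (rule maps_Id)
    have "Id \<C> A \<boxplus> s 0 \<cdot> dif X1 0 = Id \<C> A \<boxplus> zero A A"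
      using heq[of 0] ends X1(4) by (simp add: boundary_simps)
    then show ?thesis using add_cancel[of "Id \<C> A" "s 0 \<cdot> dif X1 0" "zero A A"] sd I by (simp add: maps_unfold)
  qed
  have dsn: "dif Y2 n \<cdot> s n = zero C D"
  proof -
    have sd: "dif Y2 n \<cdot> s n \<proportion> C \<rightarrow> D" using sn dYn maps_comp by blast
    have "c \<boxplus> dif Y2 n \<cdot> s n = c \<boxplus> zero C D"
      using heq[of "Suc n"] ends c by (simp add: boundary_simps maps_unfold)
    then show ?thesis using add_cancel[of c "dif Y2 n \<cdot> s n" "zero C D"] sd c by (simp add: maps_unfold)
  qed
  let ?mid = "\<lambda>k. j1 k \<cdot> \<phi> (Suc k) \<cdot> p1 k \<boxplus> j2 k \<cdot> (s k \<cdot> p1 k \<boxplus> \<psi> k \<cdot> p2 k)"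
  define t where "t k = (if k = 0 then \<phi> 1 \<boxplus> dif X2 0 \<cdot> s 0 else if k = Suc n then Id \<C> D else ?mid k)" for k
  have t0: "t 0 = \<phi> 1 \<boxplus> dif X2 0 \<cdot> s 0" and tn: "t (Suc n) = Id \<C> D" by (simp_all add: t_def)
  have \<phi>m: "\<phi> k \<proportion> obj X1 k \<rightarrow> obj X2 k" and \<psi>m: "\<psi> k \<proportion> obj Y1 k \<rightarrow> obj Y2 k" if "k \<le> Suc n" for k
    using that chain_map_maps[OF X1(1) X2(1) \<phi>c] chain_map_maps[OF Y1(1) Y2(1) \<psi>c] by auto
  have tmid: "t k \<proportion> obj M1 k \<rightarrow> obj M2 k" "q1 k \<cdot> t k = \<phi> (Suc k) \<cdot> p1 k"
      "q2 k \<cdot> t k = s k \<cdot> p1 k \<boxplus> \<psi> k \<cdot> p2 k" if k: "1 \<le> k" "k \<le> n" for k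
  proof -
    have tk: "t k = ?mid k" using k by (simp add: t_def)
    note m = R1(10-13)[OF k] R2(10-13)[OF k] \<phi>m[of "Suc k", simplified, OF k(2)] \<psi>m[of k, OF le_SucI, OF k(2)]
      sm[OF k(2)]
    note e = comp_rewrite[OF R2(14)[OF k]] comp_rewrite[OF R2(15)[OF k]] comp_rewrite[OF R2(16)[OF k]]
      comp_rewrite[OF R2(17)[OF k]]
    show "t k \<proportion> obj M1 k \<rightarrow> obj M2 k" unfolding tk using m by algebra
    show "q1 k \<cdot> t k = \<phi> (Suc k) \<cdot> p1 k" unfolding tk using m e by algebra
    show "q2 k \<cdot> t k = s k \<cdot> p1 k \<boxplus> \<psi> k \<cdot> p2 k" unfolding tk using m e by algebra
  qed
  have \<phi>1: "\<phi> 1 \<proportion> obj X1 1 \<rightarrow> obj X2 1" using \<phi>m[of 1] n by simp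
  have t0m: "t 0 \<proportion> obj X1 1 \<rightarrow> obj X2 1" unfolding t0 using \<phi>1 s0 d0 by algebra
  have tm: "t k \<proportion> obj M1 k \<rightarrow> obj M2 k" if "k \<le> Suc n" for k
    using that
  proof (cases rule: degree_cases)
    case first then show ?thesis using t0m R1(1) R2(1) by simp
  next
    case (middle j) then show ?thesis using tmid(1) by simp
  next
    case last then show ?thesis using tn R1(2) R2(2) Y1 Y2 maps_Id by simp
  qed
  have "t (Suc k) \<cdot> dif M1 k = dif M2 k \<cdot> t k" if k: "k \<le> n" for k
  proof -
    have D1: "dif M1 k \<proportion> obj M1 k \<rightarrow> obj M1 (Suc k)" and D2: "dif M2 k \<proportion> obj M2 k \<rightarrow> obj M2 (Suc k)"
      using R1(3) R2(3) k by auto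
    have tk: "t k \<proportion> obj M1 k \<rightarrow> obj M2 k" "t (Suc k) \<proportion> obj M1 (Suc k) \<rightarrow> obj M2 (Suc k)"
      using tm k by auto
    show ?thesis
    proof (cases "k = n")
      case True
      have k1: "1 \<le> n" "n \<le> n" using n by auto
      have m: "p1 n \<proportion> obj M1 n \<rightarrow> C" "p2 n \<proportion> obj M1 n \<rightarrow> obj Y1 n" "q1 n \<proportion> obj M2 n \<rightarrow> C" "q2 n \<proportion> obj M2 n \<rightarrow> obj Y2 n"
        "\<psi> n \<proportion> obj Y1 n \<rightarrow> obj Y2 n" "t n \<proportion> obj M1 n \<rightarrow> obj M2 n"
        using R1(12,13)[OF k1] R2(12,13)[OF k1] X1 X2 \<psi>m[of n] tm[of n] by simp_all
      have e: "q1 n \<cdot> t n = p1 n" "q2 n \<cdot> t n = s n \<cdot> p1 n \<boxplus> \<psi> n \<cdot> p2 n"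
        using tmid(2,3)[OF k1] ends m(1) by (simp_all add: maps_unfold)
      have \<psi>d: "dif Y2 n \<cdot> \<psi> n = dif Y1 n"
        using chain_map_commute[OF Y1(1) Y2(1) \<psi>c, of n] ends dYn by (simp add: maps_unfold)
      have "(c \<cdot> q1 n \<boxplus> dif Y2 n \<cdot> q2 n) \<cdot> t n = c \<cdot> p1 n \<boxplus> dif Y1 n \<cdot> p2 n"
        using m c dYn sn e comp_rewrite[OF \<psi>d] comp_rewrite[OF dsn] by algebra
      moreover have "Id \<C> D \<cdot> (c \<cdot> p1 n \<boxplus> dif Y1 n \<cdot> p2 n) = c \<cdot> p1 n \<boxplus> dif Y1 n \<cdot> p2 n"
        using m c dYn by algebra
      ultimately show ?thesis unfolding True tn R1(9) R2(9) ends by simp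
    next
      case False
      then have lt: "k < n" and k': "1 \<le> Suc k" "Suc k \<le> n" using k by auto
      note t' = tmid[OF k']
      note m = R1(10-13)[OF k'] R2(10-13)[OF k']
      have fm: "f1 (Suc k) \<proportion> obj X1 (Suc k) \<rightarrow> obj Y1 (Suc k)" "f2 (Suc k) \<proportion> obj X2 (Suc k) \<rightarrow> obj Y2 (Suc k)"
        using chain_map_maps[OF X1(1) Y1(1) f1c] chain_map_maps[OF X2(1) Y2(1) f2c] k by auto
      have \<phi>\<psi>: "\<phi> (Suc k) \<proportion> obj X1 (Suc k) \<rightarrow> obj X2 (Suc k)"
        "\<phi> (Suc (Suc k)) \<proportion> obj X1 (Suc (Suc k)) \<rightarrow> obj X2 (Suc (Suc k))"
        "\<psi> (Suc k) \<proportion> obj Y1 (Suc k) \<rightarrow> obj Y2 (Suc k)" "\<psi> k \<proportion> obj Y1 k \<rightarrow> obj Y2 k"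
        using \<phi>m \<psi>m lt by auto
      have d: "dif X1 (Suc k) \<proportion> obj X1 (Suc k) \<rightarrow> obj X1 (Suc (Suc k))"
        "dif X2 (Suc k) \<proportion> obj X2 (Suc k) \<rightarrow> obj X2 (Suc (Suc k))"
        "dif Y1 k \<proportion> obj Y1 k \<rightarrow> obj Y1 (Suc k)" "dif Y2 k \<proportion> obj Y2 k \<rightarrow> obj Y2 (Suc k)"
        using complex_dif[OF X1(1)] complex_dif[OF X2(1)] complex_dif[OF Y1(1)] complex_dif[OF Y2(1)] lt by auto
      have ss: "s k \<proportion> obj X1 (Suc k) \<rightarrow> obj Y2 k" "s (Suc k) \<proportion> obj X1 (Suc (Suc k)) \<rightarrow> obj Y2 (Suc k)"
        using sm lt by auto
      have \<phi>d: "\<phi> (Suc (Suc k)) \<cdot> dif X1 (Suc k) = dif X2 (Suc k) \<cdot> \<phi> (Suc k)"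
        using chain_map_commute[OF X1(1) X2(1) \<phi>c, of "Suc k"] lt by simp
      have \<psi>d: "\<psi> (Suc k) \<cdot> dif Y1 k = dif Y2 k \<cdot> \<psi> k"
        using chain_map_commute[OF Y1(1) Y2(1) \<psi>c, of "k"] lt by simp
      have hk: "\<psi> (Suc k) \<cdot> f1 (Suc k) = f2 (Suc k) \<cdot> \<phi> (Suc k) \<boxplus> (dif Y2 k \<cdot> s k \<boxplus> s (Suc k) \<cdot> dif X1 (Suc k))"
        using heq[of "Suc k"] lt by (simp add: boundary_simps)
      have u: "t (Suc k) \<cdot> dif M1 k \<proportion> obj M1 k \<rightarrow> obj M2 (Suc k)" "dif M2 k \<cdot> t k \<proportion> obj M1 k \<rightarrow> obj M2 (Suc k)"
        using maps_comp D1 D2 tk by blast+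
      have l1: "q1 (Suc k) \<cdot> t (Suc k) \<cdot> dif M1 k = \<phi> (Suc (Suc k)) \<cdot> (p1 (Suc k) \<cdot> dif M1 k)"
        using comp_rewrite[OF t'(2)] m tk D1 \<phi>\<psi> by algebra
      have l2: "q2 (Suc k) \<cdot> t (Suc k) \<cdot> dif M1 k =
          s (Suc k) \<cdot> (p1 (Suc k) \<cdot> dif M1 k) \<boxplus> \<psi> (Suc k) \<cdot> (p2 (Suc k) \<cdot> dif M1 k)"
        using comp_rewrite[OF t'(3)] m tk D1 \<phi>\<psi> ss by algebra
      have "q1 (Suc k) \<cdot> t (Suc k) \<cdot> dif M1 k = q1 (Suc k) \<cdot> dif M2 k \<cdot> t k \<and>
          q2 (Suc k) \<cdot> t (Suc k) \<cdot> dif M1 k = q2 (Suc k) \<cdot> dif M2 k \<cdot> t k"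
      proof (cases "k = 0")
        case True
        have dd: "dif X2 1 \<cdot> dif X2 0 = zero A (obj X2 2)" using complex_dif_dif[OF X2(1), of 0] n X2
          by (simp add: numeral_2_eq_2)
        have fd: "f2 1 \<cdot> dif X2 0 = dif Y2 0" using chain_map_commute[OF X2(1) Y2(1) f2c, of 0] ends d0
          by (simp add: maps_unfold)
        have r1: "q1 1 \<cdot> dif M2 0 \<cdot> t 0 = (\<boxminus> dif X2 1) \<cdot> t 0" "q2 1 \<cdot> dif M2 0 \<cdot> t 0 = f2 1 \<cdot> t 0"
          using comp_rewrite[OF R2(5)] comp_rewrite[OF R2(6)] m(7,8) D2 t0m R2(1) True by (simp_all add: maps_unfold)
        have "(\<boxminus> dif X2 1) \<cdot> (\<phi> 1 \<boxplus> dif X2 0 \<cdot> s 0) = \<phi> 2 \<cdot> (\<boxminus> dif X1 1)"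
          using \<phi>d[unfolded True] comp_rewrite[OF dd] \<phi>1 s0 d0 d(1,2)[unfolded True] \<phi>\<psi>(2)[unfolded True]
          unfolding One_nat_def[symmetric] numeral_2_eq_2[symmetric] Suc_1 by algebra
        moreover have "f2 1 \<cdot> (\<phi> 1 \<boxplus> dif X2 0 \<cdot> s 0) = s 1 \<cdot> (\<boxminus> dif X1 1) \<boxplus> \<psi> 1 \<cdot> f1 1"
          using hk[unfolded True] comp_rewrite[OF fd] \<phi>1 s0 d0 d(1,2)[unfolded True] \<phi>\<psi>(2)[unfolded True]
            ss(2)[unfolded True] fm[unfolded True]
          unfolding One_nat_def[symmetric] numeral_2_eq_2[symmetric] Suc_1 by algebra
        ultimately show ?thesis unfolding l1 l2
          unfolding True One_nat_def[symmetric] numeral_2_eq_2[symmetric] Suc_1 r1 R1(5,6) unfolding t0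
          by simp
      next
        case False
        then have k1: "1 \<le> k" "k \<le> n" using k by auto
        note t'' = tmid[OF k1]
        note m' = R1(10-13)[OF k1] R2(10-13)[OF k1]
        have r1: "q1 (Suc k) \<cdot> dif M2 k \<cdot> t k = \<boxminus> (dif X2 (Suc k) \<cdot> (q1 k \<cdot> t k))"
          using comp_rewrite[OF R2(7)[OF k1(1) lt]] m m' D2 tk d by algebra
        have r2: "q2 (Suc k) \<cdot> dif M2 k \<cdot> t k = f2 (Suc k) \<cdot> (q1 k \<cdot> t k) \<boxplus> dif Y2 k \<cdot> (q2 k \<cdot> t k)"
          using comp_rewrite[OF R2(8)[OF k1(1) lt]] m m' D2 tk d fm by algebra
        have 1: "\<phi> (Suc (Suc k)) \<cdot> (\<boxminus> (dif X1 (Suc k) \<cdot> p1 k)) = \<boxminus> (dif X2 (Suc k) \<cdot> (\<phi> (Suc k) \<cdot> p1 k))"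
          using comp_rewrite[OF \<phi>d] d m' \<phi>\<psi> by algebra
        have 2: "s (Suc k) \<cdot> (\<boxminus> (dif X1 (Suc k) \<cdot> p1 k)) \<boxplus> \<psi> (Suc k) \<cdot> (f1 (Suc k) \<cdot> p1 k \<boxplus> dif Y1 k \<cdot> p2 k)
            = f2 (Suc k) \<cdot> (\<phi> (Suc k) \<cdot> p1 k) \<boxplus> dif Y2 k \<cdot> (s k \<cdot> p1 k \<boxplus> \<psi> k \<cdot> p2 k)"
          using comp_rewrite[OF \<psi>d] comp_rewrite[OF hk] d m' \<phi>\<psi> ss fm by algebra
        show ?thesis unfolding l1 l2 r1 r2 R1(7,8)[OF k1(1) lt] t''(2,3) 1 2 by simp
      qed
      then show ?thesis using cone_into_eqI[OF n X2(1) Y2(1) f2c M2 k' u] by blast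
    qed
  qed
  with tm have "chain_map n \<C> M1 M2 t" by (simp add: chain_map_iff[OF M1c M2c])
  moreover have "t 0 \<cdot> dif X1 0 = dif X2 0"
    unfolding t0 using comp_rewrite[OF s0d] s0d \<phi>1 s0 d0 chain_map_commute[OF X1(1) X2(1) \<phi>c, of 0] ends
    by (simp add: maps_unfold add_comp assoc)
  ultimately show thesis using that tn by blast
qed

text \<open>
  A diagram chase. The hypothesis \<open>top\<close> replaces exactness of \<open>X\<close> at its last term, where the cone
  continues with \<open>c\<close> although \<open>X\<close> ends; it holds if \<open>X\<close> realizes a pullback along \<open>c\<close> of the extension
  realized by \<open>Y\<close>.
\<close>

lemma cone_weak_kernels:
  assumes n: "n \<ge> 1" and X': "X \<in> complexes_between n \<C> A C" and Y': "Y \<in> complexes_between n \<C> A D"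
    and f: "lift n \<C> X Y (Id \<C> A) c f" and M: "cone_rows n X Y f M i\<^sub>1 i\<^sub>2 p\<^sub>1 p\<^sub>2"
    and wX: "weak_kernels n X" and wY: "weak_kernels n Y"
    and top: "\<And>W x y. x \<proportion> W \<rightarrow> C \<Longrightarrow> y \<proportion> W \<rightarrow> obj Y n \<Longrightarrow> c \<cdot> x = dif Y n \<cdot> y \<Longrightarrow>
      \<exists>x'. x' \<proportion> W \<rightarrow> obj X n \<and> dif X n \<cdot> x' = x"
  shows "weak_kernels n M"
  unfolding weak_kernels_def
proof (intro allI impI)
  note X = complexes_betweenD[OF X'] and Y = complexes_betweenD[OF Y']
  have fc: "chain_map n \<C> X Y f" and f0: "f 0 = Id \<C> A" and fn: "f (Suc n) = c" using f by (auto simp: lift_def)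
  note R = cone_rowsD[OF n X(1) Y(1) fc M]
  fix i W u
  assume i: "i < n" and u: "u \<proportion> W \<rightarrow> obj M (Suc i)" and Du: "dif M (Suc i) \<cdot> u = zero W (obj M (Suc (Suc i)))"
  have k: "1 \<le> Suc i" "Suc i \<le> n" using i by auto
  have D: "dif M (Suc i) \<proportion> obj M (Suc i) \<rightarrow> obj M (Suc (Suc i))" "dif M i \<proportion> obj M i \<rightarrow> obj M (Suc i)" using R(3) i
    by auto
  note p = R(10-13)[OF k]
  let ?x = "p\<^sub>1 (Suc i) \<cdot> u" and ?y = "p\<^sub>2 (Suc i) \<cdot> u"
  have xy: "?x \<proportion> W \<rightarrow> obj X (Suc (Suc i))" "?y \<proportion> W \<rightarrow> obj Y (Suc i)" using p u maps_comp by blast+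
  have d: "dif X (Suc i) \<proportion> obj X (Suc i) \<rightarrow> obj X (Suc (Suc i))" "dif Y (Suc i) \<proportion> obj Y (Suc i) \<rightarrow> obj Y (Suc (Suc i))"
    "dif Y i \<proportion> obj Y i \<rightarrow> obj Y (Suc i)" "dif X i \<proportion> obj X i \<rightarrow> obj X (Suc i)"
    using complex_dif[OF X(1)] complex_dif[OF Y(1)] i by auto
  have fm: "f (Suc i) \<proportion> obj X (Suc i) \<rightarrow> obj Y (Suc i)" "f (Suc (Suc i)) \<proportion> obj X (Suc (Suc i)) \<rightarrow> obj Y (Suc (Suc i))"
    using chain_map_maps[OF X(1) Y(1) fc] i by auto
  have fd: "f (Suc (Suc i)) \<cdot> dif X (Suc i) = dif Y (Suc i) \<cdot> f (Suc i)"
    using chain_map_commute[OF X(1) Y(1) fc, of "Suc i"] i by simp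
  have "f (Suc (Suc i)) \<cdot> ?x \<boxplus> dif Y (Suc i) \<cdot> ?y = zero W (obj Y (Suc (Suc i))) \<and>
      (\<exists>x'. x' \<proportion> W \<rightarrow> obj X (Suc i) \<and> dif X (Suc i) \<cdot> x' = ?x)"
  proof (cases "Suc i = n")
    case True
    have z: "f (Suc (Suc i)) \<cdot> ?x \<boxplus> dif Y (Suc i) \<cdot> ?y = zero W (obj Y (Suc (Suc i)))"
    proof -
      have "(f (Suc (Suc i)) \<cdot> p\<^sub>1 (Suc i) \<boxplus> dif Y (Suc i) \<cdot> p\<^sub>2 (Suc i)) \<cdot> u = f (Suc (Suc i)) \<cdot> ?x \<boxplus> dif Y (Suc i) \<cdot>
        ?y"
        using fm d p u by algebra
      then show ?thesis using Du R(9) R(2) True by simp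
    qed
    have "c \<cdot> ?x \<boxplus> dif Y n \<cdot> ?y = zero W D" using z True fn Y by simp
    moreover have "c \<proportion> C \<rightarrow> D" "dif Y n \<proportion> obj Y n \<rightarrow> D" "?x \<proportion> W \<rightarrow> C" "?y \<proportion> W \<rightarrow> obj Y n"
      using fm(2) fn d(2) xy True X Y by simp_all
    ultimately have "c \<cdot> ?x = dif Y n \<cdot> (\<boxminus> ?y)"
      using neg_unique[of "dif Y n \<cdot> ?y" "c \<cdot> ?x"] add_comm[of "dif Y n \<cdot> ?y" "c \<cdot> ?x"]
      by (simp add: maps_unfold comp_neg)
    then show ?thesis using z top[of ?x W "\<boxminus> ?y"] maps_neg[OF xy(2)] xy(1) True X by simp
  next
    case False
    then have lt: "Suc i < n" using i by simp
    note p' = R(12,13)[of "Suc (Suc i)", simplified, OF lt[unfolded Suc_le_eq[symmetric]]]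
    have dX: "dif X (Suc (Suc i)) \<proportion> obj X (Suc (Suc i)) \<rightarrow> obj X (Suc (Suc (Suc i)))"
      using complex_dif[OF X(1), of "Suc (Suc i)"] lt by simp
    have "p\<^sub>1 (Suc (Suc i)) \<cdot> dif M (Suc i) \<cdot> u = \<boxminus> (dif X (Suc (Suc i)) \<cdot> ?x)"
      using comp_rewrite[OF R(7)[OF k(1) lt]] p p' dX D u by algebra
    then have "\<boxminus> (dif X (Suc (Suc i)) \<cdot> ?x) = zero W (obj X (Suc (Suc (Suc i))))"
      using Du p' u by (simp add: maps_unfold)
    then have "dif X (Suc (Suc i)) \<cdot> ?x = zero W (obj X (Suc (Suc (Suc i))))"
      using neg_neg[of "dif X (Suc (Suc i)) \<cdot> ?x"] dX xy(1) by (simp add: maps_unfold)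
    moreover have "p\<^sub>2 (Suc (Suc i)) \<cdot> dif M (Suc i) \<cdot> u = f (Suc (Suc i)) \<cdot> ?x \<boxplus> dif Y (Suc i) \<cdot> ?y"
      using comp_rewrite[OF R(8)[OF k(1) lt]] p p' fm d D u by algebra
    moreover have "p\<^sub>2 (Suc (Suc i)) \<cdot> zero W (obj M (Suc (Suc i))) = zero W (obj Y (Suc (Suc i)))"
      using p' u by (simp add: maps_unfold)
    ultimately show ?thesis using weak_kernelsE[OF wX lt xy(1)] Du by metis
  qed
  then obtain x' where z: "f (Suc (Suc i)) \<cdot> ?x \<boxplus> dif Y (Suc i) \<cdot> ?y = zero W (obj Y (Suc (Suc i)))"
    and x': "x' \<proportion> W \<rightarrow> obj X (Suc i)" "dif X (Suc i) \<cdot> x' = ?x" by blast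
  let ?z = "?y \<boxplus> f (Suc i) \<cdot> x'"
  have zm: "?z \<proportion> W \<rightarrow> obj Y (Suc i)" using xy x' fm by algebra
  have "dif Y (Suc i) \<cdot> ?z = dif Y (Suc i) \<cdot> ?y \<boxplus> f (Suc (Suc i)) \<cdot> (dif X (Suc i) \<cdot> x')"
    using comp_rewrite[OF fd] xy(2) x'(1) d fm by algebra
  also have "\<dots> = f (Suc (Suc i)) \<cdot> ?x \<boxplus> dif Y (Suc i) \<cdot> ?y" unfolding x'(2) using xy d fm by algebra
  finally obtain y' where y': "y' \<proportion> W \<rightarrow> obj Y i" "dif Y i \<cdot> y' = ?z"
    using z weak_kernelsE[OF wY i zm] by metis
  have "\<exists>v. v \<proportion> W \<rightarrow> obj M i \<and> p\<^sub>1 (Suc i) \<cdot> dif M i \<cdot> v = ?x \<and> p\<^sub>2 (Suc i) \<cdot> dif M i \<cdot> v = ?y"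
  proof (cases i)
    case 0
    have y0: "y' \<proportion> W \<rightarrow> A" "dif X 0 \<proportion> A \<rightarrow> obj X 1" "dif Y 0 \<proportion> A \<rightarrow> obj Y 1" using y' d 0 X Y by simp_all
    let ?v = "(\<boxminus> x') \<boxplus> dif X 0 \<cdot> y'"
    have v: "?v \<proportion> W \<rightarrow> obj X 1" using x'(1) y0 0 by (simp add: maps_unfold)
    have dd: "dif X 1 \<cdot> dif X 0 = zero A (obj X 2)" using complex_dif_dif[OF X(1), of 0] n X
      by (simp add: numeral_2_eq_2)
    have fd0: "f 1 \<cdot> dif X 0 = dif Y 0" using chain_map_commute[OF X(1) Y(1) fc, of 0] f0 y0
      by (simp add: maps_unfold)
    have one: "dif X 1 \<proportion> obj X 1 \<rightarrow> obj X 2" "x' \<proportion> W \<rightarrow> obj X 1" "f 1 \<proportion> obj X 1 \<rightarrow> obj Y 1"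
      "dif M 0 \<proportion> obj X 1 \<rightarrow> obj M 1" "p\<^sub>1 1 \<proportion> obj M 1 \<rightarrow> obj X 2" "p\<^sub>2 1 \<proportion> obj M 1 \<rightarrow> obj Y 1"
      using d x' fm D p 0 R(1) by (simp_all add: numeral_2_eq_2)
    have "p\<^sub>1 1 \<cdot> dif M 0 \<cdot> ?v = dif X 1 \<cdot> x'"
      using comp_rewrite[OF R(5)] comp_rewrite[OF dd] one v y0 by algebra
    moreover have "p\<^sub>2 1 \<cdot> dif M 0 \<cdot> ?v = (\<boxminus> (f 1 \<cdot> x')) \<boxplus> dif Y 0 \<cdot> y'"
      using comp_rewrite[OF R(6)] comp_rewrite[OF fd0] one v y0 by algebra
    moreover have "(\<boxminus> (f (Suc i) \<cdot> x')) \<boxplus> (?y \<boxplus> f (Suc i) \<cdot> x') = ?y" using fm x'(1) xy by algebra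
    ultimately show ?thesis using v y' x' R(1) 0 by auto
  next
    case (Suc j)
    then have k1: "1 \<le> i" "i \<le> n" using i by auto
    note q = R(10-13)[OF k1] and e = comp_rewrite[OF R(14)[OF k1]] comp_rewrite[OF R(15)[OF k1]]
      comp_rewrite[OF R(16)[OF k1]] comp_rewrite[OF R(17)[OF k1]]
    let ?v = "i\<^sub>1 i \<cdot> (\<boxminus> x') \<boxplus> i\<^sub>2 i \<cdot> y'"
    have v: "?v \<proportion> W \<rightarrow> obj M i" using q x' y' by algebra
    have pv: "p\<^sub>1 i \<cdot> ?v = \<boxminus> x'" "p\<^sub>2 i \<cdot> ?v = y'" using q e x'(1) y'(1) by (algebra, algebra)
    have "p\<^sub>1 (Suc i) \<cdot> dif M i \<cdot> ?v = \<boxminus> (dif X (Suc i) \<cdot> (p\<^sub>1 i \<cdot> ?v))"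
      using comp_rewrite[OF R(7)[OF k1(1) i]] p q D d v by (simp add: maps_unfold neg_comp assoc)
    moreover have "\<boxminus> (dif X (Suc i) \<cdot> (\<boxminus> x')) = dif X (Suc i) \<cdot> x'" using d x'(1) by algebra
    moreover have "p\<^sub>2 (Suc i) \<cdot> dif M i \<cdot> ?v = f (Suc i) \<cdot> (p\<^sub>1 i \<cdot> ?v) \<boxplus> dif Y i \<cdot> (p\<^sub>2 i \<cdot> ?v)"
      using comp_rewrite[OF R(8)[OF k1(1) i]] p q D d fm v by (simp add: maps_unfold add_comp assoc)
    moreover have "f (Suc i) \<cdot> (\<boxminus> x') \<boxplus> (?y \<boxplus> f (Suc i) \<cdot> x') = ?y" using fm x'(1) xy by algebra
    ultimately show ?thesis using v pv x' y' by auto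
  qed
  then obtain v where v: "v \<proportion> W \<rightarrow> obj M i" "p\<^sub>1 (Suc i) \<cdot> dif M i \<cdot> v = ?x" "p\<^sub>2 (Suc i) \<cdot> dif M i \<cdot> v = ?y" by blast
  have "dif M i \<cdot> v = u" by (rule cone_into_eqI[OF n X(1) Y(1) fc M k maps_comp[OF v(1) D(2)] u v(2,3)])
  then show "\<exists>v. v \<proportion> W \<rightarrow> obj M i \<and> dif M i \<cdot> v = u" using v(1) by blast
qed

text \<open>
  If \<open>e\<close> restricts on \<open>A\<close> to the restriction of \<open>w\<close>, then \<open>e - w f\<^sub>1\<close> vanishes on \<open>A\<close> and extends to \<open>X\<^sup>2\<close>;
  this extension, with a sign, and \<open>w\<close> are the two components of \<open>r\<close>.
\<close>

lemma cone_bottom_factor: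
  assumes n: "n \<ge> 1" and X': "X \<in> complexes_between n \<C> A C" and Y': "Y \<in> complexes_between n \<C> A D"
    and f: "lift n \<C> X Y (Id \<C> A) c f" and M: "cone_rows n X Y f M i\<^sub>1 i\<^sub>2 p\<^sub>1 p\<^sub>2"
    and wX: "weak_cokernels n X"
    and e: "e \<proportion> obj X 1 \<rightarrow> W" and w: "w \<proportion> obj Y 1 \<rightarrow> W" and ew: "e \<cdot> dif X 0 = w \<cdot> dif Y 0"
  obtains r where "r \<proportion> obj M 1 \<rightarrow> W" "r \<cdot> dif M 0 = e"
proof -
  note X = complexes_betweenD[OF X'] and Y = complexes_betweenD[OF Y']
  have fc: "chain_map n \<C> X Y f" and f0: "f 0 = Id \<C> A" using f by (auto simp: lift_def)
  note R = cone_rowsD[OF n X(1) Y(1) fc M]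
  have p: "p\<^sub>1 1 \<proportion> obj M 1 \<rightarrow> obj X 2" "p\<^sub>2 1 \<proportion> obj M 1 \<rightarrow> obj Y 1" "dif M 0 \<proportion> obj X 1 \<rightarrow> obj M 1"
    using R(12,13)[of 1] R(3)[of 0] R(1) n by (simp_all add: numeral_2_eq_2)
  have d: "dif X 0 \<proportion> A \<rightarrow> obj X 1" "dif Y 0 \<proportion> A \<rightarrow> obj Y 1" "dif X 1 \<proportion> obj X 1 \<rightarrow> obj X 2"
    using complex_dif[OF X(1), of 0] complex_dif[OF Y(1), of 0] complex_dif[OF X(1), of 1] n X Y
      by (simp_all add: numeral_2_eq_2)
  have f1: "f 1 \<proportion> obj X 1 \<rightarrow> obj Y 1" using chain_map_maps[OF X(1) Y(1) fc, of 1] by simp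
  have fd0: "f 1 \<cdot> dif X 0 = dif Y 0" using chain_map_commute[OF X(1) Y(1) fc, of 0] f0 d by (simp add: maps_unfold)
  let ?z = "e \<boxplus> \<boxminus> (w \<cdot> f 1)"
  have z: "?z \<proportion> obj X (Suc 0) \<rightarrow> W" using e w f1 by (simp add: maps_unfold)
  have "?z \<cdot> dif X 0 = zero A W" using fd0 ew e w f1 d by algebra
  then obtain v where v: "v \<proportion> obj X 2 \<rightarrow> W" "v \<cdot> dif X 1 = ?z"
    using weak_cokernelsE[OF wX _ z] n X by (auto simp: numeral_2_eq_2)
  let ?r = "(\<boxminus> v) \<cdot> p\<^sub>1 1 \<boxplus> w \<cdot> p\<^sub>2 1"
  have "?r \<cdot> dif M 0 = v \<cdot> dif X 1 \<boxplus> w \<cdot> f 1"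
    using comp_rewrite[OF R(5)] R(5,6) p v(1) w d f1 by algebra
  also have "\<dots> = e" unfolding v(2) using e w f1 by algebra
  finally have "?r \<cdot> dif M 0 = e" .
  moreover have "?r \<proportion> obj M 1 \<rightarrow> W" using p v w by algebra
  ultimately show thesis using that by blast
qed

end

section \<open>Distinguished complexes up to homotopy\<close>

context exact_realization
begin

abbreviation dist :: "('o, 'm) cochain \<Rightarrow> 'e \<Rightarrow> bool" where
  "dist \<equiv> distinguished n \<C> \<E> \<ss>"

lemma distinguished_complex:
  assumes "dist X \<delta>"
  shows "X \<in> complexes_between n \<C> (obj X 0) (obj X (Suc n))" "\<delta> \<in> extensions \<E> (obj X (Suc n)) (obj X 0)"
  using assms realization_class[of "obj X (Suc n)" "obj X 0" \<delta>]
  by (auto simp: distinguished_def homotopy_class_def)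

lemma distinguished_exact:
  assumes "dist X \<delta>"
  shows "cochain_complex n \<C> X" "left_exact n X \<delta>" "right_exact n X \<delta>" "weak_kernels n X" "weak_cokernels n X"
  using R1[OF assms] by (auto simp: n_exangle_iff left_exact_def right_exact_def)

lemma distinguished_exists:
  assumes "C \<in> Ob \<C>" "A \<in> Ob \<C>" "\<delta> \<in> extensions \<E> C A"
  obtains X where "dist X \<delta>" "obj X 0 = A" "obj X (Suc n) = C"
proof -
  obtain X where X: "X \<in> complexes_between n \<C> A C" "\<ss> C A \<delta> = homotopy_class n \<C> A C X"
    using realization_class[OF assms] by blast
  then have "X \<in> \<ss> C A \<delta>" using homotopy_class_self by blast
  then show thesis using that[of X] X(1) assms by (simp add: distinguished_def complexes_between_def)
qed

lemma distinguished_transfer: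
  assumes X: "dist X \<delta>" and Y: "Y \<in> complexes_between n \<C> (obj X 0) (obj X (Suc n))"
    and XY: "homotopy_equivalent n \<C> (obj X 0) (obj X (Suc n)) X Y"
  shows "dist Y \<delta>"
proof -
  let ?A = "obj X 0" and ?C = "obj X (Suc n)"
  obtain Z where Z: "Z \<in> complexes_between n \<C> ?A ?C" "\<ss> ?C ?A \<delta> = homotopy_class n \<C> ?A ?C Z"
    using realization_class[of ?C ?A \<delta>] X by (auto simp: distinguished_def)
  have "homotopy_equivalent n \<C> ?A ?C Z X" using X Z by (simp add: distinguished_def homotopy_class_def)
  then have "homotopy_equivalent n \<C> ?A ?C Z Y"
    using homotopy_equivalent_trans[OF Z(1) distinguished_complex(1)[OF X] Y _ XY] by blast
  then have "Y \<in> \<ss> ?C ?A \<delta>" using Z(2) Y by (simp add: homotopy_class_def)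
  moreover have "obj Y 0 = ?A" "obj Y (Suc n) = ?C" using Y by (auto simp: complexes_between_def)
  ultimately show ?thesis using X by (simp add: distinguished_def)
qed

lemma distinguished_equivalent:
  assumes X: "dist X \<delta>" and Y: "dist Y \<delta>" and ends: "obj Y 0 = obj X 0" "obj Y (Suc n) = obj X (Suc n)"
  shows "homotopy_equivalent n \<C> (obj X 0) (obj X (Suc n)) X Y"
proof -
  let ?A = "obj X 0" and ?C = "obj X (Suc n)"
  obtain Z where Z: "Z \<in> complexes_between n \<C> ?A ?C" "\<ss> ?C ?A \<delta> = homotopy_class n \<C> ?A ?C Z"
    using realization_class[of ?C ?A \<delta>] X by (auto simp: distinguished_def)
  have Y': "Y \<in> complexes_between n \<C> ?A ?C" using distinguished_complex(1)[OF Y] ends by simp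
  have "homotopy_equivalent n \<C> ?A ?C Z X" "homotopy_equivalent n \<C> ?A ?C Z Y"
    using X Y Z ends by (simp_all add: distinguished_def homotopy_class_def)
  then show ?thesis
    using homotopy_equivalent_trans[OF distinguished_complex(1)[OF X] Z(1) Y'] homotopy_equivalent_sym by blast
qed

lemma distinguished_lift:
  assumes X: "dist X \<delta>" and Y: "dist Y \<rho>" and a: "a \<proportion> obj X 0 \<rightarrow> obj Y 0" and c: "c \<proportion> obj X (Suc n) \<rightarrow> obj Y (Suc n)"
    and eq: "push \<C> \<E> (obj X (Suc n)) a \<delta> = pull \<C> \<E> (obj Y 0) c \<rho>"
  obtains f where "lift n \<C> X Y a c f"
  using R0[OF X Y, of a c] a c eq by (auto simp: ext_morphism_def maps_def)

text \<open>
  Used to correct a lift so that it becomes the identity at its lower end.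
\<close>

lemma stabilizer_congruent_Id:
  assumes X: "dist X \<delta>" and t: "t \<proportion> obj X 0 \<rightarrow> obj X 0"
    and eq: "push \<C> \<E> (obj X (Suc n)) t \<delta> = \<delta>"
  obtains r where "r \<proportion> obj X 1 \<rightarrow> obj X 0" "Id \<C> (obj X 0) \<boxplus> \<boxminus> t = r \<cdot> dif X 0"
proof -
  note Xc = complexes_betweenD[OF distinguished_complex(1)[OF X]] and \<delta> = distinguished_complex(2)[OF X]
  have I: "Id \<C> (obj X 0) \<proportion> obj X 0 \<rightarrow> obj X 0" using Xc maps_Id by blast
  have u: "Id \<C> (obj X 0) \<boxplus> \<boxminus> t \<proportion> obj X 0 \<rightarrow> obj X 0" using I t by algebra
  have "push \<C> \<E> (obj X (Suc n)) (Id \<C> (obj X 0) \<boxplus> \<boxminus> t) \<delta> = \<one>\<^bsub>Ext \<E> (obj X (Suc n)) (obj X 0)\<^esub>"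
    by (rule push_difference[OF Xc(5) I t \<delta>]) (use eq push_Id[OF Xc(5,4) \<delta>] in simp)
  then show thesis using distinguished_exact(3)[OF X] u that unfolding right_exact_def by metis
qed

text \<open>
  Let \<open>f'\<close> be the composite of \<open>f\<close> with homotopy equivalences \<open>X' \<rightarrow> X\<close> and \<open>Y \<rightarrow> Y'\<close>, and \<open>Z\<close> a realization
  of the extension that the cone \<open>M'\<close> of \<open>f'\<close> should realize. The cones \<open>M\<close> and \<open>M'\<close> map to each other, and
  so do \<open>Z\<close> and \<open>M\<close>. The resulting maps between \<open>Z\<close> and \<open>M'\<close> are identities at the upper end; at the lower
  end they fix the first differential of \<open>X'\<close>, which suffices to correct them to identities. As \<open>M'\<close> has
  weak kernels, \<open>Z\<close> and \<open>M'\<close> are homotopy equivalent.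
\<close>

lemma EA2_representatives:
  assumes n: "n \<ge> 1" and \<rho>: "\<rho> \<in> extensions \<E> D A" and c: "c \<proportion> C \<rightarrow> D" and A: "A \<in> Ob \<C>"
    and X: "dist X (pull \<C> \<E> A c \<rho>)" "obj X 0 = A" "obj X (Suc n) = C"
    and Y: "dist Y \<rho>" "obj Y 0 = A" "obj Y (Suc n) = D"
    and f: "lift n \<C> X Y (Id \<C> A) c f" and M: "mapping_cone n \<C> X Y f M"
    and dM: "dist M (push \<C> \<E> D (dif X 0) \<rho>)"
    and X': "dist X' (pull \<C> \<E> A c \<rho>)" "obj X' 0 = A" "obj X' (Suc n) = C"
    and Y': "dist Y' \<rho>" "obj Y' 0 = A" "obj Y' (Suc n) = D"
  obtains f' M' where "lift n \<C> X' Y' (Id \<C> A) c f'" "mapping_cone n \<C> X' Y' f' M'"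
    "dist M' (push \<C> \<E> D (dif X' 0) \<rho>)"
proof -
  have Xb: "X \<in> complexes_between n \<C> A C" and X'b: "X' \<in> complexes_between n \<C> A C"
    and Yb: "Y \<in> complexes_between n \<C> A D" and Y'b: "Y' \<in> complexes_between n \<C> A D"
    using distinguished_complex(1)[OF X(1)] distinguished_complex(1)[OF X'(1)]
      distinguished_complex(1)[OF Y(1)] distinguished_complex(1)[OF Y'(1)] X X' Y Y' by simp_all
  note Xc = complexes_betweenD[OF Xb] and X'c = complexes_betweenD[OF X'b]
    and Yc = complexes_betweenD[OF Yb] and Y'c = complexes_betweenD[OF Y'b]
  obtain \<phi> \<phi>' where \<phi>: "lift n \<C> X' X (Id \<C> A) (Id \<C> C) \<phi>" and \<phi>': "lift n \<C> X X' (Id \<C> A) (Id \<C> C) \<phi>'"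
    and \<phi>\<phi>': "homotopic n \<C> X X (\<lambda>i. \<phi> i \<cdot> \<phi>' i) (\<lambda>i. Id \<C> (obj X i))"
    using distinguished_equivalent[OF X'(1) X(1)] X X' unfolding homotopy_equivalent_def by auto
  obtain \<psi> \<psi>' where \<psi>: "lift n \<C> Y Y' (Id \<C> A) (Id \<C> D) \<psi>" and \<psi>': "lift n \<C> Y' Y (Id \<C> A) (Id \<C> D) \<psi>'"
    and \<psi>'\<psi>: "homotopic n \<C> Y Y (\<lambda>i. \<psi>' i \<cdot> \<psi> i) (\<lambda>i. Id \<C> (obj Y i))"
    using distinguished_equivalent[OF Y(1) Y'(1)] Y Y' unfolding homotopy_equivalent_def by auto
  have fc: "chain_map n \<C> X Y f" and \<phi>c: "chain_map n \<C> X' X \<phi>" and \<phi>'c: "chain_map n \<C> X X' \<phi>'"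
    and \<psi>c: "chain_map n \<C> Y Y' \<psi>" and \<psi>'c: "chain_map n \<C> Y' Y \<psi>'"
    using f \<phi> \<phi>' \<psi> \<psi>' by (auto simp: lift_def)
  define f' where "f' i = \<psi> i \<cdot> f i \<cdot> \<phi> i" for i
  have f\<phi>: "lift n \<C> X' Y (Id \<C> A) c (\<lambda>i. f i \<cdot> \<phi> i)"
    using lift_comp[OF X'c(1) Xc(1) Yc(1) \<phi> f] A c by (simp add: maps_unfold)
  have f': "lift n \<C> X' Y' (Id \<C> A) c f'"
    unfolding f'_def[abs_def] using lift_comp[OF X'c(1) Yc(1) Y'c(1) f\<phi> \<psi>] A c by (simp add: maps_unfold)
  have f'c: "chain_map n \<C> X' Y' f'" and f\<phi>c: "chain_map n \<C> X' Y (\<lambda>i. f i \<cdot> \<phi> i)" using f' f\<phi>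
    by (auto simp: lift_def)
  obtain i1 i2 p1 p2 where rM: "cone_rows n X Y f M i1 i2 p1 p2"
    using M mapping_cone_iff[OF n Xc(1) Yc(1) fc] by blast
  obtain M' j1 j2 q1 q2 where rM': "cone_rows n X' Y' f' M' j1 j2 q1 q2"
    using cone_exists[OF n X'c(1) Y'c(1) f'c] by blast
  have M'cone: "mapping_cone n \<C> X' Y' f' M'" using rM' mapping_cone_iff[OF n X'c(1) Y'c(1) f'c] by blast
  have Mc: "cochain_complex n \<C> M" and M'c: "cochain_complex n \<C> M'"
    using cone_complex[OF n Xc(1) Yc(1) fc rM] cone_complex[OF n X'c(1) Y'c(1) f'c rM'] .
  have M0: "obj M 0 = obj X 1" "obj M (Suc n) = D" and M'0: "obj M' 0 = obj X' 1" "obj M' (Suc n) = D"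
    using rM rM' Y Y' by (auto simp: cone_rows_def)
  have maps: "f i \<proportion> obj X i \<rightarrow> obj Y i" "\<phi> i \<proportion> obj X' i \<rightarrow> obj X i" "\<phi>' i \<proportion> obj X i \<rightarrow> obj X' i"
    "\<psi> i \<proportion> obj Y i \<rightarrow> obj Y' i" "\<psi>' i \<proportion> obj Y' i \<rightarrow> obj Y i" if "i \<le> Suc n" for i
    using that chain_map_maps[OF Xc(1) Yc(1) fc] chain_map_maps[OF X'c(1) Xc(1) \<phi>c]
      chain_map_maps[OF Xc(1) X'c(1) \<phi>'c]
      chain_map_maps[OF Yc(1) Y'c(1) \<psi>c] chain_map_maps[OF Y'c(1) Yc(1) \<psi>'c] by auto
  \<comment> \<open>Both cones map to each other, since the squares commute up to homotopy.\<close>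
  have "homotopic n \<C> X Y (\<lambda>i. f i \<cdot> \<phi> i \<cdot> \<phi>' i) (\<lambda>i. f i \<cdot> Id \<C> (obj X i))"
    by (rule homotopic_comp_left[OF Xc(1,1) Yc(1) chain_map_comp[OF Xc(1) X'c(1) Xc(1) \<phi>'c \<phi>c] fc \<phi>\<phi>'])
  then have "homotopic n \<C> X Y' (\<lambda>i. \<psi> i \<cdot> f i \<cdot> \<phi> i \<cdot> \<phi>' i) (\<lambda>i. \<psi> i \<cdot> f i \<cdot> Id \<C> (obj X i))"
    by (rule homotopic_comp_left[OF Xc(1) Yc(1) Y'c(1) chain_map_comp[OF Xc(1,1) Yc(1)
          chain_map_comp[OF Xc(1) X'c(1) Xc(1) \<phi>'c \<phi>c] fc] \<psi>c])
  moreover have "homotopic n \<C> X Y' (\<lambda>i. f' i \<cdot> \<phi>' i) (\<lambda>i. \<psi> i \<cdot> f i \<cdot> \<phi> i \<cdot> \<phi>' i)"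
    by (rule homotopic_refl[OF Xc(1) Y'c(1) chain_map_comp[OF Xc(1) X'c(1) Y'c(1) \<phi>'c f'c]])
      (use maps in \<open>simp add: f'_def maps_unfold assoc\<close>)
  moreover have "homotopic n \<C> X Y' (\<lambda>i. \<psi> i \<cdot> f i \<cdot> Id \<C> (obj X i)) (\<lambda>i. \<psi> i \<cdot> f i)"
    by (rule homotopic_refl[OF Xc(1) Y'c(1) chain_map_comp[OF Xc(1) Yc(1) Y'c(1) chain_map_comp[OF Xc(1,1) Yc(1)
      chain_map_Id[OF Xc(1)] fc] \<psi>c]])
      (use maps in \<open>simp add: maps_unfold\<close>)
  ultimately have h1: "homotopic n \<C> X Y' (\<lambda>i. f' i \<cdot> \<phi>' i) (\<lambda>i. \<psi> i \<cdot> f i)"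
    using homotopic_trans[OF Xc(1) Y'c(1)] chain_map_comp[OF Xc(1) X'c(1) Y'c(1) \<phi>'c f'c]
      chain_map_comp[OF Xc(1) Yc(1) Y'c(1) chain_map_comp[OF Xc(1,1) Yc(1) chain_map_Id[OF Xc(1)] fc] \<psi>c]
      chain_map_comp[OF Xc(1) Yc(1) Y'c(1) chain_map_comp[OF Xc(1,1) Yc(1)
          chain_map_comp[OF Xc(1) X'c(1) Xc(1) \<phi>'c \<phi>c] fc] \<psi>c] by meson
  have "homotopic n \<C> X' Y (\<lambda>i. (\<psi>' i \<cdot> \<psi> i) \<cdot> f i \<cdot> \<phi> i) (\<lambda>i. Id \<C> (obj Y i) \<cdot> f i \<cdot> \<phi> i)"
    by (rule homotopic_comp_right[OF X'c(1) Yc(1,1) f\<phi>c chain_map_comp[OF Yc(1) Y'c(1) Yc(1) \<psi>c \<psi>'c] \<psi>'\<psi>])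
  moreover have "homotopic n \<C> X' Y (\<lambda>i. \<psi>' i \<cdot> f' i) (\<lambda>i. (\<psi>' i \<cdot> \<psi> i) \<cdot> f i \<cdot> \<phi> i)"
    by (rule homotopic_refl[OF X'c(1) Yc(1) chain_map_comp[OF X'c(1) Y'c(1) Yc(1) f'c \<psi>'c]])
      (use maps in \<open>simp add: f'_def maps_unfold assoc\<close>)
  moreover have "homotopic n \<C> X' Y (\<lambda>i. Id \<C> (obj Y i) \<cdot> f i \<cdot> \<phi> i) (\<lambda>i. f i \<cdot> \<phi> i)"
    by (rule homotopic_refl[OF X'c(1) Yc(1) chain_map_comp[OF X'c(1) Yc(1,1) f\<phi>c chain_map_Id[OF Yc(1)]]])
      (use maps in \<open>simp add: maps_unfold\<close>)
  ultimately have "homotopic n \<C> X' Y (\<lambda>i. \<psi>' i \<cdot> f' i) (\<lambda>i. f i \<cdot> \<phi> i)"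
    using homotopic_trans[OF X'c(1) Yc(1)] chain_map_comp[OF X'c(1) Y'c(1) Yc(1) f'c \<psi>'c]
      chain_map_comp[OF X'c(1) Yc(1,1) f\<phi>c chain_map_Id[OF Yc(1)]]
      chain_map_comp[OF X'c(1) Yc(1,1) f\<phi>c chain_map_comp[OF Yc(1) Y'c(1) Yc(1) \<psi>c \<psi>'c]] by meson
  then have h2: "homotopic n \<C> X' Y (\<lambda>i. f i \<cdot> \<phi> i) (\<lambda>i. \<psi>' i \<cdot> f' i)"
    by (rule homotopic_sym[OF X'c(1) Yc(1) chain_map_comp[OF X'c(1) Y'c(1) Yc(1) f'c \<psi>'c] f\<phi>c])
  obtain t where t: "chain_map n \<C> M M' t" "t (Suc n) = Id \<C> D" "t 0 \<cdot> dif X 0 = dif X' 0"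
    using cone_comparison[OF n Xb X'b Yb Y'b f f' \<phi>' \<psi> h1 rM rM'] .
  obtain t' where t': "chain_map n \<C> M' M t'" "t' (Suc n) = Id \<C> D" "t' 0 \<cdot> dif X' 0 = dif X 0"
    using cone_comparison[OF n X'b Xb Y'b Yb f' f \<phi> \<psi>' h2 rM' rM] .
  have d0: "dif X 0 \<proportion> A \<rightarrow> obj X 1" "dif X' 0 \<proportion> A \<rightarrow> obj X' 1"
    using complex_dif[OF Xc(1), of 0] complex_dif[OF X'c(1), of 0] Xc X'c by simp_all
  have D: "D \<in> Ob \<C>" using c by (simp add: maps_def)
  let ?\<sigma> = "push \<C> \<E> D (dif X' 0) \<rho>" and ?\<tau> = "push \<C> \<E> D (dif X 0) \<rho>"
  have \<sigma>: "?\<sigma> \<in> extensions \<E> D (obj X' 1)" using push_closed[OF D d0(2) \<rho>] .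
  obtain Z where Z: "dist Z ?\<sigma>" "obj Z 0 = obj X' 1" "obj Z (Suc n) = D"
    using distinguished_exists[OF D _ \<sigma>] d0(2) by (auto simp: maps_def)
  note Zc = distinguished_complex(1)[OF Z(1), unfolded Z(2,3)]
  have \<phi>1: "\<phi> 1 \<proportion> obj X' 1 \<rightarrow> obj X 1" "\<phi>' 1 \<proportion> obj X 1 \<rightarrow> obj X' 1" using maps[of 1] n by auto
  have \<phi>d: "\<phi> 1 \<cdot> dif X' 0 = dif X 0" "\<phi>' 1 \<cdot> dif X 0 = dif X' 0"
    using chain_map_commute[OF X'c(1) Xc(1) \<phi>c, of 0] chain_map_commute[OF Xc(1) X'c(1) \<phi>'c, of 0] \<phi> \<phi>' d0
    by (simp_all add: lift_def maps_unfold)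
  have I: "Id \<C> D \<proportion> D \<rightarrow> D" using D by (rule maps_Id)
  have \<tau>: "?\<tau> \<in> extensions \<E> D (obj X 1)" using push_closed[OF D d0(1) \<rho>] .
  obtain g where g: "lift n \<C> Z M (\<phi> 1) (Id \<C> D) g"
  proof (rule distinguished_lift[OF Z(1) dM])
    show "\<phi> 1 \<proportion> obj Z 0 \<rightarrow> obj M 0" "Id \<C> D \<proportion> obj Z (Suc n) \<rightarrow> obj M (Suc n)" using \<phi>1 I Z M0 by simp_all
    show "push \<C> \<E> (obj Z (Suc n)) (\<phi> 1) ?\<sigma> = pull \<C> \<E> (obj M 0) (Id \<C> D) ?\<tau>"
      using push_push[OF D d0(2) \<phi>1(1) \<rho>] \<phi>d Z M0 pull_Id[OF D _ \<tau>] \<phi>1 by (simp add: maps_unfold)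
  qed
  obtain g' where g': "lift n \<C> M Z (\<phi>' 1) (Id \<C> D) g'"
  proof (rule distinguished_lift[OF dM Z(1)])
    show "\<phi>' 1 \<proportion> obj M 0 \<rightarrow> obj Z 0" "Id \<C> D \<proportion> obj M (Suc n) \<rightarrow> obj Z (Suc n)" using \<phi>1 I Z M0 by simp_all
    show "push \<C> \<E> (obj M (Suc n)) (\<phi>' 1) ?\<tau> = pull \<C> \<E> (obj Z 0) (Id \<C> D) ?\<sigma>"
      using push_push[OF D d0(1) \<phi>1(2) \<rho>] \<phi>d Z M0 pull_Id[OF D _ \<sigma>] \<phi>1 by (simp add: maps_unfold)
  qed
  note Zc1 = complexes_betweenD(1)[OF Zc]
  let ?F = "\<lambda>i. t i \<cdot> g i" and ?G = "\<lambda>i. g' i \<cdot> t' i"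
  have Fc: "chain_map n \<C> Z M' ?F" and Gc: "chain_map n \<C> M' Z ?G"
    using chain_map_comp[OF Zc1 Mc M'c _ t(1)] chain_map_comp[OF M'c Mc Zc1 t'(1)] g g' by (auto simp: lift_def)
  have t0: "t 0 \<proportion> obj X 1 \<rightarrow> obj X' 1" "t' 0 \<proportion> obj X' 1 \<rightarrow> obj X 1"
    using chain_map_maps[OF Mc M'c t(1), of 0] chain_map_maps[OF M'c Mc t'(1), of 0] M0 M'0 by simp_all
  have F0: "?F 0 = t 0 \<cdot> \<phi> 1" "?F (Suc n) = Id \<C> D" and G0: "?G 0 = \<phi>' 1 \<cdot> t' 0" "?G (Suc n) = Id \<C> D"
    using g g' t t' D by (simp_all add: lift_def)
  have m0: "t 0 \<cdot> \<phi> 1 \<proportion> obj X' 1 \<rightarrow> obj X' 1" "\<phi>' 1 \<cdot> t' 0 \<proportion> obj X' 1 \<rightarrow> obj X' 1"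
    using t0 \<phi>1 maps_comp by blast+
  have fix_d: "(t 0 \<cdot> \<phi> 1) \<cdot> dif X' 0 = dif X' 0" "(\<phi>' 1 \<cdot> t' 0) \<cdot> dif X' 0 = dif X' 0"
    using t0 \<phi>1 d0 t(3) t'(3) \<phi>d by (simp_all add: maps_unfold assoc)
  have I1: "Id \<C> (obj X' 1) \<proportion> obj X' 1 \<rightarrow> obj X' 1" using \<phi>1 by (simp add: maps_unfold)
  \<comment> \<open>Both lower ends fix \<open>d\<close>, the first differential of \<open>X'\<close>. On the side of \<open>Z\<close> they therefore fix the
    extension \<open>d\<^sub>*\<rho>\<close>; on the side of the cone the difference to the identity vanishes on \<open>A\<close>.\<close>
  obtain r where r: "r \<proportion> obj Z 1 \<rightarrow> obj X' 1" "Id \<C> (obj X' 1) \<boxplus> \<boxminus> (t 0 \<cdot> \<phi> 1) = r \<cdot> dif Z 0"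
    using stabilizer_congruent_Id[OF Z(1), of "t 0 \<cdot> \<phi> 1"] m0 Z push_push[OF D d0(2) m0(1) \<rho>] fix_d by auto
  let ?e = "Id \<C> (obj X' 1) \<boxplus> \<boxminus> (\<phi>' 1 \<cdot> t' 0)"
  have e: "?e \<proportion> obj X' 1 \<rightarrow> obj X' 1" using m0 I1 by algebra
  have "?e \<cdot> dif X' 0 = zero A (obj X' 1)"
    using fix_d(2) m0(2) d0(2) I1 by (simp add: maps_unfold add_comp neg_comp)
  moreover have "dif Y' 0 \<proportion> A \<rightarrow> obj Y' 1" using complex_dif[OF Y'c(1), of 0] Y'c by simp
  ultimately have "?e \<cdot> dif X' 0 = zero (obj Y' 1) (obj X' 1) \<cdot> dif Y' 0"
    "zero (obj Y' 1) (obj X' 1) \<proportion> obj Y' 1 \<rightarrow> obj X' 1"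
    using d0 by (simp_all add: maps_unfold)
  then obtain r' where r': "r' \<proportion> obj M' 1 \<rightarrow> obj X' 1" "r' \<cdot> dif M' 0 = ?e"
    using cone_bottom_factor[OF n X'b Y'b f' rM' distinguished_exact(5)[OF X'(1)] e] by blast
  obtain F' where F': "chain_map n \<C> Z M' F'" "F' 0 = ?F 0 \<boxplus> r \<cdot> dif Z 0" "F' (Suc n) = ?F (Suc n)"
    using adjust_bottom[OF n Zc1 M'c Fc, of r] r M'0 by auto
  obtain G' where G': "chain_map n \<C> M' Z G'" "G' 0 = ?G 0 \<boxplus> r' \<cdot> dif M' 0" "G' (Suc n) = ?G (Suc n)"
    using adjust_bottom[OF n M'c Zc1 Gc, of r'] r' Z by auto
  have "t 0 \<cdot> \<phi> 1 \<boxplus> (Id \<C> (obj X' 1) \<boxplus> \<boxminus> (t 0 \<cdot> \<phi> 1)) = Id \<C> (obj X' 1)"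
    "\<phi>' 1 \<cdot> t' 0 \<boxplus> ?e = Id \<C> (obj X' 1)"
    using t0 \<phi>1 by (algebra, algebra)
  then have "F' 0 = Id \<C> (obj X' 1)" "G' 0 = Id \<C> (obj X' 1)"
    using F'(2) G'(2) F0 G0 r(2) r'(2) by simp_all
  then have lifts: "lift n \<C> Z M' (Id \<C> (obj X' 1)) (Id \<C> D) F'" "lift n \<C> M' Z (Id \<C> (obj X' 1)) (Id \<C> D) G'"
    using F' G' F0 G0 by (simp_all add: lift_def)
  have M'b: "M' \<in> complexes_between n \<C> (obj X' 1) D" using M'c M'0 by (simp add: complexes_between_def)
  have wM': "weak_kernels n M'"
  proof (rule cone_weak_kernels[OF n X'b Y'b f' rM' distinguished_exact(4)[OF X'(1)] distinguished_exact(4)[OF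
    Y'(1)]])
    fix W x y
    assume x: "x \<proportion> W \<rightarrow> C" and y: "y \<proportion> W \<rightarrow> obj Y' n" and eq: "c \<cdot> x = dif Y' n \<cdot> y"
    have dY: "dif Y' n \<proportion> obj Y' n \<rightarrow> D" using complex_dif[OF Y'c(1), of n] Y'c by simp
    have "pull \<C> \<E> A x (pull \<C> \<E> A c \<rho>) = pull \<C> \<E> A y (pull \<C> \<E> A (dif Y' n) \<rho>)"
      using pull_pull[OF A c x \<rho>] pull_pull[OF A dY y \<rho>] eq by simp
    also have "\<dots> = \<one>\<^bsub>Ext \<E> W A\<^esub>"
      using distinguished_exact(2)[OF Y'(1)] Y' pull_zero[OF A y] by (simp add: left_exact_def)
    finally show "\<exists>x'. x' \<proportion> W \<rightarrow> obj X' n \<and> dif X' n \<cdot> x' = x"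
      using distinguished_exact(2)[OF X'(1)] X' x by (simp add: left_exact_def)
  qed
  have "homotopy_equivalent n \<C> (obj X' 1) D Z M'"
    by (rule homotopy_equivalent_of_lifts[OF Zc M'b distinguished_exact(4)[OF Z(1)] wM' lifts])
  then have "dist M' ?\<sigma>" using distinguished_transfer[OF Z(1), unfolded Z(2,3), OF M'b] by blast
  with f' M'cone show thesis by (rule that)
qed

text \<open>
  Compare \<open>N\<close> with a realization \<open>Z\<close> of \<open>\<pi>\<^sup>*\<delta>\<close> by passing through \<open>M\<close> in both directions. The composites are
  \<open>\<iota>\<pi>\<close> at the upper end. Since \<open>\<iota>\<pi>\<close> fixes \<open>\<pi>\<^sup>*\<delta>\<close>, the difference \<open>1 - \<iota>\<pi>\<close> factors through the last
  differentials of \<open>N\<close> and \<open>Z\<close>, and both maps can be corrected to identities at the ends.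
\<close>

lemma distinguished_by_domination:
  assumes n: "n \<ge> 1" and M: "dist M \<delta>" and N': "N \<in> complexes_between n \<C> (obj M 0) E"
    and \<pi>: "\<pi> \<proportion> E \<rightarrow> obj M (Suc n)" and lN: "left_exact n N (pull \<C> \<E> (obj M 0) \<pi> \<delta>)"
    and G: "lift n \<C> N M (Id \<C> (obj M 0)) \<pi> G" and H: "lift n \<C> M N (Id \<C> (obj M 0)) \<iota> H"
    and \<pi>\<iota>: "\<pi> \<cdot> \<iota> = Id \<C> (obj M (Suc n))"
  shows "dist N (pull \<C> \<E> (obj M 0) \<pi> \<delta>)"
proof -
  let ?A = "obj M 0" and ?C = "obj M (Suc n)" and ?\<delta> = "pull \<C> \<E> (obj M 0) \<pi> \<delta>"
  note Mb = distinguished_complex(1)[OF M] and \<delta> = distinguished_complex(2)[OF M]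
  note Mc = complexes_betweenD[OF Mb] and Nc = complexes_betweenD[OF N']
  have \<iota>: "\<iota> \<proportion> ?C \<rightarrow> E" using chain_map_maps[OF Mc(1) Nc(1), of H "Suc n"] H Nc by (auto simp: lift_def)
  have \<delta>': "?\<delta> \<in> extensions \<E> E ?A" using pull_closed[OF Mc(4) \<pi> \<delta>] .
  have E: "E \<in> Ob \<C>" using \<pi> by (simp add: maps_def)
  have \<iota>\<delta>': "pull \<C> \<E> ?A \<iota> ?\<delta> = \<delta>" using pull_pull[OF Mc(4) \<pi> \<iota> \<delta>] \<pi>\<iota> pull_Id[OF Mc(5,4) \<delta>] by simp
  obtain Z where Z: "dist Z ?\<delta>" "obj Z 0 = ?A" "obj Z (Suc n) = E" using distinguished_exists[OF E Mc(4) \<delta>'] .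
  note Zb = distinguished_complex(1)[OF Z(1), unfolded Z(2,3)]
  note Zc = complexes_betweenD[OF Zb]
  have I: "Id \<C> ?A \<proportion> ?A \<rightarrow> ?A" using Mc(4) by (rule maps_Id)
  obtain f where f: "lift n \<C> Z M (Id \<C> ?A) \<pi> f"
    by (rule distinguished_lift[OF Z(1) M, unfolded Z(2,3), OF I \<pi>]) (use push_Id[OF E Mc(4) \<delta>'] in simp)
  obtain g where g: "lift n \<C> M Z (Id \<C> ?A) \<iota> g"
    by (rule distinguished_lift[OF M Z(1), unfolded Z(2,3), OF I \<iota>]) (use push_Id[OF Mc(5,4) \<delta>] \<iota>\<delta>' in simp)
  have \<iota>\<pi>: "\<iota> \<cdot> \<pi> \<proportion> E \<rightarrow> E" using \<iota> \<pi> maps_comp by blast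
  have F: "lift n \<C> Z N (Id \<C> ?A) (\<iota> \<cdot> \<pi>) (\<lambda>i. H i \<cdot> f i)" using lift_comp[OF Zc(1) Mc(1) Nc(1) f H] Mc by simp
  have K: "lift n \<C> N Z (Id \<C> ?A) (\<iota> \<cdot> \<pi>) (\<lambda>i. g i \<cdot> G i)" using lift_comp[OF Nc(1) Mc(1) Zc(1) G g] Mc by simp
  have IE: "Id \<C> E \<proportion> E \<rightarrow> E" using E by (rule maps_Id)
  let ?u = "Id \<C> E \<boxplus> \<boxminus> (\<iota> \<cdot> \<pi>)"
  have u: "?u \<proportion> E \<rightarrow> E" using IE \<iota>\<pi> by algebra
  have "pull \<C> \<E> ?A (\<iota> \<cdot> \<pi>) ?\<delta> = ?\<delta>" using pull_pull[OF Mc(4) \<iota> \<pi> \<delta>'] \<iota>\<delta>' by simp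
  then have u0: "pull \<C> \<E> ?A ?u ?\<delta> = \<one>\<^bsub>Ext \<E> E ?A\<^esub>"
    using pull_difference[OF Mc(4) IE \<iota>\<pi> \<delta>'] pull_Id[OF E Mc(4) \<delta>'] by simp
  obtain v where v: "v \<proportion> E \<rightarrow> obj N n" "dif N n \<cdot> v = ?u"
    using lN u u0 Nc(2,3) unfolding left_exact_def by metis
  obtain w where w: "w \<proportion> E \<rightarrow> obj Z n" "dif Z n \<cdot> w = ?u"
    using distinguished_exact(2)[OF Z(1)] u u0 Z(2,3) unfolding left_exact_def by metis
  have uu: "\<iota> \<cdot> \<pi> \<boxplus> ?u = Id \<C> E" using \<iota> \<pi> by algebra
  obtain F' where "lift n \<C> Z N (Id \<C> ?A) (Id \<C> E) F'"
    using adjust_top[OF n Zc(1) Nc(1), of "\<lambda>i. H i \<cdot> f i" v] F v uu Z Nc by (auto simp: lift_def)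
  moreover obtain K' where "lift n \<C> N Z (Id \<C> ?A) (Id \<C> E) K'"
    using adjust_top[OF n Nc(1) Zc(1), of "\<lambda>i. g i \<cdot> G i" w] K w uu Z Nc by (auto simp: lift_def)
  moreover have "weak_kernels n N" using lN by (simp add: left_exact_def)
  ultimately have "homotopy_equivalent n \<C> ?A E Z N"
    using homotopy_equivalent_of_lifts[OF Zb N' distinguished_exact(4)[OF Z(1)]] by blast
  then show ?thesis using distinguished_transfer[OF Z(1), unfolded Z(2,3), OF N'] by blast
qed

end

section \<open>Recognizing inflations\<close>

context additive_category
begin

lemma biproduct_pairing:
  assumes "biproduct \<C> A B S i\<^sub>1 i\<^sub>2 p\<^sub>1 p\<^sub>2" "A \<in> Ob \<C>" "B \<in> Ob \<C>" "x \<proportion> W \<rightarrow> A" "y \<proportion> W \<rightarrow> B"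
  shows "i\<^sub>1 \<cdot> x \<boxplus> i\<^sub>2 \<cdot> y \<proportion> W \<rightarrow> S" "p\<^sub>1 \<cdot> (i\<^sub>1 \<cdot> x \<boxplus> i\<^sub>2 \<cdot> y) = x" "p\<^sub>2 \<cdot> (i\<^sub>1 \<cdot> x \<boxplus> i\<^sub>2 \<cdot> y) = y"
proof -
  note B = biproductD[OF assms(1-3)]
  show "i\<^sub>1 \<cdot> x \<boxplus> i\<^sub>2 \<cdot> y \<proportion> W \<rightarrow> S" using B(1,2) assms(4,5) by algebra
  show "p\<^sub>1 \<cdot> (i\<^sub>1 \<cdot> x \<boxplus> i\<^sub>2 \<cdot> y) = x" "p\<^sub>2 \<cdot> (i\<^sub>1 \<cdot> x \<boxplus> i\<^sub>2 \<cdot> y) = y"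
    using comp_rewrite[OF B(5)] comp_rewrite[OF B(6)] comp_rewrite[OF B(7)] comp_rewrite[OF B(8)] B(1-4) assms(4,5)
    by (algebra, algebra)
qed

end

context exact_realization
begin

text \<open>
  The morphism \<open>x\<close> is completed to the complex
  \<open>M\<^sup>0 \<rightarrow> D \<rightarrow> M\<^sup>2 \<oplus> D \<rightarrow> M\<^sup>3 \<oplus> M\<^sup>1 \<rightarrow> M\<^sup>4 \<rightarrow> \<dots>\<close> with differentials
  \<open>x\<close>, \<open>(d\<^sub>1\<beta>, 1 - \<alpha>\<beta>)\<close>, \<open>(d\<^sub>2, 0; r, -\<beta>)\<close>, \<open>(d\<^sub>3, 0)\<close>, \<open>d\<^sub>4\<close>, where \<open>r\<close> measures how far \<open>\<beta>\<alpha>\<close> is from the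
  identity: \<open>1 - \<beta>\<alpha>\<close> vanishes on \<open>d\<^sub>0\<close>, hence equals \<open>r d\<^sub>1\<close>. Up to homotopy this is \<open>M\<close>, except that
  for \<open>n = 2\<close> the last term is \<open>M\<^sup>3 \<oplus> M\<^sup>1\<close>; in all cases it realizes the pullback of \<open>\<delta>\<close> along the
  projection \<open>\<pi>\<close> of its last term to that of \<open>M\<close>, which is the identity for \<open>n \<ge> 3\<close>.
\<close>

lemma inflation_of_domination:
  assumes n: "n \<ge> 2" and M: "dist M \<delta>"
    and \<alpha>: "\<alpha> \<proportion> obj M 1 \<rightarrow> D" and \<beta>: "\<beta> \<proportion> D \<rightarrow> obj M 1"
    and x: "x \<proportion> obj M 0 \<rightarrow> D" and \<alpha>x: "\<alpha> \<cdot> dif M 0 = x" and \<beta>x: "\<beta> \<cdot> x = dif M 0"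
  shows "inflation n \<C> \<E> \<ss> (obj M 0) D x"
proof -
  note Mb = distinguished_complex(1)[OF M] and \<delta> = distinguished_complex(2)[OF M]
  note Mc = complexes_betweenD[OF Mb]
  note wk = distinguished_exact(4)[OF M]
  have n1: "n \<ge> 1" using n by simp
  let ?A = "obj M 0"
  have Ob: "D \<in> Ob \<C>" "obj M 1 \<in> Ob \<C>" "obj M 2 \<in> Ob \<C>" "obj M 3 \<in> Ob \<C>"
    using x complex_Ob[OF Mc(1), of 1] complex_Ob[OF Mc(1), of 2] complex_Ob[OF Mc(1), of 3] n
      by (simp_all add: maps_unfold)
  have d: "dif M 0 \<proportion> ?A \<rightarrow> obj M 1" "dif M 1 \<proportion> obj M 1 \<rightarrow> obj M 2" "dif M 2 \<proportion> obj M 2 \<rightarrow> obj M 3"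
    using complex_dif[OF Mc(1), of 0] complex_dif[OF Mc(1), of 1] complex_dif[OF Mc(1), of 2] n
    by (simp_all add: numeral_2_eq_2 numeral_3_eq_3)
  have dd: "dif M 1 \<cdot> dif M 0 = zero ?A (obj M 2)" "dif M 2 \<cdot> dif M 1 = zero (obj M 1) (obj M 3)"
    using complex_dif_dif[OF Mc(1), of 0] complex_dif_dif[OF Mc(1), of 1] n
    by (simp_all add: numeral_2_eq_2 numeral_3_eq_3)
  have d3: "dif M 3 \<proportion> obj M 3 \<rightarrow> obj M 4" "dif M 3 \<cdot> dif M 2 = zero (obj M 2) (obj M 4)" if "n \<ge> 3"
    using complex_dif[OF Mc(1), of 3] complex_dif_dif[OF Mc(1), of 2] that
    by (simp_all add: eval_nat_numeral)
  have z: "(Id \<C> (obj M 1) \<boxplus> \<boxminus> (\<beta> \<cdot> \<alpha>)) \<cdot> dif M 0 = zero ?A (obj M 1)"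
    using \<alpha>x \<beta>x \<alpha> \<beta> d x by algebra
  have "Id \<C> (obj M 1) \<boxplus> \<boxminus> (\<beta> \<cdot> \<alpha>) \<proportion> obj M (Suc 0) \<rightarrow> obj M 1" using \<alpha> \<beta> by (simp add: maps_unfold)
  then obtain r where r: "r \<proportion> obj M 2 \<rightarrow> obj M 1" "r \<cdot> dif M 1 = Id \<C> (obj M 1) \<boxplus> \<boxminus> (\<beta> \<cdot> \<alpha>)"
    using weak_cokernelsE[OF distinguished_exact(5)[OF M], of 0] n z by (auto simp: numeral_2_eq_2)
  obtain S2 i1 i2 p1 p2 where S2: "biproduct \<C> (obj M 2) D S2 i1 i2 p1 p2"
    using biproduct_exists[OF Ob(3,1)] by blast
  obtain S3 j1 j2 q1 q2 where S3: "biproduct \<C> (obj M 3) (obj M 1) S3 j1 j2 q1 q2"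
    using biproduct_exists[OF Ob(4,2)] by blast
  note B2 = biproductD[OF S2 Ob(3,1)] and B3 = biproductD[OF S3 Ob(4,2)]
  note pair2 = biproduct_pairing[OF S2 Ob(3,1)] and pair3 = biproduct_pairing[OF S3 Ob(4,2)]
  let ?e = "Id \<C> D \<boxplus> \<boxminus> (\<alpha> \<cdot> \<beta>)"
  have e: "?e \<proportion> D \<rightarrow> D" using \<alpha> \<beta> by algebra
  define D1 where "D1 = i1 \<cdot> (dif M 1 \<cdot> \<beta>) \<boxplus> i2 \<cdot> ?e"
  define D2 where "D2 = j1 \<cdot> (dif M 2 \<cdot> p1) \<boxplus> j2 \<cdot> (r \<cdot> p1 \<boxplus> \<boxminus> (\<beta> \<cdot> p2))"
  have d\<beta>: "dif M 1 \<cdot> \<beta> \<proportion> D \<rightarrow> obj M 2" using d \<beta> by algebra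
  have D1: "D1 \<proportion> D \<rightarrow> S2" "p1 \<cdot> D1 = dif M 1 \<cdot> \<beta>" "p2 \<cdot> D1 = ?e"
    unfolding D1_def using pair2[OF d\<beta> e] by auto
  have rows2: "dif M 2 \<cdot> p1 \<proportion> S2 \<rightarrow> obj M 3" "r \<cdot> p1 \<boxplus> \<boxminus> (\<beta> \<cdot> p2) \<proportion> S2 \<rightarrow> obj M 1"
    using d r \<beta> B2(1-4) by (algebra, algebra)
  have D2: "D2 \<proportion> S2 \<rightarrow> S3" "q1 \<cdot> D2 = dif M 2 \<cdot> p1" "q2 \<cdot> D2 = r \<cdot> p1 \<boxplus> \<boxminus> (\<beta> \<cdot> p2)"
    unfolding D2_def using pair3[OF rows2] by auto
  define N where "N = \<lparr>obj = (obj M)(1 := D, 2 := S2, 3 := S3),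
      dif = (dif M)(0 := x, 1 := D1, 2 := D2, 3 := dif M 3 \<cdot> q1)\<rparr>"
  have N: "obj N 0 = ?A" "obj N 1 = D" "obj N 2 = S2" "obj N 3 = S3" "\<And>i. i \<ge> 4 \<Longrightarrow> obj N i = obj M i"
    "dif N 0 = x" "dif N 1 = D1" "dif N 2 = D2" "dif N 3 = dif M 3 \<cdot> q1" "\<And>i. i \<ge> 4 \<Longrightarrow> dif N i = dif M i"
    by (auto simp: N_def)
  have N': "obj N (Suc 0) = D" "obj N (Suc (Suc 0)) = S2" "obj N (Suc (Suc (Suc 0))) = S3"
     "dif N (Suc 0) = D1" "dif N (Suc (Suc 0)) = D2" "dif N (Suc (Suc (Suc 0))) = dif M 3 \<cdot> q1"
    using N by (simp_all add: numeral_2_eq_2 numeral_3_eq_3)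
  have SOb: "S2 \<in> Ob \<C>" "S3 \<in> Ob \<C>" using B2(1) B3(1) by (simp_all add: maps_unfold)
  have cases4: "i = 0 \<or> i = 1 \<or> i = 2 \<or> i = 3 \<or> i \<ge> 4" for i :: nat by linarith
  have Suc_num [simp]: "Suc (Suc 0) = 2" by simp
  have Nc: "cochain_complex n \<C> N"
    unfolding cochain_complex_iff
  proof (intro conjI allI impI)
    fix i assume i: "i \<le> Suc n"
    show "obj N i \<in> Ob \<C>"
      using cases4[of i] N complex_Ob[OF Mc(1) i] Ob SOb Mc(4) by (elim disjE) simp_all
  next
    fix i assume i: "i \<le> n"
    consider "i = 0" | "i = 1" | "i = 2" | "i = 3" | "i \<ge> 4" using cases4[of i] by blast
    then show "dif N i \<proportion> obj N i \<rightarrow> obj N (Suc i)"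
    proof cases
      case 4
      then have "dif M 3 \<proportion> obj M 3 \<rightarrow> obj M 4" using d3 i by simp
      then show ?thesis using 4 N B3(3)  by (auto intro: maps_comp)
    next
      case 5
      then show ?thesis using N complex_dif[OF Mc(1) i] by simp
    qed (use N N' x D1(1) D2(1)  in simp_all)
  next
    fix i assume i: "i < n"
    consider "i = 0" | "i = 1" | "i = 2" | "i = 3" | "i \<ge> 4" using cases4[of i] by blast
    then show "dif N (Suc i) \<cdot> dif N i = zero (obj N i) (obj N (Suc (Suc i)))"
    proof cases
      case 1
      have "p1 \<cdot> D1 \<cdot> x = p1 \<cdot> zero ?A S2"
      proof -
        have "p1 \<cdot> D1 \<cdot> x = dif M 1 \<cdot> (\<beta> \<cdot> x)" using comp_rewrite[OF D1(2)] B2(3) D1(1) x d \<beta> by algebra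
        then show ?thesis using \<beta>x dd(1) B2(3) x by (simp add: maps_unfold)
      qed
      moreover have "p2 \<cdot> D1 \<cdot> x = p2 \<cdot> zero ?A S2"
      proof -
        have "p2 \<cdot> D1 \<cdot> x = x \<boxplus> \<boxminus> (\<alpha> \<cdot> (\<beta> \<cdot> x))" using comp_rewrite[OF D1(3)] B2(4) D1(1) x \<alpha> \<beta> by algebra
        then show ?thesis using \<beta>x \<alpha>x B2(4) x by (simp add: maps_unfold)
      qed
      moreover have "zero ?A S2 \<proportion> ?A \<rightarrow> S2" using x D1 by algebra
      ultimately have "D1 \<cdot> x = zero ?A S2"
        using biproduct_into_eqI[OF S2 Ob(3,1) maps_comp[OF x D1(1)]] by blast
      then show ?thesis using 1 N N' by simp
    next
      case 2
      have "q1 \<cdot> D2 \<cdot> D1 = q1 \<cdot> zero D S3"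
        using comp_rewrite[OF D2(2)] D1(2) comp_rewrite[OF dd(2)] B3(3) B2(3) D1(1) D2(1) d \<beta> by algebra
      moreover have "q2 \<cdot> D2 \<cdot> D1 = q2 \<cdot> zero D S3"
      proof -
        have "q2 \<cdot> D2 \<cdot> D1 = r \<cdot> (p1 \<cdot> D1) \<boxplus> \<boxminus> (\<beta> \<cdot> (p2 \<cdot> D1))"
          using comp_rewrite[OF D2(3)] B3(4) B2(3,4) D1(1) D2(1) r(1) \<beta> by algebra
        also have "\<dots> = q2 \<cdot> zero D S3" unfolding D1(2,3)
          using comp_rewrite[OF r(2)] B3(4) D2(1) d r(1) \<alpha> \<beta> by algebra
        finally show ?thesis .
      qed
      moreover have "zero D S3 \<proportion> D \<rightarrow> S3" using D1(1) D2(1) by algebra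
      ultimately have "D2 \<cdot> D1 = zero D S3"
        using biproduct_into_eqI[OF S3 Ob(4,2) maps_comp[OF D1(1) D2(1)]] by blast
      then show ?thesis using 2 N N' by simp
    next
      case 3
      then have "n \<ge> 3" using i by simp
      note d3 = d3[OF this]
      have "(dif M 3 \<cdot> q1) \<cdot> D2 = zero S2 (obj M 4)"
        using D2(2) comp_rewrite[OF d3(2)] d3(1) B3(3) B2(3) D2(1) d(3) by algebra
      then show ?thesis using 3 N  by simp
    next
      case 4
      then have "n \<ge> 3" "dif M 4 \<proportion> obj M 4 \<rightarrow> obj M 5" "dif M 4 \<cdot> dif M 3 = zero (obj M 3) (obj M 5)"
        using i complex_dif[OF Mc(1), of 4] complex_dif_dif[OF Mc(1), of 3] by simp_all
      then have "dif M 4 \<cdot> dif M 3 \<cdot> q1 = zero S3 (obj M 5)"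
        using comp_rewrite[of "dif M 4" "dif M 3"] d3(1) B3(3) by (simp add: maps_unfold)
      then show ?thesis using 4 N  by simp
    next
      case 5
      then show ?thesis using N complex_dif_dif[OF Mc(1) i] by simp
    qed
  qed
  let ?E = "obj N (Suc n)"
  have Nb: "N \<in> complexes_between n \<C> ?A ?E" using Nc N(1) by (simp add: complexes_between_def)
  \<comment> \<open>\<open>G\<close> projects to \<open>M\<close>. In degree \<open>2\<close> the inclusion of \<open>M\<^sup>2\<close> does not commute with the differentials;
    \<open>K\<close> corrects it by means of \<open>r\<close>.\<close>
  define G where "G = (\<lambda>i. Id \<C> (obj M i))(1 := \<beta>, 2 := p1, 3 := q1)"
  define K where "K = i1 \<cdot> (Id \<C> (obj M 2) \<boxplus> \<boxminus> (dif M 1 \<cdot> r)) \<boxplus> i2 \<cdot> (\<alpha> \<cdot> r)"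
  define H where "H = (\<lambda>i. Id \<C> (obj M i))(1 := \<alpha>, 2 := K, 3 := j1)"
  have G: "G 0 = Id \<C> ?A" "G 1 = \<beta>" "G 2 = p1" "G 3 = q1" "\<And>i. i \<ge> 4 \<Longrightarrow> G i = Id \<C> (obj M i)"
    and H: "H 0 = Id \<C> ?A" "H 1 = \<alpha>" "H 2 = K" "H 3 = j1" "\<And>i. i \<ge> 4 \<Longrightarrow> H i = Id \<C> (obj M i)"
    by (auto simp: G_def H_def)
  have Krows: "Id \<C> (obj M 2) \<boxplus> \<boxminus> (dif M 1 \<cdot> r) \<proportion> obj M 2 \<rightarrow> obj M 2" "\<alpha> \<cdot> r \<proportion> obj M 2 \<rightarrow> D"
    using d r \<alpha> by (algebra, algebra)
  have K: "K \<proportion> obj M 2 \<rightarrow> S2" "p1 \<cdot> K = Id \<C> (obj M 2) \<boxplus> \<boxminus> (dif M 1 \<cdot> r)" "p2 \<cdot> K = \<alpha> \<cdot> r"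
    unfolding K_def using pair2[OF Krows] by auto
  have Gc: "chain_map n \<C> N M G"
    unfolding chain_map_iff[OF Nc Mc(1)]
  proof (intro conjI allI impI)
    fix i assume i: "i \<le> Suc n"
    show "G i \<proportion> obj N i \<rightarrow> obj M i"
      using cases4[of i] N G \<beta> B2(3) B3(3) maps_Id[OF complex_Ob[OF Mc(1) i]] by (elim disjE) simp_all
  next
    fix i assume i: "i \<le> n"
    consider "i = 0" | "i = 1" | "i = 2" | "i = 3" | "i \<ge> 4" using cases4[of i] by blast
    then show "G (Suc i) \<cdot> dif N i = dif M i \<cdot> G i"
    proof cases
      case 4
      then have "dif M 3 \<proportion> obj M 3 \<rightarrow> obj M 4" using d3 i by simp
      then show ?thesis using 4 N G  B3(3) by (simp add: maps_unfold)
    next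
      case 5
      then show ?thesis using N G complex_dif[OF Mc(1) i] by (simp add: maps_unfold)
    qed (use N G  \<beta>x d D1(2) D2(2) in \<open>simp_all add: maps_unfold\<close>)
  qed
  have Hc: "chain_map n \<C> M N H"
    unfolding chain_map_iff[OF Mc(1) Nc]
  proof (intro conjI allI impI)
    fix i assume i: "i \<le> Suc n"
    show "H i \<proportion> obj M i \<rightarrow> obj N i"
      using cases4[of i] N H \<alpha> K(1) B3(1) maps_Id[OF complex_Ob[OF Mc(1) i]] by (elim disjE) simp_all
  next
    fix i assume i: "i \<le> n"
    consider "i = 0" | "i = 1" | "i = 2" | "i = 3" | "i \<ge> 4" using cases4[of i] by blast
    then show "H (Suc i) \<cdot> dif M i = dif N i \<cdot> H i"
    proof cases
      case 1
      then show ?thesis using N H  \<alpha>x x by (simp add: maps_unfold)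
    next
      case 2
      have "p1 \<cdot> K \<cdot> dif M 1 = dif M 1 \<boxplus> \<boxminus> (dif M 1 \<cdot> (r \<cdot> dif M 1))"
        using comp_rewrite[OF K(2)] K(1) d r(1) B2(3) by algebra
      also have "\<dots> = dif M 1 \<cdot> \<beta> \<cdot> \<alpha>" unfolding r(2) using d \<alpha> \<beta> by algebra
      also have "\<dots> = p1 \<cdot> D1 \<cdot> \<alpha>" using comp_rewrite[OF D1(2)] D1(1) d \<alpha> \<beta> B2(3) by algebra
      finally have 1: "p1 \<cdot> K \<cdot> dif M 1 = p1 \<cdot> D1 \<cdot> \<alpha>" .
      have "p2 \<cdot> K \<cdot> dif M 1 = \<alpha> \<cdot> (r \<cdot> dif M 1)"
        using comp_rewrite[OF K(3)] K(1) d \<alpha> r(1) B2(4) by algebra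
      also have "\<dots> = ?e \<cdot> \<alpha>" unfolding r(2) using \<alpha> \<beta> by algebra
      also have "\<dots> = p2 \<cdot> D1 \<cdot> \<alpha>" using comp_rewrite[OF D1(3)] D1(1) \<alpha> \<beta> B2(4) by algebra
      finally have 3: "p2 \<cdot> K \<cdot> dif M 1 = p2 \<cdot> D1 \<cdot> \<alpha>" .
      have "K \<cdot> dif M 1 = D1 \<cdot> \<alpha>"
        by (rule biproduct_into_eqI[OF S2 Ob(3,1) maps_comp[OF d(2) K(1)] maps_comp[OF \<alpha> D1(1)] 1 3])
      then show ?thesis using 2 N H  by simp
    next
      case 3
      have "q1 \<cdot> D2 \<cdot> K = dif M 2 \<cdot> (p1 \<cdot> K)" using comp_rewrite[OF D2(2)] D2(1) K(1) d B2(3) B3(3) by algebra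
      also have "\<dots> = q1 \<cdot> j1 \<cdot> dif M 2" unfolding K(2)
        using comp_rewrite[OF dd(2)] comp_rewrite[OF B3(5)] d r(1) B3(1,3) by algebra
      finally have 1: "q1 \<cdot> j1 \<cdot> dif M 2 = q1 \<cdot> D2 \<cdot> K" by simp
      have "q2 \<cdot> D2 \<cdot> K = r \<cdot> (p1 \<cdot> K) \<boxplus> \<boxminus> (\<beta> \<cdot> (p2 \<cdot> K))"
        using comp_rewrite[OF D2(3)] D2(1) K(1) r(1) \<beta> B2(3,4) B3(4) by algebra
      also have "\<dots> = r \<boxplus> \<boxminus> ((r \<cdot> dif M 1) \<cdot> r) \<boxplus> \<boxminus> (\<beta> \<cdot> \<alpha> \<cdot> r)" unfolding K(2,3)
        using r(1) \<alpha> \<beta> d by algebra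
      also have "\<dots> = q2 \<cdot> j1 \<cdot> dif M 2" unfolding r(2)
        using comp_rewrite[OF B3(8)] d r(1) \<alpha> \<beta> B3(1,4) by algebra
      finally have 2: "q2 \<cdot> j1 \<cdot> dif M 2 = q2 \<cdot> D2 \<cdot> K" by simp
      have "j1 \<cdot> dif M 2 = D2 \<cdot> K"
        by (rule biproduct_into_eqI[OF S3 Ob(4,2) maps_comp[OF d(3) B3(1)] maps_comp[OF K(1) D2(1)] 1 2])
      then show ?thesis using 3 N H  by simp
    next
      case 4
      then have "dif M 3 \<proportion> obj M 3 \<rightarrow> obj M 4" using d3 i by simp
      then show ?thesis using 4 N H  B3(1,3,5) by (simp add: maps_unfold assoc)
    next
      case 5
      then show ?thesis using N H complex_dif[OF Mc(1) i] by (simp add: maps_unfold)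
    qed
  qed
  let ?\<pi> = "G (Suc n)" and ?\<iota> = "H (Suc n)"
  have \<pi>: "?\<pi> \<proportion> ?E \<rightarrow> obj M (Suc n)" using chain_map_maps[OF Nc Mc(1) Gc, of "Suc n"] by simp
  have \<pi>\<iota>: "?\<pi> \<cdot> ?\<iota> = Id \<C> (obj M (Suc n))"
    using cases4[of "Suc n"] n G H B3(5)  Mc(5) by auto
  \<comment> \<open>The first component of \<open>u\<close> is solved by \<open>m\<close>; what \<open>r m\<close> leaves of the second component lies in \<open>M\<^sup>1\<close>,
    and is reached by means of \<open>r d\<^sub>1 + \<beta>\<alpha> = 1\<close>.\<close>
  have lift2: "\<exists>v. v \<proportion> W \<rightarrow> S2 \<and> D2 \<cdot> v = u"
    if u: "u \<proportion> W \<rightarrow> S3" and m: "m \<proportion> W \<rightarrow> obj M 2" "dif M 2 \<cdot> m = q1 \<cdot> u" for W u m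
  proof -
    let ?w = "q2 \<cdot> u \<boxplus> \<boxminus> (r \<cdot> m)"
    have w: "?w \<proportion> W \<rightarrow> obj M 1" using u m r B3(4) by algebra
    have c: "m \<boxplus> dif M 1 \<cdot> ?w \<proportion> W \<rightarrow> obj M 2" "\<boxminus> (\<alpha> \<cdot> ?w) \<proportion> W \<rightarrow> D" using m d w \<alpha> by (algebra, algebra)
    let ?v = "i1 \<cdot> (m \<boxplus> dif M 1 \<cdot> ?w) \<boxplus> i2 \<cdot> (\<boxminus> (\<alpha> \<cdot> ?w))"
    note v = pair2[OF c]
    have "q1 \<cdot> D2 \<cdot> ?v = dif M 2 \<cdot> (p1 \<cdot> ?v)"
      using comp_rewrite[OF D2(2)] D2(1) v(1) d B2(3) B3(3) by (simp add: maps_unfold assoc)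
    also have "\<dots> = dif M 2 \<cdot> m" unfolding v(2) using comp_rewrite[OF dd(2)] d m(1) w
      by (simp add: maps_unfold comp_add)
    finally have 1: "q1 \<cdot> D2 \<cdot> ?v = q1 \<cdot> u" using m(2) by simp
    have "q2 \<cdot> D2 \<cdot> ?v = r \<cdot> (p1 \<cdot> ?v) \<boxplus> \<boxminus> (\<beta> \<cdot> (p2 \<cdot> ?v))"
      using comp_rewrite[OF D2(3)] D2(1) v(1) r(1) \<beta> B2(3,4) B3(4) by (simp add: maps_unfold assoc add_comp neg_comp)
    also have "\<dots> = r \<cdot> m \<boxplus> ((r \<cdot> dif M 1) \<boxplus> \<beta> \<cdot> \<alpha>) \<cdot> ?w" unfolding v(2,3)
      using r(1) \<alpha> \<beta> d m(1) u B3(4) by algebra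
    also have "\<dots> = q2 \<cdot> u" unfolding r(2) using r(1) \<alpha> \<beta> d m(1) u B3(4) by algebra
    finally have 2: "q2 \<cdot> D2 \<cdot> ?v = q2 \<cdot> u" .
    have "D2 \<cdot> ?v = u" by (rule biproduct_into_eqI[OF S3 Ob(4,2) maps_comp[OF v(1) D2(1)] u 1 2])
    then show ?thesis using v(1) by blast
  qed
  have lift3: "\<exists>v. v \<proportion> W \<rightarrow> S3 \<and> (dif M 3 \<cdot> q1) \<cdot> v = u"
    if "n \<ge> 3" and m: "m \<proportion> W \<rightarrow> obj M 3" "dif M 3 \<cdot> m = u" for W u m
  proof (intro exI conjI)
    show "j1 \<cdot> m \<proportion> W \<rightarrow> S3" using m B3(1) maps_comp by blast
    show "(dif M 3 \<cdot> q1) \<cdot> j1 \<cdot> m = u"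
      using comp_rewrite[OF B3(5)] d3(1)[OF that(1)] m B3(1,3) by (simp add: maps_unfold assoc)
  qed
  have "weak_kernels n N"
    unfolding weak_kernels_def
  proof (intro allI impI)
    fix i W u assume i: "i < n" and u: "u \<proportion> W \<rightarrow> obj N (Suc i)"
      and du: "dif N (Suc i) \<cdot> u = zero W (obj N (Suc (Suc i)))"
    consider "i = 0" | "i = 1" | "i = 2" | "i = 3" | "i \<ge> 4" using cases4[of i] by blast
    then show "\<exists>v. v \<proportion> W \<rightarrow> obj N i \<and> dif N i \<cdot> v = u"
    proof cases
      case 1
      have u: "u \<proportion> W \<rightarrow> D" and du: "D1 \<cdot> u = zero W S2" using u du 1 N' by auto
      have "dif M 1 \<cdot> \<beta> \<cdot> u = p1 \<cdot> (D1 \<cdot> u)" using comp_rewrite[OF D1(2)] D1(1) d \<beta> u B2(3) by algebra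
      then have "dif M 1 \<cdot> (\<beta> \<cdot> u) = zero W (obj M 2)" unfolding du using B2(3) u by (simp add: maps_unfold)
      moreover have "\<beta> \<cdot> u \<proportion> W \<rightarrow> obj M 1" using \<beta> u maps_comp by blast
      ultimately obtain a where a: "a \<proportion> W \<rightarrow> ?A" "dif M 0 \<cdot> a = \<beta> \<cdot> u"
        using weak_kernelsE[OF wk, of 0 "\<beta> \<cdot> u" W] n by auto
      have "u \<boxplus> \<boxminus> (\<alpha> \<cdot> (\<beta> \<cdot> u)) = p2 \<cdot> (D1 \<cdot> u)" using comp_rewrite[OF D1(3)] D1(1) \<alpha> \<beta> u B2(4) by algebra
      also have "\<dots> = zero W D" unfolding du using B2(4) u by (simp add: maps_unfold)
      finally have uz: "u \<boxplus> \<boxminus> (\<alpha> \<cdot> (\<beta> \<cdot> u)) = zero W D" .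
      have "u = (u \<boxplus> \<boxminus> (\<alpha> \<cdot> (\<beta> \<cdot> u))) \<boxplus> \<alpha> \<cdot> (\<beta> \<cdot> u)" using \<alpha> \<beta> u by algebra
      also have "\<dots> = \<alpha> \<cdot> (dif M 0 \<cdot> a)" unfolding uz a(2) using \<alpha> \<beta> u by algebra
      also have "\<dots> = x \<cdot> a" using comp_rewrite[OF \<alpha>x] \<alpha> d a(1) by (simp add: maps_unfold)
      finally show ?thesis using a(1) 1 N by auto
    next
      case 2
      have u: "u \<proportion> W \<rightarrow> S2" and du: "D2 \<cdot> u = zero W S3" using u du 2 N' by auto
      have "dif M 2 \<cdot> (p1 \<cdot> u) = q1 \<cdot> (D2 \<cdot> u)" using comp_rewrite[OF D2(2)] D2(1) d u B2(3) B3(3) by algebra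
      then have "dif M 2 \<cdot> (p1 \<cdot> u) = zero W (obj M 3)" unfolding du using B3(3) u by (simp add: maps_unfold)
      moreover have m: "p1 \<cdot> u \<proportion> W \<rightarrow> obj M 2" using B2(3) u maps_comp by blast
      ultimately obtain v where v: "v \<proportion> W \<rightarrow> obj M 1" "dif M 1 \<cdot> v = p1 \<cdot> u"
        using weak_kernelsE[OF wk, of 1 "p1 \<cdot> u" W] n by auto
      have "r \<cdot> (p1 \<cdot> u) \<boxplus> \<boxminus> (\<beta> \<cdot> (p2 \<cdot> u)) = q2 \<cdot> (D2 \<cdot> u)" using comp_rewrite[OF D2(3)] D2(1) r(1) \<beta> u B2(3,4) B3(4)
        by algebra
      also have "\<dots> = zero W (obj M 1)" unfolding du using B3(4) u by (simp add: maps_unfold)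
      finally have rz: "r \<cdot> (p1 \<cdot> u) \<boxplus> \<boxminus> (\<beta> \<cdot> (p2 \<cdot> u)) = zero W (obj M 1)" .
      \<comment> \<open>The preimage in \<open>D\<close> of the pair \<open>u\<close>; it satisfies \<open>\<beta> w = v\<close> because \<open>\<beta> p\<^sub>2 u = r p\<^sub>1 u = r d\<^sub>1 v\<close>.\<close>
      let ?w = "\<alpha> \<cdot> v \<boxplus> p2 \<cdot> u"
      have w: "?w \<proportion> W \<rightarrow> D" using \<alpha> v u B2(4) by algebra
      have "\<beta> \<cdot> (p2 \<cdot> u) = r \<cdot> (p1 \<cdot> u) \<boxplus> \<boxminus> (r \<cdot> (p1 \<cdot> u) \<boxplus> \<boxminus> (\<beta> \<cdot> (p2 \<cdot> u)))"
        using \<beta> u r(1) B2(3,4) by algebra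
      also have "\<dots> = (r \<cdot> dif M 1) \<cdot> v"
        unfolding rz unfolding v(2)[symmetric] using v(1) r(1) d by algebra
      finally have \<beta>p: "\<beta> \<cdot> (p2 \<cdot> u) = (r \<cdot> dif M 1) \<cdot> v" .
      have "\<beta> \<cdot> ?w = \<beta> \<cdot> \<alpha> \<cdot> v \<boxplus> \<beta> \<cdot> (p2 \<cdot> u)"
        using \<alpha> \<beta> v(1) u B2(4) by algebra
      also have "\<dots> = \<beta> \<cdot> \<alpha> \<cdot> v \<boxplus> (r \<cdot> dif M 1) \<cdot> v" unfolding \<beta>p ..
      also have "\<dots> = v" unfolding r(2) using \<alpha> \<beta> v(1) by algebra
      finally have \<beta>w: "\<beta> \<cdot> ?w = v" .
      have "p1 \<cdot> D1 \<cdot> ?w = dif M 1 \<cdot> (\<beta> \<cdot> ?w)" using comp_rewrite[OF D1(2)] D1(1) d \<beta> w B2(3)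
        by (simp add: maps_unfold assoc)
      then have 1: "p1 \<cdot> D1 \<cdot> ?w = p1 \<cdot> u" unfolding \<beta>w v(2) .
      have "p2 \<cdot> D1 \<cdot> ?w = ?w \<boxplus> \<boxminus> (\<alpha> \<cdot> (\<beta> \<cdot> ?w))"
        using comp_rewrite[OF D1(3)] D1(1) \<alpha> \<beta> w B2(4) by (simp add: maps_unfold assoc add_comp neg_comp)
      then have "p2 \<cdot> D1 \<cdot> ?w = ?w \<boxplus> \<boxminus> (\<alpha> \<cdot> v)" unfolding \<beta>w .
      moreover have "?w \<boxplus> \<boxminus> (\<alpha> \<cdot> v) = p2 \<cdot> u" using \<alpha> v(1) u B2(4) by algebra
      ultimately have "p2 \<cdot> D1 \<cdot> ?w = p2 \<cdot> u" by simp
      then have "D1 \<cdot> ?w = u" using biproduct_into_eqI[OF S2 Ob(3,1) maps_comp[OF w D1(1)] u 1] by blast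
      then show ?thesis using w 2 N by auto
    next
      case 3
      then have n3: "n \<ge> 3" using i by simp
      have u: "u \<proportion> W \<rightarrow> S3" and du: "(dif M 3 \<cdot> q1) \<cdot> u = zero W (obj M 4)" using u du 3 N  by auto
      have "dif M 3 \<cdot> (q1 \<cdot> u) = zero W (obj M 4)" using du d3(1)[OF n3] u B3(3) by (simp add: maps_unfold assoc)
      moreover have "q1 \<cdot> u \<proportion> W \<rightarrow> obj M 3" using B3(3) u maps_comp by blast
      ultimately obtain m where "m \<proportion> W \<rightarrow> obj M 2" "dif M 2 \<cdot> m = q1 \<cdot> u"
        using weak_kernelsE[OF wk, of 2 "q1 \<cdot> u" W] n3  by auto
      then show ?thesis using lift2[OF u] 3 N by auto
    next
      case 4
      then have n3: "n \<ge> 3" and N4: "obj N (Suc i) = obj M 4" "dif N (Suc i) = dif M 4"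
        "obj N (Suc (Suc i)) = obj M (Suc (Suc i))"
        using i N  by auto
      then obtain m where "m \<proportion> W \<rightarrow> obj M 3" "dif M 3 \<cdot> m = u"
        using weak_kernelsE[OF wk i, of u W] u du 4  by auto
      then show ?thesis using lift3[OF n3] 4 N by auto
    next
      case 5
      then show ?thesis using weak_kernelsE[OF wk i, of u W] u du N by (metis le_SucI)
    qed
  qed
  moreover have "pull \<C> \<E> ?A (dif N n) (pull \<C> \<E> ?A ?\<pi> \<delta>) = \<one>\<^bsub>Ext \<E> (obj N n) ?A\<^esub>"
  proof -
    have dn: "dif N n \<proportion> obj N n \<rightarrow> ?E" "dif M n \<proportion> obj M n \<rightarrow> obj M (Suc n)" "G n \<proportion> obj N n \<rightarrow> obj M n"
      using complex_dif[OF Nc, of n] complex_dif[OF Mc(1), of n] chain_map_maps[OF Nc Mc(1) Gc, of n] by simp_all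
    have "pull \<C> \<E> ?A (dif N n) (pull \<C> \<E> ?A ?\<pi> \<delta>) = pull \<C> \<E> ?A (?\<pi> \<cdot> dif N n) \<delta>"
      by (rule pull_pull[OF Mc(4) \<pi> dn(1) \<delta>])
    also have "?\<pi> \<cdot> dif N n = dif M n \<cdot> G n" using chain_map_commute[OF Nc Mc(1) Gc] by simp
    also have "pull \<C> \<E> ?A (dif M n \<cdot> G n) \<delta> = pull \<C> \<E> ?A (G n) (pull \<C> \<E> ?A (dif M n) \<delta>)"
      by (rule pull_pull[OF Mc(4) dn(2,3) \<delta>, symmetric])
    also have "\<dots> = \<one>\<^bsub>Ext \<E> (obj N n) ?A\<^esub>"
      using distinguished_exact(2)[OF M] pull_zero[OF Mc(4) dn(3)] by (simp add: left_exact_def)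
    finally show ?thesis .
  qed
  moreover have "\<exists>v. v \<proportion> W \<rightarrow> obj N n \<and> dif N n \<cdot> v = u"
    if u: "u \<proportion> W \<rightarrow> ?E" and u0: "pull \<C> \<E> ?A u (pull \<C> \<E> ?A ?\<pi> \<delta>) = \<one>\<^bsub>Ext \<E> W ?A\<^esub>" for W u
  proof -
    have "?\<pi> \<cdot> u \<proportion> W \<rightarrow> obj M (Suc n)" using u \<pi> maps_comp by blast
    moreover have "pull \<C> \<E> ?A (?\<pi> \<cdot> u) \<delta> = \<one>\<^bsub>Ext \<E> W ?A\<^esub>" using pull_pull[OF Mc(4) \<pi> u \<delta>] u0 by simp
    ultimately obtain m where m: "m \<proportion> W \<rightarrow> obj M n" "dif M n \<cdot> m = ?\<pi> \<cdot> u"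
      using distinguished_exact(2)[OF M] unfolding left_exact_def by blast
    consider "n = 2" | "n = 3" | "n \<ge> 4" using n by linarith
    then show ?thesis
    proof cases
      case 1
      then show ?thesis using lift2[of u W m] u m N G  by auto
    next
      case 2
      have "u = dif M 3 \<cdot> m" using m u 2 N G  by (auto simp: maps_unfold)
      then show ?thesis using lift3[of m W u] m 2 N by auto
    next
      case 3
      then show ?thesis using m u N G by (auto simp: maps_unfold)
    qed
  qed
  ultimately have lN: "left_exact n N (pull \<C> \<E> ?A ?\<pi> \<delta>)" using N(1) by (simp add: left_exact_def)
  have "dist N (pull \<C> \<E> ?A ?\<pi> \<delta>)"
    by (rule distinguished_by_domination[OF n1 M Nb \<pi> lN _ _ \<pi>\<iota>])
      (use Gc Hc G(1) H(1) in \<open>simp_all add: lift_def\<close>)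
  then show ?thesis unfolding inflation_def using N by auto
qed

text \<open>
  For \<open>n = 1\<close> the middle object can only be replaced along an isomorphism.
\<close>

lemma inflation_of_short_isomorphism:
  assumes n: "n = 1" and M: "dist M \<delta>"
    and \<alpha>: "\<alpha> \<proportion> obj M 1 \<rightarrow> D" and \<beta>: "\<beta> \<proportion> D \<rightarrow> obj M 1" and \<alpha>\<beta>: "\<alpha> \<cdot> \<beta> = Id \<C> D" "\<beta> \<cdot> \<alpha> = Id \<C> (obj M 1)"
    and x: "x \<proportion> obj M 0 \<rightarrow> D" and \<alpha>x: "\<alpha> \<cdot> dif M 0 = x"
  shows "inflation n \<C> \<E> \<ss> (obj M 0) D x"
proof -
  note Mb = distinguished_complex(1)[OF M]
  note Mc = complexes_betweenD[OF Mb]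
  let ?A = "obj M 0" and ?C = "obj M (Suc n)"
  have d: "dif M 0 \<proportion> ?A \<rightarrow> obj M 1" "dif M 1 \<proportion> obj M 1 \<rightarrow> obj M 2"
    using complex_dif[OF Mc(1), of 0] complex_dif[OF Mc(1), of 1] n by (simp_all add: numeral_2_eq_2)
  have dd: "dif M 1 \<cdot> dif M 0 = zero ?A (obj M 2)" using complex_dif_dif[OF Mc(1), of 0] n
    by (simp add: numeral_2_eq_2)
  have \<beta>x: "\<beta> \<cdot> x = dif M 0" using comp_rewrite[OF \<alpha>\<beta>(2)] \<alpha>x \<alpha> \<beta> d by (auto simp: maps_unfold)
  define N where "N = \<lparr>obj = (obj M)(1 := D), dif = (dif M)(0 := x, 1 := dif M 1 \<cdot> \<beta>)\<rparr>"
  have N: "obj N 0 = ?A" "obj N 1 = D" "obj N 2 = obj M 2" "dif N 0 = x" "dif N 1 = dif M 1 \<cdot> \<beta>"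
    by (simp_all add: N_def)
  have Ob: "?A \<in> Ob \<C>" "D \<in> Ob \<C>" "obj M 1 \<in> Ob \<C>" "obj M 2 \<in> Ob \<C>" using d x by (simp_all add: maps_unfold)
  have le1: "i \<le> Suc n \<longleftrightarrow> i = 0 \<or> i = 1 \<or> i = 2" "i \<le> n \<longleftrightarrow> i = 0 \<or> i = 1" "i < n \<longleftrightarrow> i = 0" for i using n by auto
  have S [simp]: "Suc (Suc 0) = 2" by simp
  have "(dif M 1 \<cdot> \<beta>) \<cdot> x = zero ?A (obj M 2)" using \<beta>x dd x \<beta> d by (simp add: maps_unfold assoc)
  then have Nc: "cochain_complex n \<C> N"
    unfolding cochain_complex_iff le1 using N Ob x maps_comp[OF \<beta> d(2)] by auto
  have Nb: "N \<in> complexes_between n \<C> ?A ?C" using Nc N n by (simp add: complexes_between_def)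
  define f g where "f = (\<lambda>i. Id \<C> (obj M i))(1 := \<alpha>)" and "g = (\<lambda>i. Id \<C> (obj M i))(1 := \<beta>)"
  have fg: "f 0 = Id \<C> ?A" "f 1 = \<alpha>" "f 2 = Id \<C> (obj M 2)" "g 0 = Id \<C> ?A" "g 1 = \<beta>" "g 2 = Id \<C> (obj M 2)"
    by (simp_all add: f_def g_def)
  have "chain_map n \<C> M N f"
    unfolding chain_map_iff[OF Mc(1) Nc] le1
    using N fg \<alpha> \<alpha>x x d \<alpha>\<beta> \<beta> Ob by (auto simp: maps_Id maps_unfold assoc)
  moreover have "chain_map n \<C> N M g"
    unfolding chain_map_iff[OF Nc Mc(1)] le1
    using N fg \<beta> \<beta>x x d Ob by (auto simp: maps_Id maps_unfold assoc)
  moreover have "Suc n = 2" using n by simp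
  moreover have "g i \<cdot> f i = Id \<C> (obj M i)" "f i \<cdot> g i = Id \<C> (obj N i)" if "i \<le> Suc n" for i
    using le1(1)[of i] that fg \<alpha>\<beta> N Ob by auto
  ultimately have "homotopy_equivalent n \<C> ?A ?C M N"
    using fg by (intro homotopy_equivalent_of_iso[OF Mb Nb, of f g]) (simp_all add: lift_def)
  then have "dist N \<delta>" using distinguished_transfer[OF M Nb] by blast
  then show ?thesis unfolding inflation_def using N by auto
qed

end

section \<open>The ideal quotient of an additive category\<close>

locale ideal_category = additive_category \<C>
  for \<C> :: "('o, 'm) precategory" (structure) +
  fixes \<X> :: "'o set"
  assumes X_Ob: "\<X> \<subseteq> Ob \<C>" and X_sums: "finite_sum_closed \<C> \<X>"
begin

abbreviation Quot :: "('o, 'm set) precategory" where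
  "Quot \<equiv> ideal_quotient \<C> \<X>"

definition cls :: "'m \<Rightarrow> 'm set" where
  "cls f = residue \<C> \<X> (src f) (tgt f) f"

lemma factoring_iff:
  assumes "A \<in> Ob \<C>" "B \<in> Ob \<C>"
  shows "f \<in> factoring \<C> \<X> A B \<longleftrightarrow> (\<exists>Q u v. Q \<in> \<X> \<and> u \<proportion> A \<rightarrow> Q \<and> v \<proportion> Q \<rightarrow> B \<and> f = v \<cdot> u)"
proof
  assume "f \<in> factoring \<C> \<X> A B"
  then obtain Q u v where "Q \<in> \<X>" "u \<in> arrows \<C> A Q" "v \<in> arrows \<C> Q B" "f = v \<cdot> u"
    unfolding factoring_def by blast
  moreover from this(1) have "Q \<in> Ob \<C>" using X_Ob by blast
  ultimately have "Q \<in> \<X> \<and> u \<proportion> A \<rightarrow> Q \<and> v \<proportion> Q \<rightarrow> B \<and> f = v \<cdot> u"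
    using assms by (simp add: maps_def)
  then show "\<exists>Q u v. Q \<in> \<X> \<and> u \<proportion> A \<rightarrow> Q \<and> v \<proportion> Q \<rightarrow> B \<and> f = v \<cdot> u" by blast
next
  assume "\<exists>Q u v. Q \<in> \<X> \<and> u \<proportion> A \<rightarrow> Q \<and> v \<proportion> Q \<rightarrow> B \<and> f = v \<cdot> u"
  then show "f \<in> factoring \<C> \<X> A B" unfolding factoring_def maps_def by blast
qed

lemma factoring_maps:
  assumes "A \<in> Ob \<C>" "B \<in> Ob \<C>" "f \<in> factoring \<C> \<X> A B"
  shows "f \<proportion> A \<rightarrow> B"
proof -
  obtain Q u v where "u \<proportion> A \<rightarrow> Q" "v \<proportion> Q \<rightarrow> B" "f = v \<cdot> u"
    using assms(3) factoring_iff[OF assms(1,2)] by blast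
  then show ?thesis using maps_comp by simp
qed

text \<open>
  Two morphisms factoring through \<open>P\<close> and \<open>Q\<close> have a sum that factors through \<open>P \<oplus> Q\<close>.
\<close>

lemma factoring_add:
  assumes AB: "A \<in> Ob \<C>" "B \<in> Ob \<C>" and f: "f \<in> factoring \<C> \<X> A B" and g: "g \<in> factoring \<C> \<X> A B"
  shows "f \<boxplus> g \<in> factoring \<C> \<X> A B"
proof -
  obtain P u v where P: "P \<in> \<X>" "u \<proportion> A \<rightarrow> P" "v \<proportion> P \<rightarrow> B" "f = v \<cdot> u"
    using f factoring_iff[OF AB] by blast
  obtain Q u' v' where Q: "Q \<in> \<X>" "u' \<proportion> A \<rightarrow> Q" "v' \<proportion> Q \<rightarrow> B" "g = v' \<cdot> u'"
    using g factoring_iff[OF AB] by blast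
  have Ob: "P \<in> Ob \<C>" "Q \<in> Ob \<C>" using P Q X_Ob by auto
  obtain S i1 i2 p1 p2 where S: "biproduct \<C> P Q S i1 i2 p1 p2" using biproduct_exists[OF Ob] by blast
  note B = biproductD[OF S Ob] and pair = biproduct_pairing[OF S Ob P(2) Q(2)]
  have "(v \<cdot> p1 \<boxplus> v' \<cdot> p2) \<cdot> (i1 \<cdot> u \<boxplus> i2 \<cdot> u') = v \<cdot> (p1 \<cdot> (i1 \<cdot> u \<boxplus> i2 \<cdot> u')) \<boxplus> v' \<cdot> (p2 \<cdot> (i1 \<cdot> u \<boxplus> i2 \<cdot> u'))"
    using pair(1) P Q B(3,4) by (simp add: maps_unfold add_comp assoc)
  also have "\<dots> = f \<boxplus> g" unfolding pair(2,3) P(4) Q(4) ..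
  finally have "f \<boxplus> g = (v \<cdot> p1 \<boxplus> v' \<cdot> p2) \<cdot> (i1 \<cdot> u \<boxplus> i2 \<cdot> u')" ..
  moreover have "v \<cdot> p1 \<boxplus> v' \<cdot> p2 \<proportion> S \<rightarrow> B" using P Q B by algebra
  moreover have "S \<in> \<X>" using X_sums S P(1) Q(1) unfolding finite_sum_closed_def by blast
  ultimately show ?thesis using pair(1) factoring_iff[OF AB] by blast
qed

lemma factoring_neg:
  assumes AB: "A \<in> Ob \<C>" "B \<in> Ob \<C>" and f: "f \<in> factoring \<C> \<X> A B"
  shows "\<boxminus> f \<in> factoring \<C> \<X> A B"
proof -
  obtain P u v where P: "P \<in> \<X>" "u \<proportion> A \<rightarrow> P" "v \<proportion> P \<rightarrow> B" "f = v \<cdot> u"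
    using f factoring_iff[OF AB] by blast
  have "\<boxminus> f = (\<boxminus> v) \<cdot> u" "\<boxminus> v \<proportion> P \<rightarrow> B" unfolding P(4) using P(2,3) by (algebra, algebra)
  then show ?thesis using P factoring_iff[OF AB] by blast
qed

lemma factoring_zero:
  assumes AB: "A \<in> Ob \<C>" "B \<in> Ob \<C>"
  shows "zero A B \<in> factoring \<C> \<X> A B"
proof -
  obtain Z where "zero_object \<C> Z" using zero_object_exists by blast
  then have Z: "Z \<in> \<X>" "Z \<in> Ob \<C>" using X_sums X_Ob by (auto simp: finite_sum_closed_def)
  have "zero A B = zero Z B \<cdot> zero A Z" using AB Z by simp
  then show ?thesis using factoring_iff[OF AB] Z AB maps_zero by blast
qed

lemma factoring_comp:
  assumes f: "f \<in> factoring \<C> \<X> A B" "A \<in> Ob \<C>" "B \<in> Ob \<C>"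
  shows "g \<proportion> B \<rightarrow> D \<Longrightarrow> g \<cdot> f \<in> factoring \<C> \<X> A D"
    and "h \<proportion> D \<rightarrow> A \<Longrightarrow> f \<cdot> h \<in> factoring \<C> \<X> D B"
proof -
  obtain P u v where P: "P \<in> \<X>" "u \<proportion> A \<rightarrow> P" "v \<proportion> P \<rightarrow> B" "f = v \<cdot> u"
    using f factoring_iff by blast
  show "g \<cdot> f \<in> factoring \<C> \<X> A D" if g: "g \<proportion> B \<rightarrow> D"
  proof -
    have "g \<cdot> f = (g \<cdot> v) \<cdot> u" "g \<cdot> v \<proportion> P \<rightarrow> D" unfolding P(4) using P(2,3) g by (algebra, algebra)
    moreover have "D \<in> Ob \<C>" using g by (simp add: maps_def)
    ultimately show ?thesis using factoring_iff[of A D] f P by blast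
  qed
  show "f \<cdot> h \<in> factoring \<C> \<X> D B" if h: "h \<proportion> D \<rightarrow> A"
  proof -
    have "f \<cdot> h = v \<cdot> (u \<cdot> h)" "u \<cdot> h \<proportion> D \<rightarrow> P" unfolding P(4) using P(2,3) h by (algebra, algebra)
    moreover have "D \<in> Ob \<C>" using h by (simp add: maps_def)
    ultimately show ?thesis using factoring_iff[of D B] f P by blast
  qed
qed

lemma factoring_subgroup:
  assumes AB: "A \<in> Ob \<C>" "B \<in> Ob \<C>"
  shows "subgroup (factoring \<C> \<X> A B) (Hom \<C> A B)"
proof
  show "factoring \<C> \<X> A B \<subseteq> arrows \<C> A B" using factoring_maps[OF AB] by (auto simp: maps_def)
  show "\<one>\<^bsub>Hom \<C> A B\<^esub> \<in> factoring \<C> \<X> A B" using factoring_zero[OF AB] by (simp add: zero_def)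
  fix f assume f: "f \<in> factoring \<C> \<X> A B"
  show "inv\<^bsub>Hom \<C> A B\<^esub> f \<in> factoring \<C> \<X> A B"
    using factoring_neg[OF AB f] neg_eq[OF factoring_maps[OF AB f]] by simp
  fix g assume g: "g \<in> factoring \<C> \<X> A B"
  show "f \<otimes>\<^bsub>Hom \<C> A B\<^esub> g \<in> factoring \<C> \<X> A B"
    using factoring_add[OF AB f g] add_eq[OF factoring_maps[OF AB f]] by simp
qed

lemma factoring_normal:
  assumes AB: "A \<in> Ob \<C>" "B \<in> Ob \<C>"
  shows "factoring \<C> \<X> A B \<lhd> Hom \<C> A B"
  using comm_group.subgroup_imp_normal[OF hom_comm_group[OF AB] factoring_subgroup[OF AB]] .

lemma residue_cls: "f \<proportion> A \<rightarrow> B \<Longrightarrow> residue \<C> \<X> A B f = cls f"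
  by (simp add: cls_def maps_unfold)

lemma mem_cls_iff:
  assumes f: "f \<proportion> A \<rightarrow> B"
  shows "g \<in> cls f \<longleftrightarrow> g \<proportion> A \<rightarrow> B \<and> g \<boxplus> \<boxminus> f \<in> factoring \<C> \<X> A B"
proof -
  have AB: "A \<in> Ob \<C>" "B \<in> Ob \<C>" and fc: "f \<in> arrows \<C> A B" using f by (auto simp: maps_def)
  note G = hom_group[OF AB] and H = factoring_subgroup[OF AB]
  have "g \<in> cls f \<longleftrightarrow> g \<in> factoring \<C> \<X> A B #>\<^bsub>Hom \<C> A B\<^esub> f"
    using residue_cls[OF f] by (simp add: residue_def)
  moreover have "g \<in> factoring \<C> \<X> A B #>\<^bsub>Hom \<C> A B\<^esub> f \<Longrightarrow> g \<in> arrows \<C> A B"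
    using monoid.r_coset_subset_G[OF hom_monoid[OF AB] subgroup.subset[OF H] fc] by blast
  moreover have "g \<in> factoring \<C> \<X> A B #>\<^bsub>Hom \<C> A B\<^esub> f \<longleftrightarrow> g \<otimes>\<^bsub>Hom \<C> A B\<^esub> inv\<^bsub>Hom \<C> A B\<^esub> f \<in> factoring \<C> \<X> A B"
    if "g \<in> arrows \<C> A B"
    using subgroup.rcos_module[OF H G fc that] .
  ultimately show ?thesis using AB add_eq[of g A B] neg_eq[OF f] by (auto simp: maps_def)
qed

lemma cls_eq_iff:
  assumes f: "f \<proportion> A \<rightarrow> B" and g: "g \<proportion> A \<rightarrow> B"
  shows "cls f = cls g \<longleftrightarrow> f \<boxplus> \<boxminus> g \<in> factoring \<C> \<X> A B"
proof
  have AB: "A \<in> Ob \<C>" "B \<in> Ob \<C>" using f by (auto simp: maps_def)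
  have self: "f \<in> cls f" using mem_cls_iff[OF f] f factoring_zero[OF AB] by (simp add: maps_unfold)
  show "f \<boxplus> \<boxminus> g \<in> factoring \<C> \<X> A B" if "cls f = cls g"
    using self that mem_cls_iff[OF g] by simp
  show "cls f = cls g" if "f \<boxplus> \<boxminus> g \<in> factoring \<C> \<X> A B"
  proof -
    have "f \<in> cls g" using mem_cls_iff[OF g] f that by simp
    then have "cls g = factoring \<C> \<X> A B #>\<^bsub>Hom \<C> A B\<^esub> f"
      using group.repr_independence[OF hom_group[OF AB], of f "factoring \<C> \<X> A B" g]
        residue_cls[OF g] g factoring_subgroup[OF AB] by (simp add: residue_def maps_def)
    then show ?thesis using residue_cls[OF f] by (simp add: residue_def)
  qed
qed

lemma cls_self: "f \<proportion> A \<rightarrow> B \<Longrightarrow> f \<in> cls f"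
  using mem_cls_iff[of f A B f] factoring_zero[of A B] by (simp add: maps_unfold)

lemma quot_simps:
  "Ob Quot = Ob \<C>" "Hom Quot A B = Hom \<C> A B Mod factoring \<C> \<X> A B"
  "Id Quot A = residue \<C> \<X> A A (Id \<C> A)"
  by (simp_all add: ideal_quotient_def)

lemma quot_Id: "A \<in> Ob \<C> \<Longrightarrow> Id Quot A = cls (Id \<C> A)"
  using residue_cls[OF maps_Id] by (simp add: quot_simps)

lemma quot_arrows_iff:
  assumes AB: "A \<in> Ob \<C>" "B \<in> Ob \<C>"
  shows "F \<in> arrows Quot A B \<longleftrightarrow> (\<exists>f. f \<proportion> A \<rightarrow> B \<and> F = cls f)"
  using AB residue_cls by (auto simp: quot_simps carrier_FactGroup residue_def maps_def image_iff)

lemma quot_arrowsE: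
  assumes "A \<in> Ob Quot" "B \<in> Ob Quot" "F \<in> arrows Quot A B"
  obtains f where "f \<proportion> A \<rightarrow> B" "F = cls f"
  using assms quot_arrows_iff[of A B F] unfolding quot_simps(1) by blast

lemma cls_arrows: "f \<proportion> A \<rightarrow> B \<Longrightarrow> cls f \<in> arrows Quot A B"
  using quot_arrows_iff[of A B] by (auto simp: maps_def)

lemma quot_mult:
  assumes f: "f \<proportion> A \<rightarrow> B" and g: "g \<proportion> A \<rightarrow> B"
  shows "cls f \<otimes>\<^bsub>Hom Quot A B\<^esub> cls g = cls (f \<boxplus> g)"
proof -
  have AB: "A \<in> Ob \<C>" "B \<in> Ob \<C>" using f by (auto simp: maps_def)
  show ?thesis
    using normal.rcos_sum[OF factoring_normal[OF AB], of f g] f g add_eq[OF f, of g]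
      residue_cls[OF f] residue_cls[OF g] residue_cls[OF maps_add[OF f g]]
    by (simp add: quot_simps residue_def maps_def)
qed

lemma quot_one:
  assumes AB: "A \<in> Ob \<C>" "B \<in> Ob \<C>"
  shows "\<one>\<^bsub>Hom Quot A B\<^esub> = cls (zero A B)"
proof -
  have "factoring \<C> \<X> A B #>\<^bsub>Hom \<C> A B\<^esub> \<one>\<^bsub>Hom \<C> A B\<^esub> = factoring \<C> \<X> A B"
    using group.coset_mult_one[OF hom_group[OF AB] subgroup.subset[OF factoring_subgroup[OF AB]]] .
  then show ?thesis
    using residue_cls[OF maps_zero[OF AB]] by (simp add: quot_simps residue_def zero_def)
qed

text \<open>
  All representatives of the two classes give the same residue class, so the union that defines the
  composition is one of equal sets.
\<close>

lemma quot_comp: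
  assumes f: "f \<proportion> A \<rightarrow> B" and g: "g \<proportion> B \<rightarrow> D"
  shows "cls g \<cdot>\<^bsub>Quot\<^esub> cls f = cls (g \<cdot> f)"
proof -
  have Ob: "A \<in> Ob \<C>" "B \<in> Ob \<C>" "D \<in> Ob \<C>" using f g by (auto simp: maps_def)
  have "residue \<C> \<X> A' D' (g' \<cdot> f') = cls (g \<cdot> f)"
    if "A' \<in> Ob \<C>" "B' \<in> Ob \<C>" "D' \<in> Ob \<C>" and f': "f' \<in> cls f" "f' \<in> arrows \<C> A' B'"
      and g': "g' \<in> cls g" "g' \<in> arrows \<C> B' D'" for A' B' D' f' g'
  proof -
    have m: "f' \<proportion> A \<rightarrow> B" "g' \<proportion> B \<rightarrow> D" and d: "f' \<boxplus> \<boxminus> f \<in> factoring \<C> \<X> A B" "g' \<boxplus> \<boxminus> g \<in> factoring \<C> \<X> B D"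
      using f' g' mem_cls_iff[OF f] mem_cls_iff[OF g] by auto
    have "f' \<proportion> A' \<rightarrow> B'" "g' \<proportion> B' \<rightarrow> D'" using that by (simp_all add: maps_def)
    then have "A' = A" "B' = B" "D' = D"
      using src_eq tgt_eq src_eq[OF m(1)] tgt_eq[OF m(1)] tgt_eq[OF m(2)] by blast+
    moreover have "g' \<cdot> f' \<boxplus> \<boxminus> (g \<cdot> f) \<in> factoring \<C> \<X> A D"
    proof -
      have "g' \<cdot> f' \<boxplus> \<boxminus> (g \<cdot> f) = g' \<cdot> (f' \<boxplus> \<boxminus> f) \<boxplus> (g' \<boxplus> \<boxminus> g) \<cdot> f" using m f g by algebra
      then show ?thesis
        using factoring_add[OF Ob(1,3) factoring_comp(1)[OF d(1) Ob(1,2) m(2)] factoring_comp(2)[OF d(2) Ob(2,3) f]]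
          by simp
    qed
    ultimately show ?thesis
      using residue_cls[OF maps_comp[OF m]] cls_eq_iff[OF maps_comp[OF m] maps_comp[OF f g]] by simp
  qed
  moreover have "f \<in> cls f" "g \<in> cls g" "f \<in> arrows \<C> A B" "g \<in> arrows \<C> B D"
    using cls_self f g by (auto simp: maps_def)
  ultimately have "{residue \<C> \<X> A D (g' \<cdot> f') | A B D f' g'. A \<in> Ob \<C> \<and> B \<in> Ob \<C> \<and> D \<in> Ob \<C> \<and>
      f' \<in> cls f \<inter> arrows \<C> A B \<and> g' \<in> cls g \<inter> arrows \<C> B D} = {cls (g \<cdot> f)}"
    (is "?S = _")
  proof -
    assume eq: "\<And>A' B' D' f' g'. A' \<in> Ob \<C> \<Longrightarrow> B' \<in> Ob \<C> \<Longrightarrow> D' \<in> Ob \<C> \<Longrightarrow> f' \<in> cls f \<Longrightarrow> f' \<in> arrows \<C> A' B' \<Longrightarrow>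
        g' \<in> cls g \<Longrightarrow> g' \<in> arrows \<C> B' D' \<Longrightarrow> residue \<C> \<X> A' D' (g' \<cdot> f') = cls (g \<cdot> f)"
      and mem: "f \<in> cls f" "g \<in> cls g" "f \<in> arrows \<C> A B" "g \<in> arrows \<C> B D"
    have "?S \<subseteq> {cls (g \<cdot> f)}" using eq by auto
    moreover have "residue \<C> \<X> A D (g \<cdot> f) \<in> ?S" using mem Ob by blast
    ultimately show ?thesis by blast
  qed
  then show ?thesis by (simp add: ideal_quotient_def)
qed

lemma quot_zero_object:
  assumes Z: "zero_object \<C> Z"
  shows "zero_object Quot Z"
  unfolding zero_object_def quot_simps(1)
proof (intro conjI ballI)
  show ZO: "Z \<in> Ob \<C>" using Z by (simp add: zero_object_def)
  fix A assume A: "A \<in> Ob \<C>"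
  obtain f g where fg: "\<And>h. h \<proportion> A \<rightarrow> Z \<longleftrightarrow> h = f" "\<And>h. h \<proportion> Z \<rightarrow> A \<longleftrightarrow> h = g"
    using Z A ZO unfolding zero_object_def maps_def by metis
  show "\<exists>!F. F \<in> arrows Quot A Z" "\<exists>!F. F \<in> arrows Quot Z A"
    using quot_arrows_iff[OF A ZO] quot_arrows_iff[OF ZO A] fg by auto
qed

lemma quot_biproduct:
  assumes S: "biproduct \<C> A B S i1 i2 p1 p2" and Ob: "A \<in> Ob \<C>" "B \<in> Ob \<C>"
  shows "biproduct Quot A B S (cls i1) (cls i2) (cls p1) (cls p2)"
proof -
  note b = biproductD[OF S Ob]
  have "S \<in> Ob \<C>" using b(1) by (simp add: maps_def)
  then show ?thesis
    unfolding biproduct_def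
    using b Ob cls_arrows quot_comp[OF b(1,3)] quot_comp[OF b(2,4)] quot_comp[OF b(2,3)] quot_comp[OF b(1,4)]
      quot_comp[OF b(3,1)] quot_comp[OF b(4,2)] quot_mult[OF maps_comp[OF b(3,1)] maps_comp[OF b(4,2)]] quot_Id
        quot_one
    by (simp add: quot_simps(1))
qed

lemma quot_additive_category: "additive_category Quot"
proof (rule additive_category.intro)
  fix A B A' B' F
  assume Ob: "A \<in> Ob Quot" "B \<in> Ob Quot" "A' \<in> Ob Quot" "B' \<in> Ob Quot"
    and F: "F \<in> arrows Quot A B" "F \<in> arrows Quot A' B'"
  obtain f where f: "f \<proportion> A \<rightarrow> B" "F = cls f" by (rule quot_arrowsE[OF Ob(1,2) F(1)])
  obtain g where g: "g \<proportion> A' \<rightarrow> B'" "F = cls g" by (rule quot_arrowsE[OF Ob(3,4) F(2)])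
  have "f \<proportion> A' \<rightarrow> B'" using cls_self[OF f(1)] f(2) g mem_cls_iff[OF g(1)] by simp
  then show "A = A' \<and> B = B'" using f(1) by (auto simp: maps_unfold)
next
  show "Id Quot A \<in> arrows Quot A A" if "A \<in> Ob Quot" for A
    using that quot_Id cls_arrows maps_Id by (simp add: quot_simps(1))
next
  show "G \<cdot>\<^bsub>Quot\<^esub> F \<in> arrows Quot A D"
    if Ob: "A \<in> Ob Quot" "B \<in> Ob Quot" "D \<in> Ob Quot" and F: "F \<in> arrows Quot A B" and G: "G \<in> arrows Quot B D"
      for A B D F G
  proof -
    obtain f where f: "f \<proportion> A \<rightarrow> B" "F = cls f" by (rule quot_arrowsE[OF Ob(1,2) F])
    obtain g where g: "g \<proportion> B \<rightarrow> D" "G = cls g" by (rule quot_arrowsE[OF Ob(2,3) G])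
    show ?thesis using quot_comp[OF f(1) g(1)] f g cls_arrows[OF maps_comp[OF f(1) g(1)]] by simp
  qed
next
  show "(H \<cdot>\<^bsub>Quot\<^esub> G) \<cdot>\<^bsub>Quot\<^esub> F = H \<cdot>\<^bsub>Quot\<^esub> (G \<cdot>\<^bsub>Quot\<^esub> F)"
    if Ob: "A \<in> Ob Quot" "B \<in> Ob Quot" "D \<in> Ob Quot" "E \<in> Ob Quot"
      and F: "F \<in> arrows Quot A B" and G: "G \<in> arrows Quot B D" and H: "H \<in> arrows Quot D E" for A B D E F G H
  proof -
    obtain f where f: "f \<proportion> A \<rightarrow> B" "F = cls f" by (rule quot_arrowsE[OF Ob(1,2) F])
    obtain g where g: "g \<proportion> B \<rightarrow> D" "G = cls g" by (rule quot_arrowsE[OF Ob(2,3) G])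
    obtain h where h: "h \<proportion> D \<rightarrow> E" "H = cls h" by (rule quot_arrowsE[OF Ob(3,4) H])
    show ?thesis
      using quot_comp[OF f(1) g(1)] quot_comp[OF g(1) h(1)] quot_comp[OF maps_comp[OF f(1) g(1)] h(1)]
        quot_comp[OF f(1) maps_comp[OF g(1) h(1)]] maps_comp_assoc[OF f(1) g(1) h(1)] f g h by simp
  qed
next
  show "Id Quot B \<cdot>\<^bsub>Quot\<^esub> F = F" "F \<cdot>\<^bsub>Quot\<^esub> Id Quot A = F"
    if Ob: "A \<in> Ob Quot" "B \<in> Ob Quot" and F: "F \<in> arrows Quot A B" for A B F
  proof -
    obtain f where f: "f \<proportion> A \<rightarrow> B" "F = cls f" by (rule quot_arrowsE[OF Ob(1,2) F])
    have Id: "Id \<C> A \<proportion> A \<rightarrow> A" "Id \<C> B \<proportion> B \<rightarrow> B" using f maps_Id by (auto simp: maps_def)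
    show "Id Quot B \<cdot>\<^bsub>Quot\<^esub> F = F" "F \<cdot>\<^bsub>Quot\<^esub> Id Quot A = F"
      using quot_comp[OF f(1) Id(2)] quot_comp[OF Id(1) f(1)] f Id quot_Id by (simp_all add: maps_unfold)
  qed
next
  show "comm_group (Hom Quot A B)" if "A \<in> Ob Quot" "B \<in> Ob Quot" for A B
    using comm_group.abelian_FactGroup[OF hom_comm_group factoring_subgroup] that by (simp add: quot_simps)
next
  show "(G \<otimes>\<^bsub>Hom Quot B D\<^esub> G') \<cdot>\<^bsub>Quot\<^esub> F = (G \<cdot>\<^bsub>Quot\<^esub> F) \<otimes>\<^bsub>Hom Quot A D\<^esub> (G' \<cdot>\<^bsub>Quot\<^esub> F)"
    if Ob: "A \<in> Ob Quot" "B \<in> Ob Quot" "D \<in> Ob Quot" and F: "F \<in> arrows Quot A B"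
      and G: "G \<in> arrows Quot B D" and G': "G' \<in> arrows Quot B D" for A B D F G G'
  proof -
    obtain f where f: "f \<proportion> A \<rightarrow> B" "F = cls f" by (rule quot_arrowsE[OF Ob(1,2) F])
    obtain g where g: "g \<proportion> B \<rightarrow> D" "G = cls g" by (rule quot_arrowsE[OF Ob(2,3) G])
    obtain h where h: "h \<proportion> B \<rightarrow> D" "G' = cls h" by (rule quot_arrowsE[OF Ob(2,3) G'])
    have "(g \<boxplus> h) \<cdot> f = g \<cdot> f \<boxplus> h \<cdot> f" using f(1) g(1) h(1) by algebra
    then show ?thesis
      using quot_mult[OF g(1) h(1)] quot_comp[OF f(1) maps_add[OF g(1) h(1)]] quot_comp[OF f(1) g(1)]
        quot_comp[OF f(1) h(1)]
        quot_mult[OF maps_comp[OF f(1) g(1)] maps_comp[OF f(1) h(1)]] f g h by simp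
  qed
next
  show "G \<cdot>\<^bsub>Quot\<^esub> (F \<otimes>\<^bsub>Hom Quot A B\<^esub> F') = (G \<cdot>\<^bsub>Quot\<^esub> F) \<otimes>\<^bsub>Hom Quot A D\<^esub> (G \<cdot>\<^bsub>Quot\<^esub> F')"
    if Ob: "A \<in> Ob Quot" "B \<in> Ob Quot" "D \<in> Ob Quot" and F: "F \<in> arrows Quot A B" and F': "F' \<in> arrows Quot A B"
      and G: "G \<in> arrows Quot B D" for A B D F F' G
  proof -
    obtain f where f: "f \<proportion> A \<rightarrow> B" "F = cls f" by (rule quot_arrowsE[OF Ob(1,2) F])
    obtain h where h: "h \<proportion> A \<rightarrow> B" "F' = cls h" by (rule quot_arrowsE[OF Ob(1,2) F'])
    obtain g where g: "g \<proportion> B \<rightarrow> D" "G = cls g" by (rule quot_arrowsE[OF Ob(2,3) G])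
    have "g \<cdot> (f \<boxplus> h) = g \<cdot> f \<boxplus> g \<cdot> h" using f(1) g(1) h(1) by algebra
    then show ?thesis
      using quot_mult[OF f(1) h(1)] quot_comp[OF maps_add[OF f(1) h(1)] g(1)] quot_comp[OF f(1) g(1)]
        quot_comp[OF h(1) g(1)]
        quot_mult[OF maps_comp[OF f(1) g(1)] maps_comp[OF h(1) g(1)]] f g h by simp
  qed
next
  show "\<exists>Z. zero_object Quot Z" using zero_object_exists quot_zero_object by blast
next
  show "\<exists>S i1 i2 p1 p2. biproduct Quot A B S i1 i2 p1 p2" if "A \<in> Ob Quot" "B \<in> Ob Quot" for A B
    using biproduct_exists[of A B] quot_biproduct that unfolding quot_simps(1) by blast
qed

sublocale quot: additive_category Quot
  by (rule quot_additive_category)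

lemma quot_maps_iff: "quot.maps F A B \<longleftrightarrow> (\<exists>f. f \<proportion> A \<rightarrow> B \<and> F = cls f)"
  unfolding quot.maps_def using quot_arrows_iff by (auto simp: quot_simps(1) maps_def)

lemma cls_maps: "f \<proportion> A \<rightarrow> B \<Longrightarrow> quot.maps (cls f) A B"
  using quot_maps_iff by blast

lemma quot_mapsE:
  assumes "quot.maps F A B"
  obtains f where "f \<proportion> A \<rightarrow> B" "F = cls f"
  using assms quot_maps_iff by blast

lemma quot_zero: "A \<in> Ob \<C> \<Longrightarrow> B \<in> Ob \<C> \<Longrightarrow> quot.zero A B = cls (zero A B)"
  by (simp add: quot.zero_def quot_one)

lemma quot_add: "f \<proportion> A \<rightarrow> B \<Longrightarrow> g \<proportion> A \<rightarrow> B \<Longrightarrow> quot.add (cls f) (cls g) = cls (f \<boxplus> g)"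
  using quot.add_eq[OF cls_maps] quot_mult by metis

lemma quot_neg:
  assumes f: "f \<proportion> A \<rightarrow> B"
  shows "quot.neg (cls f) = cls (\<boxminus> f)"
proof -
  have AB: "A \<in> Ob \<C>" "B \<in> Ob \<C>" using f by (auto simp: maps_def)
  have "quot.add (cls f) (cls (\<boxminus> f)) = cls (zero A B)"
    using quot_add[OF f maps_neg[OF f]] f by (simp add: maps_unfold)
  then show ?thesis
    using quot.neg_unique[of "cls f" "cls (\<boxminus> f)"] cls_maps[OF f] cls_maps[OF maps_neg[OF f]] quot_zero[OF AB]
    by (simp add: quot.maps_unfold)
qed

end

section \<open>Opposite categories\<close>

definition op_category :: "('o, 'm) precategory \<Rightarrow> ('o, 'm) precategory" where
  "op_category \<C> = \<lparr>Ob = Ob \<C>, Hom = (\<lambda>A B. Hom \<C> B A), Id = Id \<C>, Comp = (\<lambda>g f. f \<cdot>\<^bsub>\<C>\<^esub> g)\<rparr>"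

definition op_bifunctor :: "('o, 'm, 'e) bifunctor \<Rightarrow> ('o, 'm, 'e) bifunctor" where
  "op_bifunctor \<E> = \<lparr>Ext = (\<lambda>C A. Ext \<E> A C), Act = (\<lambda>c a. Act \<E> a c)\<rparr>"

text \<open>
  Degree \<open>i\<close> becomes degree \<open>n + 1 - i\<close>. By truncated subtraction, reversing twice restores the values in
  the range of degrees only.
\<close>

definition op_cochain :: "nat \<Rightarrow> ('o, 'm) cochain \<Rightarrow> ('o, 'm) cochain" where
  "op_cochain n X = \<lparr>obj = (\<lambda>i. obj X (Suc n - i)), dif = (\<lambda>i. dif X (n - i))\<rparr>"

lemma op_category_simps [simp]:
  "Ob (op_category \<C>) = Ob \<C>" "Hom (op_category \<C>) A B = Hom \<C> B A" "Id (op_category \<C>) = Id \<C>"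
  "g \<cdot>\<^bsub>op_category \<C>\<^esub> f = f \<cdot>\<^bsub>\<C>\<^esub> g"
  by (simp_all add: op_category_def)

lemma op_bifunctor_simps [simp]:
  "Ext (op_bifunctor \<E>) C A = Ext \<E> A C" "Act (op_bifunctor \<E>) c a = Act \<E> a c"
  by (simp_all add: op_bifunctor_def)

lemma op_cochain_simps [simp]:
  "obj (op_cochain n X) i = obj X (Suc n - i)" "dif (op_cochain n X) i = dif X (n - i)"
  by (simp_all add: op_cochain_def)

lemma op_op_category [simp]: "op_category (op_category \<C>) = \<C>"
  by (simp add: op_category_def)

lemma op_op_bifunctor [simp]: "op_bifunctor (op_bifunctor \<E>) = \<E>"
  by (simp add: op_bifunctor_def)

lemma push_op [simp]: "push (op_category \<C>) (op_bifunctor \<E>) C a \<delta> = pull \<C> \<E> C a \<delta>"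
  and pull_op [simp]: "pull (op_category \<C>) (op_bifunctor \<E>) A c \<delta> = push \<C> \<E> A c \<delta>"
  by (simp_all add: push_def pull_def)

lemma zero_object_op [simp]: "zero_object (op_category \<C>) Z \<longleftrightarrow> zero_object \<C> Z"
  by (auto simp: zero_object_def)

lemma biproduct_op:
  "biproduct (op_category \<C>) A B S i\<^sub>1 i\<^sub>2 p\<^sub>1 p\<^sub>2 \<longleftrightarrow> biproduct \<C> A B S p\<^sub>1 p\<^sub>2 i\<^sub>1 i\<^sub>2"
  by (auto simp: biproduct_def)

lemma all_le_reflect: "(\<forall>i\<le>m. P i) \<longleftrightarrow> (\<forall>i\<le>m. P (m - i))" for m :: nat
  by (metis diff_diff_cancel diff_le_self)

lemma all_less_reflect: "(\<forall>i<m. P i) \<longleftrightarrow> (\<forall>i<m. P (m - Suc i))" for m :: nat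
proof (intro iffI allI impI)
  fix i assume *: "\<forall>i<m. P (m - Suc i)" and i: "i < m"
  have "m - Suc i < m" "m - Suc (m - Suc i) = i" using i by auto
  then show "P i" using * by metis
qed auto

context additive_category
begin

lemma dual: "additive_category (op_category \<C>)"
proof (rule additive_category.intro)
  show "\<exists>Z. zero_object (op_category \<C>) Z" using zero_object_exists by simp
  show "\<exists>S i1 i2 p1 p2. biproduct (op_category \<C>) A B S i1 i2 p1 p2"
    if "A \<in> Ob (op_category \<C>)" "B \<in> Ob (op_category \<C>)" for A B
    using biproduct_exists[of A B] that unfolding biproduct_op op_category_simps by blast
qed (use hom_disjoint id_closed comp_closed comp_assoc id_left id_right hom_comm_group comp_add_left comp_add_right
     in \<open>auto simp: op_category_simps\<close>)

interpretation dual: additive_category "op_category \<C>"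
  by (rule dual)

lemma dual_maps: "dual.maps f A B \<longleftrightarrow> f \<proportion> B \<rightarrow> A"
  by (auto simp: dual.maps_def maps_def)

lemma dual_zero: "dual.zero A B = zero B A"
  by (simp add: dual.zero_def zero_def)

lemma dual_add: "f \<proportion> B \<rightarrow> A \<Longrightarrow> dual.add f g = f \<boxplus> g"
  using dual.add_eq[of f A B g] add_eq[of f B A g] dual_maps[of f A B] by simp

lemma dual_complex: "cochain_complex n (op_category \<C>) X \<longleftrightarrow> cochain_complex n \<C> (op_cochain n X)"
proof -
  have "cochain_complex n (op_category \<C>) X \<longleftrightarrow> (\<forall>i\<le>Suc n. obj X i \<in> Ob \<C>) \<and>
      (\<forall>i\<le>n. dif X i \<proportion> obj X (Suc i) \<rightarrow> obj X i) \<and>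
      (\<forall>i<n. dif X i \<cdot> dif X (Suc i) = zero (obj X (Suc (Suc i))) (obj X i))"
    unfolding dual.cochain_complex_iff dual_maps dual_zero by simp
  also have "\<dots> \<longleftrightarrow> (\<forall>i\<le>Suc n. obj X (Suc n - i) \<in> Ob \<C>) \<and>
      (\<forall>i\<le>n. dif X (n - i) \<proportion> obj X (Suc (n - i)) \<rightarrow> obj X (n - i)) \<and>
      (\<forall>i<n. dif X (n - Suc i) \<cdot> dif X (Suc (n - Suc i)) = zero (obj X (Suc (Suc (n - Suc i)))) (obj X (n - Suc i)))"
    by (subst all_le_reflect[of "Suc n"], subst all_le_reflect[of n], subst all_less_reflect) (rule refl)
  also have "\<dots> \<longleftrightarrow> cochain_complex n \<C> (op_cochain n X)"
    unfolding cochain_complex_iff by (simp add: Suc_diff_le Suc_diff_Suc cong: conj_cong)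
  finally show ?thesis .
qed

lemma dual_chain_map:
  assumes X: "cochain_complex n \<C> (op_cochain n X)" and Y: "cochain_complex n \<C> (op_cochain n Y)"
  shows "chain_map n (op_category \<C>) X Y f \<longleftrightarrow>
    chain_map n \<C> (op_cochain n Y) (op_cochain n X) (\<lambda>i. f (Suc n - i))"
proof -
  have "chain_map n (op_category \<C>) X Y f \<longleftrightarrow> (\<forall>i\<le>Suc n. f i \<proportion> obj Y i \<rightarrow> obj X i) \<and>
      (\<forall>i\<le>n. dif X i \<cdot> f (Suc i) = f i \<cdot> dif Y i)"
    using dual.chain_map_iff[of n X Y f] X Y by (simp add: dual_complex dual_maps)
  also have "\<dots> \<longleftrightarrow> (\<forall>i\<le>Suc n. f (Suc n - i) \<proportion> obj Y (Suc n - i) \<rightarrow> obj X (Suc n - i)) \<and>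
      (\<forall>i\<le>n. dif X (n - i) \<cdot> f (Suc (n - i)) = f (n - i) \<cdot> dif Y (n - i))"
    by (subst all_le_reflect[of "Suc n"], subst all_le_reflect[of n]) (rule refl)
  also have "\<dots> \<longleftrightarrow> chain_map n \<C> (op_cochain n Y) (op_cochain n X) (\<lambda>i. f (Suc n - i))"
    unfolding chain_map_iff[OF Y X] by (auto simp: Suc_diff_le)
  finally show ?thesis .
qed

lemma dual_lift:
  assumes X: "cochain_complex n \<C> (op_cochain n X)" and Y: "cochain_complex n \<C> (op_cochain n Y)"
  shows "lift n (op_category \<C>) X Y a c f \<longleftrightarrow>
    lift n \<C> (op_cochain n Y) (op_cochain n X) c a (\<lambda>i. f (Suc n - i))"
  unfolding lift_def using dual_chain_map[OF X Y] by auto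

lemma dual_weak_kernels: "dual.weak_kernels n X \<longleftrightarrow> weak_cokernels n (op_cochain n X)"
proof -
  have "dual.weak_kernels n X \<longleftrightarrow> (\<forall>i<n. \<forall>W u. u \<proportion> obj X (Suc i) \<rightarrow> W \<longrightarrow>
     u \<cdot> dif X (Suc i) = zero (obj X (Suc (Suc i))) W \<longrightarrow> (\<exists>v. v \<proportion> obj X i \<rightarrow> W \<and> v \<cdot> dif X i = u))"
    unfolding dual.weak_kernels_def dual_maps dual_zero by simp
  also have "\<dots> \<longleftrightarrow> (\<forall>i<n. \<forall>W u. u \<proportion> obj X (Suc (n - Suc i)) \<rightarrow> W \<longrightarrow>
     u \<cdot> dif X (Suc (n - Suc i)) = zero (obj X (Suc (Suc (n - Suc i)))) W \<longrightarrow>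
     (\<exists>v. v \<proportion> obj X (n - Suc i) \<rightarrow> W \<and> v \<cdot> dif X (n - Suc i) = u))"
    by (subst all_less_reflect) (rule refl)
  also have "\<dots> \<longleftrightarrow> weak_cokernels n (op_cochain n X)"
    unfolding weak_cokernels_def by (simp add: Suc_diff_le Suc_diff_Suc)
  finally show ?thesis .
qed

lemma dual_weak_cokernels: "dual.weak_cokernels n X \<longleftrightarrow> weak_kernels n (op_cochain n X)"
proof -
  have "dual.weak_cokernels n X \<longleftrightarrow> (\<forall>i<n. \<forall>W u. u \<proportion> W \<rightarrow> obj X (Suc i) \<longrightarrow>
     dif X i \<cdot> u = zero W (obj X i) \<longrightarrow> (\<exists>v. v \<proportion> W \<rightarrow> obj X (Suc (Suc i)) \<and> dif X (Suc i) \<cdot> v = u))"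
    unfolding dual.weak_cokernels_def dual_maps dual_zero by simp
  also have "\<dots> \<longleftrightarrow> (\<forall>i<n. \<forall>W u. u \<proportion> W \<rightarrow> obj X (Suc (n - Suc i)) \<longrightarrow>
     dif X (n - Suc i) \<cdot> u = zero W (obj X (n - Suc i)) \<longrightarrow>
     (\<exists>v. v \<proportion> W \<rightarrow> obj X (Suc (Suc (n - Suc i))) \<and> dif X (Suc (n - Suc i)) \<cdot> v = u))"
    by (subst all_less_reflect) (rule refl)
  also have "\<dots> \<longleftrightarrow> weak_kernels n (op_cochain n X)"
    unfolding weak_kernels_def by (simp add: Suc_diff_le Suc_diff_Suc)
  finally show ?thesis .
qed

lemma dual_weak_kernel_cokernel:
  assumes "cochain_complex n \<C> (op_cochain n X)"
  shows "weak_kernel_cokernel n (op_category \<C>) X \<longleftrightarrow> weak_kernel_cokernel n \<C> (op_cochain n X)"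
  using dual.weak_kernel_cokernel_iff[of n X] weak_kernel_cokernel_iff[OF assms] dual_complex[of n X] assms
    dual_weak_kernels dual_weak_cokernels by auto

lemma dual_boundary:
  assumes X: "cochain_complex n \<C> (op_cochain n X)" and Y: "cochain_complex n \<C> (op_cochain n Y)"
    and k: "dual.lowering n X Y k" and i: "i \<le> Suc n"
  shows "dual.boundary n X Y k (Suc n - i) = boundary n (op_cochain n Y) (op_cochain n X) (\<lambda>i. k (n - i)) i"
  using i
proof (cases rule: degree_cases)
  case (middle j)
  let ?m = "n - Suc j"
  have m: "Suc n - i = Suc ?m" "?m < n" "n - j = Suc ?m" "n - i = ?m" using middle by auto
  have km: "k ?m \<proportion> obj Y ?m \<rightarrow> obj X (Suc ?m)" "k (Suc ?m) \<proportion> obj Y (Suc ?m) \<rightarrow> obj X (Suc (Suc ?m))"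
    using k m unfolding dual.lowering_def dual_maps by auto
  have d: "dif Y ?m \<proportion> obj Y (Suc ?m) \<rightarrow> obj Y ?m" "dif X (Suc ?m) \<proportion> obj X (Suc (Suc ?m)) \<rightarrow> obj X (Suc ?m)"
    using X Y m unfolding dual_complex[symmetric] dual.cochain_complex_iff dual_maps by auto
  have c: "k ?m \<cdot> dif Y ?m \<proportion> obj Y (Suc ?m) \<rightarrow> obj X (Suc ?m)"
    "dif X (Suc ?m) \<cdot> k (Suc ?m) \<proportion> obj Y (Suc ?m) \<rightarrow> obj X (Suc ?m)"
    using maps_comp km d by blast+
  show ?thesis
    unfolding m(1) unfolding dual.boundary_simps(3)[OF m(2)] middle(1) boundary_simps(3)[OF middle(2)]
    using dual_add[of "k ?m \<cdot> dif Y ?m"] c m add_comm[of "k ?m \<cdot> dif Y ?m" "dif X (Suc ?m) \<cdot> k (Suc ?m)"]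
    by (simp add: maps_unfold)
qed (simp_all add: dual.boundary_simps boundary_simps)

lemma dual_homotopic:
  assumes X: "cochain_complex n \<C> (op_cochain n X)" and Y: "cochain_complex n \<C> (op_cochain n Y)"
    and f: "chain_map n (op_category \<C>) X Y f" and fg: "homotopic n (op_category \<C>) X Y f g"
  shows "homotopic n \<C> (op_cochain n Y) (op_cochain n X) (\<lambda>i. f (Suc n - i)) (\<lambda>i. g (Suc n - i))"
proof -
  note X' = X[folded dual_complex] and Y' = Y[folded dual_complex]
  have f': "chain_map n \<C> (op_cochain n Y) (op_cochain n X) (\<lambda>i. f (Suc n - i))"
    using f dual_chain_map[OF X Y] by simp
  obtain k where k: "dual.lowering n X Y k"
    and eq: "\<And>i. i \<le> Suc n \<Longrightarrow> g i = dual.add (f i) (dual.boundary n X Y k i)"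
    using fg unfolding dual.homotopic_chain_map_iff[OF X' Y' f] by blast
  have "lowering n (op_cochain n Y) (op_cochain n X) (\<lambda>i. k (n - i))"
    using k unfolding dual.lowering_def dual_maps lowering_def by (simp add: Suc_diff_le)
  moreover have "g (Suc n - i) = f (Suc n - i) \<boxplus> boundary n (op_cochain n Y) (op_cochain n X) (\<lambda>i. k (n - i)) i"
    if i: "i \<le> Suc n" for i
  proof -
    have "f (Suc n - i) \<proportion> obj Y (Suc n - i) \<rightarrow> obj X (Suc n - i)"
      using dual.chain_map_maps[OF X' Y' f, of "Suc n - i"] unfolding dual_maps by simp
    then show ?thesis using eq[of "Suc n - i"] dual_boundary[OF X Y k i] dual_add by simp
  qed
  ultimately show ?thesis
    unfolding homotopic_chain_map_iff[OF Y X f'] by blast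
qed

lemma dual_complexes_between:
  "X \<in> complexes_between n (op_category \<C>) A C \<longleftrightarrow> op_cochain n X \<in> complexes_between n \<C> C A"
  by (auto simp: complexes_between_def dual_complex)

lemma dual_homotopy_equivalent:
  assumes X: "op_cochain n X \<in> complexes_between n \<C> C A" and Y: "op_cochain n Y \<in> complexes_between n \<C> C A"
    and XY: "homotopy_equivalent n (op_category \<C>) A C X Y"
  shows "homotopy_equivalent n \<C> C A (op_cochain n X) (op_cochain n Y)"
proof -
  note Xc = complexes_betweenD(1)[OF X] and Yc = complexes_betweenD(1)[OF Y]
  note X' = Xc[folded dual_complex] and Y' = Yc[folded dual_complex]
  obtain f g where f: "lift n (op_category \<C>) X Y (Id \<C> A) (Id \<C> C) f"
    and g: "lift n (op_category \<C>) Y X (Id \<C> A) (Id \<C> C) g"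
    and gf: "homotopic n (op_category \<C>) X X (\<lambda>i. f i \<cdot> g i) (\<lambda>i. Id \<C> (obj X i))"
    and fg: "homotopic n (op_category \<C>) Y Y (\<lambda>i. g i \<cdot> f i) (\<lambda>i. Id \<C> (obj Y i))"
    using XY unfolding homotopy_equivalent_def by auto
  have fc: "chain_map n (op_category \<C>) X Y f" and gc: "chain_map n (op_category \<C>) Y X g" using f g
    by (auto simp: lift_def)
  have "chain_map n (op_category \<C>) X X (\<lambda>i. f i \<cdot> g i)" "chain_map n (op_category \<C>) Y Y (\<lambda>i. g i \<cdot> f i)"
    using dual.chain_map_comp[OF X' Y' X' fc gc] dual.chain_map_comp[OF Y' X' Y' gc fc] by simp_all
  from dual_homotopic[OF Xc Xc this(1) gf] dual_homotopic[OF Yc Yc this(2) fg]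
  show ?thesis
    using f g dual_lift[OF Xc Yc] dual_lift[OF Yc Xc] unfolding homotopy_equivalent_def op_cochain_simps by blast
qed

text \<open>
  Values outside the range of degrees are arbitrary, so complexes that agree inside it are homotopy
  equivalent, by identities.
\<close>

lemma agree_equivalent:
  assumes X: "X \<in> complexes_between n \<C> A C"
    and eq: "\<And>i. i \<le> Suc n \<Longrightarrow> obj Y i = obj X i" "\<And>i. i \<le> n \<Longrightarrow> dif Y i = dif X i"
  shows "Y \<in> complexes_between n \<C> A C" "homotopy_equivalent n \<C> A C X Y"
proof -
  note Xc = complexes_betweenD[OF X]
  have Yc: "cochain_complex n \<C> Y" using Xc(1) unfolding cochain_complex_iff using eq by simp
  then show Y: "Y \<in> complexes_between n \<C> A C" using Xc eq by (simp add: complexes_between_def)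
  have I: "Id \<C> (obj X i) \<proportion> obj X i \<rightarrow> obj X i" if "i \<le> Suc n" for i using complex_Ob[OF Xc(1) that] by (rule maps_Id)
  have c: "Id \<C> (obj X (Suc i)) \<cdot> dif X i = dif X i \<cdot> Id \<C> (obj X i)" if "i \<le> n" for i
    using complex_dif[OF Xc(1) that] by (simp add: maps_unfold)
  have "lift n \<C> X Y (Id \<C> A) (Id \<C> C) (\<lambda>i. Id \<C> (obj X i))" "lift n \<C> Y X (Id \<C> A) (Id \<C> C) (\<lambda>i. Id \<C> (obj X i))"
    unfolding lift_def chain_map_iff[OF Xc(1) Yc] chain_map_iff[OF Yc Xc(1)] using eq I c Xc(2,3) by simp_all
  then show "homotopy_equivalent n \<C> A C X Y"
    by (rule homotopy_equivalent_of_iso[OF X Y]) (use I eq in \<open>simp_all add: maps_unfold\<close>)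
qed

lemma op_op_cochain_equivalent:
  assumes X: "X \<in> complexes_between n \<C> A C"
  shows "op_cochain n (op_cochain n X) \<in> complexes_between n \<C> A C"
    "homotopy_equivalent n \<C> A C X (op_cochain n (op_cochain n X))"
  using agree_equivalent[OF X, of "op_cochain n (op_cochain n X)"] by simp_all

lemma dual_homotopy_class:
  assumes X: "X \<in> complexes_between n \<C> A C"
  shows "{Y. op_cochain n Y \<in> homotopy_class n \<C> A C X} = homotopy_class n (op_category \<C>) C A (op_cochain n X)"
proof (intro Set.set_eqI iffI)
  note XX = op_op_cochain_equivalent[OF X]
  have oX: "op_cochain n X \<in> complexes_between n (op_category \<C>) C A" using XX(1)
    by (simp only: dual_complexes_between)
  fix Y
  {
    assume "Y \<in> {Y. op_cochain n Y \<in> homotopy_class n \<C> A C X}"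
    then have Y: "op_cochain n Y \<in> complexes_between n \<C> A C" and XY: "homotopy_equivalent n \<C> A C X (op_cochain n Y)"
      by (auto simp: homotopy_class_def)
    have Y': "Y \<in> complexes_between n (op_category \<C>) C A" using Y by (simp only: dual_complexes_between)
    note YY = additive_category.op_op_cochain_equivalent[OF dual Y']
    have "homotopy_equivalent n (op_category \<C>) C A (op_cochain n X) (op_cochain n (op_cochain n Y))"
      by (rule additive_category.dual_homotopy_equivalent[OF dual oX YY(1)]) (use XY in simp)
    then have "homotopy_equivalent n (op_category \<C>) C A (op_cochain n X) Y"
      using dual.homotopy_equivalent_sym[OF YY(2)]
        dual.homotopy_equivalent_trans[OF oX YY(1) Y'] by blast
    then show "Y \<in> homotopy_class n (op_category \<C>) C A (op_cochain n X)" using Y' by (simp add: homotopy_class_def)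
  }
  {
    assume "Y \<in> homotopy_class n (op_category \<C>) C A (op_cochain n X)"
    then have Y: "op_cochain n Y \<in> complexes_between n \<C> A C"
      and XY: "homotopy_equivalent n (op_category \<C>) C A (op_cochain n X) Y"
      by (auto simp: homotopy_class_def dual_complexes_between)
    have "homotopy_equivalent n \<C> A C (op_cochain n (op_cochain n X)) (op_cochain n Y)"
      by (rule dual_homotopy_equivalent[OF XX(1) Y XY])
    then have "homotopy_equivalent n \<C> A C X (op_cochain n Y)"
      using homotopy_equivalent_trans[OF X XX(1) Y XX(2)] by blast
    then show "Y \<in> {Y. op_cochain n Y \<in> homotopy_class n \<C> A C X}" using Y by (simp add: homotopy_class_def)
  }
qed

end

context additive_bifunctor
begin

lemma dual_bifunctor: "additive_bifunctor (op_category \<C>) (op_bifunctor \<E>)"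
proof (rule additive_bifunctor.intro[OF dual], rule additive_bifunctor_axioms.intro)
  fix C C' A A' c c' a \<delta>
  assume "C \<in> Ob (op_category \<C>)" "C' \<in> Ob (op_category \<C>)" "A \<in> Ob (op_category \<C>)" "A' \<in> Ob (op_category \<C>)"
    "c \<in> arrows (op_category \<C>) C' C" "c' \<in> arrows (op_category \<C>) C' C" "a \<in> arrows (op_category \<C>) A A'"
    "\<delta> \<in> extensions (op_bifunctor \<E>) C A"
  then show "Act (op_bifunctor \<E>) (c \<otimes>\<^bsub>Hom (op_category \<C>) C' C\<^esub> c') a \<delta> =
      Act (op_bifunctor \<E>) c a \<delta> \<otimes>\<^bsub>Ext (op_bifunctor \<E>) C' A'\<^esub> Act (op_bifunctor \<E>) c' a \<delta>"
    using act_add_right[of A A' C C' a c c' \<delta>] by simp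
next
  fix C C' A A' c a a' \<delta>
  assume "C \<in> Ob (op_category \<C>)" "C' \<in> Ob (op_category \<C>)" "A \<in> Ob (op_category \<C>)" "A' \<in> Ob (op_category \<C>)"
    "c \<in> arrows (op_category \<C>) C' C" "a \<in> arrows (op_category \<C>) A A'" "a' \<in> arrows (op_category \<C>) A A'"
    "\<delta> \<in> extensions (op_bifunctor \<E>) C A"
  then show "Act (op_bifunctor \<E>) c (a \<otimes>\<^bsub>Hom (op_category \<C>) A A'\<^esub> a') \<delta> =
      Act (op_bifunctor \<E>) c a \<delta> \<otimes>\<^bsub>Ext (op_bifunctor \<E>) C' A'\<^esub> Act (op_bifunctor \<E>) c a' \<delta>"
    using act_add_left[of A A' C C' a a' c \<delta>] by simp
qed (use ext_comm_group act_hom act_id act_comp in \<open>auto simp: op_category_simps\<close>)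

interpretation dual: additive_bifunctor "op_category \<C>" "op_bifunctor \<E>"
  by (rule dual_bifunctor)

lemma dual_left_exact: "dual.left_exact n X \<delta> \<longleftrightarrow> right_exact n (op_cochain n X) \<delta>"
  unfolding dual.left_exact_def right_exact_def dual_weak_kernels dual_maps by simp

lemma dual_right_exact: "dual.right_exact n X \<delta> \<longleftrightarrow> left_exact n (op_cochain n X) \<delta>"
  unfolding dual.right_exact_def left_exact_def dual_weak_cokernels dual_maps by simp

lemma dual_n_exangle:
  "n_exangle n (op_category \<C>) (op_bifunctor \<E>) X \<delta> \<longleftrightarrow> n_exangle n \<C> \<E> (op_cochain n X) \<delta>"
  unfolding dual.n_exangle_iff n_exangle_iff dual_complex dual_left_exact dual_right_exact by auto

lemma right_exact_homotopy_invariant: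
  assumes X: "X \<in> complexes_between n \<C> A C" and Y: "Y \<in> complexes_between n \<C> A C"
    and XY: "homotopy_equivalent n \<C> A C X Y" and \<delta>: "\<delta> \<in> extensions \<E> C A" and rX: "right_exact n X \<delta>"
  shows "right_exact n Y \<delta>"
proof -
  have unop: "right_exact n (op_cochain n (op_cochain n Z)) \<delta> \<longleftrightarrow> right_exact n Z \<delta>" for Z \<delta>
    unfolding right_exact_def weak_cokernels_def by simp
  have X': "op_cochain n X \<in> complexes_between n (op_category \<C>) C A"
    and Y': "op_cochain n Y \<in> complexes_between n (op_category \<C>) C A"
    using op_op_cochain_equivalent(1)[OF X] op_op_cochain_equivalent(1)[OF Y]
      by (simp_all only: dual_complexes_between)
  have "homotopy_equivalent n (op_category \<C>) C A (op_cochain n X) (op_cochain n Y)"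
    by (rule additive_category.dual_homotopy_equivalent[OF dual X' Y']) (use XY in simp)
  then have "dual.left_exact n (op_cochain n Y) \<delta>"
    using dual.left_exact_homotopy_invariant[OF X' Y'] \<delta> rX by (simp add: dual_left_exact unop)
  then show ?thesis by (simp add: dual_left_exact unop)
qed

lemma n_exangle_homotopy_invariant:
  assumes X: "X \<in> complexes_between n \<C> A C" and Y: "Y \<in> complexes_between n \<C> A C"
    and XY: "homotopy_equivalent n \<C> A C X Y" and ex: "n_exangle n \<C> \<E> X \<delta>"
  shows "n_exangle n \<C> \<E> Y \<delta>"
  using ex left_exact_homotopy_invariant[OF X Y XY] right_exact_homotopy_invariant[OF X Y XY]
    complexes_betweenD[OF X] complexes_betweenD[OF Y] by (simp add: n_exangle_iff)

end

section \<open>Extensions and complexes in the quotient\<close>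

text \<open>
  Vanishing on \<open>\<X>\<close> in both variables is all that the bifunctor needs to descend to the quotient.
\<close>

locale ideal_bifunctor = ideal_category \<C> \<X> + additive_bifunctor \<C> \<E>
  for \<C> :: "('o, 'm) precategory" (structure) and \<X> :: "'o set" and \<E> :: "('o, 'm, 'e) bifunctor" +
  assumes vanish_left: "\<lbrakk>Q \<in> \<X>; A \<in> Ob \<C>; \<delta> \<in> extensions \<E> Q A\<rbrakk> \<Longrightarrow> \<delta> = \<one>\<^bsub>Ext \<E> Q A\<^esub>"
    and vanish_right: "\<lbrakk>Q \<in> \<X>; C \<in> Ob \<C>; \<delta> \<in> extensions \<E> C Q\<rbrakk> \<Longrightarrow> \<delta> = \<one>\<^bsub>Ext \<E> C Q\<^esub>"
begin

abbreviation QExt :: "('o, 'm set, 'e) bifunctor" where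
  "QExt \<equiv> quotient_bifunctor \<E>"

lemma act_push_pull:
  assumes c: "c \<proportion> C' \<rightarrow> C" and a: "a \<proportion> A \<rightarrow> A'" and \<delta>: "\<delta> \<in> extensions \<E> C A"
  shows "Act \<E> c a \<delta> = push \<C> \<E> C' a (pull \<C> \<E> A c \<delta>)"
  using act_comp[of C C' C' A A A' c "Id \<C> C'" "Id \<C> A" a \<delta>] c a \<delta>
  by (simp add: push_def pull_def maps_unfold arrows_iff)

lemma pull_factoring:
  assumes A: "A \<in> Ob \<C>" and C: "C' \<in> Ob \<C>" "C \<in> Ob \<C>" and c: "c \<in> factoring \<C> \<X> C' C" and \<delta>: "\<delta> \<in> extensions \<E> C A"
  shows "pull \<C> \<E> A c \<delta> = \<one>\<^bsub>Ext \<E> C' A\<^esub>"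
proof -
  obtain Q u v where Q: "Q \<in> \<X>" "u \<proportion> C' \<rightarrow> Q" "v \<proportion> Q \<rightarrow> C" "c = v \<cdot> u"
    using c factoring_iff[OF C] by blast
  have "pull \<C> \<E> A v \<delta> = \<one>\<^bsub>Ext \<E> Q A\<^esub>" using vanish_left[OF Q(1) A pull_closed[OF A Q(3) \<delta>]] .
  then show ?thesis using pull_pull[OF A Q(3,2) \<delta>] pull_zero[OF A Q(2)] Q(4) by simp
qed

lemma push_factoring:
  assumes C: "C \<in> Ob \<C>" and A: "A \<in> Ob \<C>" "A' \<in> Ob \<C>" and a: "a \<in> factoring \<C> \<X> A A'" and \<delta>: "\<delta> \<in> extensions \<E> C A"
  shows "push \<C> \<E> C a \<delta> = \<one>\<^bsub>Ext \<E> C A'\<^esub>"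
proof -
  obtain Q u v where Q: "Q \<in> \<X>" "u \<proportion> A \<rightarrow> Q" "v \<proportion> Q \<rightarrow> A'" "a = v \<cdot> u"
    using a factoring_iff[OF A] by blast
  have "push \<C> \<E> C u \<delta> = \<one>\<^bsub>Ext \<E> C Q\<^esub>" using vanish_right[OF Q(1) C push_closed[OF C Q(2) \<delta>]] .
  then show ?thesis using push_push[OF C Q(2,3) \<delta>] push_zero[OF C Q(3)] Q(4) by simp
qed

lemma pull_cls_cong:
  assumes A: "A \<in> Ob \<C>" and c: "c \<proportion> C' \<rightarrow> C" and d: "d \<in> cls c" and \<delta>: "\<delta> \<in> extensions \<E> C A"
  shows "pull \<C> \<E> A d \<delta> = pull \<C> \<E> A c \<delta>"
proof -
  have C: "C' \<in> Ob \<C>" "C \<in> Ob \<C>" using c by (auto simp: maps_def)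
  have dm: "d \<proportion> C' \<rightarrow> C" and dc: "d \<boxplus> \<boxminus> c \<in> factoring \<C> \<X> C' C" using d mem_cls_iff[OF c] by auto
  note dcm = factoring_maps[OF C dc]
  have "d = (d \<boxplus> \<boxminus> c) \<boxplus> c" using dm c by algebra
  then have "pull \<C> \<E> A d \<delta> = pull \<C> \<E> A (d \<boxplus> \<boxminus> c) \<delta> \<otimes>\<^bsub>Ext \<E> C' A\<^esub> pull \<C> \<E> A c \<delta>"
    using pull_add[OF A dcm c \<delta>] by simp
  then show ?thesis
    using pull_factoring[OF A C dc \<delta>] pull_closed[OF A c \<delta>] ext_group[OF C(1) A] group.is_monoid monoid.l_one
      by fastforce
qed

lemma push_cls_cong:
  assumes C: "C \<in> Ob \<C>" and a: "a \<proportion> A \<rightarrow> A'" and b: "b \<in> cls a" and \<delta>: "\<delta> \<in> extensions \<E> C A"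
  shows "push \<C> \<E> C b \<delta> = push \<C> \<E> C a \<delta>"
proof -
  have A: "A \<in> Ob \<C>" "A' \<in> Ob \<C>" using a by (auto simp: maps_def)
  have bm: "b \<proportion> A \<rightarrow> A'" and ba: "b \<boxplus> \<boxminus> a \<in> factoring \<C> \<X> A A'" using b mem_cls_iff[OF a] by auto
  note bam = factoring_maps[OF A ba]
  have "b = (b \<boxplus> \<boxminus> a) \<boxplus> a" using bm a by algebra
  then have "push \<C> \<E> C b \<delta> = push \<C> \<E> C (b \<boxplus> \<boxminus> a) \<delta> \<otimes>\<^bsub>Ext \<E> C A'\<^esub> push \<C> \<E> C a \<delta>"
    using push_add[OF C bam a \<delta>] by simp
  then show ?thesis
    using push_factoring[OF C A ba \<delta>] push_closed[OF C a \<delta>] ext_group[OF C A(2)] group.is_monoid monoid.l_one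
      by fastforce
qed

lemma quot_act:
  assumes c: "c \<proportion> C' \<rightarrow> C" and a: "a \<proportion> A \<rightarrow> A'" and \<delta>: "\<delta> \<in> extensions \<E> C A"
  shows "Act QExt (cls c) (cls a) \<delta> = Act \<E> c a \<delta>"
proof -
  have Ob: "C' \<in> Ob \<C>" "A \<in> Ob \<C>" using c a by (auto simp: maps_def)
  have "Act \<E> d b \<delta> = Act \<E> c a \<delta>" if d: "d \<in> cls c" and b: "b \<in> cls a" for d b
  proof -
    have m: "d \<proportion> C' \<rightarrow> C" "b \<proportion> A \<rightarrow> A'" using d b mem_cls_iff[OF c] mem_cls_iff[OF a] by auto
    show ?thesis
      using act_push_pull[OF m \<delta>] act_push_pull[OF c a \<delta>] pull_cls_cong[OF Ob(2) c d \<delta>]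
        push_cls_cong[OF Ob(1) a b pull_closed[OF Ob(2) c \<delta>]] by simp
  qed
  then have "{Act \<E> d b \<delta> |d b. d \<in> cls c \<and> b \<in> cls a} = {Act \<E> c a \<delta>}"
    using cls_self[OF c] cls_self[OF a] by blast
  then show ?thesis by (simp add: quotient_bifunctor_def)
qed

lemma quot_Ext [simp]: "Ext QExt = Ext \<E>"
  by (simp add: quotient_bifunctor_def)

lemma quot_additive_bifunctor: "additive_bifunctor Quot QExt"
proof (rule additive_bifunctor.intro[OF quot_additive_category], rule additive_bifunctor_axioms.intro)
  show "comm_group (Ext QExt C A)" if "C \<in> Ob Quot" "A \<in> Ob Quot" for C A
    using that ext_comm_group by (simp add: quot_simps(1))
next
  fix C C' A A' c a
  assume Ob: "C \<in> Ob Quot" "C' \<in> Ob Quot" "A \<in> Ob Quot" "A' \<in> Ob Quot" and c: "c \<in> arrows Quot C' C"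
    and a: "a \<in> arrows Quot A A'"
  obtain c0 where c0: "c0 \<proportion> C' \<rightarrow> C" "c = cls c0" by (rule quot_arrowsE[OF Ob(2,1) c])
  obtain a0 where a0: "a0 \<proportion> A \<rightarrow> A'" "a = cls a0" by (rule quot_arrowsE[OF Ob(3,4) a])
  have h: "Act \<E> c0 a0 \<in> hom (Ext \<E> C A) (Ext \<E> C' A')" using act_hom c0 a0 by (auto simp: maps_def)
  have "x \<otimes>\<^bsub>Ext \<E> C A\<^esub> y \<in> extensions \<E> C A" if "x \<in> extensions \<E> C A" "y \<in> extensions \<E> C A" for x y
    using that ext_group[of C A] Ob by (simp add: quot_simps(1) group.is_monoid monoid.m_closed)
  then show "Act QExt c a \<in> hom (Ext QExt C A) (Ext QExt C' A')"
    using h quot_act[OF c0(1) a0(1)] c0(2) a0(2) by (simp add: hom_def Pi_def)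
next
  show "Act QExt (Id Quot C) (Id Quot A) \<delta> = \<delta>"
    if "C \<in> Ob Quot" "A \<in> Ob Quot" "\<delta> \<in> extensions QExt C A" for C A \<delta>
    using that quot_act[OF maps_Id maps_Id] act_id by (simp add: quot_simps(1) quot_Id)
next
  fix C C' C'' A A' A'' c c' a a' \<delta>
  assume Ob: "C \<in> Ob Quot" "C' \<in> Ob Quot" "C'' \<in> Ob Quot" "A \<in> Ob Quot" "A' \<in> Ob Quot" "A'' \<in> Ob Quot"
    and c: "c \<in> arrows Quot C' C" and c': "c' \<in> arrows Quot C'' C'" and a: "a \<in> arrows Quot A A'"
      and a': "a' \<in> arrows Quot A' A''"
    and \<delta>: "\<delta> \<in> extensions QExt C A"
  obtain c0 where c0: "c0 \<proportion> C' \<rightarrow> C" "c = cls c0" by (rule quot_arrowsE[OF Ob(2,1) c])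
  obtain c1 where c1: "c1 \<proportion> C'' \<rightarrow> C'" "c' = cls c1" by (rule quot_arrowsE[OF Ob(3,2) c'])
  obtain a0 where a0: "a0 \<proportion> A \<rightarrow> A'" "a = cls a0" by (rule quot_arrowsE[OF Ob(4,5) a])
  obtain a1 where a1: "a1 \<proportion> A' \<rightarrow> A''" "a' = cls a1" by (rule quot_arrowsE[OF Ob(5,6) a'])
  have \<delta>': "\<delta> \<in> extensions \<E> C A" using \<delta> by simp
  have "Act \<E> c0 a0 \<delta> \<in> extensions \<E> C' A'"
    using act_hom[of C C' A A' c0 a0] c0 a0 \<delta>' by (auto simp: maps_def hom_def Pi_def)
  moreover have "Act \<E> (c0 \<cdot> c1) (a1 \<cdot> a0) \<delta> = Act \<E> c1 a1 (Act \<E> c0 a0 \<delta>)"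
    using act_comp c0 c1 a0 a1 \<delta>' by (auto simp: maps_def)
  ultimately show "Act QExt (c \<cdot>\<^bsub>Quot\<^esub> c') (a' \<cdot>\<^bsub>Quot\<^esub> a) \<delta> = Act QExt c' a' (Act QExt c a \<delta>)"
    using quot_comp[OF c1(1) c0(1)] quot_comp[OF a0(1) a1(1)]
      quot_act[OF maps_comp[OF c1(1) c0(1)] maps_comp[OF a0(1) a1(1)] \<delta>']
      quot_act[OF c0(1) a0(1) \<delta>'] quot_act[OF c1(1) a1(1)] c0(2) c1(2) a0(2) a1(2) by simp
next
  fix C C' A A' c c' a \<delta>
  assume Ob: "C \<in> Ob Quot" "C' \<in> Ob Quot" "A \<in> Ob Quot" "A' \<in> Ob Quot"
    and c: "c \<in> arrows Quot C' C" and c': "c' \<in> arrows Quot C' C" and a: "a \<in> arrows Quot A A'"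
      and \<delta>: "\<delta> \<in> extensions QExt C A"
  obtain c0 where c0: "c0 \<proportion> C' \<rightarrow> C" "c = cls c0" by (rule quot_arrowsE[OF Ob(2,1) c])
  obtain c1 where c1: "c1 \<proportion> C' \<rightarrow> C" "c' = cls c1" by (rule quot_arrowsE[OF Ob(2,1) c'])
  obtain a0 where a0: "a0 \<proportion> A \<rightarrow> A'" "a = cls a0" by (rule quot_arrowsE[OF Ob(3,4) a])
  have \<delta>': "\<delta> \<in> extensions \<E> C A" using \<delta> by simp
  have "Act \<E> (c0 \<boxplus> c1) a0 \<delta> = Act \<E> c0 a0 \<delta> \<otimes>\<^bsub>Ext \<E> C' A'\<^esub> Act \<E> c1 a0 \<delta>"
    using act_add_left[of C C' A A' c0 c1 a0 \<delta>] c0 c1 a0 \<delta>' add_eq[OF c0(1)] by (auto simp: maps_def)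
  then show "Act QExt (c \<otimes>\<^bsub>Hom Quot C' C\<^esub> c') a \<delta> = Act QExt c a \<delta> \<otimes>\<^bsub>Ext QExt C' A'\<^esub> Act QExt c' a \<delta>"
    using quot_mult[OF c0(1) c1(1)] quot_act[OF maps_add[OF c0(1) c1(1)] a0(1) \<delta>'] quot_act[OF c0(1) a0(1) \<delta>']
      quot_act[OF c1(1) a0(1) \<delta>'] c0(2) c1(2) a0(2) by simp
next
  fix C C' A A' c a a' \<delta>
  assume Ob: "C \<in> Ob Quot" "C' \<in> Ob Quot" "A \<in> Ob Quot" "A' \<in> Ob Quot"
    and c: "c \<in> arrows Quot C' C" and a: "a \<in> arrows Quot A A'" and a': "a' \<in> arrows Quot A A'"
      and \<delta>: "\<delta> \<in> extensions QExt C A"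
  obtain c0 where c0: "c0 \<proportion> C' \<rightarrow> C" "c = cls c0" by (rule quot_arrowsE[OF Ob(2,1) c])
  obtain a0 where a0: "a0 \<proportion> A \<rightarrow> A'" "a = cls a0" by (rule quot_arrowsE[OF Ob(3,4) a])
  obtain a1 where a1: "a1 \<proportion> A \<rightarrow> A'" "a' = cls a1" by (rule quot_arrowsE[OF Ob(3,4) a'])
  have \<delta>': "\<delta> \<in> extensions \<E> C A" using \<delta> by simp
  have "Act \<E> c0 (a0 \<boxplus> a1) \<delta> = Act \<E> c0 a0 \<delta> \<otimes>\<^bsub>Ext \<E> C' A'\<^esub> Act \<E> c0 a1 \<delta>"
    using act_add_right[of C C' A A' c0 a0 a1 \<delta>] c0 a0 a1 \<delta>' add_eq[OF a0(1)] by (auto simp: maps_def)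
  then show "Act QExt c (a \<otimes>\<^bsub>Hom Quot A A'\<^esub> a') \<delta> = Act QExt c a \<delta> \<otimes>\<^bsub>Ext QExt C' A'\<^esub> Act QExt c a' \<delta>"
    using quot_mult[OF a0(1) a1(1)] quot_act[OF c0(1) maps_add[OF a0(1) a1(1)] \<delta>'] quot_act[OF c0(1) a0(1) \<delta>']
      quot_act[OF c0(1) a1(1) \<delta>'] c0(2) a0(2) a1(2) by simp
qed

lemma quot_push: "\<lbrakk>C \<in> Ob \<C>; a \<proportion> A \<rightarrow> A'; \<delta> \<in> extensions \<E> C A\<rbrakk>
    \<Longrightarrow> push Quot QExt C (cls a) \<delta> = push \<C> \<E> C a \<delta>"
  using quot_act[OF maps_Id] by (simp add: push_def quot_Id)

lemma quot_pull: "\<lbrakk>A \<in> Ob \<C>; c \<proportion> C' \<rightarrow> C; \<delta> \<in> extensions \<E> C A\<rbrakk>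
    \<Longrightarrow> pull Quot QExt A (cls c) \<delta> = pull \<C> \<E> A c \<delta>"
  using quot_act[OF _ maps_Id] by (simp add: pull_def quot_Id)

end

sublocale ideal_bifunctor \<subseteq> quot: additive_bifunctor Quot QExt
  by (rule quot_additive_bifunctor)

context ideal_category
begin

abbreviation qc :: "('o, 'm) cochain \<Rightarrow> ('o, 'm set) cochain" where
  "qc \<equiv> quotient_complex \<C> \<X>"

lemma qc_obj [simp]: "obj (qc X) = obj X"
  by (simp add: quotient_complex_def)

lemma qc_dif: "cochain_complex n \<C> X \<Longrightarrow> i \<le> n \<Longrightarrow> dif (qc X) i = cls (dif X i)"
  using residue_cls[OF complex_dif] by (simp add: quotient_complex_def)

lemma qc_complex:
  assumes X: "cochain_complex n \<C> X"
  shows "cochain_complex n Quot (qc X)"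
  unfolding quot.cochain_complex_iff
proof (intro conjI allI impI)
  show "obj (qc X) i \<in> Ob Quot" if "i \<le> Suc n" for i using complex_Ob[OF X that] by (simp add: quot_simps(1))
  show "quot.maps (dif (qc X) i) (obj (qc X) i) (obj (qc X) (Suc i))" if "i \<le> n" for i
    using cls_maps[OF complex_dif[OF X that]] qc_dif[OF X that] by simp
  show "dif (qc X) (Suc i) \<cdot>\<^bsub>Quot\<^esub> dif (qc X) i = quot.zero (obj (qc X) i) (obj (qc X) (Suc (Suc i)))" if i: "i < n"
    for i
    using quot_comp[OF complex_dif[OF X, of i] complex_dif[OF X, of "Suc i"]] i complex_dif_dif[OF X i]
      quot_zero[OF complex_Ob[OF X, of i] complex_Ob[OF X, of "Suc (Suc i)"]] qc_dif[OF X, of i]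
        qc_dif[OF X, of "Suc i"] by simp
qed

lemma qc_complexes_between:
  "X \<in> complexes_between n \<C> A C \<Longrightarrow> qc X \<in> complexes_between n Quot A C"
  using qc_complex by (simp add: complexes_between_def)

lemma qc_chain_map:
  assumes X: "cochain_complex n \<C> X" and Y: "cochain_complex n \<C> Y" and f: "chain_map n \<C> X Y f"
  shows "chain_map n Quot (qc X) (qc Y) (\<lambda>i. cls (f i))"
  unfolding quot.chain_map_iff[OF qc_complex[OF X] qc_complex[OF Y]]
proof (intro conjI allI impI)
  show "quot.maps (cls (f i)) (obj (qc X) i) (obj (qc Y) i)" if "i \<le> Suc n" for i
    using cls_maps[OF chain_map_maps[OF X Y f that]] by simp
  show "cls (f (Suc i)) \<cdot>\<^bsub>Quot\<^esub> dif (qc X) i = dif (qc Y) i \<cdot>\<^bsub>Quot\<^esub> cls (f i)" if i: "i \<le> n" for i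
    using quot_comp[OF complex_dif[OF X i] chain_map_maps[OF X Y f, of "Suc i"]] i
      quot_comp[OF chain_map_maps[OF X Y f, of i] complex_dif[OF Y i]] chain_map_commute[OF X Y f i]
      qc_dif[OF X i] qc_dif[OF Y i] by simp
qed

lemma qc_lift:
  assumes X: "cochain_complex n \<C> X" and Y: "cochain_complex n \<C> Y" and f: "lift n \<C> X Y a c f"
  shows "lift n Quot (qc X) (qc Y) (cls a) (cls c) (\<lambda>i. cls (f i))"
  using qc_chain_map[OF X Y] f by (auto simp: lift_def)

lemma qc_boundary:
  assumes X: "cochain_complex n \<C> X" and Y: "cochain_complex n \<C> Y" and k: "lowering n X Y k" and i: "i \<le> Suc n"
  shows "quot.boundary n (qc X) (qc Y) (\<lambda>i. cls (k i)) i = cls (boundary n X Y k i)"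
proof -
  have km: "k j \<proportion> obj X (Suc j) \<rightarrow> obj Y j" if "j \<le> n" for j using k that by (simp add: lowering_def)
  have kd: "cls (k j) \<cdot>\<^bsub>Quot\<^esub> dif (qc X) j = cls (k j \<cdot> dif X j)" if "j \<le> n" for j
    using quot_comp[OF complex_dif[OF X that] km[OF that]] qc_dif[OF X that] by simp
  have dk: "dif (qc Y) j \<cdot>\<^bsub>Quot\<^esub> cls (k j) = cls (dif Y j \<cdot> k j)" if "j \<le> n" for j
    using quot_comp[OF km[OF that] complex_dif[OF Y that]] qc_dif[OF Y that] by simp
  show ?thesis
    using i
  proof (cases rule: degree_cases)
    case (middle j)
    have "dif Y j \<cdot> k j \<proportion> obj X (Suc j) \<rightarrow> obj Y (Suc j)" "k (Suc j) \<cdot> dif X (Suc j) \<proportion> obj X (Suc j) \<rightarrow> obj Y (Suc j)"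
      using maps_comp km complex_dif[OF X, of "Suc j"] complex_dif[OF Y, of j] middle by (meson Suc_leI less_imp_le)+
    then show ?thesis
      unfolding middle(1) quot.boundary_simps(3)[OF middle(2)] boundary_simps(3)[OF middle(2)]
      using kd[of "Suc j"] dk[of j] middle quot_add by simp
  qed (simp_all add: quot.boundary_simps boundary_simps kd dk)
qed

lemma qc_homotopic:
  assumes X: "cochain_complex n \<C> X" and Y: "cochain_complex n \<C> Y" and f: "chain_map n \<C> X Y f"
    and fg: "homotopic n \<C> X Y f g"
  shows "homotopic n Quot (qc X) (qc Y) (\<lambda>i. cls (f i)) (\<lambda>i. cls (g i))"
proof -
  obtain k where k: "lowering n X Y k" and eq: "\<And>i. i \<le> Suc n \<Longrightarrow> g i = f i \<boxplus> boundary n X Y k i"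
    using fg unfolding homotopic_chain_map_iff[OF X Y f] by blast
  have "quot.lowering n (qc X) (qc Y) (\<lambda>i. cls (k i))"
    using k cls_maps unfolding lowering_def quot.lowering_def by simp
  moreover have "cls (g i) = quot.add (cls (f i)) (quot.boundary n (qc X) (qc Y) (\<lambda>i. cls (k i)) i)" if "i \<le> Suc n"
    for i
    using quot_add[OF chain_map_maps[OF X Y f that] boundary_maps[OF X Y k that]] eq[OF that]
      qc_boundary[OF X Y k that] by simp
  ultimately show ?thesis
    unfolding quot.homotopic_chain_map_iff[OF qc_complex[OF X] qc_complex[OF Y] qc_chain_map[OF X Y f]] by blast
qed

lemma qc_homotopy_equivalent:
  assumes X: "X \<in> complexes_between n \<C> A C" and Y: "Y \<in> complexes_between n \<C> A C"
    and XY: "homotopy_equivalent n \<C> A C X Y"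
  shows "homotopy_equivalent n Quot A C (qc X) (qc Y)"
proof -
  note Xc = complexes_betweenD[OF X] and Yc = complexes_betweenD[OF Y]
  obtain f g where f: "lift n \<C> X Y (Id \<C> A) (Id \<C> C) f" and g: "lift n \<C> Y X (Id \<C> A) (Id \<C> C) g"
    and gf: "homotopic n \<C> X X (\<lambda>i. g i \<cdot> f i) (\<lambda>i. Id \<C> (obj X i))"
    and fg: "homotopic n \<C> Y Y (\<lambda>i. f i \<cdot> g i) (\<lambda>i. Id \<C> (obj Y i))"
    using XY unfolding homotopy_equivalent_def by blast
  have fc: "chain_map n \<C> X Y f" and gc: "chain_map n \<C> Y X g" using f g by (auto simp: lift_def)
  \<comment> \<open>Transport a null-homotopic composite, rewriting it in the quotient.\<close>
  have step: "homotopic n Quot (qc X) (qc X) (\<lambda>i. cls (g i) \<cdot>\<^bsub>Quot\<^esub> cls (f i)) (\<lambda>i. Id Quot (obj X i))"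
    if X: "cochain_complex n \<C> X" and Y: "cochain_complex n \<C> Y" and f: "chain_map n \<C> X Y f"
      and g: "chain_map n \<C> Y X g"
      and h: "homotopic n \<C> X X (\<lambda>i. g i \<cdot> f i) (\<lambda>i. Id \<C> (obj X i))" for X Y f g
  proof -
    note q = qc_complex[OF X] qc_complex[OF Y]
    have c1: "chain_map n Quot (qc X) (qc X) (\<lambda>i. cls (g i) \<cdot>\<^bsub>Quot\<^esub> cls (f i))"
      using quot.chain_map_comp[OF q(1,2,1) qc_chain_map[OF X Y f] qc_chain_map[OF Y X g]] .
    have c2: "chain_map n Quot (qc X) (qc X) (\<lambda>i. cls (g i \<cdot> f i))"
      using qc_chain_map[OF X X chain_map_comp[OF X Y X f g]] .
    have c3: "chain_map n Quot (qc X) (qc X) (\<lambda>i. cls (Id \<C> (obj X i)))"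
      using qc_chain_map[OF X X chain_map_Id[OF X]] .
    have h1: "homotopic n Quot (qc X) (qc X) (\<lambda>i. cls (g i) \<cdot>\<^bsub>Quot\<^esub> cls (f i)) (\<lambda>i. cls (g i \<cdot> f i))"
      using quot.homotopic_refl[OF q(1,1) c1] quot_comp[OF chain_map_maps[OF X Y f] chain_map_maps[OF Y X g]] by simp
    have h2: "homotopic n Quot (qc X) (qc X) (\<lambda>i. cls (g i \<cdot> f i)) (\<lambda>i. cls (Id \<C> (obj X i)))"
      using qc_homotopic[OF X X chain_map_comp[OF X Y X f g] h] .
    have h3: "homotopic n Quot (qc X) (qc X) (\<lambda>i. cls (Id \<C> (obj X i))) (\<lambda>i. Id Quot (obj X i))"
      using quot.homotopic_refl[OF q(1,1) c3] quot_Id[OF complex_Ob[OF X]] by simp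
    show ?thesis
      using quot.homotopic_trans[OF q(1,1) c1 c2 h1 quot.homotopic_trans[OF q(1,1) c2 c3 h2 h3]] .
  qed
  have "lift n Quot (qc X) (qc Y) (Id Quot A) (Id Quot C) (\<lambda>i. cls (f i))"
    "lift n Quot (qc Y) (qc X) (Id Quot A) (Id Quot C) (\<lambda>i. cls (g i))"
    using qc_lift[OF Xc(1) Yc(1) f] qc_lift[OF Yc(1) Xc(1) g] quot_Id Xc by simp_all
  then show ?thesis
    using step[OF Xc(1) Yc(1) fc gc gf] step[OF Yc(1) Xc(1) gc fc fg] unfolding homotopy_equivalent_def qc_obj
      by blast
qed

lemma qc_mapping_cone:
  assumes n: "n \<ge> 1" and X: "cochain_complex n \<C> X" and Y: "cochain_complex n \<C> Y" and f: "chain_map n \<C> X Y f"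
    and M: "mapping_cone n \<C> X Y f M"
  shows "mapping_cone n Quot (qc X) (qc Y) (\<lambda>i. cls (f i)) (qc M)"
proof -
  obtain i1 i2 p1 p2 where r: "cone_rows n X Y f M i1 i2 p1 p2" using M mapping_cone_iff[OF n X Y f] by blast
  note R = cone_rowsD[OF n X Y f r]
  have Mc: "cochain_complex n \<C> M" by (rule cone_complex[OF n X Y f r])
  note qM = qc_complex[OF Mc]
  have last: "f (Suc n) \<cdot> p1 n \<proportion> obj M n \<rightarrow> obj Y (Suc n)" "dif Y n \<cdot> p2 n \<proportion> obj M n \<rightarrow> obj Y (Suc n)"
    using maps_comp[OF R(12)[OF n order_refl] chain_map_maps[OF X Y f order_refl]]
      maps_comp[OF R(13)[OF n order_refl] complex_dif[OF Y order_refl]] .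
  have "quot.cone_rows n (qc X) (qc Y) (\<lambda>i. cls (f i)) (qc M) (\<lambda>i. cls (i1 i)) (\<lambda>i. cls (i2 i)) (\<lambda>i. cls (p1 i)) (\<lambda>i.
    cls (p2 i))"
    unfolding quot.cone_rows_def
  proof (intro conjI allI impI ballI)
    show "obj (qc M) 0 = obj (qc X) 1" "obj (qc M) (Suc n) = obj (qc Y) (Suc n)" using R(1,2) by simp_all
    show "quot.maps (dif (qc M) k) (obj (qc M) k) (obj (qc M) (Suc k))" if "k \<le> n" for k
      using quot.complex_dif[OF qM that] .
    show "biproduct Quot (obj (qc X) (Suc k)) (obj (qc Y) k) (obj (qc M) k) (cls (i1 k)) (cls (i2 k)) (cls (p1 k))
      (cls (p2 k))"
      if "k \<in> {1..n}" for k
      using quot_biproduct[OF R(4)[of k]] that complex_Ob[OF X, of "Suc k"] complex_Ob[OF Y, of k] by simp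
    have d0: "dif M 0 \<proportion> obj M 0 \<rightarrow> obj M 1" "p1 1 \<proportion> obj M 1 \<rightarrow> obj X (Suc 1)" "p2 1 \<proportion> obj M 1 \<rightarrow> obj Y 1"
      using R(3)[of 0] R(12)[of 1] R(13)[of 1] n by simp_all
    show "cls (p1 1) \<cdot>\<^bsub>Quot\<^esub> dif (qc M) 0 = quot.neg (dif (qc X) 1)"
      using quot_comp[OF d0(1,2)] R(5) quot_neg[OF complex_dif[OF X n]] qc_dif[OF Mc, of 0] qc_dif[OF X n] by simp
    show "cls (p2 1) \<cdot>\<^bsub>Quot\<^esub> dif (qc M) 0 = cls (f 1)"
      using quot_comp[OF d0(1,3)] R(6) qc_dif[OF Mc, of 0] by simp
    fix k assume "k \<in> {1..<n}"
    then have k: "1 \<le> k" "k < n" "k \<le> n" "1 \<le> Suc k" "Suc k \<le> n" by auto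
    note D = R(3)[OF k(3)] and p = R(12)[OF k(1,3)] R(13)[OF k(1,3)] R(12)[OF k(4,5)] R(13)[OF k(4,5)]
    have m: "dif X (Suc k) \<cdot> p1 k \<proportion> obj M k \<rightarrow> obj X (Suc (Suc k))" "f (Suc k) \<cdot> p1 k \<proportion> obj M k \<rightarrow> obj Y (Suc k)"
      "dif Y k \<cdot> p2 k \<proportion> obj M k \<rightarrow> obj Y (Suc k)"
      using maps_comp[OF p(1) complex_dif[OF X k(5)]] maps_comp[OF p(1) chain_map_maps[OF X Y f le_SucI[OF k(5)]]]
        maps_comp[OF p(2) complex_dif[OF Y k(3)]] .
    show "cls (p1 (Suc k)) \<cdot>\<^bsub>Quot\<^esub> dif (qc M) k = quot.neg (dif (qc X) (Suc k) \<cdot>\<^bsub>Quot\<^esub> cls (p1 k))"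
      using quot_comp[OF D p(3)] R(7)[OF k(1,2)] quot_neg[OF m(1)] quot_comp[OF p(1) complex_dif[OF X k(5)]]
        qc_dif[OF Mc k(3)] qc_dif[OF X k(5)] by simp
    show "cls (p2 (Suc k)) \<cdot>\<^bsub>Quot\<^esub> dif (qc M) k = quot.add (cls (f (Suc k)) \<cdot>\<^bsub>Quot\<^esub> cls (p1 k)) (dif (qc Y) k \<cdot>\<^bsub>Quot\<^esub>
      cls (p2 k))"
      using quot_comp[OF D p(4)] R(8)[OF k(1,2)] quot_add[OF m(2,3)]
        quot_comp[OF p(1) chain_map_maps[OF X Y f le_SucI[OF k(5)]]]
        quot_comp[OF p(2) complex_dif[OF Y k(3)]] qc_dif[OF Mc k(3)] qc_dif[OF Y k(3)] by simp
  next
    show "dif (qc M) n = quot.add (cls (f (Suc n)) \<cdot>\<^bsub>Quot\<^esub> cls (p1 n)) (dif (qc Y) n \<cdot>\<^bsub>Quot\<^esub> cls (p2 n))"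
      using R(9) quot_add[OF last] quot_comp[OF R(12)[OF n order_refl] chain_map_maps[OF X Y f order_refl]]
        quot_comp[OF R(13)[OF n order_refl] complex_dif[OF Y order_refl]] qc_dif[OF Mc order_refl]
          qc_dif[OF Y order_refl] by simp
  qed
  then show ?thesis
    using quot.mapping_cone_iff[OF n qc_complex[OF X] qc_complex[OF Y] qc_chain_map[OF X Y f]] by blast
qed

end

section \<open>The induced realization\<close>

context additive_category
begin

lemma zero_objectD:
  assumes "zero_object \<C> Z"
  shows "Z \<in> Ob \<C>" "f \<proportion> A \<rightarrow> Z \<Longrightarrow> f = zero A Z" "g \<proportion> Z \<rightarrow> A \<Longrightarrow> g = zero Z A"
proof -
  show Z: "Z \<in> Ob \<C>" using assms by (simp add: zero_object_def)
  show "f = zero A Z" if "f \<proportion> A \<rightarrow> Z"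
    using assms that maps_zero[of A Z] unfolding zero_object_def maps_def by metis
  show "g = zero Z A" if "g \<proportion> Z \<rightarrow> A"
    using assms that maps_zero[of Z A] unfolding zero_object_def maps_def by metis
qed

end

context additive_bifunctor
begin

text \<open>
  An \<open>n\<close>-exangle for the zero extension has a split first differential; if it ends in a zero object,
  this makes it homotopy equivalent to the trivial complex. The lemma gives (R2) for the quotient, whose
  zero objects include those of \<open>\<X>\<close> and are thus not covered by (R2) in \<open>\<C>\<close>.
\<close>

lemma split_equivalent_trivial_left:
  assumes n: "n \<ge> 1" and Z: "zero_object \<C> Z" and X: "X \<in> complexes_between n \<C> A Z"
    and ex: "n_exangle n \<C> \<E> X \<one>\<^bsub>Ext \<E> Z A\<^esub>"
  shows "trivial_left n \<C> A Z \<in> complexes_between n \<C> A Z"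
    "homotopy_equivalent n \<C> A Z X (trivial_left n \<C> A Z)"
proof -
  note Xc = complexes_betweenD[OF X] and zer = zero_objectD[OF Z]
  let ?T = "trivial_left n \<C> A Z"
  have T: "obj ?T 0 = A" "obj ?T (Suc 0) = A" "\<And>i. obj ?T (Suc (Suc i)) = Z" "dif ?T 0 = Id \<C> A"
    "\<And>i. dif ?T (Suc i) = zero (obj ?T (Suc i)) Z"
    by (simp_all add: trivial_left_def zero_def)
  have TOb: "obj ?T i \<in> Ob \<C>" for i using Xc(4) zer(1) by (simp add: trivial_left_def)
  have Td: "dif ?T i \<proportion> obj ?T i \<rightarrow> obj ?T (Suc i)" for i
    by (cases i) (use T TOb Xc(4) zer(1) in \<open>auto simp: maps_Id maps_zero\<close>)
  have Tc: "cochain_complex n \<C> ?T"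
    unfolding cochain_complex_iff using T TOb Td zer(1) by (auto simp: maps_unfold)
  obtain m where m: "n = Suc m" using n by (cases n) auto
  show Tb: "?T \<in> complexes_between n \<C> A Z" using Tc T m by (simp add: complexes_between_def)
  have \<delta>: "\<one>\<^bsub>Ext \<E> Z A\<^esub> \<in> extensions \<E> Z A" using ext_zero_closed[OF zer(1) Xc(4)] .
  obtain r where r: "r \<proportion> obj X (Suc 0) \<rightarrow> A" "r \<cdot> dif X 0 = Id \<C> A"
    using ex push_zero[OF zer(1) maps_Id[OF Xc(4)]] Xc(2,3) maps_Id[OF Xc(4)]
    unfolding n_exangle_iff right_exact_def by auto
  have d0: "dif X 0 \<proportion> A \<rightarrow> obj X (Suc 0)" using complex_dif[OF Xc(1), of 0] Xc(2) by simp
  let ?f = "\<lambda>i. if i = 0 then Id \<C> A else if i = Suc 0 then r else zero (obj X i) Z"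
  let ?g = "\<lambda>i. if i = 0 then Id \<C> A else if i = Suc 0 then dif X 0 else zero Z (obj X i)"
  have fm: "?f i \<proportion> obj X i \<rightarrow> obj ?T i" and gm: "?g i \<proportion> obj ?T i \<rightarrow> obj X i" if i: "i \<le> Suc n" for i
  proof -
    consider "i = 0" | "i = Suc 0" | j where "i = Suc (Suc j)" by (metis not0_implies_Suc)
    then have "?f i \<proportion> obj X i \<rightarrow> obj ?T i \<and> ?g i \<proportion> obj ?T i \<rightarrow> obj X i"
      by cases (use T Xc r d0 maps_Id maps_zero zer(1) complex_Ob[OF Xc(1) i] in auto)
    then show "?f i \<proportion> obj X i \<rightarrow> obj ?T i" "?g i \<proportion> obj ?T i \<rightarrow> obj X i" by auto
  qed
  have Id: "Id \<C> Z = zero Z Z" using zer(3)[OF maps_Id[OF zer(1)]] .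
  have "chain_map n \<C> X ?T ?f"
    unfolding chain_map_iff[OF Xc(1) Tc]
  proof (intro conjI allI impI fm)
    fix i assume i: "i \<le> n"
    show "?f (Suc i) \<cdot> dif X i = dif ?T i \<cdot> ?f i"
    proof (cases i)
      case 0
      then show ?thesis using r T Xc(4) by simp
    next
      case (Suc j)
      have "?f (Suc i) \<cdot> dif X i \<proportion> obj X i \<rightarrow> Z" "dif ?T i \<cdot> ?f i \<proportion> obj X i \<rightarrow> Z"
        using maps_comp[OF complex_dif[OF Xc(1) i] fm[of "Suc i"]] maps_comp[OF fm[of i] Td[of i]] i Suc T by simp_all
      then show ?thesis using zer(2) by metis
    qed
  qed
  then have f: "lift n \<C> X ?T (Id \<C> A) (Id \<C> Z) ?f" using Id m Xc(3) by (simp add: lift_def)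
  have "chain_map n \<C> ?T X ?g"
    unfolding chain_map_iff[OF Tc Xc(1)]
  proof (intro conjI allI impI gm)
    fix i assume i: "i \<le> n"
    consider "i = 0" | "i = Suc 0" | j where "i = Suc (Suc j)" by (metis not0_implies_Suc)
    then show "?g (Suc i) \<cdot> dif ?T i = dif X i \<cdot> ?g i"
    proof cases
      case 1
      then show ?thesis using T d0 by (simp add: maps_unfold)
    next
      case 2
      have "dif X (Suc 0) \<cdot> dif X 0 = zero A (obj X (Suc (Suc 0)))" using complex_dif_dif[OF Xc(1), of 0] n Xc(2)
        by simp
      then show ?thesis using 2 T zer(1) Xc(4) complex_Ob[OF Xc(1), of "Suc (Suc 0)"] n by simp
    next
      case 3
      have "?g (Suc i) \<cdot> dif ?T i \<proportion> Z \<rightarrow> obj X (Suc i)" "dif X i \<cdot> ?g i \<proportion> Z \<rightarrow> obj X (Suc i)"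
        using maps_comp[OF Td[of i] gm[of "Suc i"]] maps_comp[OF gm[of i] complex_dif[OF Xc(1) i]] i 3 T by simp_all
      then show ?thesis using zer(3) by metis
    qed
  qed
  then have g: "lift n \<C> ?T X (Id \<C> A) (Id \<C> Z) ?g" using Id m Xc(3) by (simp add: lift_def)
  have "weak_kernels n ?T"
    unfolding weak_kernels_def
  proof (intro allI impI)
    fix i W u assume u: "u \<proportion> W \<rightarrow> obj ?T (Suc i)"
    show "\<exists>v. v \<proportion> W \<rightarrow> obj ?T i \<and> dif ?T i \<cdot> v = u"
    proof (cases i)
      case 0
      then show ?thesis using u T by (intro exI[of _ u]) (simp add: maps_unfold)
    next
      case (Suc j)
      have W: "W \<in> Ob \<C>" using u by (simp add: maps_unfold)
      have "u = zero W Z" using zer(2) u Suc T by simp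
      then have "dif ?T i \<cdot> zero W (obj ?T i) = u" using Td[of i] W Suc T by (simp add: maps_unfold)
      then show ?thesis using maps_zero[OF W TOb] by blast
    qed
  qed
  then show "homotopy_equivalent n \<C> A Z X ?T"
    using homotopy_equivalent_of_lifts[OF X Tb _ _ f g] ex by (simp add: n_exangle_iff left_exact_def)
qed

lemma split_equivalent_trivial_right:
  assumes n: "n \<ge> 1" and Z: "zero_object \<C> Z" and X: "X \<in> complexes_between n \<C> Z A"
    and ex: "n_exangle n \<C> \<E> X \<one>\<^bsub>Ext \<E> A Z\<^esub>"
  shows "trivial_right n \<C> A Z \<in> complexes_between n \<C> Z A"
    "homotopy_equivalent n \<C> Z A X (trivial_right n \<C> A Z)"
proof -
  note Xc = complexes_betweenD[OF X] and zer = zero_objectD[OF Z]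
  let ?T = "trivial_right n \<C> A Z"
  have T: "\<And>i. i < n \<Longrightarrow> obj ?T i = Z" "obj ?T n = A" "obj ?T (Suc n) = A" "dif ?T n = Id \<C> A"
    "\<And>i. i < n \<Longrightarrow> dif ?T i = zero Z (obj ?T (Suc i))"
    by (simp_all add: trivial_right_def zero_def)
  have TOb: "obj ?T i \<in> Ob \<C>" for i using Xc(5) zer(1) by (simp add: trivial_right_def)
  have Td: "dif ?T i \<proportion> obj ?T i \<rightarrow> obj ?T (Suc i)" if "i \<le> n" for i
    using that T TOb Xc(5) zer(1) maps_Id maps_zero by (cases "i = n") auto
  have Tc: "cochain_complex n \<C> ?T"
    unfolding cochain_complex_iff
  proof (intro conjI allI impI TOb Td)
    fix i assume i: "i < n"
    have "dif ?T (Suc i) \<cdot> dif ?T i \<proportion> Z \<rightarrow> obj ?T (Suc (Suc i))"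
      using maps_comp[OF Td[of i] Td[of "Suc i"]] i T by simp
    then show "dif ?T (Suc i) \<cdot> dif ?T i = zero (obj ?T i) (obj ?T (Suc (Suc i)))"
      using zer(3) i T by simp
  qed
  have n0: "0 < n" using n by simp
  show Tb: "?T \<in> complexes_between n \<C> Z A" using Tc T n0 by (simp add: complexes_between_def)
  obtain s where s: "s \<proportion> A \<rightarrow> obj X n" "dif X n \<cdot> s = Id \<C> A"
    using ex pull_zero[OF zer(1) maps_Id[OF Xc(5)]] Xc(2,3) maps_Id[OF Xc(5)]
    unfolding n_exangle_iff left_exact_def by auto
  have dn: "dif X n \<proportion> obj X n \<rightarrow> A" using complex_dif[OF Xc(1), of n] Xc(3) by simp
  let ?f = "\<lambda>i. if i = Suc n then Id \<C> A else if i = n then dif X n else zero (obj X i) Z"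
  let ?g = "\<lambda>i. if i = Suc n then Id \<C> A else if i = n then s else zero Z (obj X i)"
  have fm: "?f i \<proportion> obj X i \<rightarrow> obj ?T i" and gm: "?g i \<proportion> obj ?T i \<rightarrow> obj X i" if i: "i \<le> Suc n" for i
  proof -
    consider "i = Suc n" | "i = n" | "i < n" using i by linarith
    then have "?f i \<proportion> obj X i \<rightarrow> obj ?T i \<and> ?g i \<proportion> obj ?T i \<rightarrow> obj X i"
      by cases (use T Xc s dn maps_Id maps_zero zer(1) complex_Ob[OF Xc(1) i] in auto)
    then show "?f i \<proportion> obj X i \<rightarrow> obj ?T i" "?g i \<proportion> obj ?T i \<rightarrow> obj X i" by auto
  qed
  have Id: "Id \<C> Z = zero Z Z" using zer(3)[OF maps_Id[OF zer(1)]] .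
  have "chain_map n \<C> X ?T ?f"
    unfolding chain_map_iff[OF Xc(1) Tc]
  proof (intro conjI allI impI fm)
    fix i assume i: "i \<le> n"
    consider "i = n" | "Suc i = n" | "Suc i < n" using i by linarith
    then show "?f (Suc i) \<cdot> dif X i = dif ?T i \<cdot> ?f i"
    proof cases
      case 1
      then show ?thesis using T dn by simp
    next
      case 2
      then have lt: "i < n" by simp
      have dd: "dif X n \<cdot> dif X i = zero (obj X i) A" using complex_dif_dif[OF Xc(1) lt] 2 Xc(3) by simp
      have "dif ?T i \<cdot> zero (obj X i) Z = zero (obj X i) A"
        using T(2,5) 2 lt Xc(5) zer(1) complex_Ob[OF Xc(1), of i] by simp
      then show ?thesis using dd 2 by auto
    next
      case 3
      have "?f (Suc i) \<cdot> dif X i \<proportion> obj X i \<rightarrow> Z" "dif ?T i \<cdot> ?f i \<proportion> obj X i \<rightarrow> Z"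
        using maps_comp[OF complex_dif[OF Xc(1) i] fm[of "Suc i"]] maps_comp[OF fm[of i] Td[of i]] i 3 T(1)[OF 3]
          by simp_all
      then show ?thesis using zer(2) by metis
    qed
  qed
  then have f: "lift n \<C> X ?T (Id \<C> Z) (Id \<C> A) ?f" using Id n0 Xc(2) by (simp add: lift_def)
  have "chain_map n \<C> ?T X ?g"
    unfolding chain_map_iff[OF Tc Xc(1)]
  proof (intro conjI allI impI gm)
    fix i assume i: "i \<le> n"
    show "?g (Suc i) \<cdot> dif ?T i = dif X i \<cdot> ?g i"
    proof (cases "i = n")
      case True
      then show ?thesis using T s Xc(5) by simp
    next
      case False
      then have "?g (Suc i) \<cdot> dif ?T i \<proportion> Z \<rightarrow> obj X (Suc i)" "dif X i \<cdot> ?g i \<proportion> Z \<rightarrow> obj X (Suc i)"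
        using maps_comp[OF Td[of i] gm[of "Suc i"]] maps_comp[OF gm[of i] complex_dif[OF Xc(1) i]] i T by simp_all
      then show ?thesis using zer(3) by metis
    qed
  qed
  then have g: "lift n \<C> ?T X (Id \<C> Z) (Id \<C> A) ?g" using Id n0 Xc(2) by (simp add: lift_def)
  have "weak_kernels n ?T"
    unfolding weak_kernels_def
  proof (intro allI impI)
    fix i W u assume i: "i < n" and u: "u \<proportion> W \<rightarrow> obj ?T (Suc i)"
      and du: "dif ?T (Suc i) \<cdot> u = zero W (obj ?T (Suc (Suc i)))"
    have W: "W \<in> Ob \<C>" using u by (simp add: maps_unfold)
    have "u = zero W (obj ?T (Suc i))"
    proof (cases "Suc i = n")
      case True
      then show ?thesis using du u T by (simp add: maps_unfold)
    next
      case False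
      then show ?thesis using zer(2) u i T by simp
    qed
    then have "dif ?T i \<cdot> zero W (obj ?T i) = u" using Td[of i] W i by (simp add: maps_unfold)
    then show "\<exists>v. v \<proportion> W \<rightarrow> obj ?T i \<and> dif ?T i \<cdot> v = u" using maps_zero[OF W TOb] by blast
  qed
  then show "homotopy_equivalent n \<C> Z A X ?T"
    using homotopy_equivalent_of_lifts[OF X Tb _ _ f g] ex by (simp add: n_exangle_iff left_exact_def)
qed

end

locale projective_injective_ideal = exact_realization n \<C> \<E> \<ss>
  for n :: nat and \<C> :: "('o, 'm) precategory" (structure) and \<E> :: "('o, 'm, 'e) bifunctor"
    and \<ss> :: "('o, 'm, 'e) correspondence" +
  fixes \<X> :: "'o set"
  assumes n_pos: "n \<ge> 1" and sums: "finite_sum_closed \<C> \<X>"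
    and sub: "\<X> \<subseteq> projectives n \<C> \<E> \<ss> \<inter> injectives n \<C> \<E> \<ss>"

text \<open>
  If \<open>\<delta>\<close> ends in a projective object, then the identity of that object lifts along the last
  differential \<open>d\<close> as \<open>d b = 1\<close>, and \<open>\<delta> = b\<^sup>*d\<^sup>*\<delta> = 0\<close>. Dually for injective objects.
\<close>

sublocale projective_injective_ideal \<subseteq> ideal_bifunctor \<C> \<X> \<E>
proof (unfold_locales)
  show X_Ob: "\<X> \<subseteq> Ob \<C>" using sub by (auto simp: projectives_def)
  show "finite_sum_closed \<C> \<X>" by (rule sums)
  show "\<delta> = \<one>\<^bsub>Ext \<E> Q A\<^esub>" if Q: "Q \<in> \<X>" and A: "A \<in> Ob \<C>" and \<delta>: "\<delta> \<in> extensions \<E> Q A" for Q A \<delta>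
  proof -
    have QO: "Q \<in> Ob \<C>" using Q X_Ob by blast
    obtain X where X: "dist X \<delta>" "obj X 0 = A" "obj X (Suc n) = Q" using distinguished_exists[OF QO A \<delta>] .
    have d: "dif X n \<proportion> obj X n \<rightarrow> Q" using complex_dif[OF distinguished_exact(1)[OF X(1)], of n] X by simp
    have "\<forall>c\<in>arrows \<C> Q Q. \<exists>b\<in>arrows \<C> Q (obj X n). dif X n \<cdot> b = c"
      using subsetD[OF sub Q] X by (auto simp: projectives_def)
    then obtain b where b: "b \<in> arrows \<C> Q (obj X n)" "dif X n \<cdot> b = Id \<C> Q" using id_closed[OF QO] by blast
    have b': "b \<proportion> Q \<rightarrow> obj X n" using b(1) QO d by (simp add: maps_def)
    have "\<delta> = pull \<C> \<E> A b (pull \<C> \<E> A (dif X n) \<delta>)"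
      using pull_pull[OF A d b' \<delta>] b(2) pull_Id[OF QO A \<delta>] by simp
    then show ?thesis
      using distinguished_exact(2)[OF X(1)] X pull_zero[OF A b'] by (simp add: left_exact_def)
  qed
  show "\<delta> = \<one>\<^bsub>Ext \<E> C Q\<^esub>" if Q: "Q \<in> \<X>" and C: "C \<in> Ob \<C>" and \<delta>: "\<delta> \<in> extensions \<E> C Q" for Q C \<delta>
  proof -
    have QO: "Q \<in> Ob \<C>" using Q X_Ob by blast
    obtain X where X: "dist X \<delta>" "obj X 0 = Q" "obj X (Suc n) = C" using distinguished_exists[OF C QO \<delta>] .
    have d: "dif X 0 \<proportion> Q \<rightarrow> obj X 1" using complex_dif[OF distinguished_exact(1)[OF X(1)], of 0] X by simp
    have "\<forall>c\<in>arrows \<C> Q Q. \<exists>b\<in>arrows \<C> (obj X 1) Q. b \<cdot> dif X 0 = c"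
      using subsetD[OF sub Q] X by (auto simp: injectives_def)
    then obtain b where b: "b \<in> arrows \<C> (obj X 1) Q" "b \<cdot> dif X 0 = Id \<C> Q" using id_closed[OF QO] by blast
    have b': "b \<proportion> obj X 1 \<rightarrow> Q" using b(1) QO d by (simp add: maps_def)
    have "\<delta> = push \<C> \<E> C b (push \<C> \<E> C (dif X 0) \<delta>)"
      using push_push[OF C d b' \<delta>] b(2) push_Id[OF C QO \<delta>] by simp
    then show ?thesis
      using distinguished_exact(3)[OF X(1)] X push_zero[OF C b'] by (simp add: right_exact_def)
  qed
qed

context projective_injective_ideal
begin

abbreviation QReal :: "('o, 'm set, 'e) correspondence" where
  "QReal \<equiv> quotient_correspondence n \<C> \<X> \<ss>"

abbreviation qdist :: "('o, 'm set) cochain \<Rightarrow> 'e \<Rightarrow> bool" where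
  "qdist \<equiv> distinguished n Quot QExt QReal"

lemma realizes_distinguished:
  assumes "C \<in> Ob \<C>" "A \<in> Ob \<C>" "\<delta> \<in> extensions \<E> C A" "X \<in> \<ss> C A \<delta>"
  shows "dist X \<delta>" "obj X 0 = A" "obj X (Suc n) = C"
  using assms realization_class[OF assms(1-3)]
    by (auto simp: distinguished_def homotopy_class_def complexes_between_def)

text \<open>
  The union in the definition of the induced correspondence is one of equal classes, because homotopy
  equivalences descend.
\<close>

lemma QReal_eq:
  assumes X: "dist X \<delta>"
  shows "QReal (obj X (Suc n)) (obj X 0) \<delta> = homotopy_class n Quot (obj X 0) (obj X (Suc n)) (qc X)"
proof -
  let ?A = "obj X 0" and ?C = "obj X (Suc n)"
  have Xs: "X \<in> \<ss> ?C ?A \<delta>" "?C \<in> Ob \<C>" "?A \<in> Ob \<C>" "\<delta> \<in> extensions \<E> ?C ?A" using X by (auto simp: distinguished_def)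
  have "homotopy_class n Quot ?A ?C (qc Y) = homotopy_class n Quot ?A ?C (qc X)" if "Y \<in> \<ss> ?C ?A \<delta>" for Y
  proof -
    note Y = realizes_distinguished[OF Xs(2-4) that]
    have b: "X \<in> complexes_between n \<C> ?A ?C" "Y \<in> complexes_between n \<C> ?A ?C"
      using distinguished_complex(1)[OF X] distinguished_complex(1)[OF Y(1)] Y by simp_all
    show ?thesis
      using quot.homotopy_class_eq[OF qc_complexes_between[OF b(1)] qc_complexes_between[OF b(2)]
          qc_homotopy_equivalent[OF b distinguished_equivalent[OF X Y]]] by simp
  qed
  then show ?thesis using Xs(1) unfolding quotient_correspondence_def by blast
qed

lemma qdist_qc: "dist X \<delta> \<Longrightarrow> qdist (qc X) \<delta>"
proof -
  assume X: "dist X \<delta>"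
  have "qc X \<in> QReal (obj X (Suc n)) (obj X 0) \<delta>"
    unfolding QReal_eq[OF X] using quot.homotopy_class_self[OF qc_complexes_between[OF distinguished_complex(1)[OF
      X]]] .
  then show "qdist (qc X) \<delta>" using X by (simp add: distinguished_def quot_simps(1))
qed

text \<open>
  The form in which distinguished complexes of the quotient are used: the complex \<open>X\<close> of \<open>\<C>\<close> has the same
  ends, but is related to \<open>Y\<close> by a homotopy equivalence only.
\<close>

lemma qdistE:
  assumes Y: "qdist Y \<delta>"
  obtains X where "dist X \<delta>" "obj X 0 = obj Y 0" "obj X (Suc n) = obj Y (Suc n)"
    "Y \<in> complexes_between n Quot (obj Y 0) (obj Y (Suc n))"
    "homotopy_equivalent n Quot (obj Y 0) (obj Y (Suc n)) (qc X) Y"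
proof -
  have Y': "obj Y 0 \<in> Ob \<C>" "obj Y (Suc n) \<in> Ob \<C>" "\<delta> \<in> extensions \<E> (obj Y (Suc n)) (obj Y 0)"
    "Y \<in> QReal (obj Y (Suc n)) (obj Y 0) \<delta>"
    using Y by (auto simp: distinguished_def quot_simps(1))
  obtain X where X: "dist X \<delta>" "obj X 0 = obj Y 0" "obj X (Suc n) = obj Y (Suc n)"
    using distinguished_exists[OF Y'(2,1,3)] .
  then show thesis using that[OF X] Y'(4) QReal_eq[OF X(1)] by (auto simp: homotopy_class_def)
qed

end

locale weakly_exact_ideal = projective_injective_ideal n \<C> \<E> \<ss> \<X>
  for n :: nat and \<C> :: "('o, 'm) precategory" (structure) and \<E> :: "('o, 'm, 'e) bifunctor"
    and \<ss> :: "('o, 'm, 'e) correspondence" and \<X> :: "'o set" +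
  assumes weakly_exact: "dist X \<delta> \<Longrightarrow> weak_kernel_cokernel n Quot (qc X)"
begin

text \<open>
  The weak kernel-cokernel condition takes care of the intermediate terms. At the terms next to \<open>\<E>\<close> a
  factorization in \<open>\<C>\<close> of a representative induces the required one.
\<close>

lemma qc_n_exangle:
  assumes X: "dist X \<delta>"
  shows "n_exangle n Quot QExt (qc X) \<delta>"
proof -
  note Xc = complexes_betweenD[OF distinguished_complex(1)[OF X]] and \<delta> = distinguished_complex(2)[OF X]
  note wk = weakly_exact[OF X, unfolded quot.weak_kernel_cokernel_iff[OF qc_complex[OF Xc(1)]]]
  have d: "dif X n \<proportion> obj X n \<rightarrow> obj X (Suc n)" "dif X 0 \<proportion> obj X 0 \<rightarrow> obj X 1"
    using complex_dif[OF Xc(1), of n] complex_dif[OF Xc(1), of 0] by simp_all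
  note q = qc_dif[OF Xc(1) order_refl] qc_dif[OF Xc(1), of 0]
  have "\<exists>v. quot.maps v W (obj X n) \<and> dif (qc X) n \<cdot>\<^bsub>Quot\<^esub> v = u"
    if u: "quot.maps u W (obj X (Suc n))" and u0: "pull Quot QExt (obj X 0) u \<delta> = \<one>\<^bsub>Ext \<E> W (obj X 0)\<^esub>" for W u
  proof -
    obtain u' where u': "u' \<proportion> W \<rightarrow> obj X (Suc n)" "u = cls u'" using quot_mapsE[OF u] .
    obtain v where "v \<proportion> W \<rightarrow> obj X n" "dif X n \<cdot> v = u'"
      using distinguished_exact(2)[OF X] u' u0 quot_pull[OF Xc(4) u'(1) \<delta>] unfolding left_exact_def by auto
    then show ?thesis using quot_comp[OF _ d(1)] cls_maps u'(2) q(1) by metis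
  qed
  then have l: "quot.left_exact n (qc X) \<delta>"
    unfolding quot.left_exact_def
    using wk quot_pull[OF Xc(4) d(1) \<delta>] distinguished_exact(2)[OF X] q by (simp add: left_exact_def)
  have "\<exists>v. quot.maps v (obj X 1) W \<and> v \<cdot>\<^bsub>Quot\<^esub> dif (qc X) 0 = u"
    if u: "quot.maps u (obj X 0) W" and u0: "push Quot QExt (obj X (Suc n)) u \<delta> = \<one>\<^bsub>Ext \<E> (obj X (Suc n)) W\<^esub>" for W u
  proof -
    obtain u' where u': "u' \<proportion> obj X 0 \<rightarrow> W" "u = cls u'" using quot_mapsE[OF u] .
    obtain v where "v \<proportion> obj X 1 \<rightarrow> W" "v \<cdot> dif X 0 = u'"
      using distinguished_exact(3)[OF X] u' u0 quot_push[OF Xc(5) u'(1) \<delta>] unfolding right_exact_def by auto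
    then show ?thesis using quot_comp[OF d(2)] cls_maps u'(2) q(2) by (metis le0)
  qed
  then have r: "quot.right_exact n (qc X) \<delta>"
    unfolding quot.right_exact_def
    using wk quot_push[OF Xc(5) d(2) \<delta>] distinguished_exact(3)[OF X] q by (simp add: right_exact_def)
  show ?thesis using l r qc_complex[OF Xc(1)] \<delta> by (simp add: quot.n_exangle_iff)
qed

lemma quot_exact_realization: "exact_realization n Quot QExt QReal"
proof (rule exact_realization.intro[OF quot_additive_bifunctor], rule exact_realization_axioms.intro)
  show "\<exists>X\<in>complexes_between n Quot A C. QReal C A \<delta> = homotopy_class n Quot A C X"
    if CA: "C \<in> Ob Quot" "A \<in> Ob Quot" "\<delta> \<in> extensions QExt C A" for C A \<delta>
  proof -
    obtain X where X: "dist X \<delta>" "obj X 0 = A" "obj X (Suc n) = C"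
      by (rule distinguished_exists[of C A \<delta>]) (use CA in \<open>simp_all add: quot_simps(1)\<close>)
    then show ?thesis using QReal_eq[OF X(1)] qc_complexes_between[OF distinguished_complex(1)[OF X(1)]] by auto
  qed
next
  fix X' \<delta> Y' \<rho> a c
  assume X': "qdist X' \<delta>" and Y': "qdist Y' \<rho>"
    and m: "ext_morphism Quot QExt (obj X' (n+1)) (obj X' 0) \<delta> (obj Y' (n+1)) (obj Y' 0) \<rho> a c"
  obtain X where X: "dist X \<delta>" "obj X 0 = obj X' 0" "obj X (Suc n) = obj X' (Suc n)"
    and X'b: "X' \<in> complexes_between n Quot (obj X' 0) (obj X' (Suc n))"
    and XX': "homotopy_equivalent n Quot (obj X' 0) (obj X' (Suc n)) (qc X) X'" using qdistE[OF X'] .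
  obtain Y where Y: "dist Y \<rho>" "obj Y 0 = obj Y' 0" "obj Y (Suc n) = obj Y' (Suc n)"
    and Y'b: "Y' \<in> complexes_between n Quot (obj Y' 0) (obj Y' (Suc n))"
    and YY': "homotopy_equivalent n Quot (obj Y' 0) (obj Y' (Suc n)) (qc Y) Y'" using qdistE[OF Y'] .
  note Xc = complexes_betweenD[OF distinguished_complex(1)[OF X(1)]] and \<delta> = distinguished_complex(2)[OF X(1)]
  note Yc = complexes_betweenD[OF distinguished_complex(1)[OF Y(1)]] and \<rho> = distinguished_complex(2)[OF Y(1)]
  have "quot.maps a (obj X 0) (obj Y 0)" "quot.maps c (obj X (Suc n)) (obj Y (Suc n))"
    using m X Y Xc Yc by (auto simp: ext_morphism_def quot.maps_def quot_simps(1))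
  then obtain a0 c0 where a0: "a0 \<proportion> obj X 0 \<rightarrow> obj Y 0" "a = cls a0"
    and c0: "c0 \<proportion> obj X (Suc n) \<rightarrow> obj Y (Suc n)" "c = cls c0"
    using quot_maps_iff by metis
  have "push \<C> \<E> (obj X (Suc n)) a0 \<delta> = pull \<C> \<E> (obj Y 0) c0 \<rho>"
    using m quot_push[OF Xc(5) a0(1) \<delta>] quot_pull[OF Yc(4) c0(1) \<rho>] X Y a0 c0 by (simp add: ext_morphism_def)
  then obtain f where f: "lift n \<C> X Y a0 c0 f" using distinguished_lift[OF X(1) Y(1) a0(1) c0(1)] by blast
  obtain \<phi> where \<phi>: "lift n Quot X' (qc X) (Id Quot (obj X' 0)) (Id Quot (obj X' (Suc n))) \<phi>"
    using XX' unfolding homotopy_equivalent_def by blast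
  obtain \<psi> where \<psi>: "lift n Quot (qc Y) Y' (Id Quot (obj Y' 0)) (Id Quot (obj Y' (Suc n))) \<psi>"
    using YY' unfolding homotopy_equivalent_def by blast
  note X'c = quot.complexes_betweenD[OF X'b] and Y'c = quot.complexes_betweenD[OF Y'b]
  note l = quot.lift_comp[OF X'c(1) qc_complex[OF Yc(1)] Y'c(1)
      quot.lift_comp[OF X'c(1) qc_complex[OF Xc(1)] qc_complex[OF Yc(1)] \<phi> qc_lift[OF Xc(1) Yc(1) f]] \<psi>]
  have "quot.maps a (obj X' 0) (obj Y' 0)" "quot.maps c (obj X' (Suc n)) (obj Y' (Suc n))"
    using a0 c0 cls_maps X Y by auto
  then have "Id Quot (obj Y' 0) \<cdot>\<^bsub>Quot\<^esub> a \<cdot>\<^bsub>Quot\<^esub> Id Quot (obj X' 0) = a"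
    "Id Quot (obj Y' (Suc n)) \<cdot>\<^bsub>Quot\<^esub> c \<cdot>\<^bsub>Quot\<^esub> Id Quot (obj X' (Suc n)) = c"
    by (simp_all add: quot.maps_unfold)
  then show "\<exists>f. lift n Quot X' Y' a c f" using l a0(2) c0(2) by auto
next
  fix Y \<delta> assume Y: "qdist Y \<delta>"
  obtain X where X: "dist X \<delta>" "obj X 0 = obj Y 0" "obj X (Suc n) = obj Y (Suc n)"
    and Yb: "Y \<in> complexes_between n Quot (obj Y 0) (obj Y (Suc n))"
    and XY: "homotopy_equivalent n Quot (obj Y 0) (obj Y (Suc n)) (qc X) Y" using qdistE[OF Y] .
  have "qc X \<in> complexes_between n Quot (obj Y 0) (obj Y (Suc n))"
    using qc_complexes_between[OF distinguished_complex(1)[OF X(1)]] X by simp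
  then show "n_exangle n Quot QExt Y \<delta>"
    using quot.n_exangle_homotopy_invariant[OF _ Yb XY qc_n_exangle[OF X(1)]] by blast
next
  fix A Z assume "A \<in> Ob Quot" and Z: "zero_object Quot Z"
  then have Ob: "A \<in> Ob \<C>" "Z \<in> Ob \<C>" by (auto simp: zero_object_def quot_simps(1))
  obtain X where X: "dist X \<one>\<^bsub>Ext \<E> Z A\<^esub>" "obj X 0 = A" "obj X (Suc n) = Z"
    using distinguished_exists[OF Ob(2,1) ext_zero_closed[OF Ob(2,1)]] .
  have b: "qc X \<in> complexes_between n Quot A Z" using qc_complexes_between[OF distinguished_complex(1)[OF X(1)]] X
    by simp
  have "n_exangle n Quot QExt (qc X) \<one>\<^bsub>Ext QExt Z A\<^esub>" using qc_n_exangle[OF X(1)] by simp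
  note t = quot.split_equivalent_trivial_left[OF n_pos Z b this]
  show "QReal Z A \<one>\<^bsub>Ext QExt Z A\<^esub> = homotopy_class n Quot A Z (trivial_left n Quot A Z)"
    using QReal_eq[OF X(1)] X quot.homotopy_class_eq[OF b t] by simp
  obtain Y where Y: "dist Y \<one>\<^bsub>Ext \<E> A Z\<^esub>" "obj Y 0 = Z" "obj Y (Suc n) = A"
    using distinguished_exists[OF Ob ext_zero_closed[OF Ob]] .
  have b: "qc Y \<in> complexes_between n Quot Z A" using qc_complexes_between[OF distinguished_complex(1)[OF Y(1)]] Y
    by simp
  have "n_exangle n Quot QExt (qc Y) \<one>\<^bsub>Ext QExt A Z\<^esub>" using qc_n_exangle[OF Y(1)] by simp
  note t = quot.split_equivalent_trivial_right[OF n_pos Z b this]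
  show "QReal A Z \<one>\<^bsub>Ext QExt A Z\<^esub> = homotopy_class n Quot Z A (trivial_right n Quot A Z)"
    using QReal_eq[OF Y(1)] Y quot.homotopy_class_eq[OF b t] by simp
qed

end

sublocale weakly_exact_ideal \<subseteq> quot: exact_realization n Quot QExt QReal
  by (rule quot_exact_realization)

section \<open>Cones and inflations in the quotient\<close>

locale exangulated_ideal = n_exangulated_category n \<C> \<E> \<ss> + weakly_exact_ideal n \<C> \<E> \<ss> \<X>
  for n :: nat and \<C> :: "('o, 'm) precategory" (structure) and \<E> :: "('o, 'm, 'e) bifunctor"
    and \<ss> :: "('o, 'm, 'e) correspondence" and \<X> :: "'o set"
begin

text \<open>
  (EA2) in \<open>\<C>\<close> provides one pair of representatives with a good cone; \<open>EA2_representatives\<close>, applied in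
  the quotient, carries it over to the given pair.
\<close>

lemma quot_EA2:
  assumes A: "A \<in> Ob \<C>" and \<rho>: "\<rho> \<in> extensions \<E> D A" and F: "quot.maps F C D"
    and X': "obj X' 0 = A" "obj X' (Suc n) = C" "qdist X' (pull Quot QExt A F \<rho>)"
    and Y': "obj Y' 0 = A" "obj Y' (Suc n) = D" "qdist Y' \<rho>"
  shows "\<exists>f M. lift n Quot X' Y' (Id Quot A) F f \<and> mapping_cone n Quot X' Y' f M \<and>
    qdist M (push Quot QExt D (dif X' 0) \<rho>)"
proof -
  obtain c where c: "c \<proportion> C \<rightarrow> D" "F = cls c" using quot_mapsE[OF F] .
  have CD: "C \<in> Ob \<C>" "D \<in> Ob \<C>" using c by (auto simp: maps_def)
  have \<sigma>: "pull Quot QExt A F \<rho> = pull \<C> \<E> A c \<rho>" "pull \<C> \<E> A c \<rho> \<in> extensions \<E> C A"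
    using quot_pull[OF A c(1) \<rho>] pull_closed[OF A c(1) \<rho>] c(2) by simp_all
  obtain X where X: "dist X (pull \<C> \<E> A c \<rho>)" "obj X 0 = A" "obj X (Suc n) = C"
    using distinguished_exists[OF CD(1) A \<sigma>(2)] .
  obtain Y where Y: "dist Y \<rho>" "obj Y 0 = A" "obj Y (Suc n) = D" using distinguished_exists[OF CD(2) A \<rho>] .
  obtain f M where f: "lift n \<C> X Y (Id \<C> A) c f" and M: "mapping_cone n \<C> X Y f M"
    and dM: "dist M (push \<C> \<E> D (dif X 0) \<rho>)"
    using EA2[OF A CD \<rho> _ X(2) _ X(1) Y(2) _ Y(1)] c(1) X(3) Y(3) by (auto simp: maps_def)
  note Xc = complexes_betweenD[OF distinguished_complex(1)[OF X(1)]]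
    and Yc = complexes_betweenD[OF distinguished_complex(1)[OF Y(1)]]
  have fc: "chain_map n \<C> X Y f" using f by (simp add: lift_def)
  have d0: "dif X 0 \<proportion> A \<rightarrow> obj X 1" using complex_dif[OF Xc(1), of 0] X by simp
  have "qdist (qc X) (pull Quot QExt A F \<rho>)" "qdist (qc Y) \<rho>"
    using qdist_qc[OF X(1)] qdist_qc[OF Y(1)] \<sigma> by simp_all
  moreover have "lift n Quot (qc X) (qc Y) (Id Quot A) F (\<lambda>i. cls (f i))"
    using qc_lift[OF Xc(1) Yc(1) f] quot_Id[OF A] c(2) by simp
  moreover have "mapping_cone n Quot (qc X) (qc Y) (\<lambda>i. cls (f i)) (qc M)"
    using qc_mapping_cone[OF n_pos Xc(1) Yc(1) fc M] .
  moreover have "qdist (qc M) (push Quot QExt D (dif (qc X) 0) \<rho>)"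
    using qdist_qc[OF dM] quot_push[OF CD(2) d0 \<rho>] qc_dif[OF Xc(1), of 0] by simp
  ultimately obtain f' M' where "lift n Quot X' Y' (Id Quot A) F f'" "mapping_cone n Quot X' Y' f' M'"
      "qdist M' (push Quot QExt D (dif X' 0) \<rho>)"
    using quot.EA2_representatives[OF n_pos, of \<rho> D A F C "qc X" "qc Y" "\<lambda>i. cls (f i)" "qc M" X' Y'] F A \<rho> X X' Y Y'
    by (auto simp: quot_simps(1))
  then show ?thesis by blast
qed

text \<open>
  Let \<open>X\<close> be a complex of \<open>\<C>\<close> realizing \<open>\<delta>\<close>, and let \<open>a\<close> represent the first differential of \<open>X'\<close>. For
  \<open>n \<ge> 2\<close>, (EA2\<open>\<^sup>o\<^sup>p\<close>) for the push-out of \<open>\<delta>\<close> along \<open>a\<close> shows that \<open>(d, a) : X\<^sup>0 \<rightarrow> X\<^sup>1 \<oplus> X'\<^sup>1\<close> is an inflation. In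
  the quotient \<open>d\<close> factors through \<open>a\<close> as \<open>d = wa\<close>, so that \<open>X'\<^sup>1\<close> is a retract of \<open>X\<^sup>1 \<oplus> X'\<^sup>1\<close> by the
  second projection and the section \<open>(w, 1)\<close>. For \<open>n = 1\<close> the middle terms of \<open>X\<close> and \<open>X'\<close> are
  isomorphic in the quotient, and \<open>d\<close> itself serves as \<open>f\<close>.
\<close>

lemma split_inflation:
  assumes X': "qdist X' \<delta>"
  obtains B f \<phi> \<psi> where "inflation n \<C> \<E> \<ss> (obj X' 0) B f" "f \<proportion> obj X' 0 \<rightarrow> B"
    "quot.maps \<phi> B (obj X' 1)" "quot.maps \<psi> (obj X' 1) B" "\<phi> \<cdot>\<^bsub>Quot\<^esub> \<psi> = Id Quot (obj X' 1)"
    "\<phi> \<cdot>\<^bsub>Quot\<^esub> cls f = dif X' 0" "\<psi> \<cdot>\<^bsub>Quot\<^esub> dif X' 0 = cls f" "n = 1 \<Longrightarrow> \<psi> \<cdot>\<^bsub>Quot\<^esub> \<phi> = Id Quot B"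
proof -
  let ?A = "obj X' 0" and ?C = "obj X' (Suc n)" and ?B = "obj X' 1"
  obtain X where X: "dist X \<delta>" "obj X 0 = ?A" "obj X (Suc n) = ?C"
    and X'b: "X' \<in> complexes_between n Quot ?A ?C" and XX': "homotopy_equivalent n Quot ?A ?C (qc X) X'"
      using qdistE[OF X'] .
  note Xb = distinguished_complex(1)[OF X(1), unfolded X(2,3)]
    and \<delta> = distinguished_complex(2)[OF X(1), unfolded X(2,3)]
  note Xc = complexes_betweenD[OF Xb] and X'c = quot.complexes_betweenD[OF X'b]
    and qXc = qc_complex[OF complexes_betweenD(1)[OF Xb]]
  obtain g \<Psi> where g: "lift n Quot (qc X) X' (Id Quot ?A) (Id Quot ?C) g"
    and \<Psi>: "lift n Quot X' (qc X) (Id Quot ?A) (Id Quot ?C) \<Psi>" using XX' unfolding homotopy_equivalent_def by blast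
  have gc: "chain_map n Quot (qc X) X' g" and \<Psi>c: "chain_map n Quot X' (qc X) \<Psi>"
    and ends: "g 0 = Id Quot ?A" "\<Psi> 0 = Id Quot ?A" "g (Suc n) = Id Quot ?C" "\<Psi> (Suc n) = Id Quot ?C"
    using g \<Psi> by (auto simp: lift_def)
  have \<Psi>m: "quot.maps (\<Psi> 1) ?B (obj X 1)" using quot.chain_map_maps[OF X'c(1) qXc \<Psi>c, of 1] by simp
  have d': "quot.maps (dif X' 0) ?A ?B" using quot.complex_dif[OF X'c(1), of 0] by simp
  have d: "dif X 0 \<proportion> ?A \<rightarrow> obj X 1" using complex_dif[OF Xc(1), of 0] X by simp
  have dc: "dif (qc X) 0 = cls (dif X 0)" using qc_dif[OF Xc(1), of 0] by simp
  have \<Psi>d: "\<Psi> 1 \<cdot>\<^bsub>Quot\<^esub> dif X' 0 = cls (dif X 0)"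
    using quot.chain_map_commute[OF X'c(1) qXc \<Psi>c, of 0] ends dc cls_maps[OF d] by (simp add: quot.maps_unfold)
  show thesis
  proof (cases "n = 1")
    case True
    have I: "Id Quot ?A \<cdot>\<^bsub>Quot\<^esub> Id Quot ?A = Id Quot ?A" "Id Quot ?C \<cdot>\<^bsub>Quot\<^esub> Id Quot ?C = Id Quot ?C"
      using quot.maps_Id[OF X'c(4)] quot.maps_Id[OF X'c(5)] by (simp_all add: quot.maps_unfold)
    have two: "obj X 2 = ?C" "obj X' 2 = ?C" "g 2 = Id Quot ?C" "\<Psi> 2 = Id Quot ?C"
      using True X(3) ends by (simp_all add: numeral_2_eq_2)
    obtain m where m: "quot.maps m (obj (qc X) 1) ?B" "m \<cdot>\<^bsub>Quot\<^esub> \<Psi> 1 = Id Quot ?B"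
      "\<Psi> 1 \<cdot>\<^bsub>Quot\<^esub> m = Id Quot (obj (qc X) 1)"
      "m \<cdot>\<^bsub>Quot\<^esub> dif (qc X) 0 = dif X' 0 \<cdot>\<^bsub>Quot\<^esub> g 0"
      by (rule quot.short_middle_isomorphism[of X' "qc X" \<Psi> g])
        (use X'c(1) qXc \<Psi>c gc True ends I two X quot.distinguished_exact(4)[OF X'] quot.distinguished_exact(4)[OF
          qdist_qc[OF X(1)]] in simp_all)
    have "inflation n \<C> \<E> \<ss> ?A (obj X 1) (dif X 0)" unfolding inflation_def using X by blast
    moreover have "m \<cdot>\<^bsub>Quot\<^esub> cls (dif X 0) = dif X' 0" using m(4) dc ends d' by (simp add: quot.maps_unfold)
    ultimately show thesis using that[of "obj X 1" "dif X 0" m "\<Psi> 1"] d m \<Psi>m \<Psi>d by simp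
  next
    case False
    obtain a where a: "a \<proportion> ?A \<rightarrow> ?B" "dif X' 0 = cls a" using quot_mapsE[OF d'] .
    obtain w where w: "w \<proportion> ?B \<rightarrow> obj X 1" "\<Psi> 1 = cls w" using quot_mapsE[OF \<Psi>m] .
    have B: "?B \<in> Ob \<C>" using a by (simp add: maps_def)
    obtain Y where Y: "dist Y (push \<C> \<E> ?C a \<delta>)" "obj Y 0 = ?B" "obj Y (Suc n) = ?C"
      using distinguished_exists[OF Xc(5) B push_closed[OF Xc(5) a(1) \<delta>]] .
    obtain h N where h: "lift n \<C> X Y a (Id \<C> ?C) h" and N: "mapping_cocone n \<C> X Y h N"
      and dN: "dist N (pull \<C> \<E> ?A (dif Y n) \<delta>)"
      using EA2_op[OF Xc(4) B Xc(5) \<delta> _ X(2) _ X(1) Y(2) _ Y(1)] a(1) X(3) Y(3) by (auto simp: maps_def)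
    let ?S = "obj N 1" and ?f = "dif N 0"
    obtain i1 i2 p1 p2 where bps: "\<forall>k\<in>{1..n}. biproduct \<C> (obj X k) (obj Y (k-1)) (obj N k) (i1 k) (i2 k) (p1 k) (p2
      k)"
      and p1f: "p1 1 \<cdot> ?f = dif X 0" and p2f: "p2 1 \<cdot> ?f = h 0"
      using N unfolding mapping_cocone_def by blast
    have "biproduct \<C> (obj X 1) ?B ?S (i1 1) (i2 1) (p1 1) (p2 1)" using bspec[OF bps, of 1] n_pos Y(2) by simp
    then obtain i1 i2 p1 p2 where bp: "biproduct \<C> (obj X 1) ?B ?S i1 i2 p1 p2"
      and pf: "p1 \<cdot> ?f = dif X 0" "p2 \<cdot> ?f = a"
      using p1f p2f h unfolding lift_def by blast
    have N0: "obj N 0 = ?A" using N X unfolding mapping_cocone_def by simp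
    have X1: "obj X 1 \<in> Ob \<C>" using d by (simp add: maps_def)
    note b = biproductD[OF bp X1 B]
    have f: "?f \<proportion> ?A \<rightarrow> ?S" using complex_dif[OF distinguished_exact(1)[OF dN], of 0] N0 by simp
    have iw: "i1 \<cdot> w \<boxplus> i2 \<proportion> ?B \<rightarrow> ?S" using b w by algebra
    have "p2 \<cdot> (i1 \<cdot> w \<boxplus> i2) = Id \<C> ?B" using comp_rewrite[OF b(8)] b w(1) by algebra
    then have 1: "cls p2 \<cdot>\<^bsub>Quot\<^esub> cls (i1 \<cdot> w \<boxplus> i2) = Id Quot ?B" using quot_comp[OF iw b(4)] quot_Id[OF B] by simp
    have 2: "cls p2 \<cdot>\<^bsub>Quot\<^esub> cls ?f = dif X' 0" using quot_comp[OF f b(4)] pf a by simp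
    have fdec: "?f = i1 \<cdot> dif X 0 \<boxplus> i2 \<cdot> a"
    proof -
      have "?f = (i1 \<cdot> p1 \<boxplus> i2 \<cdot> p2) \<cdot> ?f" unfolding b(9) using f by algebra
      also have "\<dots> = i1 \<cdot> (p1 \<cdot> ?f) \<boxplus> i2 \<cdot> (p2 \<cdot> ?f)" using b(1-4) f by algebra
      finally show ?thesis unfolding pf .
    qed
    have wa: "cls (w \<cdot> a) = cls (dif X 0)" using \<Psi>d a w quot_comp[OF a(1) w(1)] by simp
    have m1: "w \<cdot> a \<proportion> ?A \<rightarrow> obj X 1" "i1 \<cdot> w \<cdot> a \<proportion> ?A \<rightarrow> ?S" "i2 \<cdot> a \<proportion> ?A \<rightarrow> ?S" "i1 \<cdot> dif X 0 \<proportion> ?A \<rightarrow> ?S"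
      using b(1,2) w(1) a(1) d by (algebra, algebra, algebra, algebra)
    have "cls (i1 \<cdot> w \<boxplus> i2) \<cdot>\<^bsub>Quot\<^esub> dif X' 0 = cls (i1 \<cdot> w \<cdot> a \<boxplus> i2 \<cdot> a)"
      unfolding a(2) quot_comp[OF a(1) iw] using b(1,2) w(1) a(1) by (simp add: maps_unfold add_comp assoc)
    also have "\<dots> = quot.add (cls i1 \<cdot>\<^bsub>Quot\<^esub> cls (w \<cdot> a)) (cls (i2 \<cdot> a))"
      using quot_add[OF m1(2,3)] quot_comp[OF m1(1) b(1)] by simp
    also have "\<dots> = cls ?f"
      unfolding wa fdec using quot_add[OF m1(4,3)] quot_comp[OF d b(1)] by simp
    finally have 3: "cls (i1 \<cdot> w \<boxplus> i2) \<cdot>\<^bsub>Quot\<^esub> dif X' 0 = cls ?f" .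
    have "inflation n \<C> \<E> \<ss> ?A ?S ?f" unfolding inflation_def using dN N0 by blast
    then show thesis using that[of ?S ?f "cls p2" "cls (i1 \<cdot> w \<boxplus> i2)"] f cls_maps[OF b(4)] cls_maps[OF iw] 1 2 3 False
      by simp
  qed
qed

text \<open>
  With \<open>f\<close>, \<open>\<phi>\<close>, \<open>\<psi>\<close> from \<open>split_inflation\<close>, let \<open>W\<close> realize in \<open>\<C>\<close> the extension of \<open>G\<close> pushed out along \<open>\<psi>\<close>,
  with first differential \<open>d\<close>. Then \<open>d f\<close> is an inflation of \<open>\<C>\<close>, and lifts of \<open>(\<psi>, 1)\<close> and \<open>(\<phi>, 1)\<close>
  between the realization of \<open>G\<close> and \<open>W\<close> show that \<open>d f\<close> and \<open>GF\<close> factor through each other.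
\<close>

lemma quot_EA1_inflation:
  assumes F: "inflation n Quot QExt QReal A B F" and G: "inflation n Quot QExt QReal B D G"
  shows "inflation n Quot QExt QReal A D (G \<cdot>\<^bsub>Quot\<^esub> F)"
proof -
  obtain X' \<delta> where X': "qdist X' \<delta>" "obj X' 0 = A" "obj X' 1 = B" "dif X' 0 = F" using F unfolding inflation_def
    by blast
  obtain Y' \<rho> where Y': "qdist Y' \<rho>" "obj Y' 0 = B" "obj Y' 1 = D" "dif Y' 0 = G" using G unfolding inflation_def
    by blast
  obtain S f \<phi> \<psi> where inf: "inflation n \<C> \<E> \<ss> A S f" and f: "f \<proportion> A \<rightarrow> S" and \<phi>: "quot.maps \<phi> S B"
    and \<psi>: "quot.maps \<psi> B S"
    and \<phi>\<psi>: "\<phi> \<cdot>\<^bsub>Quot\<^esub> \<psi> = Id Quot B" and \<phi>f: "\<phi> \<cdot>\<^bsub>Quot\<^esub> cls f = F" and \<psi>F: "\<psi> \<cdot>\<^bsub>Quot\<^esub> F = cls f"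
    and \<psi>\<phi>: "n = 1 \<Longrightarrow> \<psi> \<cdot>\<^bsub>Quot\<^esub> \<phi> = Id Quot S"
    using split_inflation[OF X'(1), unfolded X'(2-4)] by blast
  let ?C = "obj Y' (Suc n)"
  note Y'b = quot.distinguished_complex(1)[OF Y'(1), unfolded Y'(2)]
    and \<rho>' = quot.distinguished_complex(2)[OF Y'(1), unfolded Y'(2)]
  note Y'c = quot.complexes_betweenD[OF Y'b]
  have \<rho>: "\<rho> \<in> extensions \<E> ?C B" and C: "?C \<in> Ob \<C>" using \<rho>' Y'c(5) by (simp_all add: quot_simps(1))
  obtain w where w: "w \<proportion> B \<rightarrow> S" "\<psi> = cls w" using quot_mapsE[OF \<psi>] .
  let ?\<sigma> = "push \<C> \<E> ?C w \<rho>"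
  have \<sigma>: "?\<sigma> \<in> extensions \<E> ?C S" "push Quot QExt ?C \<psi> \<rho> = ?\<sigma>"
    using push_closed[OF C w(1) \<rho>] quot_push[OF C w(1) \<rho>] w(2) by simp_all
  have S: "S \<in> Ob \<C>" using w by (simp add: maps_def)
  obtain W where W: "dist W ?\<sigma>" "obj W 0 = S" "obj W (Suc n) = ?C" using distinguished_exists[OF C S \<sigma>(1)] .
  have "inflation n \<C> \<E> \<ss> S (obj W 1) (dif W 0)" unfolding inflation_def using W by blast
  then have "inflation n \<C> \<E> \<ss> A (obj W 1) (dif W 0 \<cdot> f)" using EA1_inflation[OF inf] by blast
  then obtain V \<epsilon> where V: "dist V \<epsilon>" "obj V 0 = A" "obj V 1 = obj W 1" "dif V 0 = dif W 0 \<cdot> f"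
    unfolding inflation_def by blast
  note Wc = complexes_betweenD[OF distinguished_complex(1)[OF W(1)]]
    and Vc = complexes_betweenD[OF distinguished_complex(1)[OF V(1)]]
  have dW: "dif W 0 \<proportion> S \<rightarrow> obj W 1" using complex_dif[OF Wc(1), of 0] W by simp
  have qW: "dif (qc W) 0 = cls (dif W 0)" using qc_dif[OF Wc(1), of 0] by simp
  have qV: "dif (qc V) 0 = cls (dif W 0) \<cdot>\<^bsub>Quot\<^esub> cls f" using qc_dif[OF Vc(1), of 0] V quot_comp[OF f dW] by simp
  have dV: "quot.maps (cls (dif W 0) \<cdot>\<^bsub>Quot\<^esub> cls f) A (obj W 1)"
    using quot.maps_comp[OF cls_maps[OF f] cls_maps[OF dW]] .
  have qWd: "qdist (qc W) ?\<sigma>" using qdist_qc[OF W(1)] .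
  have Ob: "B \<in> Ob Quot" "?C \<in> Ob Quot" "S \<in> Ob Quot" using Y'c(4,5) S by (simp_all add: quot_simps(1))
  have I: "quot.maps (Id Quot ?C) ?C ?C" using quot.maps_Id[OF Ob(2)] .
  have \<sigma>': "?\<sigma> \<in> extensions QExt ?C S" using \<sigma>(1) by simp
  obtain u where u: "lift n Quot Y' (qc W) \<psi> (Id Quot ?C) u"
    by (rule quot.distinguished_lift[OF Y'(1) qWd, of \<psi> "Id Quot ?C"])
      (use Y'(2) W \<psi> I \<sigma>(2) quot.pull_Id[OF Ob(2,3) \<sigma>'] in simp_all)
  have "push Quot QExt ?C \<phi> ?\<sigma> = \<rho>"
    using quot.push_push[OF Ob(2) \<psi> \<phi> \<rho>'] \<phi>\<psi> \<sigma>(2) quot.push_Id[OF Ob(2,1) \<rho>'] by simp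
  then obtain v where v: "lift n Quot (qc W) Y' \<phi> (Id Quot ?C) v"
    using quot.distinguished_lift[OF qWd Y'(1), of \<phi> "Id Quot ?C"] Y'(2) W \<phi> I quot.pull_Id[OF Ob(2,1) \<rho>'] by auto
  note qWc = qc_complex[OF Wc(1)]
  have uc: "chain_map n Quot Y' (qc W) u" "u 0 = \<psi>" "u (Suc n) = Id Quot ?C"
    and vc: "chain_map n Quot (qc W) Y' v" "v 0 = \<phi>" "v (Suc n) = Id Quot ?C" using u v by (auto simp: lift_def)
  let ?\<beta> = "u 1" and ?\<alpha> = "v 1"
  have \<alpha>: "quot.maps ?\<alpha> (obj W 1) D" and \<beta>: "quot.maps ?\<beta> D (obj W 1)"
    using quot.chain_map_maps[OF qWc Y'c(1) vc(1), of 1] quot.chain_map_maps[OF Y'c(1) qWc uc(1), of 1] Y'(3)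
      by simp_all
  have \<beta>G: "?\<beta> \<cdot>\<^bsub>Quot\<^esub> G = cls (dif W 0) \<cdot>\<^bsub>Quot\<^esub> \<psi>" and \<alpha>d: "?\<alpha> \<cdot>\<^bsub>Quot\<^esub> cls (dif W 0) = G \<cdot>\<^bsub>Quot\<^esub> \<phi>"
    using quot.chain_map_commute[OF Y'c(1) qWc uc(1), of 0] quot.chain_map_commute[OF qWc Y'c(1) vc(1), of 0] uc(2)
      vc(2) Y'(4) qW by simp_all
  have Gm: "quot.maps G B D" using quot.complex_dif[OF Y'c(1), of 0] Y' by simp
  have Fm: "quot.maps F A B" using \<phi>f quot.maps_comp[OF cls_maps[OF f] \<phi>] by simp
  have x: "quot.maps (G \<cdot>\<^bsub>Quot\<^esub> F) A D" using quot.maps_comp[OF Fm Gm] .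
  have \<alpha>x: "?\<alpha> \<cdot>\<^bsub>Quot\<^esub> dif (qc V) 0 = G \<cdot>\<^bsub>Quot\<^esub> F"
    unfolding qV using quot.comp_rewrite[OF \<alpha>d] \<alpha> Gm \<phi> cls_maps[OF f] cls_maps[OF dW] \<phi>f
    by (simp add: quot.maps_unfold quot.assoc)
  have \<beta>x: "?\<beta> \<cdot>\<^bsub>Quot\<^esub> (G \<cdot>\<^bsub>Quot\<^esub> F) = dif (qc V) 0"
    unfolding qV using quot.comp_rewrite[OF \<beta>G] \<beta> Gm Fm \<psi> cls_maps[OF dW] \<psi>F
    by (simp add: quot.maps_unfold quot.assoc)
  have qVd: "qdist (qc V) \<epsilon>" using qdist_qc[OF V(1)] .
  show ?thesis
  proof (cases "n = 1")
    case True
    have two: "obj W 2 = ?C" "obj Y' 2 = ?C" "u 2 = Id Quot ?C" "v 2 = Id Quot ?C"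
      using True W(3) uc vc by (simp_all add: numeral_2_eq_2)
    have II: "Id Quot ?C \<cdot>\<^bsub>Quot\<^esub> Id Quot ?C = Id Quot ?C" using I by (simp add: quot.maps_unfold)
    obtain m where m: "quot.maps m (obj Y' 1) (obj (qc W) 1)" "m \<cdot>\<^bsub>Quot\<^esub> v 1 = Id Quot (obj (qc W) 1)"
      "v 1 \<cdot>\<^bsub>Quot\<^esub> m = Id Quot (obj Y' 1)"
      by (rule quot.short_middle_isomorphism[of "qc W" Y' v u])
        (use Y'c(1) qWc uc vc True II two W Y' \<psi>\<phi> \<phi>\<psi> quot.distinguished_exact(4)[OF Y'(1)]
          quot.distinguished_exact(4)[OF qWd] in simp_all)
    show ?thesis
      using quot.inflation_of_short_isomorphism[OF True qVd, of ?\<alpha> D m "G \<cdot>\<^bsub>Quot\<^esub> F"] \<alpha> m Y'(3) V x \<alpha>x by simp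
  next
    case False
    then have "n \<ge> 2" using n_pos by simp
    then show ?thesis
      using quot.inflation_of_domination[OF _ qVd, of ?\<alpha> D ?\<beta> "G \<cdot>\<^bsub>Quot\<^esub> F"] \<alpha> \<beta> V x \<alpha>x \<beta>x by simp
  qed
qed

end

section \<open>Duals of cones and of the quotient\<close>

definition op_correspondence :: "nat \<Rightarrow> ('o, 'm, 'e) correspondence \<Rightarrow> ('o, 'm, 'e) correspondence" where
  "op_correspondence n \<ss> = (\<lambda>C A \<delta>. {X. op_cochain n X \<in> \<ss> A C \<delta>})"

lemma distinguished_op [simp]:
  "distinguished n (op_category \<C>) (op_bifunctor \<E>) (op_correspondence n \<ss>) X \<delta> \<longleftrightarrow>
   distinguished n \<C> \<E> \<ss> (op_cochain n X) \<delta>"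
  by (auto simp: distinguished_def op_correspondence_def)

lemma factoring_op: "factoring (op_category \<C>) \<X> A B = factoring \<C> \<X> B A"
  by (auto simp: factoring_def)

lemma residue_op: "residue (op_category \<C>) \<X> A B f = residue \<C> \<X> B A f"
  by (simp add: residue_def factoring_op)

lemma ideal_quotient_op: "ideal_quotient (op_category \<C>) \<X> = op_category (ideal_quotient \<C> \<X>)"
proof -
  have "{residue \<C> \<X> D A (f \<cdot>\<^bsub>\<C>\<^esub> g) |A B D f g. A \<in> Ob \<C> \<and> B \<in> Ob \<C> \<and> D \<in> Ob \<C> \<and>
          f \<in> F \<inter> arrows \<C> B A \<and> g \<in> G \<inter> arrows \<C> D B} =
        {residue \<C> \<X> A D (g \<cdot>\<^bsub>\<C>\<^esub> f) |A B D f g. A \<in> Ob \<C> \<and> B \<in> Ob \<C> \<and> D \<in> Ob \<C> \<and>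
          f \<in> G \<inter> arrows \<C> A B \<and> g \<in> F \<inter> arrows \<C> B D}" for F G
    by (rule Collect_cong) metis
  then show ?thesis
    by (simp add: ideal_quotient_def op_category_def factoring_op[unfolded op_category_def] residue_op[unfolded
      op_category_def])
qed

lemma quotient_bifunctor_op: "quotient_bifunctor (op_bifunctor \<E>) = op_bifunctor (quotient_bifunctor \<E>)"
proof -
  have "{Act \<E> a c \<delta> |c a. c \<in> c' \<and> a \<in> a'} = {Act \<E> c a \<delta> |c a. c \<in> a' \<and> a \<in> c'}" for c' a' \<delta>
    by blast
  then show ?thesis by (simp add: quotient_bifunctor_def op_bifunctor_def)
qed

lemma finite_sum_closed_op:
  assumes X: "finite_sum_closed \<C> \<X>"
  shows "finite_sum_closed (op_category \<C>) \<X>"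
  unfolding finite_sum_closed_def
proof (intro conjI allI impI ballI)
  show "Z \<in> \<X>" if "zero_object (op_category \<C>) Z" for Z
    using X that by (simp add: finite_sum_closed_def)
  fix A B S i1 i2 p1 p2
  assume "A \<in> \<X>" "B \<in> \<X>" "biproduct (op_category \<C>) A B S i1 i2 p1 p2"
  then have "A \<in> \<X>" "B \<in> \<X>" "biproduct \<C> A B S p1 p2 i1 i2" by (simp_all add: biproduct_op)
  then show "S \<in> \<X>" using X unfolding finite_sum_closed_def by blast
qed

context additive_category
begin

lemma biproduct_swap:
  assumes "biproduct \<C> A B S i\<^sub>1 i\<^sub>2 p\<^sub>1 p\<^sub>2" "A \<in> Ob \<C>" "B \<in> Ob \<C>"
  shows "biproduct \<C> B A S i\<^sub>2 i\<^sub>1 p\<^sub>2 p\<^sub>1"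
proof -
  note b = biproductD[OF assms]
  have "i\<^sub>2 \<cdot> p\<^sub>2 \<boxplus> i\<^sub>1 \<cdot> p\<^sub>1 = Id \<C> S"
    using b(9) add_comm[of "i\<^sub>1 \<cdot> p\<^sub>1" "i\<^sub>2 \<cdot> p\<^sub>2"] b(1-4) by (simp add: maps_unfold)
  then show ?thesis using b by (intro biproductI)
qed

text \<open>
  Reversal exchanges the two summands of each biproduct: the cocone has \<open>X\<^sup>k \<oplus> Y\<^sup>k\<^sup>-\<^sup>1\<close> in degree \<open>k\<close>,
  and \<open>Y\<close>, read backwards, is the source of the dual cone.
\<close>

lemma mapping_cone_dual_cocone:
  assumes n: "n \<ge> 1" and X: "cochain_complex n \<C> (op_cochain n X)" and Y: "cochain_complex n \<C> (op_cochain n Y)"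
    and N: "mapping_cocone n \<C> (op_cochain n Y) (op_cochain n X) h N"
  shows "mapping_cone n (op_category \<C>) X Y (\<lambda>i. h (Suc n - i)) (op_cochain n N)"
proof -
  have ObX: "obj X i \<in> Ob \<C>" and ObY: "obj Y i \<in> Ob \<C>" if "i \<le> Suc n" for i
    using complex_Ob[OF X, of "Suc n - i"] complex_Ob[OF Y, of "Suc n - i"] that by simp_all
  let ?P = "op_cochain n Y" and ?Q = "op_cochain n X"
  have N0: "obj N 0 = obj Y (Suc n)" "obj N (Suc n) = obj X 1"
    and D: "\<And>k. k \<le> n \<Longrightarrow> dif N k \<in> arrows \<C> (obj N k) (obj N (Suc k))"
    using N unfolding mapping_cocone_def by simp_all
  obtain a1 a2 b1 b2 where
    bps: "\<forall>k\<in>{1..n}. biproduct \<C> (obj ?P k) (obj ?Q (k-1)) (obj N k) (a1 k) (a2 k) (b1 k) (b2 k)"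
    and first': "b1 1 \<cdot> dif N 0 = dif ?P 0" "b2 1 \<cdot> dif N 0 = h 0"
    and mids: "\<forall>k\<in>{1..<n}. b1 (k+1) \<cdot> dif N k \<cdot> a1 k = dif ?P k \<and>
           b1 (k+1) \<cdot> dif N k \<cdot> a2 k = \<one>\<^bsub>Hom \<C> (obj ?Q (k-1)) (obj ?P (k+1))\<^esub> \<and>
           b2 (k+1) \<cdot> dif N k \<cdot> a1 k = h k \<and>
           b2 (k+1) \<cdot> dif N k \<cdot> a2 k = inv\<^bsub>Hom \<C> (obj ?Q (k-1)) (obj ?Q k)\<^esub> dif ?Q (k-1)"
    and last': "dif N n \<cdot> a1 n = h n" "dif N n \<cdot> a2 n = inv\<^bsub>Hom \<C> (obj ?Q (n-1)) (obj ?Q n)\<^esub> dif ?Q (n-1)"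
    using N unfolding mapping_cocone_def by blast
  have bp: "biproduct \<C> (obj Y (Suc n - k)) (obj X (Suc n - (k-1))) (obj N k) (a1 k) (a2 k) (b1 k) (b2 k)"
    if "k \<in> {1..n}" for k
    using bspec[OF bps that] by simp
  have first: "b1 1 \<cdot> dif N 0 = dif Y n" "b2 1 \<cdot> dif N 0 = h 0" using first' by simp_all
  have mid: "b1 (Suc k) \<cdot> dif N k \<cdot> a1 k = dif Y (n - k)"
      "b1 (Suc k) \<cdot> dif N k \<cdot> a2 k = \<one>\<^bsub>Hom \<C> (obj X (Suc n - (k-1))) (obj Y (Suc n - Suc k))\<^esub>"
      "b2 (Suc k) \<cdot> dif N k \<cdot> a1 k = h k"
      "b2 (Suc k) \<cdot> dif N k \<cdot> a2 k = inv\<^bsub>Hom \<C> (obj X (Suc n - (k-1))) (obj X (Suc n - k))\<^esub> dif X (n - (k - 1))"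
    if "k \<in> {1..<n}" for k
    using bspec[OF mids that] by simp_all
  have last: "dif N n \<cdot> a1 n = h n" "dif N n \<cdot> a2 n = inv\<^bsub>Hom \<C> (obj X (Suc n - (n-1))) (obj X (Suc n - n))\<^esub> dif X (n
    - (n - 1))"
    using last' by simp_all
  have bs: "biproduct \<C> (obj X (Suc k)) (obj Y k) (obj N (Suc n - k)) (a2 (Suc n - k)) (a1 (Suc n - k)) (b2 (Suc n -
    k)) (b1 (Suc n - k))"
    if "k \<in> {1..n}" for k
  proof -
    have "Suc n - k \<in> {1..n}" "Suc n - (Suc n - k) = k" "Suc n - (Suc n - k - 1) = Suc k" using that by auto
    then show ?thesis using bp[of "Suc n - k"] biproduct_swap ObX[of "Suc k"] ObY[of k] that by simp
  qed
  have NOb: "obj N k \<in> Ob \<C>" if "k \<le> Suc n" for k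
    using that
  proof (cases rule: degree_cases)
    case first then show ?thesis using N0 ObY by simp
  next
    case (middle j) then show ?thesis using bp[of k] by (simp add: biproduct_def)
  next
    case last then show ?thesis using N0 ObX by simp
  qed
  have Dm: "dif N k \<proportion> obj N k \<rightarrow> obj N (Suc k)" if "k \<le> n" for k using D that NOb by (simp add: maps_def)
  have entry: "(b \<cdot> dif N (n - k)) \<cdot> a = b \<cdot> dif N (n - k) \<cdot> a"
    if "k \<in> {1..<n}" "b \<proportion> obj N (Suc (n - k)) \<rightarrow> E" "a \<proportion> W \<rightarrow> obj N (n - k)" for k a b W E
    using maps_comp_assoc[OF that(3) Dm that(2)] by simp
  show ?thesis
    unfolding mapping_cone_def
  proof (intro conjI allI impI exI ballI)
    let ?r = "\<lambda>k. Suc n - k"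
    show "obj (op_cochain n N) 0 = obj X 1" "obj (op_cochain n N) (n + 1) = obj Y (n + 1)" using N0 by simp_all
    show "dif (op_cochain n N) k \<in> arrows (op_category \<C>) (obj (op_cochain n N) k) (obj (op_cochain n N) (k + 1))"
      if "k \<le> n" for k
      using D[of "n - k"] that by (simp add: Suc_diff_le)
    show "biproduct (op_category \<C>) (obj X (k + 1)) (obj Y k) (obj (op_cochain n N) k) (b2 (?r k)) (b1 (?r k)) (a2 (?r
      k)) (a1 (?r k))"
      if "k \<in> {1..n}" for k
      using bs[OF that] by (simp add: biproduct_op)
    show "a2 (?r 1) \<cdot>\<^bsub>op_category \<C>\<^esub> dif (op_cochain n N) 0 = inv\<^bsub>Hom (op_category \<C>) (obj X 1) (obj X 2)\<^esub> dif X 1"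
      using last n by (simp add: numeral_2_eq_2 Suc_diff_le)
    show "a1 (?r 1) \<cdot>\<^bsub>op_category \<C>\<^esub> dif (op_cochain n N) 0 = h (?r 1)" using last by simp
    fix k assume k: "k \<in> {1..<n}"
    let ?j = "n - k"
    have j: "?j \<in> {1..<n}" "?r k = Suc ?j" "?r (k + 1) = ?j" "n - ?j = k" "Suc n - ?j = Suc k"
      "Suc n - (?j - 1) = Suc (Suc k)" "n - (?j - 1) = Suc k"
      "Suc n - Suc ?j = k"
      using k by auto
    have kk: "k \<in> {1..n}" "k + 1 \<in> {1..n}" using k by auto
    note b = biproductD[OF bs[OF kk(1)]] biproductD[OF bs[OF kk(2)]]
    have m: "b2 (Suc ?j) \<proportion> obj N (Suc ?j) \<rightarrow> obj X (Suc k)" "b1 (Suc ?j) \<proportion> obj N (Suc ?j) \<rightarrow> obj Y k"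
      "a2 ?j \<proportion> obj X (Suc (Suc k)) \<rightarrow> obj N ?j" "a1 ?j \<proportion> obj Y (Suc k) \<rightarrow> obj N ?j"
      using biproductD(3,4)[OF bs[OF kk(1)]] biproductD(1,2)[OF bs[OF kk(2)]] ObX[of "Suc k"] ObX[of "Suc (Suc k)"]
        ObY[of k] ObY[of "Suc k"] k j by auto
    show "a2 (?r (k + 1)) \<cdot>\<^bsub>op_category \<C>\<^esub> dif (op_cochain n N) k \<cdot>\<^bsub>op_category \<C>\<^esub> b2 (?r k) =
        inv\<^bsub>Hom (op_category \<C>) (obj X (k + 1)) (obj X (k + 2))\<^esub> dif X (k + 1)"
      unfolding j using entry[OF k m(1,3)] mid(4)[OF j(1)] unfolding j by simp
    show "a2 (?r (k + 1)) \<cdot>\<^bsub>op_category \<C>\<^esub> dif (op_cochain n N) k \<cdot>\<^bsub>op_category \<C>\<^esub> b1 (?r k) =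
        \<one>\<^bsub>Hom (op_category \<C>) (obj Y k) (obj X (k + 2))\<^esub>"
      unfolding j using entry[OF k m(2,3)] mid(2)[OF j(1)] unfolding j by simp
    show "a1 (?r (k + 1)) \<cdot>\<^bsub>op_category \<C>\<^esub> dif (op_cochain n N) k \<cdot>\<^bsub>op_category \<C>\<^esub> b2 (?r k) = h (?r (k + 1))"
      unfolding j using entry[OF k m(1,4)] mid(3)[OF j(1)] by simp
    show "a1 (?r (k + 1)) \<cdot>\<^bsub>op_category \<C>\<^esub> dif (op_cochain n N) k \<cdot>\<^bsub>op_category \<C>\<^esub> b1 (?r k) = dif Y k"
      unfolding j using entry[OF k m(2,4)] mid(1)[OF j(1)] unfolding j by simp
  next
    show "dif (op_cochain n N) n \<cdot>\<^bsub>op_category \<C>\<^esub> b2 (Suc n - n) = h (Suc n - (n + 1))" using first by simp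
    show "dif (op_cochain n N) n \<cdot>\<^bsub>op_category \<C>\<^esub> b1 (Suc n - n) = dif Y n" using first by simp
  qed
qed

lemma mapping_cocone_dual_cone:
  assumes n: "n \<ge> 1" and X: "cochain_complex n \<C> (op_cochain n X)" and Y: "cochain_complex n \<C> (op_cochain n Y)"
    and M: "mapping_cone n \<C> (op_cochain n Y) (op_cochain n X) f M"
  shows "mapping_cocone n (op_category \<C>) X Y (\<lambda>i. f (Suc n - i)) (op_cochain n M)"
proof -
  have ObX: "obj X i \<in> Ob \<C>" and ObY: "obj Y i \<in> Ob \<C>" if "i \<le> Suc n" for i
    using complex_Ob[OF X, of "Suc n - i"] complex_Ob[OF Y, of "Suc n - i"] that by simp_all
  let ?P = "op_cochain n Y" and ?Q = "op_cochain n X"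
  have M0: "obj M 0 = obj Y n" "obj M (Suc n) = obj X 0"
    and D: "\<And>k. k \<le> n \<Longrightarrow> dif M k \<in> arrows \<C> (obj M k) (obj M (Suc k))"
    using M unfolding mapping_cone_def by simp_all
  obtain a1 a2 b1 b2 where
    bps: "\<forall>k\<in>{1..n}. biproduct \<C> (obj ?P (k+1)) (obj ?Q k) (obj M k) (a1 k) (a2 k) (b1 k) (b2 k)"
    and first': "b1 1 \<cdot> dif M 0 = inv\<^bsub>Hom \<C> (obj ?P 1) (obj ?P 2)\<^esub> dif ?P 1" "b2 1 \<cdot> dif M 0 = f 1"
    and mids: "\<forall>k\<in>{1..<n}. b1 (k+1) \<cdot> dif M k \<cdot> a1 k = inv\<^bsub>Hom \<C> (obj ?P (k+1)) (obj ?P (k+2))\<^esub> dif ?P (k+1) \<and>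
           b1 (k+1) \<cdot> dif M k \<cdot> a2 k = \<one>\<^bsub>Hom \<C> (obj ?Q k) (obj ?P (k+2))\<^esub> \<and>
           b2 (k+1) \<cdot> dif M k \<cdot> a1 k = f (k+1) \<and>
           b2 (k+1) \<cdot> dif M k \<cdot> a2 k = dif ?Q k"
    and last': "dif M n \<cdot> a1 n = f (n+1)" "dif M n \<cdot> a2 n = dif ?Q n"
    using M unfolding mapping_cone_def by blast
  have bp: "biproduct \<C> (obj Y (Suc n - Suc k)) (obj X (Suc n - k)) (obj M k) (a1 k) (a2 k) (b1 k) (b2 k)"
    if "k \<in> {1..n}" for k
    using bspec[OF bps that] by simp
  have first: "b1 1 \<cdot> dif M 0 = inv\<^bsub>Hom \<C> (obj Y (Suc n - 1)) (obj Y (Suc n - 2))\<^esub> dif Y (n - 1)"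
    "b2 1 \<cdot> dif M 0 = f 1"
    using first' by simp_all
  have mid: "b1 (Suc k) \<cdot> dif M k \<cdot> a1 k = inv\<^bsub>Hom \<C> (obj Y (Suc n - Suc k)) (obj Y (Suc n - Suc (Suc k)))\<^esub> dif Y (n -
    Suc k)"
      "b1 (Suc k) \<cdot> dif M k \<cdot> a2 k = \<one>\<^bsub>Hom \<C> (obj X (Suc n - k)) (obj Y (Suc n - Suc (Suc k)))\<^esub>"
      "b2 (Suc k) \<cdot> dif M k \<cdot> a1 k = f (Suc k)"
      "b2 (Suc k) \<cdot> dif M k \<cdot> a2 k = dif X (n - k)"
    if "k \<in> {1..<n}" for k
    using bspec[OF mids that] by simp_all
  have last: "dif M n \<cdot> a1 n = f (Suc n)" "dif M n \<cdot> a2 n = dif X 0" using last' by simp_all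
  have bs: "biproduct \<C> (obj X k) (obj Y (k - 1)) (obj M (Suc n - k)) (a2 (Suc n - k)) (a1 (Suc n - k)) (b2 (Suc n -
    k)) (b1 (Suc n - k))"
    if "k \<in> {1..n}" for k
  proof -
    have "Suc n - k \<in> {1..n}" "Suc n - (Suc n - k) = k" "Suc n - Suc (Suc n - k) = k - 1" "k - 1 \<le> Suc n" using that
      by auto
    then show ?thesis using bp[of "Suc n - k"] biproduct_swap ObX[of k] ObY[of "k - 1"] that by simp
  qed
  have MOb: "obj M k \<in> Ob \<C>" if "k \<le> Suc n" for k
    using that
  proof (cases rule: degree_cases)
    case first then show ?thesis using M0 ObY by simp
  next
    case (middle j) then show ?thesis using bp[of k] by (simp add: biproduct_def)
  next
    case last then show ?thesis using M0 ObX by simp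
  qed
  have Dm: "dif M k \<proportion> obj M k \<rightarrow> obj M (Suc k)" if "k \<le> n" for k using D that MOb by (simp add: maps_def)
  have entry: "(b \<cdot> dif M (n - k)) \<cdot> a = b \<cdot> dif M (n - k) \<cdot> a"
    if "k \<in> {1..<n}" "b \<proportion> obj M (Suc (n - k)) \<rightarrow> E" "a \<proportion> W \<rightarrow> obj M (n - k)" for k a b W E
    using maps_comp_assoc[OF that(3) Dm that(2)] by simp
  show ?thesis
    unfolding mapping_cocone_def
  proof (intro conjI allI impI exI ballI)
    let ?r = "\<lambda>k. Suc n - k"
    show "obj (op_cochain n M) 0 = obj X 0" "obj (op_cochain n M) (n + 1) = obj Y n" using M0 by simp_all
    show "dif (op_cochain n M) k \<in> arrows (op_category \<C>) (obj (op_cochain n M) k) (obj (op_cochain n M) (k + 1))"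
      if "k \<le> n" for k
      using D[of "n - k"] that by (simp add: Suc_diff_le)
    show "biproduct (op_category \<C>) (obj X k) (obj Y (k - 1)) (obj (op_cochain n M) k) (b2 (?r k)) (b1 (?r k)) (a2 (?r
      k)) (a1 (?r k))"
      if "k \<in> {1..n}" for k
      using bs[OF that] by (simp add: biproduct_op)
    show "a2 (?r 1) \<cdot>\<^bsub>op_category \<C>\<^esub> dif (op_cochain n M) 0 = dif X 0" using last by simp
    show "a1 (?r 1) \<cdot>\<^bsub>op_category \<C>\<^esub> dif (op_cochain n M) 0 = f (Suc n - 0)" using last by simp
    fix k assume k: "k \<in> {1..<n}"
    let ?j = "n - k"
    have j: "?j \<in> {1..<n}" "?r k = Suc ?j" "?r (k + 1) = ?j" "n - ?j = k" "Suc n - ?j = Suc k" "Suc n - Suc ?j = k"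
      "Suc n - Suc (Suc ?j) = k - 1" "n - Suc ?j = k - 1"
      using k by auto
    have kk: "k \<in> {1..n}" "k + 1 \<in> {1..n}" using k by auto
    have m: "b2 (Suc ?j) \<proportion> obj M (Suc ?j) \<rightarrow> obj X k" "b1 (Suc ?j) \<proportion> obj M (Suc ?j) \<rightarrow> obj Y (k - 1)"
      "a2 ?j \<proportion> obj X (Suc k) \<rightarrow> obj M ?j" "a1 ?j \<proportion> obj Y k \<rightarrow> obj M ?j"
      using biproductD(3,4)[OF bs[OF kk(1)]] biproductD(1,2)[OF bs[OF kk(2)]] ObX[of k] ObX[of "Suc k"] ObY[of k]
        ObY[of "k - 1"] k j by auto
    show "a2 (?r (k + 1)) \<cdot>\<^bsub>op_category \<C>\<^esub> dif (op_cochain n M) k \<cdot>\<^bsub>op_category \<C>\<^esub> b2 (?r k) = dif X k"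
      unfolding j using entry[OF k m(1,3)] mid(4)[OF j(1)] unfolding j by simp
    show "a2 (?r (k + 1)) \<cdot>\<^bsub>op_category \<C>\<^esub> dif (op_cochain n M) k \<cdot>\<^bsub>op_category \<C>\<^esub> b1 (?r k) =
        \<one>\<^bsub>Hom (op_category \<C>) (obj Y (k - 1)) (obj X (k + 1))\<^esub>"
      unfolding j using entry[OF k m(2,3)] mid(2)[OF j(1)] unfolding j by simp
    show "a1 (?r (k + 1)) \<cdot>\<^bsub>op_category \<C>\<^esub> dif (op_cochain n M) k \<cdot>\<^bsub>op_category \<C>\<^esub> b2 (?r k) = f (?r k)"
      unfolding j using entry[OF k m(1,4)] mid(3)[OF j(1)] by simp
    show "a1 (?r (k + 1)) \<cdot>\<^bsub>op_category \<C>\<^esub> dif (op_cochain n M) k \<cdot>\<^bsub>op_category \<C>\<^esub> b1 (?r k) =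
        inv\<^bsub>Hom (op_category \<C>) (obj Y (k - 1)) (obj Y k)\<^esub> dif Y (k - 1)"
      unfolding j using entry[OF k m(2,4)] mid(1)[OF j(1)] unfolding j by simp
  next
    show "dif (op_cochain n M) n \<cdot>\<^bsub>op_category \<C>\<^esub> b2 (Suc n - n) = f (Suc n - n)" using first by simp
    show "dif (op_cochain n M) n \<cdot>\<^bsub>op_category \<C>\<^esub> b1 (Suc n - n) =
        inv\<^bsub>Hom (op_category \<C>) (obj Y (n - 1)) (obj Y n)\<^esub> dif Y (n - 1)" using first n by (simp add: numeral_2_eq_2)
  qed
qed

lemma op_op_complexes_between:
  "op_cochain n (op_cochain n X) \<in> complexes_between n \<C> A C \<longleftrightarrow> X \<in> complexes_between n \<C> A C"
  using dual_complexes_between[of "op_cochain n X" n C A]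
    additive_category.dual_complexes_between[OF dual, of X n A C] by simp

lemma dual_lift_reverse:
  assumes X: "cochain_complex n \<C> (op_cochain n X)" and Y: "cochain_complex n \<C> (op_cochain n Y)"
    and h: "lift n \<C> (op_cochain n Y) (op_cochain n X) c a h"
  shows "lift n (op_category \<C>) X Y a c (\<lambda>i. h (Suc n - i))"
proof -
  have "lift n \<C> (op_cochain n Y) (op_cochain n X) c a (\<lambda>i. h (Suc n - (Suc n - i)))"
    using h unfolding lift_def chain_map_def by auto
  then show ?thesis unfolding dual_lift[OF X Y] .
qed

end

context exact_realization
begin

text \<open>
  The two complexes differ outside the range of degrees, hence the detour through homotopy classes.
\<close>

lemma distinguished_op_op: "dist (op_cochain n (op_cochain n X)) \<delta> \<longleftrightarrow> dist X \<delta>"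
proof
  assume "dist X \<delta>"
  then show "dist (op_cochain n (op_cochain n X)) \<delta>"
    using distinguished_transfer op_op_cochain_equivalent[OF distinguished_complex(1)] by blast
next
  assume *: "dist (op_cochain n (op_cochain n X)) \<delta>"
  have "X \<in> complexes_between n \<C> (obj X 0) (obj X (Suc n))"
    using distinguished_complex(1)[OF *] op_op_complexes_between by simp
  then show "dist X \<delta>"
    using distinguished_transfer[OF *] homotopy_equivalent_sym[OF op_op_cochain_equivalent(2)] by simp
qed

end

section \<open>Duality for exact realizations\<close>

context exact_realization
begin

text \<open>
  The zero extension has some realization, and that is homotopy equivalent to the trivial complex.
\<close>

lemma trivial_complexes:
  assumes n: "n \<ge> 1" and A: "A \<in> Ob \<C>" and Z: "zero_object \<C> Z"
  shows "trivial_left n \<C> A Z \<in> complexes_between n \<C> A Z" "trivial_right n \<C> A Z \<in> complexes_between n \<C> Z A"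
proof -
  have ZO: "Z \<in> Ob \<C>" using Z by (simp add: zero_object_def)
  obtain X where X: "dist X \<one>\<^bsub>Ext \<E> Z A\<^esub>" "obj X 0 = A" "obj X (Suc n) = Z"
    using distinguished_exists[OF ZO A ext_zero_closed[OF ZO A]] .
  show "trivial_left n \<C> A Z \<in> complexes_between n \<C> A Z"
    using split_equivalent_trivial_left(1)[OF n Z] distinguished_complex(1)[OF X(1)] R1[OF X(1)] X by simp
  obtain Y where Y: "dist Y \<one>\<^bsub>Ext \<E> A Z\<^esub>" "obj Y 0 = Z" "obj Y (Suc n) = A"
    using distinguished_exists[OF A ZO ext_zero_closed[OF A ZO]] .
  show "trivial_right n \<C> A Z \<in> complexes_between n \<C> Z A"
    using split_equivalent_trivial_right(1)[OF n Z] distinguished_complex(1)[OF Y(1)] R1[OF Y(1)] Y by simp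
qed

lemma dual_realization:
  assumes n: "n \<ge> 1"
  shows "exact_realization n (op_category \<C>) (op_bifunctor \<E>) (op_correspondence n \<ss>)"
proof (rule exact_realization.intro[OF dual_bifunctor], rule exact_realization_axioms.intro)
  show "\<exists>X\<in>complexes_between n (op_category \<C>) A C. op_correspondence n \<ss> C A \<delta> = homotopy_class n (op_category \<C>) A C
    X"
    if CA: "C \<in> Ob (op_category \<C>)" "A \<in> Ob (op_category \<C>)" "\<delta> \<in> extensions (op_bifunctor \<E>) C A" for C A \<delta>
  proof -
    obtain X where X: "X \<in> complexes_between n \<C> C A" "\<ss> A C \<delta> = homotopy_class n \<C> C A X"
      using realization_class[of A C \<delta>] CA by auto
    have "op_cochain n X \<in> complexes_between n (op_category \<C>) A C"
      using X(1) by (simp only: dual_complexes_between op_op_complexes_between)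
    moreover have "op_correspondence n \<ss> C A \<delta> = homotopy_class n (op_category \<C>) A C (op_cochain n X)"
      using dual_homotopy_class[OF X(1)] X(2) by (simp add: op_correspondence_def)
    ultimately show ?thesis by blast
  qed
next
  fix X \<delta> Y \<rho> a c
  assume X: "distinguished n (op_category \<C>) (op_bifunctor \<E>) (op_correspondence n \<ss>) X \<delta>"
    and Y: "distinguished n (op_category \<C>) (op_bifunctor \<E>) (op_correspondence n \<ss>) Y \<rho>"
    and m: "ext_morphism (op_category \<C>) (op_bifunctor \<E>) (obj X (n + 1)) (obj X 0) \<delta> (obj Y (n + 1)) (obj Y 0) \<rho> a c"
  have "ext_morphism \<C> \<E> (obj (op_cochain n Y) (n + 1)) (obj (op_cochain n Y) 0) \<rho>
      (obj (op_cochain n X) (n + 1)) (obj (op_cochain n X) 0) \<delta> c a"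
    using m by (simp add: ext_morphism_def)
  then obtain f where f: "lift n \<C> (op_cochain n Y) (op_cochain n X) c a f"
    using R0[of "op_cochain n Y" \<rho> "op_cochain n X" \<delta> c a] X Y by auto
  show "\<exists>f. lift n (op_category \<C>) X Y a c f"
    using dual_lift_reverse[OF _ _ f] X Y distinguished_exact(1) by auto
next
  show "n_exangle n (op_category \<C>) (op_bifunctor \<E>) X \<delta>"
    if "distinguished n (op_category \<C>) (op_bifunctor \<E>) (op_correspondence n \<ss>) X \<delta>" for X \<delta>
    using that R1 dual_n_exangle by simp
next
  fix A Z assume "A \<in> Ob (op_category \<C>)" "zero_object (op_category \<C>) Z"
  then have A: "A \<in> Ob \<C>" and Z: "zero_object \<C> Z" by simp_all
  have swap: "{X. op_cochain n X \<in> homotopy_class n \<C> B D T} = homotopy_class n (op_category \<C>) D B T'"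
    if T: "T \<in> complexes_between n \<C> B D" and eq: "\<And>i. i \<le> Suc n \<Longrightarrow> obj T' i = obj (op_cochain n T) i"
      "\<And>i. i \<le> n \<Longrightarrow> dif T' i = dif (op_cochain n T) i" for B D T T'
  proof -
    have oT: "op_cochain n T \<in> complexes_between n (op_category \<C>) D B"
      using T by (simp only: dual_complexes_between op_op_complexes_between)
    note ag = additive_category.agree_equivalent[OF dual oT eq]
    show ?thesis
      unfolding dual_homotopy_class[OF T] using additive_category.homotopy_class_eq[OF dual oT ag] .
  qed
  note triv = trivial_complexes[OF n A Z]
  show "op_correspondence n \<ss> Z A \<one>\<^bsub>Ext (op_bifunctor \<E>) Z A\<^esub> =
      homotopy_class n (op_category \<C>) A Z (trivial_left n (op_category \<C>) A Z)"
    unfolding op_correspondence_def op_bifunctor_simps R2_right[OF A Z]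
    by (rule swap[OF triv(2)]) (use n in \<open>auto simp: trivial_left_def trivial_right_def Suc_diff_le\<close>)
  show "op_correspondence n \<ss> A Z \<one>\<^bsub>Ext (op_bifunctor \<E>) A Z\<^esub> =
      homotopy_class n (op_category \<C>) Z A (trivial_right n (op_category \<C>) A Z)"
    unfolding op_correspondence_def op_bifunctor_simps R2_left[OF A Z]
    by (rule swap[OF triv(1)]) (use n in \<open>auto simp: trivial_left_def trivial_right_def Suc_diff_le\<close>)
qed

lemma inflation_op:
  "inflation n (op_category \<C>) (op_bifunctor \<E>) (op_correspondence n \<ss>) A B f \<longleftrightarrow> deflation n \<C> \<E> \<ss> B A f"
proof
  assume "inflation n (op_category \<C>) (op_bifunctor \<E>) (op_correspondence n \<ss>) A B f"
  then obtain X \<delta> where "dist (op_cochain n X) \<delta>" "obj X 0 = A" "obj X 1 = B" "dif X 0 = f"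
    unfolding inflation_def by auto
  then show "deflation n \<C> \<E> \<ss> B A f" unfolding deflation_def by (intro exI[of _ "op_cochain n X"]) auto
next
  assume "deflation n \<C> \<E> \<ss> B A f"
  then obtain X \<delta> where "dist X \<delta>" "obj X n = B" "obj X (Suc n) = A" "dif X n = f" unfolding deflation_def by auto
  then show "inflation n (op_category \<C>) (op_bifunctor \<E>) (op_correspondence n \<ss>) A B f"
    unfolding inflation_def by (intro exI[of _ "op_cochain n X"]) (auto simp: distinguished_op_op)
qed

lemma deflation_op:
  assumes n: "n \<ge> 1"
  shows "deflation n (op_category \<C>) (op_bifunctor \<E>) (op_correspondence n \<ss>) A B f \<longleftrightarrow> inflation n \<C> \<E> \<ss> B A f"
proof
  assume "deflation n (op_category \<C>) (op_bifunctor \<E>) (op_correspondence n \<ss>) A B f"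
  then obtain X \<delta> where "dist (op_cochain n X) \<delta>" "obj X n = A" "obj X (Suc n) = B" "dif X n = f"
    unfolding deflation_def by auto
  then show "inflation n \<C> \<E> \<ss> B A f" unfolding inflation_def by (intro exI[of _ "op_cochain n X"]) auto
next
  assume "inflation n \<C> \<E> \<ss> B A f"
  then obtain X \<delta> where "dist X \<delta>" "obj X 0 = B" "obj X 1 = A" "dif X 0 = f" unfolding inflation_def by auto
  then show "deflation n (op_category \<C>) (op_bifunctor \<E>) (op_correspondence n \<ss>) A B f"
    unfolding deflation_def using n
    by (intro exI[of _ "op_cochain n X"]) (auto simp: distinguished_op_op Suc_diff_le)
qed

end

lemma (in n_exangulated_category) dual_n_exangulated:
  assumes n: "n \<ge> 1"
  shows "n_exangulated_category n (op_category \<C>) (op_bifunctor \<E>) (op_correspondence n \<ss>)"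
proof (rule n_exangulated_category.intro[OF dual_realization[OF n]], rule n_exangulated_category_axioms.intro)
  show "inflation n (op_category \<C>) (op_bifunctor \<E>) (op_correspondence n \<ss>) A D (g \<cdot>\<^bsub>op_category \<C>\<^esub> f)"
    if "inflation n (op_category \<C>) (op_bifunctor \<E>) (op_correspondence n \<ss>) A B f"
      "inflation n (op_category \<C>) (op_bifunctor \<E>) (op_correspondence n \<ss>) B D g" for A B D f g
    using that EA1_deflation unfolding inflation_op by simp
  show "deflation n (op_category \<C>) (op_bifunctor \<E>) (op_correspondence n \<ss>) A D (g \<cdot>\<^bsub>op_category \<C>\<^esub> f)"
    if "deflation n (op_category \<C>) (op_bifunctor \<E>) (op_correspondence n \<ss>) A B f"
      "deflation n (op_category \<C>) (op_bifunctor \<E>) (op_correspondence n \<ss>) B D g" for A B D f g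
    using that EA1_inflation unfolding deflation_op[OF n] by simp
next
  fix A C D \<rho> c X Y
  assume Ob: "A \<in> Ob (op_category \<C>)" "C \<in> Ob (op_category \<C>)" "D \<in> Ob (op_category \<C>)"
    and \<rho>: "\<rho> \<in> extensions (op_bifunctor \<E>) D A" and c: "c \<in> arrows (op_category \<C>) C D"
    and X: "obj X 0 = A" "obj X (n + 1) = C"
      "distinguished n (op_category \<C>) (op_bifunctor \<E>) (op_correspondence n \<ss>) X (pull (op_category \<C>) (op_bifunctor
        \<E>) A c \<rho>)"
    and Y: "obj Y 0 = A" "obj Y (n + 1) = D" "distinguished n (op_category \<C>) (op_bifunctor \<E>) (op_correspondence n \<ss>)
      Y \<rho>"
  have "\<exists>h N. lift n \<C> (op_cochain n Y) (op_cochain n X) c (Id \<C> A) h \<and>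
      mapping_cocone n \<C> (op_cochain n Y) (op_cochain n X) h N \<and> dist N (pull \<C> \<E> D (dif (op_cochain n X) n) \<rho>)"
    by (rule EA2_op[of D C A \<rho> c]) (use Ob \<rho> c X Y in simp_all)
  then obtain h N where h: "lift n \<C> (op_cochain n Y) (op_cochain n X) c (Id \<C> A) h"
    and N: "mapping_cocone n \<C> (op_cochain n Y) (op_cochain n X) h N" and dN: "dist N (pull \<C> \<E> D (dif X 0) \<rho>)"
      by auto
  have c': "cochain_complex n \<C> (op_cochain n X)" "cochain_complex n \<C> (op_cochain n Y)"
    using X(3) Y(3) distinguished_exact(1) by auto
  show "\<exists>f M. lift n (op_category \<C>) X Y (Id (op_category \<C>) A) c f \<and> mapping_cone n (op_category \<C>) X Y f M \<and>
      distinguished n (op_category \<C>) (op_bifunctor \<E>) (op_correspondence n \<ss>) M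
        (push (op_category \<C>) (op_bifunctor \<E>) D (dif X 0) \<rho>)"
    using dual_lift_reverse[OF c' h] mapping_cone_dual_cocone[OF n c' N] dN
    by (intro exI[of _ "\<lambda>i. h (Suc n - i)"] exI[of _ "op_cochain n N"]) (simp add: distinguished_op_op)
next
  fix A B C \<rho> a X Y
  assume Ob: "A \<in> Ob (op_category \<C>)" "B \<in> Ob (op_category \<C>)" "C \<in> Ob (op_category \<C>)"
    and \<rho>: "\<rho> \<in> extensions (op_bifunctor \<E>) C A" and a: "a \<in> arrows (op_category \<C>) A B"
    and X: "obj X 0 = A" "obj X (n + 1) = C" "distinguished n (op_category \<C>) (op_bifunctor \<E>) (op_correspondence n \<ss>)
      X \<rho>"
    and Y: "obj Y 0 = B" "obj Y (n + 1) = C"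
      "distinguished n (op_category \<C>) (op_bifunctor \<E>) (op_correspondence n \<ss>) Y (push (op_category \<C>) (op_bifunctor
        \<E>) C a \<rho>)"
  have "\<exists>f M. lift n \<C> (op_cochain n Y) (op_cochain n X) (Id \<C> C) a f \<and>
      mapping_cone n \<C> (op_cochain n Y) (op_cochain n X) f M \<and> dist M (push \<C> \<E> A (dif (op_cochain n Y) 0) \<rho>)"
    by (rule EA2[of C B A \<rho> a]) (use Ob \<rho> a X Y in simp_all)
  then obtain f M where f: "lift n \<C> (op_cochain n Y) (op_cochain n X) (Id \<C> C) a f"
    and M: "mapping_cone n \<C> (op_cochain n Y) (op_cochain n X) f M" and dM: "dist M (push \<C> \<E> A (dif Y n) \<rho>)" by auto
  have c': "cochain_complex n \<C> (op_cochain n X)" "cochain_complex n \<C> (op_cochain n Y)"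
    using X(3) Y(3) distinguished_exact(1) by auto
  show "\<exists>h N. lift n (op_category \<C>) X Y a (Id (op_category \<C>) C) h \<and> mapping_cocone n (op_category \<C>) X Y h N \<and>
      distinguished n (op_category \<C>) (op_bifunctor \<E>) (op_correspondence n \<ss>) N
        (pull (op_category \<C>) (op_bifunctor \<E>) A (dif Y n) \<rho>)"
    using dual_lift_reverse[OF c' f] mapping_cocone_dual_cone[OF n c' M] dM
    by (intro exI[of _ "\<lambda>i. f (Suc n - i)"] exI[of _ "op_cochain n M"]) (simp add: distinguished_op_op)
qed

lemma (in exact_realization) projectives_op:
  "injectives n \<C> \<E> \<ss> \<subseteq> projectives n (op_category \<C>) (op_bifunctor \<E>) (op_correspondence n \<ss>)"
proof
  fix I assume I: "I \<in> injectives n \<C> \<E> \<ss>"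
  have "\<exists>b\<in>arrows \<C> (obj X n) I. b \<cdot> dif X n = c"
    if X: "dist (op_cochain n X) \<delta>" and c: "c \<in> arrows \<C> (obj X (Suc n)) I" for X \<delta> c
  proof -
    have "\<forall>a\<in>arrows \<C> (obj (op_cochain n X) 0) I. \<exists>b\<in>arrows \<C> (obj (op_cochain n X) 1) I. b \<cdot> dif (op_cochain n X) 0 =
      a"
      using I X unfolding injectives_def by blast
    then show ?thesis using c by simp
  qed
  then show "I \<in> projectives n (op_category \<C>) (op_bifunctor \<E>) (op_correspondence n \<ss>)"
    using I by (auto simp: projectives_def injectives_def)
qed

lemma (in exact_realization) injectives_op:
  "projectives n \<C> \<E> \<ss> \<subseteq> injectives n (op_category \<C>) (op_bifunctor \<E>) (op_correspondence n \<ss>)"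
proof
  fix P assume P: "P \<in> projectives n \<C> \<E> \<ss>"
  have "\<exists>b\<in>arrows \<C> P (obj X (Suc 0)). dif X 0 \<cdot> b = c"
    if X: "dist (op_cochain n X) \<delta>" and c: "c \<in> arrows \<C> P (obj X 0)" for X \<delta> c
  proof -
    have "\<forall>a\<in>arrows \<C> P (obj (op_cochain n X) (n+1)). \<exists>b\<in>arrows \<C> P (obj (op_cochain n X) n). dif (op_cochain n X) n \<cdot>
      b = a"
      using P X unfolding projectives_def by blast
    then show ?thesis using c by simp
  qed
  then show "P \<in> injectives n (op_category \<C>) (op_bifunctor \<E>) (op_correspondence n \<ss>)"
    using P by (auto simp: projectives_def injectives_def)
qed

context projective_injective_ideal
begin

lemma dual_ideal:
  "projective_injective_ideal n (op_category \<C>) (op_bifunctor \<E>) (op_correspondence n \<ss>) \<X>"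
  using dual_realization[OF n_pos] projectives_op injectives_op sub n_pos finite_sum_closed_op[OF sums]
  by (intro projective_injective_ideal.intro projective_injective_ideal_axioms.intro) auto

abbreviation qc_op :: "('o, 'm) cochain \<Rightarrow> ('o, 'm set) cochain" where
  "qc_op \<equiv> quotient_complex (op_category \<C>) \<X>"

lemma qc_op_agree:
  "obj (op_cochain n (qc_op X)) i = obj (qc (op_cochain n X)) i"
  "i \<le> n \<Longrightarrow> dif (op_cochain n (qc_op X)) i = dif (qc (op_cochain n X)) i"
  by (simp_all add: quotient_complex_def residue_op Suc_diff_le)

text \<open>
  Taking opposites commutes with passing to the quotient, except that the complexes may differ outside
  the range of degrees. Therefore the two correspondences are compared through the distinguished
  complexes that they define and not as functions.
\<close>

lemma dual_qdist:
  "distinguished n (op_category Quot) (op_bifunctor QExt) (quotient_correspondence n (op_category \<C>) \<X>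
    (op_correspondence n \<ss>)) Y \<delta>
    \<longleftrightarrow> qdist (op_cochain n Y) \<delta>"
proof (cases "obj Y 0 \<in> Ob \<C> \<and> obj Y (Suc n) \<in> Ob \<C> \<and> \<delta> \<in> extensions \<E> (obj Y 0) (obj Y (Suc n))")
  case True
  let ?oC = "op_category Quot" and ?A = "obj Y 0" and ?C = "obj Y (Suc n)"
  obtain X where X: "dist X \<delta>" "obj X 0 = ?C" "obj X (Suc n) = ?A"
    using distinguished_exists[of ?A ?C \<delta>] True by blast
  let ?oX = "op_cochain n X"
  have oX: "distinguished n (op_category \<C>) (op_bifunctor \<E>) (op_correspondence n \<ss>) ?oX \<delta>"
    using X(1) by (simp add: distinguished_op_op)
  have b: "qc X \<in> complexes_between n Quot ?C ?A"
    using qc_complexes_between[OF distinguished_complex(1)[OF X(1)]] X by simp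
  have ob: "op_cochain n (qc X) \<in> complexes_between n ?oC ?A ?C"
    using b by (simp only: quot.dual_complexes_between quot.op_op_complexes_between)
  have agree: "obj (qc_op ?oX) i = obj (op_cochain n (qc X)) i"
      "i \<le> n \<Longrightarrow> dif (qc_op ?oX) i = dif (op_cochain n (qc X)) i" for i
    by (simp_all add: quotient_complex_def residue_op Suc_diff_le)
  note ag = additive_category.agree_equivalent[OF quot.dual ob agree]
  have "Y \<in> quotient_correspondence n (op_category \<C>) \<X> (op_correspondence n \<ss>) ?C ?A \<delta>
      \<longleftrightarrow> Y \<in> homotopy_class n ?oC ?A ?C (op_cochain n (qc X))"
    using projective_injective_ideal.QReal_eq[OF dual_ideal oX, unfolded ideal_quotient_op] X
      additive_category.homotopy_class_eq[OF quot.dual ob ag] by simp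
  also have "\<dots> \<longleftrightarrow> op_cochain n Y \<in> QReal ?A ?C \<delta>"
    using quot.dual_homotopy_class[OF b] QReal_eq[OF X(1)] X by auto
  finally show ?thesis using True by (simp add: distinguished_def quot_simps(1))
qed (auto simp: distinguished_def quot_simps(1))

end

section \<open>The ideal quotient as an n-exangulated category\<close>

lemma weak_kernel_cokernel_agree:
  assumes wkc: "weak_kernel_cokernel n \<C> X"
    and eq: "\<And>i. obj Y i = obj X i" "\<And>i. i \<le> n \<Longrightarrow> dif Y i = dif X i"
  shows "weak_kernel_cokernel n \<C> Y"
proof -
  have "dif Y (i - 1) = dif X (i - 1)" "dif Y i = dif X i" if "i \<in> {1..n}" for i
    using that eq(2)[of "i - 1"] eq(2)[of i] by auto
  then show ?thesis using wkc eq(1) by (simp add: weak_kernel_cokernel_def)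
qed

context exangulated_ideal
begin

text \<open>
  The hypotheses are self-dual, so every result about inflations and cones in the quotient has a dual
  about deflations and cocones.
\<close>

lemma dual_exangulated_ideal:
  "exangulated_ideal n (op_category \<C>) (op_bifunctor \<E>) (op_correspondence n \<ss>) \<X>"
proof (rule exangulated_ideal.intro[OF dual_n_exangulated[OF n_pos]],
    rule weakly_exact_ideal.intro[OF dual_ideal], rule weakly_exact_ideal_axioms.intro)
  fix X \<delta> assume "distinguished n (op_category \<C>) (op_bifunctor \<E>) (op_correspondence n \<ss>) X \<delta>"
  then have X: "dist (op_cochain n X) \<delta>" by simp
  have "cochain_complex n Quot (op_cochain n (qc_op X))"
    using quot.agree_equivalent(1)[OF qc_complexes_between[OF distinguished_complex(1)[OF X]] qc_op_agree]
    by (simp add: complexes_between_def)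
  then show "weak_kernel_cokernel n (ideal_quotient (op_category \<C>) \<X>) (qc_op X)"
    using weak_kernel_cokernel_agree[OF weakly_exact[OF X] qc_op_agree]
    by (simp add: ideal_quotient_op quot.dual_weak_kernel_cokernel)
qed

lemma dual_qdist_eq:
  "distinguished n (op_category Quot) (op_bifunctor QExt) (quotient_correspondence n (op_category \<C>) \<X>
    (op_correspondence n \<ss>)) =
   distinguished n (op_category Quot) (op_bifunctor QExt) (op_correspondence n QReal)"
  using dual_qdist by (intro ext) simp

lemma quot_EA1_deflation:
  assumes F: "deflation n Quot QExt QReal A B F" and G: "deflation n Quot QExt QReal B D G"
  shows "deflation n Quot QExt QReal A D (G \<cdot>\<^bsub>Quot\<^esub> F)"
proof -
  have "inflation n (op_category Quot) (op_bifunctor QExt) (quotient_correspondence n (op_category \<C>) \<X>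
    (op_correspondence n \<ss>)) U V H
      \<longleftrightarrow> deflation n Quot QExt QReal V U H" for U V H
    unfolding quot.inflation_op[symmetric] unfolding inflation_def dual_qdist_eq ..
  then show ?thesis
    using exangulated_ideal.quot_EA1_inflation[OF dual_exangulated_ideal,
        unfolded ideal_quotient_op quotient_bifunctor_op, of D B G A F] F G by simp
qed

lemma quot_EA2_op:
  assumes A: "A \<in> Ob \<C>" and B: "B \<in> Ob \<C>" and C: "C \<in> Ob \<C>" and \<rho>: "\<rho> \<in> extensions \<E> C A" and F: "quot.maps F A B"
    and X: "obj X 0 = A" "obj X (Suc n) = C" "qdist X \<rho>"
    and Y: "obj Y 0 = B" "obj Y (Suc n) = C" "qdist Y (push Quot QExt C F \<rho>)"
  shows "\<exists>h N. lift n Quot X Y F (Id Quot C) h \<and> mapping_cocone n Quot X Y h N \<and>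
    qdist N (pull Quot QExt A (dif Y n) \<rho>)"
proof -
  let ?oX = "op_cochain n X" and ?oY = "op_cochain n Y"
  have d: "qdist (op_cochain n ?oX) \<rho>" "qdist (op_cochain n ?oY) (push Quot QExt C F \<rho>)"
    using X Y quot.distinguished_op_op by auto
  have cc: "cochain_complex n Quot X" "cochain_complex n Quot Y" 
    using X Y quot.distinguished_exact(1) by auto
  obtain f M where f: "lift n (op_category Quot) ?oY ?oX (Id Quot C) F f"
    and M: "mapping_cone n (op_category Quot) ?oY ?oX f M"
    and dM: "qdist (op_cochain n M) (pull Quot QExt A (dif Y n) \<rho>)"
    using exangulated_ideal.quot_EA2[OF dual_exangulated_ideal, unfolded ideal_quotient_op quotient_bifunctor_op,
        of C \<rho> A F B ?oY ?oX] A B C \<rho> F X Y d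
    by (auto simp: quot.dual_maps dual_qdist)
  have c': "cochain_complex n (op_category Quot) (op_cochain n X)"
    "cochain_complex n (op_category Quot) (op_cochain n Y)"
    using d quot.distinguished_exact(1) by (auto simp: quot.dual_complex)
  show ?thesis
    using additive_category.dual_lift_reverse[OF quot.dual c' f]
      additive_category.mapping_cocone_dual_cone[OF quot.dual n_pos c' M] dM
    by auto
qed

lemma quotient_n_exangulated: "n_exangulated_category n Quot QExt QReal"
proof (rule n_exangulated_category.intro[OF quot_exact_realization], rule n_exangulated_category_axioms.intro)
  show "inflation n Quot QExt QReal A D (G \<cdot>\<^bsub>Quot\<^esub> F)"
    if "inflation n Quot QExt QReal A B F" "inflation n Quot QExt QReal B D G" for A B D F G
    using that by (rule quot_EA1_inflation)
  show "deflation n Quot QExt QReal A D (G \<cdot>\<^bsub>Quot\<^esub> F)"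
    if "deflation n Quot QExt QReal A B F" "deflation n Quot QExt QReal B D G" for A B D F G
    using that by (rule quot_EA1_deflation)
  show "\<exists>f M. lift n Quot X Y (Id Quot A) F f \<and> mapping_cone n Quot X Y f M \<and> qdist M (push Quot QExt D (dif X 0) \<rho>)"
    if "A \<in> Ob Quot" "C \<in> Ob Quot" "D \<in> Ob Quot" "\<rho> \<in> extensions QExt D A" "F \<in> arrows Quot C D"
      "obj X 0 = A" "obj X (n + 1) = C" "qdist X (pull Quot QExt A F \<rho>)" "obj Y 0 = A" "obj Y (n + 1) = D" "qdist Y \<rho>"
    for A C D \<rho> F X Y
    by (rule quot_EA2) (use that in \<open>simp_all add: quot_simps(1) quot.maps_def\<close>)
  show "\<exists>h N. lift n Quot X Y F (Id Quot C) h \<and> mapping_cocone n Quot X Y h N \<and> qdist N (pull Quot QExt A (dif Y n)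
    \<rho>)"
    if "A \<in> Ob Quot" "B \<in> Ob Quot" "C \<in> Ob Quot" "\<rho> \<in> extensions QExt C A" "F \<in> arrows Quot A B"
      "obj X 0 = A" "obj X (n + 1) = C" "qdist X \<rho>" "obj Y 0 = B" "obj Y (n + 1) = C" "qdist Y (push Quot QExt C F \<rho>)"
    for A B C \<rho> F X Y
    by (rule quot_EA2_op) (use that in \<open>simp_all add: quot_simps(1) quot.maps_def\<close>)
qed

end

theorem theorem3p1:
  fixes n :: nat
    and \<C> :: "('o, 'm) precategory"
    and \<E> :: "('o, 'm, 'e) bifunctor"
    and \<ss> :: "('o, 'm, 'e) correspondence"
    and \<X> :: "'o set"
  assumes "n \<ge> 1"
    and "n_exangulated_category n \<C> \<E> \<ss>"
    and "iso_closed \<C> \<X>"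
    and "finite_sum_closed \<C> \<X>"
    and "\<X> \<subseteq> projectives n \<C> \<E> \<ss> \<inter> injectives n \<C> \<E> \<ss>"
  shows "n_exangulated_category n (ideal_quotient \<C> \<X>) (quotient_bifunctor \<E>)
           (quotient_correspondence n \<C> \<X> \<ss>) \<longleftrightarrow>
         (\<forall>A \<delta>. distinguished n \<C> \<E> \<ss> A \<delta> \<longrightarrow>
            weak_kernel_cokernel n (ideal_quotient \<C> \<X>) (quotient_complex \<C> \<X> A))"
proof -
  interpret n_exangulated_category n \<C> \<E> \<ss> by fact
  interpret projective_injective_ideal n \<C> \<E> \<ss> \<X> using assms by unfold_locales
  show ?thesis
  proof (intro iffI allI impI)
    fix A \<delta>
    assume Q: "n_exangulated_category n Quot QExt QReal" and A: "dist A \<delta>"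
    have "n_exangle n Quot QExt (qc A) \<delta>"
      by (rule exact_realization.R1[OF n_exangulated_category.axioms(1)[OF Q] qdist_qc[OF A]])
    then show "weak_kernel_cokernel n Quot (qc A)" by (simp add: n_exangle_def)
  next
    assume "\<forall>A \<delta>. dist A \<delta> \<longrightarrow> weak_kernel_cokernel n Quot (qc A)"
    then interpret exangulated_ideal n \<C> \<E> \<ss> \<X> by unfold_locales blast
    show "n_exangulated_category n Quot QExt QReal" by (rule quotient_n_exangulated)
  qed
qed

end
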